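(* There is a polynomial transformation from $\mathrm{MRF\text{-}R}^{\star}$ to $\mathrm{MRF\text{-}M}^{\star}$ that maps instances with interdiction budget $k$ to instances with the same interdiction budget $k$; the same transformation is also a polynomial transformation from Integral $\mathrm{MRF\text{-}R}^{\star}$ to Integral $\mathrm{MRF\text{-}M}^{\star}$. Moreover, every resulting $\mathrm{MRF\text{-}M}^{\star}$ instance (digraph $D=(V,A)$, capacities $u$, commodities $K$ with sources $s_i$, sinks $t_i$, demands $d_i$, budget $k$, $M:=\max_{a\in A}u_a$) has the following properties: (1) capacities are integral and $M$ is polynomial in $|A|$; (2) every $i\in K$ satisfies $\sum_{a\in\delta^+(s_i)}u_a=\sum_{a\in\delta^-(t_i)}u_a=d_i$ and $\delta^-(s_i)=\delta^+(t_i)=\emptyset$; (3) there is a commodity $i_0\in K$ with $\sum_{i\in K\setminus\{i_0\}}d_i\le M-3$; (4) for every $x\in X_K$, $\sum_{P\in\mathcal{P}_i:a\in P}x_P\ge 2$ for all $i\in K\setminus\{i_0\}$ and all $a\in A$ with $u_a\ge M-2$; (5) there is $U\subseteq V$ with $\{s_i:i\in K\}\subseteq U$, $\{t_i:i\in K\}\subseteq V\setminus U$, $\sum_{a\in\delta^+(U)}u_a=\sum_{i\in K}d_i$, and $|\{a\in\delta^+(U):u_a=M\}|=k-1$.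
   Context: For $U\subseteq V$ in a digraph, $\delta^+(U)$ ($\delta^-(U)$) denotes the set of arcs leaving (entering) $U$; for a node $v$, $\delta^\pm(v):=\delta^\pm(\{v\})$. For a set of paths $\mathcal{P}$, a path flow $x\in\mathbb{Q}_+^{\mathcal{P}}$ and an arc set $S$, $\lambda(x,S):=\sum_{P\in\mathcal{P}:P\cap S\ne\emptyset}x_P$ (paths identified with their arc sets). $\mathrm{MRF\text{-}R}^{\star}$: given a directed acyclic graph $D=(V,A)$ with $s,t\in V$, unit capacities, an interdiction budget $k\in\mathbb{N}$, a compatibility graph $H=(A,E_H)$ and a demand $\theta\in\mathbb{Q}_+$, decide whether there is $x\in\mathbb{Q}_+^{\mathcal{P}}$ ($\mathcal{P}$ the $s$-$t$-paths of $D$) with $\sum_{P\ni a}x_P\le1$ for all $a$, $\sum_Px_P=\theta$, and $\max_{S\in\mathcal{S}_{H,k}}\lambda(x,S)\le k-1$, where $\mathcal{S}_{H,k}$ is the set of cliques of $H$ of size at most $k$. Integral version: $x$ integral. $\mathrm{MRF\text{-}M}^{\star}$: given a digraph $D=(V,A)$, capacities $u\in\mathbb{Q}_+^A$, an interdiction budget $k\in\mathbb{N}$ and a set $K$ of commodities, each $i\in K$ with source $s_i$, sink $t_i$ and demand $d_i$; let $\mathcal{P}_i$ be the set of $s_i$-$t_i$-paths, $\mathcal{P}:=\bigcup_{i\in K}\mathcal{P}_i$ and $X_K:=\{x\in\mathbb{Q}_+^{\mathcal{P}}:\sum_{P\in\mathcal{P}:a\in P}x_P\le u_a\ \forall a\in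 A,\ \sum_{P\in\mathcal{P}_i}x_P=d_i\ \forall i\in K\}$; decide whether there is $x\in X_K$ with $\max_{S\subseteq A,|S|\le k}\lambda(x,S)\le kM-1$, where $M:=\max_{a\in A}u_a$. Integral version: $x$ integral. *)

theory Defs
  imports
    Complex_Main
    "HOL-Library.Ramsey"
    "HOL-Library.Discrete_Functions"
    "HOL-Computational_Algebra.Polynomial"
    "Graph_Theory.Arc_Walk"
begin

section \<open>Path flows and interdiction\<close>

text \<open>Paths visit no node twice and are identified with their arc sets.\<close>

definition st_paths :: "('v, 'a) pre_digraph \<Rightarrow> 'v \<Rightarrow> 'v \<Rightarrow> 'a set set" where
  "st_paths D s t = {set p | p. pre_digraph.apath D s p t}"

definition leaving :: "('v, 'a) pre_digraph \<Rightarrow> 'v set \<Rightarrow> 'a set" where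
  "leaving D U = {a \<in> arcs D. tail D a \<in> U \<and> head D a \<notin> U}"

definition entering :: "('v, 'a) pre_digraph \<Rightarrow> 'v set \<Rightarrow> 'a set" where
  "entering D U = {a \<in> arcs D. tail D a \<notin> U \<and> head D a \<in> U}"

text \<open>A path flow on a path set \<open>\<P>\<close> is represented by a function on all arc sets of which only
  the values on \<open>\<P>\<close> matter.\<close>

definition interdicted :: "'a set set \<Rightarrow> ('a set \<Rightarrow> rat) \<Rightarrow> 'a set \<Rightarrow> rat" where
  "interdicted \<P> x S = (\<Sum>P | P \<in> \<P> \<and> P \<inter> S \<noteq> {}. x P)"

definition arc_flow :: "'a set set \<Rightarrow> ('a set \<Rightarrow> rat) \<Rightarrow> 'a \<Rightarrow> rat" where
  "arc_flow \<P> x a = (\<Sum>P | P \<in> \<P> \<and> a \<in> P. x P)"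

definition nonneg_flow :: "'a set set \<Rightarrow> ('a set \<Rightarrow> rat) \<Rightarrow> bool" where
  "nonneg_flow \<P> x \<longleftrightarrow> (\<forall>P\<in>\<P>. 0 \<le> x P)"

definition integral_flow :: "'a set set \<Rightarrow> ('a set \<Rightarrow> rat) \<Rightarrow> bool" where
  "integral_flow \<P> x \<longleftrightarrow> (\<forall>P\<in>\<P>. x P \<in> \<int>)"


section \<open>The two decision problems\<close>

text \<open>Instances are given explicitly by lists, so that they have a well-defined encoding length.\<close>

record graph_instance =
  node_list :: "nat list"
  arc_list :: "(nat \<times> nat) list"
  budget :: nat

definition graph_of :: "'z graph_instance_scheme \<Rightarrow> (nat, nat \<times> nat) pre_digraph" where
  "graph_of I = \<lparr>verts = set (node_list I), arcs = set (arc_list I), tail = fst, head = snd\<rparr>"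

text \<open>The budget is positive, so \<open>budget I - 1\<close> does not truncate.\<close>

definition valid_graph :: "'z graph_instance_scheme \<Rightarrow> bool" where
  "valid_graph I \<longleftrightarrow>
     distinct (node_list I) \<and> distinct (arc_list I) \<and> digraph (graph_of I) \<and> 1 \<le> budget I"


subsection \<open>The unit-capacity problem with a compatibility graph\<close>

record mrf_r = graph_instance +
  r_source :: nat
  r_sink :: nat
  compat_list :: "((nat \<times> nat) \<times> (nat \<times> nat)) list"
  r_demand :: rat

definition compat_edges :: "mrf_r \<Rightarrow> (nat \<times> nat) set set" where
  "compat_edges I = {{a, b} | a b. (a, b) \<in> set (compat_list I)}"

definition mrf_r_instances :: "mrf_r set" where
  "mrf_r_instances = {I. valid_graph I
     \<and> (\<nexists>p. pre_digraph.cycle (graph_of I) p)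
     \<and> r_source I \<in> verts (graph_of I) \<and> r_sink I \<in> verts (graph_of I)
     \<and> (\<forall>(a, b) \<in> set (compat_list I).
          a \<in> arcs (graph_of I) \<and> b \<in> arcs (graph_of I) \<and> a \<noteq> b)
     \<and> 0 \<le> r_demand I}"

definition r_paths :: "mrf_r \<Rightarrow> (nat \<times> nat) set set" where
  "r_paths I = st_paths (graph_of I) (r_source I) (r_sink I)"

definition r_scenarios :: "mrf_r \<Rightarrow> (nat \<times> nat) set set" where
  "r_scenarios I =
     {S. S \<subseteq> arcs (graph_of I) \<and> clique S (compat_edges I) \<and> card S \<le> budget I}"

definition mrf_r_solution :: "mrf_r \<Rightarrow> ((nat \<times> nat) set \<Rightarrow> rat) \<Rightarrow> bool" where
  "mrf_r_solution I x \<longleftrightarrow>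
     nonneg_flow (r_paths I) x
     \<and> (\<forall>a \<in> arcs (graph_of I). arc_flow (r_paths I) x a \<le> 1)
     \<and> (\<Sum>P \<in> r_paths I. x P) = r_demand I
     \<and> Max (interdicted (r_paths I) x ` r_scenarios I) \<le> of_nat (budget I) - 1"

definition MRF_R :: "mrf_r set" where
  "MRF_R = {I \<in> mrf_r_instances. \<exists>x. mrf_r_solution I x}"

definition Integral_MRF_R :: "mrf_r set" where
  "Integral_MRF_R =
     {I \<in> mrf_r_instances. \<exists>x. mrf_r_solution I x \<and> integral_flow (r_paths I) x}"


subsection \<open>The multicommodity problem\<close>

text \<open>Commodities are indexed by their positions in the list of triples of source, sink and
  demand, so that several commodities may share the same triple.\<close>

record mrf_m = graph_instance +
  capacity :: "nat \<times> nat \<Rightarrow> rat"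
  commodity_list :: "(nat \<times> nat \<times> rat) list"

definition commodities :: "mrf_m \<Rightarrow> nat set" where
  "commodities I = {..<length (commodity_list I)}"

definition m_source :: "mrf_m \<Rightarrow> nat \<Rightarrow> nat" where
  "m_source I i = fst (commodity_list I ! i)"

definition m_sink :: "mrf_m \<Rightarrow> nat \<Rightarrow> nat" where
  "m_sink I i = fst (snd (commodity_list I ! i))"

definition m_demand :: "mrf_m \<Rightarrow> nat \<Rightarrow> rat" where
  "m_demand I i = snd (snd (commodity_list I ! i))"

text \<open>The arc set must be nonempty for the maximum capacity to exist.\<close>

definition mrf_m_instances :: "mrf_m set" where
  "mrf_m_instances = {I. valid_graph I
     \<and> arcs (graph_of I) \<noteq> {}
     \<and> (\<forall>a \<in> arcs (graph_of I). 0 \<le> capacity I a)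
     \<and> (\<forall>i \<in> commodities I. m_source I i \<in> verts (graph_of I)
          \<and> m_sink I i \<in> verts (graph_of I) \<and> 0 \<le> m_demand I i)}"

definition max_capacity :: "mrf_m \<Rightarrow> rat" where
  "max_capacity I = Max (capacity I ` arcs (graph_of I))"

definition m_paths_of :: "mrf_m \<Rightarrow> nat \<Rightarrow> (nat \<times> nat) set set" where
  "m_paths_of I i = st_paths (graph_of I) (m_source I i) (m_sink I i)"

definition m_paths :: "mrf_m \<Rightarrow> (nat \<times> nat) set set" where
  "m_paths I = (\<Union>i \<in> commodities I. m_paths_of I i)"

definition m_flows :: "mrf_m \<Rightarrow> ((nat \<times> nat) set \<Rightarrow> rat) set" where
  "m_flows I = {x. nonneg_flow (m_paths I) x
     \<and> (\<forall>a \<in> arcs (graph_of I). arc_flow (m_paths I) x a \<le> capacity I a)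
     \<and> (\<forall>i \<in> commodities I. (\<Sum>P \<in> m_paths_of I i. x P) = m_demand I i)}"

definition mrf_m_solution :: "mrf_m \<Rightarrow> ((nat \<times> nat) set \<Rightarrow> rat) \<Rightarrow> bool" where
  "mrf_m_solution I x \<longleftrightarrow>
     x \<in> m_flows I
     \<and> Max (interdicted (m_paths I) x ` {S. S \<subseteq> arcs (graph_of I) \<and> card S \<le> budget I})
         \<le> of_nat (budget I) * max_capacity I - 1"

definition MRF_M :: "mrf_m set" where
  "MRF_M = {I \<in> mrf_m_instances. \<exists>x. mrf_m_solution I x}"

definition Integral_MRF_M :: "mrf_m set" where
  "Integral_MRF_M =
     {I \<in> mrf_m_instances. \<exists>x. mrf_m_solution I x \<and> integral_flow (m_paths I) x}"


section \<open>Polynomial-time computation\<close>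

text \<open>
  The machine model is a WHILE language over binary trees with binary natural numbers at the
  leaves. An assignment costs the bit size of the value it stores, so sharing or repeated squaring
  cannot produce values that are larger than the time spent. As a program is a fixed finite object,
  evaluating one of its expressions takes time polynomial in the bit sizes of the values in the
  store. Up to polynomial factors, running times therefore agree with those of Turing machines.
\<close>

datatype val = VNum nat | VPair val val

fun bitsize :: "val \<Rightarrow> nat" where
  "bitsize (VNum n) = Suc (floor_log n)"
| "bitsize (VPair v w) = Suc (bitsize v + bitsize w)"

datatype expr =
    Var nat
  | Const nat
  | Add expr expr
  | Sub expr expr
  | Mul expr expr
  | Quo expr expr
  | MkPair expr expr
  | Fst expr
  | Snd expr

type_synonym store = "nat \<Rightarrow> val"

fun num_of :: "val \<Rightarrow> nat" where
  "num_of (VNum n) = n"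
| "num_of (VPair v w) = 0"

fun fst_of :: "val \<Rightarrow> val" where
  "fst_of (VNum n) = VNum 0"
| "fst_of (VPair v w) = v"

fun snd_of :: "val \<Rightarrow> val" where
  "snd_of (VNum n) = VNum 0"
| "snd_of (VPair v w) = w"

fun eval_expr :: "expr \<Rightarrow> store \<Rightarrow> val" where
  "eval_expr (Var i) \<sigma> = \<sigma> i"
| "eval_expr (Const n) \<sigma> = VNum n"
| "eval_expr (Add e f) \<sigma> = VNum (num_of (eval_expr e \<sigma>) + num_of (eval_expr f \<sigma>))"
| "eval_expr (Sub e f) \<sigma> = VNum (num_of (eval_expr e \<sigma>) - num_of (eval_expr f \<sigma>))"
| "eval_expr (Mul e f) \<sigma> = VNum (num_of (eval_expr e \<sigma>) * num_of (eval_expr f \<sigma>))"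
| "eval_expr (Quo e f) \<sigma> = VNum (num_of (eval_expr e \<sigma>) div num_of (eval_expr f \<sigma>))"
| "eval_expr (MkPair e f) \<sigma> = VPair (eval_expr e \<sigma>) (eval_expr f \<sigma>)"
| "eval_expr (Fst e) \<sigma> = fst_of (eval_expr e \<sigma>)"
| "eval_expr (Snd e) \<sigma> = snd_of (eval_expr e \<sigma>)"

datatype com =
    Skip
  | Assign nat expr
  | Seq com com
  | Cond expr com com
  | While expr com

text \<open>\<open>exec c \<sigma> n \<sigma>'\<close>: started in \<open>\<sigma>\<close>, the program \<open>c\<close> halts in \<open>\<sigma>'\<close> after \<open>n\<close> time units. A test
  succeeds if its value is not the number 0.\<close>

inductive exec :: "com \<Rightarrow> store \<Rightarrow> nat \<Rightarrow> store \<Rightarrow> bool" where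
  Skip: "exec Skip \<sigma> 1 \<sigma>"
| Assign: "exec (Assign i e) \<sigma> (Suc (bitsize (eval_expr e \<sigma>))) (\<sigma>(i := eval_expr e \<sigma>))"
| Seq: "exec c \<sigma> m \<sigma>' \<Longrightarrow> exec d \<sigma>' n \<sigma>'' \<Longrightarrow> exec (Seq c d) \<sigma> (m + n) \<sigma>''"
| CondTrue: "eval_expr e \<sigma> \<noteq> VNum 0 \<Longrightarrow> exec c \<sigma> n \<sigma>' \<Longrightarrow> exec (Cond e c d) \<sigma> (Suc n) \<sigma>'"
| CondFalse: "eval_expr e \<sigma> = VNum 0 \<Longrightarrow> exec d \<sigma> n \<sigma>' \<Longrightarrow> exec (Cond e c d) \<sigma> (Suc n) \<sigma>'"
| WhileFalse: "eval_expr e \<sigma> = VNum 0 \<Longrightarrow> exec (While e c) \<sigma> 1 \<sigma>"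
| WhileTrue: "eval_expr e \<sigma> \<noteq> VNum 0 \<Longrightarrow> exec c \<sigma> m \<sigma>' \<Longrightarrow> exec (While e c) \<sigma>' n \<sigma>'' \<Longrightarrow>
    exec (While e c) \<sigma> (Suc (m + n)) \<sigma>''"

text \<open>Input and output are held in variable 0; all other variables are initially 0.\<close>

definition polytime_computable ::
  "'i set \<Rightarrow> ('i \<Rightarrow> val) \<Rightarrow> ('j \<Rightarrow> val) \<Rightarrow> ('i \<Rightarrow> 'j) \<Rightarrow> bool" where
  "polytime_computable X enc enc' f \<longleftrightarrow>
     (\<exists>c. \<exists>p :: nat poly. \<forall>I\<in>X. \<exists>n \<sigma>.
        exec c ((\<lambda>_. VNum 0)(0 := enc I)) n \<sigma>
        \<and> \<sigma> 0 = enc' (f I)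
        \<and> n \<le> poly p (bitsize (enc I)))"

text \<open>A problem consists of a set of instances, an encoding, and the set of yes-instances.\<close>

definition polynomial_transformation ::
  "'i set \<Rightarrow> ('i \<Rightarrow> val) \<Rightarrow> 'i set \<Rightarrow> 'j set \<Rightarrow> ('j \<Rightarrow> val) \<Rightarrow> 'j set \<Rightarrow> ('i \<Rightarrow> 'j) \<Rightarrow> bool" where
  "polynomial_transformation X enc Y X' enc' Y' f \<longleftrightarrow>
     polytime_computable X enc enc' f
     \<and> (\<forall>I\<in>X. f I \<in> X')
     \<and> (\<forall>I\<in>X. I \<in> Y \<longleftrightarrow> f I \<in> Y')"


subsection \<open>Encodings of instances\<close>

definition enc_list :: "('i \<Rightarrow> val) \<Rightarrow> 'i list \<Rightarrow> val" where
  "enc_list enc xs = foldr (\<lambda>y v. VPair (enc y) v) xs (VNum 0)"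

definition enc_arc :: "nat \<times> nat \<Rightarrow> val" where
  "enc_arc a = VPair (VNum (fst a)) (VNum (snd a))"

text \<open>All rationals in valid instances are nonnegative; they are given in lowest terms.\<close>

definition enc_rat :: "rat \<Rightarrow> val" where
  "enc_rat q = VPair (VNum (nat (fst (quotient_of q)))) (VNum (nat (snd (quotient_of q))))"

text \<open>
  The budget is a number of arcs and is encoded in unary. Under a binary encoding, an output
  with \<open>k - 1\<close> distinguished arcs could be exponentially larger than an input of budget \<open>k\<close>.
\<close>

definition enc_unary :: "nat \<Rightarrow> val" where
  "enc_unary n = enc_list VNum (replicate n 0)"

definition enc_mrf_r :: "mrf_r \<Rightarrow> val" where
  "enc_mrf_r I =
     VPair (enc_list VNum (node_list I))
    (VPair (enc_list enc_arc (arc_list I))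
    (VPair (enc_unary (budget I))
    (VPair (VNum (r_source I))
    (VPair (VNum (r_sink I))
    (VPair (enc_list (\<lambda>(a, b). VPair (enc_arc a) (enc_arc b)) (compat_list I))
           (enc_rat (r_demand I)))))))"

definition enc_mrf_m :: "mrf_m \<Rightarrow> val" where
  "enc_mrf_m I =
     VPair (enc_list VNum (node_list I))
    (VPair (enc_list (\<lambda>a. VPair (enc_arc a) (enc_rat (capacity I a))) (arc_list I))
    (VPair (enc_unary (budget I))
           (enc_list (\<lambda>(s, t, d). VPair (VNum s) (VPair (VNum t) (enc_rat d)))
              (commodity_list I))))"

end

theory Submission
  imports Defs
begin

text \<open>
  Every arc of the given network becomes a gadget: a big arc of capacity \<open>M\<close> between an entry and an
  exit node. Private source and sink arcs of the commodities almost saturate the big arcs, so a set of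
  \<open>k\<close> big arcs is hit by less than \<open>k M\<close> units iff enough flow paths use two of them. For each pair
  of gadgets that is not compatible, a small commodity has to route one unit through both of them: it
  enters at the earlier gadget one unit short of its exit capacity and vice versa at the later one, and
  a topological potential forces it to use its transition arc from the later to the earlier gadget.
  Scenarios that are not cliques are thereby harmless, and only cliques of \<open>k\<close> gadgets impose the
  bound \<open>k - 1\<close> on the flow of the main commodity, whose paths decode to a flow in the given network.

  All capacities have to be integral and polynomially bounded, whereas the demand \<open>p / q\<close> is given in
  binary. Its fractional part is therefore enforced by additional parallel gadgets: variables
  \<open>e\<^sub>j = 2\<^sup>j / q\<close> and their negations are flow values on gadgets of which complementary ones are
  compatible, so that their sum is at most 1, and exits with fixed capacities express
  \<open>e\<^sub>j\<^sub>+\<^sub>1 = 2 e\<^sub>j\<close> and that the \<open>e\<^sub>j\<close> belonging to the binary digits 1 of \<open>q\<close> sum up to 1. There are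
  \<open>k - 1\<close> special gadgets: they provide the arcs of capacity \<open>M\<close> in the cut, and \<open>k - 2\<close> of them pad
  complementary pairs to cliques of size \<open>k\<close>. If \<open>k = 1\<close> and source and sink coincide, a nonintegral
  demand is mapped to a constant instance with a fractional but no integral solution.
\<close>

section \<open>A calculus of polynomial-time functions\<close>

text \<open>On an ordinary big arc \<open>c0\<close> private units of the main commodity and 3 units
  of each of the \<open>N\<close> small ones pass, and \<open>c0 + 3 * N + 1 = M\<close> leaves one
  unit for a network arc; a special gadget has one private unit more and is full from the start. A
  small commodity that meets two members of a scenario with the same unit saves the 1 in
  \<open>k * M - 1\<close>. If no pair lies in the scenario, nothing is saved, and the bound
  becomes: network flow hitting \<open>S\<close> plus number of special gadgets in \<open>S\<close>
  is at most \<open>k - 1\<close>. The hard direction is that an arbitrary flow must look like this.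
  Demands equal to the capacity around sources and sinks saturate all private arcs. Apart from arcs
  at sources and sinks, the potential falls only along transition arcs, and the small commodities
  together need exactly the total fall that these offer; none is left for the main commodity. Its
  paths may still join the private source arc of one gadget to the private sink arc of another, so
  they are uncrossed, which never increases a hit count. Cliques bound literals from above only, so
  each equation is written as two opposite inequalities.\<close>

lemma poly_nat_mono: "x \<le> y \<Longrightarrow> poly (p :: nat poly) x \<le> poly p y"
  by (induction p) (auto intro!: add_mono mult_le_mono)

text \<open>The program uses only the variables up to \<open>r\<close> and works whatever they initially contain,
  so programs compose without any bookkeeping of scratch variables.\<close>

definition runs ::
  "('x \<Rightarrow> val) \<Rightarrow> ('y \<Rightarrow> val) \<Rightarrow> ('x \<Rightarrow> 'y) \<Rightarrow> com \<Rightarrow> nat \<Rightarrow> nat poly \<Rightarrow> bool" where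
  "runs e e' f c r p \<longleftrightarrow> (\<forall>x \<sigma>. \<sigma> 0 = e x \<longrightarrow>
     (\<exists>n \<sigma>'. exec c \<sigma> n \<sigma>' \<and> \<sigma>' 0 = e' (f x)
        \<and> n + bitsize (e' (f x)) \<le> poly p (bitsize (e x)) \<and> (\<forall>j>r. \<sigma>' j = \<sigma> j)))"

definition PT :: "('x \<Rightarrow> val) \<Rightarrow> ('y \<Rightarrow> val) \<Rightarrow> ('x \<Rightarrow> 'y) \<Rightarrow> bool" where
  "PT e e' f \<longleftrightarrow> (\<exists>c r p. runs e e' f c r p)"

lemma runsE:
  assumes "runs e e' f c r p" "\<sigma> 0 = e x"
  obtains n \<sigma>' where "exec c \<sigma> n \<sigma>'" "\<sigma>' 0 = e' (f x)"
    "n + bitsize (e' (f x)) \<le> poly p (bitsize (e x))" "\<And>j. j > r \<Longrightarrow> \<sigma>' j = \<sigma> j"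
  using assms unfolding runs_def by blast

lemma runs_bitsize: "runs e e' f c r p \<Longrightarrow> bitsize (e' (f x)) \<le> poly p (bitsize (e x))"
  by (erule runsE[where \<sigma> = "\<lambda>_. e x"]) auto

lemma run_intro:
  "exec c \<sigma> n \<sigma>' \<Longrightarrow> \<sigma>' 0 = v \<Longrightarrow> n + bitsize v \<le> B \<Longrightarrow> \<forall>j>r. \<sigma>' j = \<sigma> j \<Longrightarrow>
   \<exists>n \<sigma>'. exec c \<sigma> n \<sigma>' \<and> \<sigma>' 0 = v \<and> n + bitsize v \<le> B \<and> (\<forall>j>r. \<sigma>' j = \<sigma> j)"
  by blast

lemma exec_Assign:
  "v = eval_expr ex \<sigma> \<Longrightarrow> exec (Assign i ex) \<sigma> (Suc (bitsize v)) (\<sigma>(i := v))"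
  by (simp add: exec.Assign)

text \<open>\<open>PT\<close> speaks about all values of a type, \<open>polytime_computable\<close>
  only about instances in \<open>X\<close>. The map \<open>g\<close> extracts from an instance the
  raw data on which the program really works.\<close>

lemma polytime_computable_PT:
  assumes "PT e e' f" "\<And>I. I \<in> X \<Longrightarrow> enc I = e (g I)" "\<And>I. I \<in> X \<Longrightarrow> enc' (h I) = e' (f (g I))"
  shows "polytime_computable X enc enc' h"
proof -
  obtain c r p where r: "runs e e' f c r p" using assms(1) unfolding PT_def by blast
  have "\<exists>n \<sigma>. exec c ((\<lambda>_. VNum 0)(0 := enc I)) n \<sigma> \<and> \<sigma> 0 = enc' (h I) \<and> n \<le> poly p (bitsize (enc I))"
    if "I \<in> X" for I
    by (rule runsE[OF r, where \<sigma> = "(\<lambda>_. VNum 0)(0 := enc I)" and x = "g I"])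
       (use assms that in \<open>auto intro: exI\<close>, metis add_leD1)
  then show ?thesis unfolding polytime_computable_def by blast
qed

lemma PT_expr:
  assumes "\<And>x (\<sigma> :: store). \<sigma> 0 = e x \<Longrightarrow> eval_expr E \<sigma> = e' (f x)"
    and "\<And>x. bitsize (e' (f x)) \<le> poly p (bitsize (e x))"
  shows "PT e e' f"
proof -
  have "runs e e' f (Assign 0 E) 0 (p + p + [:1:])"
    unfolding runs_def
  proof (intro allI impI)
    fix x and \<sigma> :: store assume "\<sigma> 0 = e x"
    then have "exec (Assign 0 E) \<sigma> (Suc (bitsize (e' (f x)))) (\<sigma>(0 := e' (f x)))"
      using exec_Assign[of "e' (f x)" E \<sigma> 0] assms(1) by metis
    then show "\<exists>n \<sigma>'. exec (Assign 0 E) \<sigma> n \<sigma>' \<and> \<sigma>' 0 = e' (f x)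
        \<and> n + bitsize (e' (f x)) \<le> poly (p + p + [:1:]) (bitsize (e x)) \<and> (\<forall>j>0. \<sigma>' j = \<sigma> j)"
      by (intro exI conjI, assumption) (use assms(2)[of x] in auto)
  qed
  then show ?thesis unfolding PT_def by blast
qed

fun expr_of :: "val \<Rightarrow> expr" where
  "expr_of (VNum n) = Const n"
| "expr_of (VPair v w) = MkPair (expr_of v) (expr_of w)"

lemma eval_expr_of [simp]: "eval_expr (expr_of v) \<sigma> = v"
  by (induction v) auto

lemma PT_const: "PT e e' (\<lambda>x. c)"
  by (rule PT_expr[where E = "expr_of (e' c)" and p = "[:bitsize (e' c):]"]) auto

lemma PT_id: "PT e e (\<lambda>x. x)"
  by (rule PT_expr[where E = "Var 0" and p = "[:0, 1:]"]) auto

text \<open>Composition works because \<open>runs\<close> bounds the size of the output together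
  with the time: the second polynomial is evaluated at the size of the first output.\<close>

lemma PT_comp:
  assumes "PT e1 e2 f" "PT e2 e3 g"
  shows "PT e1 e3 (\<lambda>x. g (f x))"
proof -
  obtain c1 r1 p1 where r1: "runs e1 e2 f c1 r1 p1" using assms(1) unfolding PT_def by blast
  obtain c2 r2 p2 where r2: "runs e2 e3 g c2 r2 p2" using assms(2) unfolding PT_def by blast
  have "runs e1 e3 (\<lambda>x. g (f x)) (Seq c1 c2) (max r1 r2) (p1 + pcompose p2 p1)"
    unfolding runs_def
  proof (intro allI impI)
    fix x and \<sigma> :: store assume s: "\<sigma> 0 = e1 x"
    obtain n1 \<sigma>1 where 1: "exec c1 \<sigma> n1 \<sigma>1" "\<sigma>1 0 = e2 (f x)"
      "n1 + bitsize (e2 (f x)) \<le> poly p1 (bitsize (e1 x))" "\<And>j. j > r1 \<Longrightarrow> \<sigma>1 j = \<sigma> j"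
      by (rule runsE[OF r1, of \<sigma> x, OF s]) auto
    obtain n2 \<sigma>2 where 2: "exec c2 \<sigma>1 n2 \<sigma>2" "\<sigma>2 0 = e3 (g (f x))"
      "n2 + bitsize (e3 (g (f x))) \<le> poly p2 (bitsize (e2 (f x)))" "\<And>j. j > r2 \<Longrightarrow> \<sigma>2 j = \<sigma>1 j"
      by (rule runsE[OF r2, of \<sigma>1 "f x", OF 1(2)]) auto
    have "poly p2 (bitsize (e2 (f x))) \<le> poly p2 (poly p1 (bitsize (e1 x)))"
      using 1(3) by (intro poly_nat_mono) auto
    then show "\<exists>n \<sigma>'. exec (Seq c1 c2) \<sigma> n \<sigma>' \<and> \<sigma>' 0 = e3 (g (f x))
        \<and> n + bitsize (e3 (g (f x))) \<le> poly (p1 + pcompose p2 p1) (bitsize (e1 x))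
        \<and> (\<forall>j>max r1 r2. \<sigma>' j = \<sigma> j)"
      using 1 2 by (intro exI[of _ "n1 + n2"] exI[of _ \<sigma>2])
        (auto intro: exec.Seq simp: poly_pcompose)
  qed
  then show ?thesis unfolding PT_def by blast
qed

abbreviation "eN \<equiv> VNum"
abbreviation "eL \<equiv> enc_list"
definition eB :: "bool \<Rightarrow> val" where "eB b = VNum (if b then 1 else 0)"
definition eP :: "('x \<Rightarrow> val) \<Rightarrow> ('y \<Rightarrow> val) \<Rightarrow> 'x \<times> 'y \<Rightarrow> val" where
  "eP a b z = VPair (a (fst z)) (b (snd z))"

lemma eP_pair [simp]: "eP a b (x, y) = VPair (a x) (b y)"
  by (simp add: eP_def)

lemma eL_Nil [simp]: "eL a [] = VNum 0" and eL_Cons [simp]: "eL a (x # xs) = VPair (a x) (eL a xs)"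
  by (auto simp: enc_list_def)

lemma PT_pair:
  assumes "PT e a f" "PT e b g"
  shows "PT e (eP a b) (\<lambda>x. (f x, g x))"
proof -
  obtain c1 r1 p1 where r1: "runs e a f c1 r1 p1" using assms(1) unfolding PT_def by blast
  obtain c2 r2 p2 where r2: "runs e b g c2 r2 p2" using assms(2) unfolding PT_def by blast
  \<comment> \<open>A register above everything that \<open>c1\<close> and \<open>c2\<close> touch.
    It keeps the input while \<open>c1\<close> runs, and \<open>Suc R\<close> keeps the first
    component while \<open>c2\<close> runs.\<close>
  define R where "R = Suc (max r1 r2)"
  have R: "r1 < R" "r2 < R" "0 < R" by (auto simp: R_def)
  let ?c = "Seq (Assign R (Var 0)) (Seq c1 (Seq (Assign (Suc R) (Var 0)) (Seq (Assign 0 (Var R))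
     (Seq c2 (Assign 0 (MkPair (Var (Suc R)) (Var 0)))))))"
  have "runs e (eP a b) (\<lambda>x. (f x, g x)) ?c (Suc R) (2 * p1 + 3 * p2 + 2 * p1 + [:10, 2:])"
    unfolding runs_def
  proof (intro allI impI)
    fix x and \<sigma> :: store assume s: "\<sigma> 0 = e x"
    define \<sigma>1 where "\<sigma>1 = \<sigma>(R := e x)"
    have 1: "exec (Assign R (Var 0)) \<sigma> (Suc (bitsize (e x))) \<sigma>1"
      unfolding \<sigma>1_def by (rule exec_Assign) (simp add: s)
    have "\<sigma>1 0 = e x" using R s by (simp add: \<sigma>1_def)
    then obtain n2 \<sigma>2 where 2: "exec c1 \<sigma>1 n2 \<sigma>2" "\<sigma>2 0 = a (f x)"
      "n2 + bitsize (a (f x)) \<le> poly p1 (bitsize (e x))" "\<And>j. j > r1 \<Longrightarrow> \<sigma>2 j = \<sigma>1 j"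
      by (rule runsE[OF r1]) auto
    define \<sigma>3 where "\<sigma>3 = \<sigma>2(Suc R := a (f x))"
    have 3: "exec (Assign (Suc R) (Var 0)) \<sigma>2 (Suc (bitsize (a (f x)))) \<sigma>3"
      unfolding \<sigma>3_def by (rule exec_Assign) (simp add: 2)
    define \<sigma>4 where "\<sigma>4 = \<sigma>3(0 := e x)"
    have 4: "exec (Assign 0 (Var R)) \<sigma>3 (Suc (bitsize (e x))) \<sigma>4"
      unfolding \<sigma>4_def by (rule exec_Assign) (simp add: \<sigma>3_def 2 R \<sigma>1_def)
    have "\<sigma>4 0 = e x" by (simp add: \<sigma>4_def)
    then obtain n5 \<sigma>5 where 5: "exec c2 \<sigma>4 n5 \<sigma>5" "\<sigma>5 0 = b (g x)"
      "n5 + bitsize (b (g x)) \<le> poly p2 (bitsize (e x))" "\<And>j. j > r2 \<Longrightarrow> \<sigma>5 j = \<sigma>4 j"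
      by (rule runsE[OF r2]) auto
    define \<sigma>6 where "\<sigma>6 = \<sigma>5(0 := eP a b (f x, g x))"
    have 6: "exec (Assign 0 (MkPair (Var (Suc R)) (Var 0))) \<sigma>5 (Suc (bitsize (eP a b (f x, g x)))) \<sigma>6"
      unfolding \<sigma>6_def by (rule exec_Assign) (use R in \<open>simp add: 5 \<sigma>4_def \<sigma>3_def\<close>)
    have E: "exec ?c \<sigma> (Suc (bitsize (e x)) + (n2 + (Suc (bitsize (a (f x))) + (Suc (bitsize (e x))
      + (n5 + Suc (bitsize (eP a b (f x, g x)))))))) \<sigma>6"
      by (rule exec.Seq[OF 1 exec.Seq[OF 2(1) exec.Seq[OF 3 exec.Seq[OF 4 exec.Seq[OF 5(1) 6]]]]])
    have J: "\<forall>j>Suc R. \<sigma>6 j = \<sigma> j"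
      using R by (auto simp: \<sigma>6_def 5 \<sigma>4_def \<sigma>3_def 2 \<sigma>1_def)
    show "\<exists>n \<sigma>'. exec ?c \<sigma> n \<sigma>' \<and> \<sigma>' 0 = eP a b (f x, g x)
        \<and> n + bitsize (eP a b (f x, g x)) \<le> poly (2 * p1 + 3 * p2 + 2 * p1 + [:10, 2:]) (bitsize (e x))
        \<and> (\<forall>j>Suc R. \<sigma>' j = \<sigma> j)"
      by (rule run_intro[OF E _ _ J]) (use 2(3) 5(3) in \<open>auto simp: \<sigma>6_def\<close>)
  qed
  then show ?thesis unfolding PT_def by blast
qed

lemma PT_if:
  assumes "PT e eB b" "PT e a f" "PT e a g"
  shows "PT e a (\<lambda>x. if b x then f x else g x)"
proof -
  obtain c0 r0 p0 where r0: "runs e eB b c0 r0 p0" using assms(1) unfolding PT_def by blast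
  obtain c1 r1 p1 where r1: "runs e a f c1 r1 p1" using assms(2) unfolding PT_def by blast
  obtain c2 r2 p2 where r2: "runs e a g c2 r2 p2" using assms(3) unfolding PT_def by blast
  define R where "R = Suc (max r0 (max r1 r2))"
  have R: "r0 < R" "r1 < R" "r2 < R" "0 < R" by (auto simp: R_def)
  let ?c = "Seq (Assign R (Var 0)) (Seq c0 (Seq (Assign (Suc R) (Var 0)) (Seq (Assign 0 (Var R))
     (Cond (Var (Suc R)) c1 c2))))"
  have "runs e a (\<lambda>x. if b x then f x else g x) ?c (Suc R) (2 * p0 + p1 + p2 + [:10, 2:])"
    unfolding runs_def
  proof (intro allI impI)
    fix x and \<sigma> :: store assume s: "\<sigma> 0 = e x"
    define \<sigma>1 where "\<sigma>1 = \<sigma>(R := e x)"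
    have 1: "exec (Assign R (Var 0)) \<sigma> (Suc (bitsize (e x))) \<sigma>1"
      unfolding \<sigma>1_def by (rule exec_Assign) (simp add: s)
    have "\<sigma>1 0 = e x" using R s by (simp add: \<sigma>1_def)
    then obtain n2 \<sigma>2 where 2: "exec c0 \<sigma>1 n2 \<sigma>2" "\<sigma>2 0 = eB (b x)"
      "n2 + bitsize (eB (b x)) \<le> poly p0 (bitsize (e x))" "\<And>j. j > r0 \<Longrightarrow> \<sigma>2 j = \<sigma>1 j"
      by (rule runsE[OF r0]) auto
    define \<sigma>3 where "\<sigma>3 = \<sigma>2(Suc R := eB (b x))"
    have 3: "exec (Assign (Suc R) (Var 0)) \<sigma>2 (Suc (bitsize (eB (b x)))) \<sigma>3"
      unfolding \<sigma>3_def by (rule exec_Assign) (simp add: 2)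
    define \<sigma>4 where "\<sigma>4 = \<sigma>3(0 := e x)"
    have 4: "exec (Assign 0 (Var R)) \<sigma>3 (Suc (bitsize (e x))) \<sigma>4"
      unfolding \<sigma>4_def by (rule exec_Assign) (simp add: \<sigma>3_def 2 R \<sigma>1_def)
    have s4: "\<sigma>4 0 = e x" by (simp add: \<sigma>4_def)
    have t: "eval_expr (Var (Suc R)) \<sigma>4 = eB (b x)" by (simp add: \<sigma>4_def \<sigma>3_def)
    have "\<exists>n \<sigma>5. exec (Cond (Var (Suc R)) c1 c2) \<sigma>4 (Suc n) \<sigma>5 \<and> \<sigma>5 0 = a (if b x then f x else g x)
       \<and> n + bitsize (a (if b x then f x else g x)) \<le> poly (p1 + p2) (bitsize (e x)) \<and> (\<forall>j>Suc R. \<sigma>5 j = \<sigma>4 j)"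
    proof (cases "b x")
      case True
      obtain n5 \<sigma>5 where 5: "exec c1 \<sigma>4 n5 \<sigma>5" "\<sigma>5 0 = a (f x)"
        "n5 + bitsize (a (f x)) \<le> poly p1 (bitsize (e x))" "\<And>j. j > r1 \<Longrightarrow> \<sigma>5 j = \<sigma>4 j"
        by (rule runsE[OF r1, of \<sigma>4 x, OF s4]) auto
      have "exec (Cond (Var (Suc R)) c1 c2) \<sigma>4 (Suc n5) \<sigma>5"
        by (rule exec.CondTrue) (use t True 5 in \<open>auto simp: eB_def\<close>)
      then show ?thesis using 5 True R by (intro exI[of _ n5] exI[of _ \<sigma>5]) auto
    next
      case False
      obtain n5 \<sigma>5 where 5: "exec c2 \<sigma>4 n5 \<sigma>5" "\<sigma>5 0 = a (g x)"
        "n5 + bitsize (a (g x)) \<le> poly p2 (bitsize (e x))" "\<And>j. j > r2 \<Longrightarrow> \<sigma>5 j = \<sigma>4 j"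
        by (rule runsE[OF r2, of \<sigma>4 x, OF s4]) auto
      have "exec (Cond (Var (Suc R)) c1 c2) \<sigma>4 (Suc n5) \<sigma>5"
        by (rule exec.CondFalse) (use t False 5 in \<open>auto simp: eB_def\<close>)
      then show ?thesis using 5 False R by (intro exI[of _ n5] exI[of _ \<sigma>5]) auto
    qed
    then obtain n5 \<sigma>5 where 5: "exec (Cond (Var (Suc R)) c1 c2) \<sigma>4 (Suc n5) \<sigma>5"
       "\<sigma>5 0 = a (if b x then f x else g x)"
       "n5 + bitsize (a (if b x then f x else g x)) \<le> poly (p1 + p2) (bitsize (e x))"
       "\<And>j. j > Suc R \<Longrightarrow> \<sigma>5 j = \<sigma>4 j" by blast
    have E: "exec ?c \<sigma> (Suc (bitsize (e x)) + (n2 + (Suc (bitsize (eB (b x))) + (Suc (bitsize (e x))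
      + Suc n5)))) \<sigma>5"
      by (rule exec.Seq[OF 1 exec.Seq[OF 2(1) exec.Seq[OF 3 exec.Seq[OF 4 5(1)]]]])
    have J: "\<forall>j>Suc R. \<sigma>5 j = \<sigma> j"
      using R by (auto simp: 5 \<sigma>4_def \<sigma>3_def 2 \<sigma>1_def)
    show "\<exists>n \<sigma>'. exec ?c \<sigma> n \<sigma>' \<and> \<sigma>' 0 = a (if b x then f x else g x)
        \<and> n + bitsize (a (if b x then f x else g x)) \<le> poly (2 * p0 + p1 + p2 + [:10, 2:]) (bitsize (e x))
        \<and> (\<forall>j>Suc R. \<sigma>' j = \<sigma> j)"
      by (rule run_intro[OF E _ _ J]) (use 2(3) 5(2,3) in auto)
  qed
  then show ?thesis unfolding PT_def by blast
qed

lemma bitsize_list_ge: "y \<in> set ys \<Longrightarrow> bitsize (a y) \<le> bitsize (eL a ys)"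
  by (induction ys) auto

lemma length_le_bitsize: "length ys < bitsize (eL a ys)"
  by (induction ys) auto

lemma bitsize_eL: "bitsize (eL a ys) = Suc (\<Sum>y\<leftarrow>ys. Suc (bitsize (a y)))"
  by (induction ys) auto

text \<open>Register \<open>R\<close> holds the context, \<open>R + 1\<close> the accumulator and
  \<open>R + 2\<close> the rest of the list; the loop test works because only the empty list is
  encoded by the number 0. \<open>B\<close> bounds the accumulators of all prefixes, so every round
  costs at most \<open>T\<close>.\<close>

lemma exec_fold:
  fixes a :: "'y \<Rightarrow> val" and b :: "'z \<Rightarrow> val"
  assumes h: "runs (eP a (eP b e)) b (\<lambda>z. h (fst z) (fst (snd z)) (snd (snd z))) ch rh ph"
    and R: "rh < R" "\<sigma> R = e x" "\<sigma> (R + 1) = b acc" "\<sigma> (R + 2) = eL a ys"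
    and B: "\<And>n. bitsize (b (fold (\<lambda>y acc. h y acc x) (take n ys) acc)) \<le> B"
    and S: "bitsize (eL a ys) \<le> S" "bitsize (e x) \<le> S"
  defines "body \<equiv> Seq (Assign 0 (MkPair (Fst (Var (R + 2))) (MkPair (Var (R + 1)) (Var R))))
      (Seq ch (Seq (Assign (R + 1) (Var 0)) (Assign (R + 2) (Snd (Var (R + 2))))))"
    and "T \<equiv> 10 + 4 * S + 2 * B + poly ph (2 + 2 * S + B)"
  shows "\<exists>n \<sigma>'. exec (While (Var (R + 2)) body) \<sigma> n \<sigma>' \<and> n \<le> Suc (length ys * Suc T)
     \<and> \<sigma>' (R + 1) = b (fold (\<lambda>y acc. h y acc x) ys acc) \<and> (\<forall>j>R + 2. \<sigma>' j = \<sigma> j)"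
  using R B S
proof (induction ys arbitrary: acc \<sigma>)
  case Nil
  have "exec (While (Var (R + 2)) body) \<sigma> 1 \<sigma>"
    by (rule exec.WhileFalse) (use Nil in auto)
  then show ?case using Nil by (intro exI[of _ 1] exI[of _ \<sigma>]) auto
next
  case (Cons y ys)
  let ?z = "(y, (acc, x))"
  define \<sigma>1 where "\<sigma>1 = \<sigma>(0 := eP a (eP b e) ?z)"
  have 1: "exec (Assign 0 (MkPair (Fst (Var (R + 2))) (MkPair (Var (R + 1)) (Var R)))) \<sigma>
     (Suc (bitsize (eP a (eP b e) ?z))) \<sigma>1"
    unfolding \<sigma>1_def by (rule exec_Assign) (use Cons.prems in \<open>simp\<close>)
  have "\<sigma>1 0 = eP a (eP b e) ?z" by (simp add: \<sigma>1_def)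
  then obtain n2 \<sigma>2 where 2: "exec ch \<sigma>1 n2 \<sigma>2" "\<sigma>2 0 = b (h y acc x)"
      "n2 + bitsize (b (h y acc x)) \<le> poly ph (bitsize (eP a (eP b e) ?z))" "\<And>j. j > rh \<Longrightarrow> \<sigma>2 j = \<sigma>1 j"
    by (rule runsE[OF h]) auto
  define \<sigma>3 where "\<sigma>3 = \<sigma>2(R + 1 := b (h y acc x))"
  have 3: "exec (Assign (R + 1) (Var 0)) \<sigma>2 (Suc (bitsize (b (h y acc x)))) \<sigma>3"
    unfolding \<sigma>3_def by (rule exec_Assign) (simp add: 2)
  define \<sigma>4 where "\<sigma>4 = \<sigma>3(R + 2 := eL a ys)"
  have 4: "exec (Assign (R + 2) (Snd (Var (R + 2)))) \<sigma>3 (Suc (bitsize (eL a ys))) \<sigma>4"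
    unfolding \<sigma>4_def by (rule exec_Assign) (use Cons.prems(1,4) in \<open>simp add: \<sigma>3_def 2 \<sigma>1_def\<close>)
  have b: "exec body \<sigma> (Suc (bitsize (eP a (eP b e) ?z)) + (n2 + (Suc (bitsize (b (h y acc x)))
      + Suc (bitsize (eL a ys))))) \<sigma>4"
    unfolding body_def by (rule exec.Seq[OF 1 exec.Seq[OF 2(1) exec.Seq[OF 3 4]]])
  have "\<exists>n \<sigma>'. exec (While (Var (R + 2)) body) \<sigma>4 n \<sigma>' \<and> n \<le> Suc (length ys * Suc T)
     \<and> \<sigma>' (R + 1) = b (fold (\<lambda>y acc. h y acc x) ys (h y acc x)) \<and> (\<forall>j>R + 2. \<sigma>' j = \<sigma>4 j)"
  proof (rule Cons.IH)
    show "\<sigma>4 R = e x" using Cons.prems(1,2) by (simp add: \<sigma>4_def \<sigma>3_def 2 \<sigma>1_def)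
    show "\<sigma>4 (R + 1) = b (h y acc x)" by (simp add: \<sigma>4_def \<sigma>3_def)
    show "bitsize (b (fold (\<lambda>y acc. h y acc x) (take n ys) (h y acc x))) \<le> B" for n
      using Cons.prems(5)[of "Suc n"] by simp
  qed (use Cons.prems in \<open>auto simp: \<sigma>4_def\<close>)
  then obtain n \<sigma>' where IH: "exec (While (Var (R + 2)) body) \<sigma>4 n \<sigma>'" "n \<le> Suc (length ys * Suc T)"
     "\<sigma>' (R + 1) = b (fold (\<lambda>y acc. h y acc x) ys (h y acc x))" "\<forall>j>R + 2. \<sigma>' j = \<sigma>4 j" by blast
  have w: "exec (While (Var (R + 2)) body) \<sigma> (Suc ((Suc (bitsize (eP a (eP b e) ?z)) + (n2 + (Suc (bitsize (b (h y acc x)))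
      + Suc (bitsize (eL a ys))))) + n)) \<sigma>'"
    by (rule exec.WhileTrue[OF _ b IH(1)]) (use Cons.prems in simp)
  have zs: "bitsize (eP a (eP b e) ?z) \<le> 2 + 2 * S + B"
    using Cons.prems(5)[of 0] Cons.prems(6,7) by simp
  have "poly ph (bitsize (eP a (eP b e) ?z)) \<le> poly ph (2 + 2 * S + B)"
    by (rule poly_nat_mono[OF zs])
  moreover have "bitsize (b (h y acc x)) \<le> B"
    using Cons.prems(5)[of 1] by simp
  ultimately have "(Suc (bitsize (eP a (eP b e) ?z)) + (n2 + (Suc (bitsize (b (h y acc x)))
      + Suc (bitsize (eL a ys))))) \<le> T"
    using zs 2(3) Cons.prems(6) unfolding T_def by simp
  then have "Suc ((Suc (bitsize (eP a (eP b e) ?z)) + (n2 + (Suc (bitsize (b (h y acc x)))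
      + Suc (bitsize (eL a ys))))) + n) \<le> Suc (length (y # ys) * Suc T)"
    using IH(2) by simp
  moreover have "\<forall>j>R + 2. \<sigma>' j = \<sigma> j"
    using IH(4) Cons.prems(1) by (auto simp: \<sigma>4_def \<sigma>3_def 2 \<sigma>1_def)
  ultimately show ?case
    by - (rule exI, rule exI, rule conjI, rule w, use IH(3) in simp)
qed

text \<open>The bound on the accumulators is a separate hypothesis because it does not follow from
  the step being polynomial: iterating a step that doubles the size already gives exponential
  growth.\<close>

lemma PT_fold:
  fixes a :: "'y \<Rightarrow> val" and b :: "'z \<Rightarrow> val"
  assumes "PT e (eL a) l" "PT e b i"
    and "PT (eP a (eP b e)) b (\<lambda>z. h (fst z) (fst (snd z)) (snd (snd z)))"
    and B: "\<And>x n. bitsize (b (fold (\<lambda>y acc. h y acc x) (take n (l x)) (i x))) \<le> poly q (bitsize (e x))"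
  shows "PT e b (\<lambda>x. fold (\<lambda>y acc. h y acc x) (l x) (i x))"
proof -
  obtain c1 r1 p1 where r1: "runs e (eL a) l c1 r1 p1" using assms(1) unfolding PT_def by blast
  obtain c2 r2 p2 where r2: "runs e b i c2 r2 p2" using assms(2) unfolding PT_def by blast
  obtain c3 r3 p3 where r3: "runs (eP a (eP b e)) b (\<lambda>z. h (fst z) (fst (snd z)) (snd (snd z))) c3 r3 p3"
    using assms(3) unfolding PT_def by blast
  define R where "R = Suc (max r1 (max r2 r3))"
  have R: "r1 < R" "r2 < R" "r3 < R" "0 < R" by (auto simp: R_def)
  define body where "body = Seq (Assign 0 (MkPair (Fst (Var (R + 2))) (MkPair (Var (R + 1)) (Var R))))
      (Seq c3 (Seq (Assign (R + 1) (Var 0)) (Assign (R + 2) (Snd (Var (R + 2))))))"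
  let ?c = "Seq (Assign R (Var 0)) (Seq c2 (Seq (Assign (R + 1) (Var 0)) (Seq (Assign 0 (Var R))
     (Seq c1 (Seq (Assign (R + 2) (Var 0)) (Seq (While (Var (R + 2)) body) (Assign 0 (Var (R + 1)))))))))"
  define S where "S = p1 + [:0, 1:]"
  define T where "T = [:10:] + 4 * S + 2 * q + pcompose p3 ([:2:] + 2 * S + q)"
  define P where "P = [:20, 2:] + 2 * p2 + 2 * p1 + 2 * q + p1 * (T + [:1:])"
  have "runs e b (\<lambda>x. fold (\<lambda>y acc. h y acc x) (l x) (i x)) ?c (R + 2) P"
    unfolding runs_def
  proof (intro allI impI)
    fix x and \<sigma> :: store assume s: "\<sigma> 0 = e x"
    let ?res = "b (fold (\<lambda>y acc. h y acc x) (l x) (i x))"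
    define \<sigma>1 where "\<sigma>1 = \<sigma>(R := e x)"
    have 1: "exec (Assign R (Var 0)) \<sigma> (Suc (bitsize (e x))) \<sigma>1"
      unfolding \<sigma>1_def by (rule exec_Assign) (simp add: s)
    have "\<sigma>1 0 = e x" using R s by (simp add: \<sigma>1_def)
    then obtain n2 \<sigma>2 where 2: "exec c2 \<sigma>1 n2 \<sigma>2" "\<sigma>2 0 = b (i x)"
      "n2 + bitsize (b (i x)) \<le> poly p2 (bitsize (e x))" "\<And>j. j > r2 \<Longrightarrow> \<sigma>2 j = \<sigma>1 j"
      by (rule runsE[OF r2]) auto
    define \<sigma>3 where "\<sigma>3 = \<sigma>2(R + 1 := b (i x))"
    have 3: "exec (Assign (R + 1) (Var 0)) \<sigma>2 (Suc (bitsize (b (i x)))) \<sigma>3"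
      unfolding \<sigma>3_def by (rule exec_Assign) (simp add: 2)
    define \<sigma>4 where "\<sigma>4 = \<sigma>3(0 := e x)"
    have 4: "exec (Assign 0 (Var R)) \<sigma>3 (Suc (bitsize (e x))) \<sigma>4"
      unfolding \<sigma>4_def by (rule exec_Assign) (simp add: \<sigma>3_def 2 R \<sigma>1_def)
    have "\<sigma>4 0 = e x" by (simp add: \<sigma>4_def)
    then obtain n5 \<sigma>5 where 5: "exec c1 \<sigma>4 n5 \<sigma>5" "\<sigma>5 0 = eL a (l x)"
      "n5 + bitsize (eL a (l x)) \<le> poly p1 (bitsize (e x))" "\<And>j. j > r1 \<Longrightarrow> \<sigma>5 j = \<sigma>4 j"
      by (rule runsE[OF r1]) auto
    define \<sigma>6 where "\<sigma>6 = \<sigma>5(R + 2 := eL a (l x))"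
    have 6: "exec (Assign (R + 2) (Var 0)) \<sigma>5 (Suc (bitsize (eL a (l x)))) \<sigma>6"
      unfolding \<sigma>6_def by (rule exec_Assign) (simp add: 5)
    let ?S = "poly S (bitsize (e x))" and ?B = "poly q (bitsize (e x))"
    have "\<exists>n \<sigma>'. exec (While (Var (R + 2)) body) \<sigma>6 n \<sigma>'
       \<and> n \<le> Suc (length (l x) * Suc (10 + 4 * ?S + 2 * ?B + poly p3 (2 + 2 * ?S + ?B)))
       \<and> \<sigma>' (R + 1) = ?res \<and> (\<forall>j>R + 2. \<sigma>' j = \<sigma>6 j)"
      unfolding body_def
    proof (rule exec_fold[OF r3])
      show "\<sigma>6 R = e x" using R by (simp add: \<sigma>6_def 5 \<sigma>4_def \<sigma>3_def 2 \<sigma>1_def)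
      show "\<sigma>6 (R + 1) = b (i x)" using R by (simp add: \<sigma>6_def 5 \<sigma>4_def \<sigma>3_def)
      show "\<sigma>6 (R + 2) = eL a (l x)" by (simp add: \<sigma>6_def)
      show "bitsize (eL a (l x)) \<le> poly S (bitsize (e x))" using 5(3) by (simp add: S_def)
    qed (use R B in \<open>auto simp: S_def\<close>)
    then obtain n7 \<sigma>7 where 7: "exec (While (Var (R + 2)) body) \<sigma>6 n7 \<sigma>7"
      "n7 \<le> Suc (length (l x) * Suc (poly T (bitsize (e x))))"
      "\<sigma>7 (R + 1) = ?res" "\<forall>j>R + 2. \<sigma>7 j = \<sigma>6 j"
      by (auto simp: T_def poly_pcompose)
    define \<sigma>8 where "\<sigma>8 = \<sigma>7(0 := ?res)"
    have 8: "exec (Assign 0 (Var (R + 1))) \<sigma>7 (Suc (bitsize ?res)) \<sigma>8"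
      unfolding \<sigma>8_def by (rule exec_Assign) (use 7 in simp)
    have E: "exec ?c \<sigma> (Suc (bitsize (e x)) + (n2 + (Suc (bitsize (b (i x))) + (Suc (bitsize (e x))
      + (n5 + (Suc (bitsize (eL a (l x))) + (n7 + Suc (bitsize ?res)))))))) \<sigma>8"
      by (rule exec.Seq[OF 1 exec.Seq[OF 2(1) exec.Seq[OF 3 exec.Seq[OF 4 exec.Seq[OF 5(1) exec.Seq[OF 6 exec.Seq[OF 7(1) 8]]]]]]])
    have rb: "bitsize ?res \<le> ?B" using B[of x "length (l x)"] by simp
    have "length (l x) \<le> poly p1 (bitsize (e x))"
      using length_le_bitsize[of "l x" a] 5(3) by simp
    then have "length (l x) * Suc (poly T (bitsize (e x))) \<le> poly p1 (bitsize (e x)) * Suc (poly T (bitsize (e x)))"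
      by (rule mult_le_mono1)
    then have n7: "n7 \<le> Suc (poly p1 (bitsize (e x)) * Suc (poly T (bitsize (e x))))"
      using 7(2) by linarith
    have time: "(Suc (bitsize (e x)) + (n2 + (Suc (bitsize (b (i x))) + (Suc (bitsize (e x))
      + (n5 + (Suc (bitsize (eL a (l x))) + (n7 + Suc (bitsize ?res)))))))) + bitsize ?res \<le> poly P (bitsize (e x))"
      using rb n7 2(3) 5(3) by (simp add: P_def)
    have J: "\<forall>j>R + 2. \<sigma>8 j = \<sigma> j"
      using R by (auto simp: \<sigma>8_def 7 \<sigma>6_def 5 \<sigma>4_def \<sigma>3_def 2 \<sigma>1_def)
    show "\<exists>n \<sigma>'. exec ?c \<sigma> n \<sigma>' \<and> \<sigma>' 0 = ?res
        \<and> n + bitsize ?res \<le> poly P (bitsize (e x)) \<and> (\<forall>j>R + 2. \<sigma>' j = \<sigma> j)"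
      by (rule run_intro[OF E _ time J]) (simp add: \<sigma>8_def)
  qed
  then show ?thesis unfolding PT_def by blast
qed

section \<open>Bit lengths; arithmetic and Boolean operations\<close>

lemma floor_log_less: "n < 2 ^ k \<Longrightarrow> 0 < k \<Longrightarrow> floor_log n < k"
proof (cases "n = 0")
  case False
  assume "n < 2 ^ k"
  then have "2 ^ floor_log n < (2 :: nat) ^ k"
    using floor_log_exp2_le[of n] False by linarith
  then show ?thesis by simp
qed simp

text \<open>One power of 2 serves for both: it bounds the product, and the sum as well, since x + y
  is at most x * y for factors of at least 2. The results are so small that the encoded pair of
  arguments is already longer than the encoded value.\<close>

lemma floor_log_add_mult:
  "floor_log (a + b) \<le> Suc (floor_log a + floor_log b)"
  "floor_log (a * b) \<le> Suc (floor_log a + floor_log b)"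
proof -
  let ?A = "2 * 2 ^ floor_log a" and ?B = "2 * 2 ^ floor_log b :: nat"
  have ab: "a < ?A" "b < ?B" by (rule floor_log_exp2_gt)+
  have p: "(2 :: nat) ^ (2 + floor_log a + floor_log b) = ?A * ?B"
    by (simp add: power_add)
  have "x + y \<le> x * y" if "2 \<le> x" "2 \<le> y" for x y :: nat
  proof -
    have "2 * y \<le> x * y" "x * 2 \<le> x * y" using that by (auto intro: mult_le_mono)
    then show ?thesis by linarith
  qed
  from this[of ?A ?B] have "?A + ?B \<le> ?A * ?B" by simp
  then have "a + b < 2 ^ (2 + floor_log a + floor_log b)" using ab unfolding p by linarith
  from floor_log_less[OF this] show "floor_log (a + b) \<le> Suc (floor_log a + floor_log b)" by simp
  have "a * b < 2 ^ (2 + floor_log a + floor_log b)" unfolding p using mult_strict_mono[OF ab] by simp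
  from floor_log_less[OF this] show "floor_log (a * b) \<le> Suc (floor_log a + floor_log b)" by simp
qed

lemma floor_log_le_self: "floor_log n \<le> n"
  by (induction n rule: floor_log.induct) (subst floor_log.simps, auto)

lemma PT_fst: "PT e (eP a b) f \<Longrightarrow> PT e a (\<lambda>x. fst (f x))"
  by (rule PT_comp, assumption, rule PT_expr[where E = "Fst (Var 0)" and p = "[:0, 1:]"])
     (auto simp: eP_def)

lemma PT_snd: "PT e (eP a b) f \<Longrightarrow> PT e b (\<lambda>x. snd (f x))"
  by (rule PT_comp, assumption, rule PT_expr[where E = "Snd (Var 0)" and p = "[:0, 1:]"])
     (auto simp: eP_def)

lemma PT_comp2:
  assumes "PT (eP a b) d (\<lambda>z. F (fst z) (snd z))" "PT e a f" "PT e b g"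
  shows "PT e d (\<lambda>x. F (f x) (g x))"
  using PT_comp[OF PT_pair[OF assms(2,3)] assms(1)] by simp

lemma PT_add: "PT e eN f \<Longrightarrow> PT e eN g \<Longrightarrow> PT e eN (\<lambda>x. f x + g x)"
  by (rule PT_comp2[where F = "(+)"], rule PT_expr[where E = "Add (Fst (Var 0)) (Snd (Var 0))" and p = "[:0, 1:]"])
     (use floor_log_add_mult in \<open>auto simp: eP_def intro: le_SucI\<close>)

lemma PT_mult: "PT e eN f \<Longrightarrow> PT e eN g \<Longrightarrow> PT e eN (\<lambda>x. f x * g x)"
  by (rule PT_comp2[where F = "(*)"], rule PT_expr[where E = "Mul (Fst (Var 0)) (Snd (Var 0))" and p = "[:0, 1:]"])
     (use floor_log_add_mult in \<open>auto simp: eP_def intro: le_SucI\<close>)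

lemma PT_diff: "PT e eN f \<Longrightarrow> PT e eN g \<Longrightarrow> PT e eN (\<lambda>x. f x - g x)"
  by (rule PT_comp2[where F = "(-)"], rule PT_expr[where E = "Sub (Fst (Var 0)) (Snd (Var 0))" and p = "[:0, 1:]"])
     (auto simp: eP_def intro!: le_SucI trans_le_add1 floor_log_le_iff)

lemma PT_div: "PT e eN f \<Longrightarrow> PT e eN g \<Longrightarrow> PT e eN (\<lambda>x. f x div g x)"
  by (rule PT_comp2[where F = "(div)"], rule PT_expr[where E = "Quo (Fst (Var 0)) (Snd (Var 0))" and p = "[:0, 1:]"])
     (auto simp: eP_def intro!: le_SucI trans_le_add1 floor_log_le_iff)

lemma PT_Suc: "PT e eN f \<Longrightarrow> PT e eN (\<lambda>x. Suc (f x))"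
  using PT_add[OF _ PT_const[where c = 1]] by fastforce

lemma bitsize_eB [simp]: "bitsize (eB b) = 1"
  by (simp add: eB_def)

lemma PT_le: "PT e eN f \<Longrightarrow> PT e eN g \<Longrightarrow> PT e eB (\<lambda>x. f x \<le> g x)"
  by (rule PT_comp2[where F = "(\<le>)"], rule PT_expr[where E = "Sub (Const 1) (Sub (Fst (Var 0)) (Snd (Var 0)))" and p = "[:1:]"])
     (auto simp: eP_def eB_def)

lemma PT_less: "PT e eN f \<Longrightarrow> PT e eN g \<Longrightarrow> PT e eB (\<lambda>x. f x < g x)"
  using PT_le[OF PT_Suc, of e f g] by (simp add: Suc_le_eq)

lemma PT_conj:
  assumes "PT e eB f" "PT e eB g" shows "PT e eB (\<lambda>x. f x \<and> g x)"
proof -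
  have "(\<lambda>x. f x \<and> g x) = (\<lambda>x. if f x then g x else False)" by auto
  then show ?thesis by (simp only: PT_if PT_const assms)
qed

lemma PT_disj:
  assumes "PT e eB f" "PT e eB g" shows "PT e eB (\<lambda>x. f x \<or> g x)"
proof -
  have "(\<lambda>x. f x \<or> g x) = (\<lambda>x. if f x then True else g x)" by auto
  then show ?thesis by (simp only: PT_if PT_const assms)
qed

lemma PT_not:
  assumes "PT e eB f" shows "PT e eB (\<lambda>x. \<not> f x)"
proof -
  have "(\<lambda>x. \<not> f x) = (\<lambda>x. if f x then False else True)" by auto
  then show ?thesis by (simp only: PT_if PT_const assms)
qed

lemma PT_eq: "PT e eN f \<Longrightarrow> PT e eN g \<Longrightarrow> PT e eB (\<lambda>x. f x = g x)"
  unfolding eq_iff by (intro PT_conj PT_le)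

section \<open>List operations, all obtained from folds\<close>

lemma PT_Cons: "PT e a f \<Longrightarrow> PT e (eL a) g \<Longrightarrow> PT e (eL a) (\<lambda>x. f x # g x)"
  using PT_pair[of e a f "eL a" g] by (simp add: PT_def runs_def)

lemma PT_bound:
  assumes "PT e a f" shows "\<exists>p. \<forall>x. bitsize (a (f x)) \<le> poly p (bitsize (e x))"
  using assms runs_bitsize unfolding PT_def by metis

lemma bitsize_eL_append: "bitsize (eL a (xs @ ys)) = bitsize (eL a xs) + bitsize (eL a ys) - 1"
  by (simp add: bitsize_eL)

lemma bitsize_eL_filter: "bitsize (eL a (filter P xs)) \<le> bitsize (eL a xs)"
  by (induction xs) auto

lemma bitsize_eL_rev: "bitsize (eL a (rev xs)) = bitsize (eL a xs)"
  by (simp add: bitsize_eL flip: rev_map)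

lemma bitsize_eL_take: "bitsize (eL a (take n xs)) \<le> bitsize (eL a xs)"
proof (induction xs arbitrary: n)
  case (Cons x xs)
  then show ?case by (cases n) auto
qed simp

lemma bitsize_eL_take_rev: "bitsize (eL a (take n (rev xs))) \<le> bitsize (eL a xs)"
  by (metis bitsize_eL_rev bitsize_eL_take)

lemma bitsize_eL_bound:
  "(\<And>y. y \<in> set ys \<Longrightarrow> bitsize (a y) \<le> B) \<Longrightarrow> bitsize (eL a ys) \<le> Suc (length ys * Suc B)"
proof (induction ys)
  case (Cons y ys)
  have "bitsize (a y) \<le> B" "bitsize (eL a ys) \<le> Suc (length ys * Suc B)" using Cons by auto
  then show ?case by simp
qed simp

lemma fold_cons_map: "fold (\<lambda>y acc. f y # acc) xs acc = rev (map f xs) @ acc"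
  by (induction xs arbitrary: acc) auto

text \<open>Comes first because consing in a left fold reverses a list: the operations below fold
  over \<open>rev\<close> of their input to restore the order.\<close>

lemma PT_rev: assumes "PT e (eL a) l" shows "PT e (eL a) (\<lambda>x. rev (l x))"
proof -
  obtain p where p: "\<And>x. bitsize (eL a (l x)) \<le> poly p (bitsize (e x))" using PT_bound[OF assms] by blast
  have "PT e (eL a) (\<lambda>x. fold (\<lambda>y acc. y # acc) (l x) [])"
  proof (rule PT_fold[OF assms PT_const])
    show "PT (eP a (eP (eL a) e)) (eL a) (\<lambda>z. fst z # fst (snd z))"
      by (intro PT_Cons PT_fst[OF PT_id] PT_fst[OF PT_snd[OF PT_id]])
    show "bitsize (eL a (fold (\<lambda>y acc. y # acc) (take n (l x)) [])) \<le> poly p (bitsize (e x))" for x n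
      using order.trans[OF bitsize_eL_take p] by (simp add: fold_cons_map bitsize_eL_rev)
  qed
  then show ?thesis by (simp add: fold_cons_map)
qed

lemma PT_append:
  assumes "PT e (eL a) f" "PT e (eL a) g" shows "PT e (eL a) (\<lambda>x. f x @ g x)"
proof -
  obtain p where p: "\<And>x. bitsize (eL a (f x)) \<le> poly p (bitsize (e x))" using PT_bound[OF assms(1)] by blast
  obtain q where q: "\<And>x. bitsize (eL a (g x)) \<le> poly q (bitsize (e x))" using PT_bound[OF assms(2)] by blast
  have "PT e (eL a) (\<lambda>x. fold (\<lambda>y acc. y # acc) (rev (f x)) (g x))"
  proof (rule PT_fold[OF PT_rev[OF assms(1)] assms(2)])
    show "PT (eP a (eP (eL a) e)) (eL a) (\<lambda>z. fst z # fst (snd z))"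
      by (intro PT_Cons PT_fst[OF PT_id] PT_fst[OF PT_snd[OF PT_id]])
    show "bitsize (eL a (fold (\<lambda>y acc. y # acc) (take n (rev (f x))) (g x))) \<le> poly (p + q) (bitsize (e x))" for x n
      using order.trans[OF bitsize_eL_take_rev p, of n x] q[of x]
      by (simp add: fold_cons_map bitsize_eL_rev bitsize_eL_append)
  qed
  then show ?thesis by (simp add: fold_cons_map)
qed

lemma PT_map:
  assumes l: "PT e (eL a) l" and h: "PT (eP a e) b (\<lambda>z. h (fst z) (snd z))"
  shows "PT e (eL b) (\<lambda>x. map (\<lambda>y. h y x) (l x))"
proof -
  obtain p where p: "\<And>x. bitsize (eL a (l x)) \<le> poly p (bitsize (e x))" using PT_bound[OF l] by blast
  obtain q where q: "\<And>z. bitsize (b (h (fst z) (snd z))) \<le> poly q (bitsize (eP a e z))" using PT_bound[OF h] by blast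
  have "PT e (eL b) (\<lambda>x. fold (\<lambda>y acc. h y x # acc) (rev (l x)) [])"
  proof (rule PT_fold[OF PT_rev[OF l] PT_const])
    have "PT (eP a (eP (eL b) e)) b (\<lambda>z. h (fst z) (snd (snd z)))"
      by (rule PT_comp2[OF h]) (intro PT_fst[OF PT_id] PT_snd[OF PT_snd[OF PT_id]])+
    then show "PT (eP a (eP (eL b) e)) (eL b) (\<lambda>z. h (fst z) (snd (snd z)) # fst (snd z))"
      by (intro PT_Cons PT_fst[OF PT_snd[OF PT_id]])
    fix x n
    have "bitsize (b (h y x)) \<le> poly (pcompose q (p + [:1, 1:])) (bitsize (e x))" if "y \<in> set (l x)" for y
    proof -
      have "bitsize (eP a e (y, x)) \<le> poly (p + [:1, 1:]) (bitsize (e x))"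
        using order.trans[OF bitsize_list_ge[OF that, of a] p] by simp
      then show ?thesis using order.trans[OF q[of "(y, x)"] poly_nat_mono] by (simp add: poly_pcompose)
    qed
    then have "bitsize (eL b (map (\<lambda>y. h y x) (take n (rev (l x)))))
        \<le> Suc (length (map (\<lambda>y. h y x) (take n (rev (l x)))) * Suc (poly (pcompose q (p + [:1, 1:])) (bitsize (e x))))"
      by (intro bitsize_eL_bound) (auto dest!: in_set_takeD)
    also have "\<dots> \<le> Suc (poly p (bitsize (e x)) * Suc (poly (pcompose q (p + [:1, 1:])) (bitsize (e x))))"
      using order.trans[OF less_imp_le[OF length_le_bitsize] p, of x]
      by (intro Suc_le_mono[THEN iffD2] mult_le_mono1) simp
    finally show "bitsize (eL b (fold (\<lambda>y acc. h y x # acc) (take n (rev (l x))) []))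
        \<le> poly ([:1:] + p * ([:1:] + pcompose q (p + [:1, 1:]))) (bitsize (e x))"
      by (simp add: fold_cons_map bitsize_eL_rev)
  qed
  then show ?thesis by (simp add: fold_cons_map rev_map)
qed

lemma fold_cons_filter: "fold (\<lambda>y acc. if P y then y # acc else acc) xs acc = rev (filter P xs) @ acc"
  by (induction xs arbitrary: acc) auto

lemma PT_filter:
  assumes l: "PT e (eL a) l" and h: "PT (eP a e) eB (\<lambda>z. P (fst z) (snd z))"
  shows "PT e (eL a) (\<lambda>x. filter (\<lambda>y. P y x) (l x))"
proof -
  obtain p where p: "\<And>x. bitsize (eL a (l x)) \<le> poly p (bitsize (e x))" using PT_bound[OF l] by blast
  have "PT e (eL a) (\<lambda>x. fold (\<lambda>y acc. if P y x then y # acc else acc) (rev (l x)) [])"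
  proof (rule PT_fold[OF PT_rev[OF l] PT_const])
    have "PT (eP a (eP (eL a) e)) eB (\<lambda>z. P (fst z) (snd (snd z)))"
      by (rule PT_comp2[OF h]) (intro PT_fst[OF PT_id] PT_snd[OF PT_snd[OF PT_id]])+
    then show "PT (eP a (eP (eL a) e)) (eL a) (\<lambda>z. if P (fst z) (snd (snd z)) then fst z # fst (snd z) else fst (snd z))"
      by (intro PT_if PT_Cons PT_fst[OF PT_id] PT_fst[OF PT_snd[OF PT_id]])
    show "bitsize (eL a (fold (\<lambda>y acc. if P y x then y # acc else acc) (take n (rev (l x))) []))
        \<le> poly p (bitsize (e x))" for x n
      using order.trans[OF order.trans[OF bitsize_eL_filter bitsize_eL_take_rev] p]
      by (simp add: fold_cons_filter bitsize_eL_rev)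
  qed
  then show ?thesis by (simp add: fold_cons_filter rev_filter)
qed

lemma fold_append_concat: "fold (\<lambda>y acc. y @ acc) xs acc = concat (rev xs) @ acc"
  by (induction xs arbitrary: acc) auto

lemma bitsize_eL_concat: "bitsize (eL a (concat xs)) \<le> bitsize (eL (eL a) xs)"
  by (induction xs) (auto simp: bitsize_eL_append)

lemma PT_concat: assumes "PT e (eL (eL a)) l" shows "PT e (eL a) (\<lambda>x. concat (l x))"
proof -
  obtain p where p: "\<And>x. bitsize (eL (eL a) (l x)) \<le> poly p (bitsize (e x))" using PT_bound[OF assms] by blast
  have "PT e (eL a) (\<lambda>x. fold (\<lambda>y acc. y @ acc) (rev (l x)) [])"
  proof (rule PT_fold[OF PT_rev[OF assms] PT_const])
    show "PT (eP (eL a) (eP (eL a) e)) (eL a) (\<lambda>z. fst z @ fst (snd z))"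
      by (intro PT_append PT_fst[OF PT_id] PT_fst[OF PT_snd[OF PT_id]])
    show "bitsize (eL a (fold (\<lambda>y acc. y @ acc) (take n (rev (l x))) [])) \<le> poly p (bitsize (e x))" for x n
    proof -
      have "bitsize (eL a (concat (rev (take n (rev (l x)))))) \<le> bitsize (eL (eL a) (l x))"
        by (rule order.trans[OF bitsize_eL_concat]) (metis bitsize_eL_rev bitsize_eL_take)
      then show ?thesis using order.trans[OF _ p] by (simp add: fold_append_concat)
    qed
  qed
  then show ?thesis by (simp add: fold_append_concat)
qed

lemma PT_null: assumes "PT e (eL a) l" shows "PT e eB (\<lambda>x. l x = [])"
proof -
  have eq: "fold (\<lambda>y acc. False) xs b = (b \<and> xs = [])" for xs :: "'c list" and b
    by (induction xs arbitrary: b) auto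
  have "PT e eB (\<lambda>x. fold (\<lambda>y acc. False) (l x) True)"
    by (rule PT_fold[OF assms PT_const PT_const, where q = "[:1:]"]) simp
  then show ?thesis by (simp add: eq)
qed

lemma PT_ex:
  assumes "PT e (eL a) l" "PT (eP a e) eB (\<lambda>z. P (fst z) (snd z))"
  shows "PT e eB (\<lambda>x. \<exists>y\<in>set (l x). P y x)"
  using PT_not[OF PT_null[OF PT_filter[OF assms]]] by (simp add: filter_empty_conv)

lemma PT_length: assumes "PT e (eL a) l" shows "PT e eN (\<lambda>x. length (l x))"
proof -
  obtain p where p: "\<And>x. bitsize (eL a (l x)) \<le> poly p (bitsize (e x))" using PT_bound[OF assms] by blast
  have eq: "fold (\<lambda>y acc. Suc acc) xs b = b + length xs" for xs :: "'c list" and b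
    by (induction xs arbitrary: b) auto
  have "PT e eN (\<lambda>x. fold (\<lambda>y acc. Suc acc) (l x) 0)"
  proof (rule PT_fold[OF assms PT_const])
    show "PT (eP a (eP eN e)) eN (\<lambda>z. Suc (fst (snd z)))"
      by (intro PT_Suc PT_fst[OF PT_snd[OF PT_id]])
    show "bitsize (VNum (fold (\<lambda>y acc. Suc acc) (take n (l x)) 0)) \<le> poly ([:1:] + p) (bitsize (e x))" for x n
      using floor_log_le_self[of "length (take n (l x))"] length_le_bitsize[of "l x" a] p[of x] unfolding eq
      by simp
  qed
  then show ?thesis by (simp add: eq)
qed

text \<open>The only access of programs to indices. Ranging over \<open>[0..<n]\<close> for a binary
  number \<open>n\<close> would take exponential time, so a range always accompanies a list of that
  length.\<close>

definition enum :: "'i list \<Rightarrow> (nat \<times> 'i) list" where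
  "enum xs = zip [0..<length xs] xs"

lemma enum_snoc: "enum (xs @ [x]) = enum xs @ [(length xs, x)]"
  by (simp add: enum_def)

lemma length_enum [simp]: "length (enum xs) = length xs"
  by (simp add: enum_def)

lemma map_enum: "map f (enum xs) = map (\<lambda>i. f (i, xs ! i)) [0..<length xs]"
  by (rule nth_equalityI) (auto simp: enum_def)

lemma set_enum: "set (enum xs) = {(i, xs ! i) | i. i < length xs}"
  by (auto simp: enum_def set_zip) (metis add_0 nth_upt)

lemma PT_enum: assumes "PT e (eL a) l" shows "PT e (eL (eP eN a)) (\<lambda>x. enum (l x))"
proof -
  obtain p where p: "\<And>x. bitsize (eL a (l x)) \<le> poly p (bitsize (e x))" using PT_bound[OF assms] by blast
  have eq: "fold (\<lambda>y acc. acc @ [(length acc, y)]) xs [] = enum xs" for xs :: "'c list"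
  proof (induction xs rule: rev_induct)
    case (snoc x xs)
    then show ?case by (simp add: enum_snoc)
  qed (simp add: enum_def)
  have "PT e (eL (eP eN a)) (\<lambda>x. fold (\<lambda>y acc. acc @ [(length acc, y)]) (l x) [])"
  proof (rule PT_fold[OF assms PT_const])
    show "PT (eP a (eP (eL (eP eN a)) e)) (eL (eP eN a)) (\<lambda>z. fst (snd z) @ [(length (fst (snd z)), fst z)])"
      by (intro PT_append PT_Cons PT_pair PT_length[where a = "eP eN a"] PT_const PT_fst[OF PT_id] PT_fst[OF PT_snd[OF PT_id]])
    fix x n
    let ?ys = "take n (l x)" and ?S = "poly p (bitsize (e x))"
    have len: "length (l x) \<le> ?S" using length_le_bitsize[of "l x" a] p[of x] by linarith
    have "bitsize (eL (eP eN a) (enum ?ys)) \<le> Suc (length (enum ?ys) * Suc (2 + 2 * ?S))"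
    proof (rule bitsize_eL_bound)
      fix z assume "z \<in> set (enum ?ys)"
      then obtain i where i: "z = (i, ?ys ! i)" "i < length ?ys" by (auto simp: set_enum)
      have "?ys ! i \<in> set (l x)" using i by (metis in_set_takeD nth_mem)
      from bitsize_list_ge[OF this, of a] p[of x] have "bitsize (a (?ys ! i)) \<le> ?S" by linarith
      moreover have "floor_log i \<le> ?S" using floor_log_le_self[of i] i(2) len by simp
      ultimately show "bitsize (eP eN a z) \<le> 2 + 2 * ?S" by (simp add: i)
    qed
    also have "\<dots> \<le> Suc (?S * Suc (2 + 2 * ?S))" using len by (auto intro!: add_mono mult_le_mono)
    finally show "bitsize (eL (eP eN a) (fold (\<lambda>y acc. acc @ [(length acc, y)]) ?ys []))
        \<le> poly ([:1:] + p * ([:3:] + 2 * p)) (bitsize (e x))" unfolding eq by (simp add: algebra_simps)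
  qed
  then show ?thesis by (simp add: eq)
qed

lemma PT_sum_list: assumes "PT e (eL eN) l" shows "PT e eN (\<lambda>x. sum_list (l x))"
proof -
  obtain p where p: "\<And>x. bitsize (eL eN (l x)) \<le> poly p (bitsize (e x))" using PT_bound[OF assms] by blast
  have eq: "fold (\<lambda>y acc. y + acc) xs b = b + sum_list xs" for xs and b :: nat
    by (induction xs arbitrary: b) auto
  have s: "bitsize (VNum (sum_list ys)) \<le> bitsize (eL eN ys)" for ys
  proof (induction ys)
    case (Cons y ys)
    then show ?case using floor_log_add_mult(1)[of y "sum_list ys"] by simp
  qed simp
  have "PT e eN (\<lambda>x. fold (\<lambda>y acc. y + acc) (l x) 0)"
  proof (rule PT_fold[OF assms PT_const])
    show "PT (eP eN (eP eN e)) eN (\<lambda>z. fst z + fst (snd z))"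
      by (intro PT_add PT_fst[OF PT_id] PT_fst[OF PT_snd[OF PT_id]])
    show "bitsize (VNum (fold (\<lambda>y acc. y + acc) (take n (l x)) 0)) \<le> poly p (bitsize (e x))" for x n
      using order.trans[OF order.trans[OF s bitsize_eL_take] p] unfolding eq by simp
  qed
  then show ?thesis by (simp add: eq)
qed

section \<open>Binary digits\<close>

fun bits :: "nat \<Rightarrow> nat list" where
  "bits n = (if n = 0 then [] else (n mod 2) # bits (n div 2))"

declare bits.simps [simp del]

lemma length_bits: "length (bits n) \<le> Suc (floor_log n)"
proof (induction n rule: bits.induct)
  case (1 n)
  show ?case
  proof (cases "n < 2")
    case True
    then have "n = 0 \<or> n = 1" by auto
    then show ?thesis by (elim disjE) (simp_all add: bits.simps)
  next
    case False
    then have "length (bits n) = Suc (length (bits (n div 2)))" by (subst bits.simps) simp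
    also have "\<dots> \<le> Suc (Suc (floor_log (n div 2)))" using 1 False by simp
    also have "\<dots> = Suc (floor_log n)" using floor_log_rec[of n] False by simp
    finally show ?thesis .
  qed
qed

lemma bits_less_2: "y \<in> set (bits n) \<Longrightarrow> y < 2"
proof (induction n rule: bits.induct)
  case (1 n)
  show ?case
  proof (cases "n = 0")
    case False
    then have "bits n = n mod 2 # bits (n div 2)" by (subst bits.simps) simp
    then show ?thesis using 1 False by auto
  qed (use 1 in \<open>simp add: bits.simps\<close>)
qed

text \<open>The one loop that does not run over a list, hence a program written by hand instead of
  an instance of \<open>PT_fold\<close>. Register 1 is halved, register 0 collects the digits;
  expressions have no remainder, so the digit is formed from a quotient.\<close>

definition bits_loop :: com where
  "bits_loop = While (Var 1) (Seq
     (Assign 0 (MkPair (Sub (Var 1) (Mul (Const 2) (Quo (Var 1) (Const 2)))) (Var 0)))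
     (Assign 1 (Quo (Var 1) (Const 2))))"

lemma exec_bits_loop:
  assumes "\<sigma> 1 = VNum n" "\<sigma> 0 = eL eN acc" "floor_log n \<le> B"
    "bitsize (eL eN acc) + 2 * length (bits n) \<le> B"
  shows "\<exists>k \<sigma>'. exec bits_loop \<sigma> k \<sigma>' \<and> \<sigma>' 0 = eL eN (rev (bits n) @ acc)
     \<and> k \<le> Suc (length (bits n) * (2 * B + 5)) \<and> (\<forall>j>1. \<sigma>' j = \<sigma> j)"
  using assms
proof (induction n arbitrary: acc \<sigma> rule: bits.induct)
  case (1 n)
  show ?case
  proof (cases "n = 0")
    case True
    have "exec bits_loop \<sigma> 1 \<sigma>" unfolding bits_loop_def by (rule exec.WhileFalse) (use 1 True in simp)
    then show ?thesis using 1 True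
      by (intro exI[of _ 1] exI[of _ \<sigma>]) (simp_all add: bits.simps)
  next
    case False
    define acc' where "acc' = (n mod 2) # acc"
    define \<sigma>1 where "\<sigma>1 = \<sigma>(0 := eL eN acc')"
    define \<sigma>2 where "\<sigma>2 = \<sigma>1(1 := VNum (n div 2))"
    have b: "bits n = (n mod 2) # bits (n div 2)" using False by (subst bits.simps) simp
    have m: "n - 2 * (n div 2) = n mod 2" by (simp add: minus_mult_div_eq_mod)
    have e1: "exec (Assign 0 (MkPair (Sub (Var 1) (Mul (Const 2) (Quo (Var 1) (Const 2)))) (Var 0))) \<sigma>
       (Suc (bitsize (eL eN acc'))) \<sigma>1"
      unfolding \<sigma>1_def by (rule exec_Assign) (use 1 m in \<open>simp add: acc'_def\<close>)
    have e2: "exec (Assign 1 (Quo (Var 1) (Const 2))) \<sigma>1 (Suc (bitsize (VNum (n div 2)))) \<sigma>2"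
      unfolding \<sigma>2_def by (rule exec_Assign) (use 1 in \<open>simp add: \<sigma>1_def\<close>)
    have fl: "floor_log (n mod 2) = 0" by (cases "n mod 2 = 0") (auto simp: mod2_eq_if)
    have s: "bitsize (eL eN acc') + 2 * length (bits (n div 2)) \<le> B"
      using 1(5) b by (simp add: acc'_def fl)
    have fB: "floor_log (n div 2) \<le> B" using 1(4) by simp
    have "\<exists>k \<sigma>'. exec bits_loop \<sigma>2 k \<sigma>' \<and> \<sigma>' 0 = eL eN (rev (bits (n div 2)) @ acc')
     \<and> k \<le> Suc (length (bits (n div 2)) * (2 * B + 5)) \<and> (\<forall>j>1. \<sigma>' j = \<sigma>2 j)"
      by (rule 1(1)) (use False s fB in \<open>auto simp: \<sigma>2_def \<sigma>1_def\<close>)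
    then obtain k \<sigma>' where IH: "exec bits_loop \<sigma>2 k \<sigma>'" "\<sigma>' 0 = eL eN (rev (bits (n div 2)) @ acc')"
      "k \<le> Suc (length (bits (n div 2)) * (2 * B + 5))" "\<forall>j>1. \<sigma>' j = \<sigma>2 j" by blast
    have "exec bits_loop \<sigma> (Suc ((Suc (bitsize (eL eN acc')) + Suc (bitsize (VNum (n div 2)))) + k)) \<sigma>'"
      unfolding bits_loop_def
      by (rule exec.WhileTrue[OF _ exec.Seq[OF e1 e2] IH(1)[unfolded bits_loop_def]]) (use 1 False in simp)
    moreover have "Suc ((Suc (bitsize (eL eN acc')) + Suc (bitsize (VNum (n div 2)))) + k)
       \<le> Suc (length (bits n) * (2 * B + 5))"
      using IH(3) s fB by (simp add: b)
    ultimately show ?thesis using IH(2,4)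
      by (intro exI[of _ "Suc ((Suc (bitsize (eL eN acc')) + Suc (bitsize (VNum (n div 2)))) + k)"] exI[of _ \<sigma>'])
         (auto simp: b acc'_def \<sigma>2_def \<sigma>1_def)
  qed
qed

lemma PT_bits: assumes "PT e eN f" shows "PT e (eL eN) (\<lambda>x. bits (f x))"
proof -
  let ?c = "Seq (Assign 1 (Var 0)) (Seq (Assign 0 (Const 0)) bits_loop)"
  define P where "P = [:10, 10:] + [:0, 1:] * ([:20, 20:] :: nat poly)"
  have "runs eN (eL eN) (\<lambda>n. rev (bits n)) ?c 1 P"
    unfolding runs_def
  proof (intro allI impI)
    fix n and \<sigma> :: store assume s: "\<sigma> 0 = VNum n"
    define \<sigma>1 where "\<sigma>1 = \<sigma>(1 := VNum n)"
    define \<sigma>2 where "\<sigma>2 = \<sigma>1(0 := VNum 0)"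
    have e1: "exec (Assign 1 (Var 0)) \<sigma> (Suc (bitsize (VNum n))) \<sigma>1"
      unfolding \<sigma>1_def by (rule exec_Assign) (simp add: s)
    have e2: "exec (Assign 0 (Const 0)) \<sigma>1 (Suc (bitsize (VNum 0))) \<sigma>2"
      unfolding \<sigma>2_def by (rule exec_Assign) simp
    let ?b = "bitsize (VNum n)"
    have l: "length (bits n) \<le> ?b" using length_bits[of n] by simp
    have "\<exists>k \<sigma>'. exec bits_loop \<sigma>2 k \<sigma>' \<and> \<sigma>' 0 = eL eN (rev (bits n) @ [])
      \<and> k \<le> Suc (length (bits n) * (2 * (1 + 2 * ?b) + 5)) \<and> (\<forall>j>1. \<sigma>' j = \<sigma>2 j)"
      by (rule exec_bits_loop) (use l in \<open>auto simp: \<sigma>2_def \<sigma>1_def\<close>)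
    then obtain k \<sigma>3 where 3: "exec bits_loop \<sigma>2 k \<sigma>3" "\<sigma>3 0 = eL eN (rev (bits n))"
      "k \<le> Suc (length (bits n) * (2 * (1 + 2 * ?b) + 5))" "\<forall>j>1. \<sigma>3 j = \<sigma>2 j" by auto
    have E: "exec ?c \<sigma> (Suc (bitsize (VNum n)) + (Suc (bitsize (VNum 0)) + k)) \<sigma>3"
      by (rule exec.Seq[OF e1 exec.Seq[OF e2 3(1)]])
    have "bitsize (eL eN (rev (bits n))) \<le> Suc (length (rev (bits n)) * Suc 1)"
    proof (rule bitsize_eL_bound)
      fix y assume "y \<in> set (rev (bits n))"
      then have "y \<in> set (bits n)" by simp
      then have "y = 0 \<or> y = 1" using bits_less_2 by fastforce
      then show "bitsize (VNum y) \<le> 1" by auto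
    qed
    moreover have "length (bits n) * (2 * (1 + 2 * ?b) + 5) \<le> ?b * (2 * (1 + 2 * ?b) + 5)"
      using l by (rule mult_le_mono1)
    ultimately have t: "Suc (bitsize (VNum n)) + (Suc (bitsize (VNum 0)) + k) + bitsize (eL eN (rev (bits n)))
        \<le> poly P ?b"
      using 3(3) l unfolding P_def by (simp add: algebra_simps)
    show "\<exists>n' \<sigma>'. exec ?c \<sigma> n' \<sigma>' \<and> \<sigma>' 0 = eL eN (rev (bits n))
        \<and> n' + bitsize (eL eN (rev (bits n))) \<le> poly P ?b \<and> (\<forall>j>1. \<sigma>' j = \<sigma> j)"
      by (rule run_intro[OF E 3(2) t]) (use 3(4) in \<open>auto simp: \<sigma>2_def \<sigma>1_def\<close>)
  qed
  then have "PT eN (eL eN) (\<lambda>n. rev (bits n))" unfolding PT_def by blast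
  from PT_rev[OF PT_comp[OF assms this]] show ?thesis by simp
qed

section \<open>Weighted lists\<close>

text \<open>Flows are handled as lists of weighted objects: relabelling, splitting and pairing are
  then list operations, and repeated objects do no harm.\<close>

definition fsum :: "(rat \<times> 'b) list \<Rightarrow> ('b \<Rightarrow> rat) \<Rightarrow> rat" where
  "fsum L F = (\<Sum>z\<leftarrow>L. fst z * F (snd z))"

lemma fsum_Nil [simp]: "fsum [] F = 0"
  and fsum_Cons [simp]: "fsum (z # L) F = fst z * F (snd z) + fsum L F"
  and fsum_append [simp]: "fsum (L @ L') F = fsum L F + fsum L' F"
  by (auto simp: fsum_def)

lemma fsum_add: "fsum L (\<lambda>s. F s + G s) = fsum L F + fsum L G"
  by (induction L) (auto simp: algebra_simps)

lemma fsum_cmult: "fsum L (\<lambda>s. c * F s) = c * fsum L F"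
  by (induction L) (auto simp: algebra_simps)

lemma fsum_sum: "finite A \<Longrightarrow> fsum L (\<lambda>s. \<Sum>a\<in>A. F a s) = (\<Sum>a\<in>A. fsum L (F a))"
  by (induction A rule: finite_induct) (auto simp: fsum_add, simp add: fsum_def)

lemma fsum_map: "fsum (map (\<lambda>z. (fst z, f (snd z))) L) F = fsum L (\<lambda>s. F (f s))"
  by (induction L) auto

lemma fsum_cong: "(\<And>z. z \<in> set L \<Longrightarrow> F (snd z) = G (snd z)) \<Longrightarrow> fsum L F = fsum L G"
  by (induction L) auto

lemma fsum_0: "(\<And>z. z \<in> set L \<Longrightarrow> F (snd z) = 0) \<Longrightarrow> fsum L F = 0"
  by (induction L) auto

lemma fsum_mono:
  "(\<And>z. z \<in> set L \<Longrightarrow> 0 \<le> fst z \<and> F (snd z) \<le> G (snd z)) \<Longrightarrow> fsum L F \<le> fsum L G"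
  by (induction L) (auto intro!: add_mono mult_left_mono)

lemma fsum_nonneg:
  "(\<And>z. z \<in> set L \<Longrightarrow> 0 \<le> fst z \<and> 0 \<le> F (snd z)) \<Longrightarrow> 0 \<le> fsum L F"
  using fsum_mono[of L "\<lambda>_. 0" F] by (simp add: fsum_def)

lemma fsum_Ints:
  "(\<And>z. z \<in> set L \<Longrightarrow> fst z \<in> \<int>) \<Longrightarrow> (\<And>s. F s \<in> \<int>) \<Longrightarrow> fsum L F \<in> \<int>"
  by (induction L) auto

lemma fsum_zero:
  assumes "\<And>z. z \<in> set L \<Longrightarrow> 0 \<le> fst z" "fsum L (\<lambda>_. 1) = 0" shows "fsum L F = 0"
  using assms
proof (induction L)
  case (Cons z L)
  have "0 \<le> fst z" "0 \<le> fsum L (\<lambda>_. 1)" using Cons.prems by (auto intro!: fsum_nonneg)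
  then have "fst z = 0" "fsum L (\<lambda>_. 1) = 0" using Cons.prems(2) by auto
  then show ?case using Cons by auto
qed simp

lemma fsum_filter: "fsum (filter (\<lambda>z. Q (snd z)) L) F = fsum L (\<lambda>s. of_bool (Q s) * F s)"
  by (induction L) auto

definition flow_of :: "(rat \<times> 'b) list \<Rightarrow> 'b \<Rightarrow> rat" where
  "flow_of L Q = fsum L (\<lambda>R. of_bool (R = Q))"

lemma sum_flow_of:
  "finite \<P> \<Longrightarrow> (\<Sum>Q\<in>\<P>. flow_of L Q) = fsum L (\<lambda>R. of_bool (R \<in> \<P>))"
proof (induction L)
  case (Cons z L)
  have "(\<Sum>Q\<in>\<P>. fst z * of_bool (snd z = Q)) = fst z * of_bool (snd z \<in> \<P>)"
    using Cons.prems by (simp add: of_bool_def if_distrib[of "\<lambda>x. _ * x"] cong: if_cong)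
  then show ?case using Cons by (simp add: flow_of_def sum.distrib)
qed (simp add: flow_of_def)

lemma flow_of_nonneg: "(\<And>z. z \<in> set L \<Longrightarrow> 0 \<le> fst z) \<Longrightarrow> 0 \<le> flow_of L Q"
  unfolding flow_of_def by (rule fsum_nonneg) auto

lemma flow_of_Ints: "(\<And>z. z \<in> set L \<Longrightarrow> fst z \<in> \<int>) \<Longrightarrow> flow_of L Q \<in> \<int>"
  unfolding flow_of_def by (rule fsum_Ints) (auto simp: of_bool_def)

text \<open>The northwest corner rule pairs two weighted lists of equal total weight without leaving the
  integers.\<close>

fun couple :: "(rat \<times> 'a) list \<Rightarrow> (rat \<times> 'b) list \<Rightarrow> (rat \<times> ('a \<times> 'b)) list" where
  "couple [] bs = []"
| "couple as [] = []"
| "couple ((a, p) # as) ((b, q) # bs) =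
     (if a \<le> b then (a, (p, q)) # couple as ((b - a, q) # bs)
      else (b, (p, q)) # couple ((a - b, p) # as) bs)"

lemma couple_mem:
  "z \<in> set (couple as bs) \<Longrightarrow> fst (snd z) \<in> snd ` set as \<and> snd (snd z) \<in> snd ` set bs"
  by (induction as bs rule: couple.induct) (auto split: if_splits)

lemma couple_nonneg:
  "(\<And>z. z \<in> set as \<Longrightarrow> 0 \<le> fst z) \<Longrightarrow> (\<And>z. z \<in> set bs \<Longrightarrow> 0 \<le> fst z) \<Longrightarrow>
    z \<in> set (couple as bs) \<Longrightarrow> 0 \<le> fst z"
proof (induction as bs rule: couple.induct)
  case (3 a p as b q bs)
  have ab: "0 \<le> a" "0 \<le> b" using "3.prems"(1)[of "(a, p)"] "3.prems"(2)[of "(b, q)"] by auto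
  show ?case
  proof (cases "a \<le> b")
    case True
    show ?thesis
    proof (cases "z = (a, p, q)")
      case False
      then have "z \<in> set (couple as ((b - a, q) # bs))" using "3.prems"(3) True by auto
      then show ?thesis using "3.IH"(1)[OF True] "3.prems"(1,2) True by fastforce
    qed (use ab in auto)
  next
    case F: False
    show ?thesis
    proof (cases "z = (b, p, q)")
      case False
      then have "z \<in> set (couple ((a - b, p) # as) bs)" using "3.prems"(3) F by auto
      then show ?thesis using "3.IH"(2)[OF F] "3.prems"(1,2) F by fastforce
    qed (use ab in auto)
  qed
qed auto

lemma couple_Ints:
  "(\<And>z. z \<in> set as \<Longrightarrow> fst z \<in> \<int>) \<Longrightarrow> (\<And>z. z \<in> set bs \<Longrightarrow> fst z \<in> \<int>) \<Longrightarrow>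
    z \<in> set (couple as bs) \<Longrightarrow> fst z \<in> \<int>"
proof (induction as bs rule: couple.induct)
  case (3 a p as b q bs)
  have ab: "a \<in> \<int>" "b \<in> \<int>" using "3.prems"(1)[of "(a, p)"] "3.prems"(2)[of "(b, q)"] by auto
  show ?case
  proof (cases "a \<le> b")
    case True
    show ?thesis
    proof (cases "z = (a, p, q)")
      case False
      then have "z \<in> set (couple as ((b - a, q) # bs))" using "3.prems"(3) True by auto
      then show ?thesis using "3.IH"(1)[OF True] "3.prems"(1,2) ab by fastforce
    qed (use ab in auto)
  next
    case F: False
    show ?thesis
    proof (cases "z = (b, p, q)")
      case False
      then have "z \<in> set (couple ((a - b, p) # as) bs)" using "3.prems"(3) F by auto
      then show ?thesis using "3.IH"(2)[OF F] "3.prems"(1,2) ab by fastforce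
    qed (use ab in auto)
  qed
qed auto

text \<open>A coupling has the two lists as its marginals. Functions of the form
  \<open>F (fst z) + G (snd z)\<close> are those whose sums are determined by the marginals.\<close>

lemma couple_fsum:
  "(\<And>z. z \<in> set as \<Longrightarrow> 0 \<le> fst z) \<Longrightarrow> (\<And>z. z \<in> set bs \<Longrightarrow> 0 \<le> fst z) \<Longrightarrow>
    fsum as (\<lambda>_. 1) = fsum bs (\<lambda>_. 1) \<Longrightarrow>
    fsum (couple as bs) (\<lambda>z. F (fst z) + G (snd z)) = fsum as F + fsum bs G"
proof (induction as bs rule: couple.induct)
  \<comment> \<open>When one list is exhausted, the other has total weight 0 and hence only weights
    0.\<close>
  case (1 bs)
  then show ?case using fsum_zero[of bs G] by simp
next
  case (2 a as)
  have "fsum (a # as) F = 0" by (rule fsum_zero) (use 2 in auto)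
  then show ?case by simp
next
  case (3 a p as b q bs)
  have ab: "0 \<le> a" "0 \<le> b" using "3.prems"(1)[of "(a, p)"] "3.prems"(2)[of "(b, q)"] by auto
  show ?case
  proof (cases "a \<le> b")
    case True
    have "fsum (couple as ((b - a, q) # bs)) (\<lambda>z. F (fst z) + G (snd z)) = fsum as F + fsum ((b - a, q) # bs) G"
      by (rule "3.IH"(1)[OF True]) (use "3.prems" True in auto)
    then show ?thesis using True by (simp add: algebra_simps)
  next
    case False
    have "fsum (couple ((a - b, p) # as) bs) (\<lambda>z. F (fst z) + G (snd z)) = fsum ((a - b, p) # as) F + fsum bs G"
      by (rule "3.IH"(2)[OF False]) (use "3.prems" False in auto)
    then show ?thesis using False by (simp add: algebra_simps)
  qed
qed

section \<open>Uncrossing\<close>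

text \<open>A segment is a chain of gadgets together with the information whether it starts at the root
  (otherwise: at a private source arc of its first gadget) and at which exit it ends, if any
  (otherwise: at a private sink arc of its last gadget).\<close>

type_synonym seg = "bool \<times> nat list \<times> nat option"

definition seg_start :: "nat \<Rightarrow> seg \<Rightarrow> rat" where
  "seg_start g s = of_bool (\<not> fst s \<and> hd (fst (snd s)) = g)"
definition seg_end :: "nat \<Rightarrow> seg \<Rightarrow> rat" where
  "seg_end g s = of_bool (snd (snd s) = None \<and> last (fst (snd s)) = g)"
definition seg_exit :: "nat \<Rightarrow> seg \<Rightarrow> rat" where
  "seg_exit v s = of_bool (snd (snd s) = Some v)"
definition seg_hit :: "nat set \<Rightarrow> seg \<Rightarrow> rat" where
  "seg_hit S s = of_bool (set (fst (snd s)) \<inter> S \<noteq> {})"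

locale uncrossing =
  fixes nx :: "nat \<Rightarrow> nat \<Rightarrow> bool" and sr :: "nat \<Rightarrow> bool" and er :: "nat \<Rightarrow> nat \<Rightarrow> bool" and G :: nat
  assumes nx: "nx g h \<Longrightarrow> g < h"
begin

definition seg_ok :: "seg \<Rightarrow> bool" where
  "seg_ok s \<longleftrightarrow> (case s of (b, gs, c) \<Rightarrow> gs \<noteq> [] \<and> set gs \<subseteq> {..<G} \<and> successively nx gs
     \<and> (b \<longrightarrow> sr (hd gs)) \<and> (\<forall>v. c = Some v \<longrightarrow> er (last gs) v))"

lemma sorted_chain: "successively nx gs \<Longrightarrow> sorted_wrt (<) gs"
  using successively_mono[of nx gs "(<)"] nx
  by (simp add: successively_conv_sorted_wrt[OF transp_on_less])

text \<open>Chains increase strictly, so they cannot return to their first gadget. In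
  \<open>uncross_step\<close> this shows that a segment with both ends at the private arcs of
  \<open>g\<close> consists of \<open>g\<close> alone.\<close>

lemma hd_last_eq: "successively nx gs \<Longrightarrow> gs \<noteq> [] \<Longrightarrow> hd gs = last gs \<Longrightarrow> gs = [hd gs]"
  using sorted_chain[of gs] by (cases gs) (auto split: if_splits)

definition glue :: "seg \<times> seg \<Rightarrow> seg" where
  "glue z = (fst (fst z), fst (snd (fst z)) @ tl (fst (snd (snd z))), snd (snd (snd z)))"

text \<open>Segments ending at the private sink arc of \<open>g\<close> and segments starting at its
  private source arc have the same total weight. Those of the form \<open>d\<close>, which do both,
  are dropped; the others are coupled and glued at \<open>g\<close>. A glued pair contained
  \<open>g\<close> in both parts and contains it only once afterwards, so a scenario containing
  \<open>g\<close> loses the whole weight \<open>c\<close>.\<close>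

lemma uncross_step:
  assumes L: "\<And>w s. (w, s) \<in> set L \<Longrightarrow> 0 \<le> w \<and> seg_ok s \<and> (ig \<longrightarrow> w \<in> \<int>)"
    and st: "fsum L (seg_start g) = c" and en: "fsum L (seg_end g) = c"
  shows "\<exists>L'. (\<forall>(w, s)\<in>set L'. 0 \<le> w \<and> seg_ok s \<and> (ig \<longrightarrow> w \<in> \<int>)
      \<and> seg_start g s = 0 \<and> seg_end g s = 0 \<and> (\<forall>h. (\<forall>z\<in>set L. seg_start h (snd z) = 0) \<longrightarrow> seg_start h s = 0)
      \<and> (\<forall>h. (\<forall>z\<in>set L. seg_end h (snd z) = 0) \<longrightarrow> seg_end h s = 0))
    \<and> (\<forall>h. h \<noteq> g \<longrightarrow> fsum L' (seg_start h) = fsum L (seg_start h) \<and> fsum L' (seg_end h) = fsum L (seg_end h))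
    \<and> (\<forall>v. fsum L' (seg_exit v) = fsum L (seg_exit v))
    \<and> (\<forall>S. fsum L' (seg_hit S) + of_bool (g \<in> S) * c \<le> fsum L (seg_hit S))"
proof -
  define d :: seg where "d = (False, [g], None)"
  define isE where "isE s \<longleftrightarrow> snd (snd s) = None \<and> last (fst (snd s)) = g" for s :: seg
  define isS where "isS s \<longleftrightarrow> \<not> fst s \<and> hd (fst (snd s)) = g" for s :: seg
  define A where "A = filter (\<lambda>z. isE (snd z) \<and> snd z \<noteq> d) L"
  define B where "B = filter (\<lambda>z. isS (snd z) \<and> snd z \<noteq> d) L"
  define D where "D = filter (\<lambda>z. snd z = d) L"
  define K where "K = filter (\<lambda>z. \<not> isE (snd z) \<and> \<not> isS (snd z)) L"
  define C where "C = couple A B"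
  define L' where "L' = K @ map (\<lambda>z. (fst z, glue (snd z))) C"
  have ok: "seg_ok (snd z)" "0 \<le> fst z" "ig \<longrightarrow> fst z \<in> \<int>" if "z \<in> set L" for z
    using L[of "fst z" "snd z"] that by auto
  have both: "s = d" if "seg_ok s" "isE s" "isS s" for s
  proof -
    obtain b gs e where s: "s = (b, gs, e)" by (cases s) auto
    have "gs = [hd gs]" by (rule hd_last_eq) (use that in \<open>auto simp: s seg_ok_def isE_def isS_def\<close>)
    then show ?thesis using that by (auto simp: s isE_def isS_def d_def)
  qed
  have dd: "isE d" "isS d" by (auto simp: d_def isE_def isS_def)
  have split: "fsum L F = fsum K F + fsum A F + fsum B F + fsum D F" for F
  proof -
    have "fsum L F = fsum L (\<lambda>s. of_bool (\<not> isE s \<and> \<not> isS s) * F s + of_bool (isE s \<and> s \<noteq> d) * F s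
       + of_bool (isS s \<and> s \<noteq> d) * F s + of_bool (s = d) * F s)"
      by (rule fsum_cong) (use both ok dd in \<open>fastforce simp: of_bool_def\<close>)
    then show ?thesis
      unfolding A_def B_def K_def D_def fsum_filter[of "\<lambda>s. \<not> isE s \<and> \<not> isS s"]
        fsum_filter[of "\<lambda>s. isE s \<and> s \<noteq> d"] fsum_filter[of "\<lambda>s. isS s \<and> s \<noteq> d"] fsum_filter[of "\<lambda>s. s = d"]
      by (simp add: fsum_add)
  qed
  have cD: "fsum D F = F d * fsum D (\<lambda>_. 1)" for F
    unfolding D_def by (induction L) (auto simp: algebra_simps)
  have AL: "set A \<subseteq> set L" "set B \<subseteq> set L" "set K \<subseteq> set L" by (auto simp: A_def B_def K_def)
  have one: "fsum L (seg_start g) = fsum B (\<lambda>_. 1) + fsum D (\<lambda>_. 1)"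
  proof -
    have "fsum K (seg_start g) = 0" "fsum A (seg_start g) = 0"
    proof -
      show "fsum K (seg_start g) = 0"
        by (rule fsum_0) (auto simp: K_def seg_start_def isS_def)
      show "fsum A (seg_start g) = 0"
      proof (rule fsum_0)
        fix z assume z: "z \<in> set A"
        then have "\<not> isS (snd z)" using both[of "snd z"] ok(1)[of z] by (auto simp: A_def)
        then show "seg_start g (snd z) = 0" by (simp add: seg_start_def isS_def)
      qed
    qed
    moreover have "fsum B (seg_start g) = fsum B (\<lambda>_. 1)"
      by (rule fsum_cong) (auto simp: B_def seg_start_def isS_def)
    moreover have "fsum D (seg_start g) = fsum D (\<lambda>_. 1)" by (subst cD) (simp add: d_def seg_start_def)
    ultimately show ?thesis by (simp add: split)
  qed
  have two: "fsum L (seg_end g) = fsum A (\<lambda>_. 1) + fsum D (\<lambda>_. 1)"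
  proof -
    have "fsum K (seg_end g) = 0" "fsum B (seg_end g) = 0"
    proof -
      show "fsum K (seg_end g) = 0"
        by (rule fsum_0) (auto simp: K_def seg_end_def isE_def)
      show "fsum B (seg_end g) = 0"
      proof (rule fsum_0)
        fix z assume z: "z \<in> set B"
        then have "\<not> isE (snd z)" using both[of "snd z"] ok(1)[of z] by (auto simp: B_def)
        then show "seg_end g (snd z) = 0" by (simp add: seg_end_def isE_def)
      qed
    qed
    moreover have "fsum A (seg_end g) = fsum A (\<lambda>_. 1)"
      by (rule fsum_cong) (auto simp: A_def seg_end_def isE_def)
    moreover have "fsum D (seg_end g) = fsum D (\<lambda>_. 1)" by (subst cD) (simp add: d_def seg_end_def)
    ultimately show ?thesis by (simp add: split)
  qed
  have tot: "fsum A (\<lambda>_. 1) = fsum B (\<lambda>_. 1)" using one two st en by simp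
  have nn: "\<And>z. z \<in> set A \<Longrightarrow> 0 \<le> fst z" "\<And>z. z \<in> set B \<Longrightarrow> 0 \<le> fst z" using ok AL by auto
  have Cf: "fsum C (\<lambda>z. F (fst z) + H (snd z)) = fsum A F + fsum B H" for F H
    unfolding C_def by (rule couple_fsum[OF nn tot])
  have Cm: "fst (snd z) \<in> snd ` set A" "snd (snd z) \<in> snd ` set B" "0 \<le> fst z" if "z \<in> set C" for z
    using couple_mem[where z = z and as = A and bs = B] couple_nonneg[OF nn, where z = z] that unfolding C_def by auto
  have pq: "\<exists>b gs gs' e. p = (b, gs, None) \<and> q = (False, gs', e) \<and> gs \<noteq> [] \<and> gs' \<noteq> [] \<and> last gs = g \<and> hd gs' = g
      \<and> seg_ok p \<and> seg_ok q \<and> p \<noteq> d \<and> q \<noteq> d \<and> p \<in> snd ` set L \<and> q \<in> snd ` set L"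
    if "p \<in> snd ` set A" "q \<in> snd ` set B" for p q
  proof -
    have "p \<in> snd ` set L" "q \<in> snd ` set L" "isE p" "isS q" "p \<noteq> d" "q \<noteq> d" using that by (auto simp: A_def B_def)
    moreover then have "seg_ok p" "seg_ok q" using ok by auto
    ultimately show ?thesis by (cases p; cases q) (auto simp: isE_def isS_def seg_ok_def)
  qed
  have fL': "fsum L' F = fsum K F + fsum C (\<lambda>z. F (glue z))" for F
    unfolding L'_def by (simp add: fsum_map)
  have add: "fsum L' F = fsum L F" if F: "F d = 0"
    "\<And>p q. p \<in> snd ` set A \<Longrightarrow> q \<in> snd ` set B \<Longrightarrow> F (glue (p, q)) = F p + F q" for F
  proof -
    have "fsum C (\<lambda>z. F (glue z)) = fsum C (\<lambda>z. F (fst z) + F (snd z))"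
    proof (rule fsum_cong)
      fix z assume "z \<in> set C"
      from F(2)[OF Cm(1,2)[OF this]] show "F (glue (snd z)) = F (fst (snd z)) + F (snd (snd z))" by simp
    qed
    then show ?thesis unfolding fL' Cf split using cD[of F] F(1) by simp
  qed
  have glok: "seg_ok (glue (p, q))" "seg_start g (glue (p, q)) = 0" "seg_end g (glue (p, q)) = 0"
     "h \<noteq> g \<Longrightarrow> seg_start h (glue (p, q)) = seg_start h p + seg_start h q"
     "h \<noteq> g \<Longrightarrow> seg_end h (glue (p, q)) = seg_end h p + seg_end h q"
     "seg_exit v (glue (p, q)) = seg_exit v p + seg_exit v q"
     "seg_hit S (glue (p, q)) + of_bool (g \<in> S) \<le> seg_hit S p + seg_hit S q"
     "seg_start h (glue (p, q)) \<le> seg_start h p" "seg_end h (glue (p, q)) \<le> seg_end h q"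
    if pqm: "p \<in> snd ` set A" "q \<in> snd ` set B" for p q h v S
  proof -
    obtain b gs gs' e where p: "p = (b, gs, None)" and q: "q = (False, gs', e)"
      and 1: "gs \<noteq> []" "gs' \<noteq> []" "last gs = g" "hd gs' = g" "seg_ok p" "seg_ok q" "p \<noteq> d" "q \<noteq> d"
      using pq[OF pqm] by blast
    have gl: "glue (p, q) = (b, gs @ tl gs', e)" by (simp add: glue_def p q)
    obtain gs1 where gs': "gs' = g # gs1" using 1 by (cases gs') auto
    have hdl: "hd (gs @ tl gs') = hd gs" "last (gs @ tl gs') = last gs'" using 1 gs' by auto
    have ss: "set (gs @ tl gs') = set gs \<union> set gs'" "g \<in> set gs" "g \<in> set gs'"
      using 1 gs' by (auto dest: last_in_set)
    have "successively nx (gs @ tl gs')"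
      using 1 by (cases gs1) (auto simp: p q gs' seg_ok_def successively_append_iff)
    then show "seg_ok (glue (p, q))"
      using 1 hdl ss(1) unfolding gl by (auto simp: seg_ok_def p q)
    show "seg_start g (glue (p, q)) = 0"
      unfolding gl seg_start_def using hdl 1 hd_last_eq[of gs] by (auto simp: p d_def seg_ok_def)
    show "seg_end g (glue (p, q)) = 0"
      unfolding gl seg_end_def using hdl 1 hd_last_eq[of gs'] by (auto simp: q d_def seg_ok_def)
    show "h \<noteq> g \<Longrightarrow> seg_start h (glue (p, q)) = seg_start h p + seg_start h q"
      "seg_start h (glue (p, q)) \<le> seg_start h p"
      unfolding gl seg_start_def using hdl 1 by (auto simp: p q)
    show "h \<noteq> g \<Longrightarrow> seg_end h (glue (p, q)) = seg_end h p + seg_end h q"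
      "seg_end h (glue (p, q)) \<le> seg_end h q"
      unfolding gl seg_end_def using hdl 1 by (auto simp: p q)
    show "seg_exit v (glue (p, q)) = seg_exit v p + seg_exit v q"
      unfolding gl seg_exit_def by (auto simp: p q)
    \<comment> \<open>If the glued chain is hit, one part is; if \<open>g\<close> belongs to
      \<open>S\<close>, both parts are.\<close>
    show "seg_hit S (glue (p, q)) + of_bool (g \<in> S) \<le> seg_hit S p + seg_hit S q"
      unfolding gl seg_hit_def using ss by (auto simp: p q)
  qed
  have hit: "fsum L' (seg_hit S) + of_bool (g \<in> S) * c \<le> fsum L (seg_hit S)" for S
  proof -
    have "fsum C (\<lambda>z. seg_hit S (glue z) + of_bool (g \<in> S)) \<le> fsum C (\<lambda>z. seg_hit S (fst z) + seg_hit S (snd z))"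
    proof (rule fsum_mono)
      fix z assume z: "z \<in> set C"
      from glok(7)[OF Cm(1,2)[OF this], of S] Cm(3)[OF z]
      show "0 \<le> fst z \<and> seg_hit S (glue (snd z)) + of_bool (g \<in> S) \<le> seg_hit S (fst (snd z)) + seg_hit S (snd (snd z))" by simp
    qed
    moreover have "fsum C (\<lambda>z. seg_hit S (glue z) + of_bool (g \<in> S))
      = fsum C (\<lambda>z. seg_hit S (glue z)) + of_bool (g \<in> S) * fsum A (\<lambda>_. 1)"
    proof -
      have "fsum C (\<lambda>z. of_bool (g \<in> S)) = of_bool (g \<in> S) * fsum C (\<lambda>z. (\<lambda>_. 1) (fst z) + (\<lambda>_. 0) (snd z))"
        by (simp flip: fsum_cmult)
      also have "fsum C (\<lambda>z. (\<lambda>_. 1) (fst z) + (\<lambda>_. 0) (snd z)) = fsum A (\<lambda>_. 1)"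
        by (subst Cf) (simp add: fsum_def)
      finally show ?thesis by (simp add: fsum_add)
    qed
    moreover have "seg_hit S d = of_bool (g \<in> S)" by (simp add: seg_hit_def d_def)
    moreover have "c = fsum A (\<lambda>_. 1) + fsum D (\<lambda>_. 1)" using two en by simp
    ultimately show ?thesis
      unfolding fL' split Cf using cD[of "seg_hit S"] by (simp add: algebra_simps)
  qed
  have str: "0 \<le> w \<and> seg_ok s \<and> (ig \<longrightarrow> w \<in> \<int>)
      \<and> seg_start g s = 0 \<and> seg_end g s = 0 \<and> (\<forall>h. (\<forall>z\<in>set L. seg_start h (snd z) = 0) \<longrightarrow> seg_start h s = 0)
      \<and> (\<forall>h. (\<forall>z\<in>set L. seg_end h (snd z) = 0) \<longrightarrow> seg_end h s = 0)" if mem: "(w, s) \<in> set L'" for w s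
  proof (cases "(w, s) \<in> set K")
    case True
    then have "(w, s) \<in> set L" using AL by auto
    then show ?thesis using L[of w s] True
      by (fastforce simp: K_def isS_def isE_def seg_start_def seg_end_def)
  next
    case False
    then obtain z where z: "z \<in> set C" "w = fst z" "s = glue (snd z)" using mem unfolding L'_def by auto
    obtain p q where pq': "snd z = (p, q)" by (cases "snd z")
    have m: "p \<in> snd ` set A" "q \<in> snd ` set B" using Cm(1,2)[OF z(1)] pq' by auto
    have "ig \<longrightarrow> w \<in> \<int>" using couple_Ints[where as = A and bs = B and z = z] ok(3) AL z unfolding C_def by blast
    moreover have "seg_start h s = 0" if "\<forall>z\<in>set L. seg_start h (snd z) = 0" for h
    proof -
      have "seg_start h p = 0" using that m AL by fastforce
      moreover have "0 \<le> seg_start h s" by (simp add: seg_start_def)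
      ultimately show ?thesis using glok(8)[OF m, of h] unfolding z pq' by simp
    qed
    moreover have "seg_end h s = 0" if "\<forall>z\<in>set L. seg_end h (snd z) = 0" for h
    proof -
      have "seg_end h q = 0" using that m AL by fastforce
      moreover have "0 \<le> seg_end h s" by (simp add: seg_end_def)
      ultimately show ?thesis using glok(9)[OF m, of h] unfolding z pq' by simp
    qed
    ultimately show ?thesis using glok(1-3)[OF m] Cm(3)[OF z(1)] unfolding z pq' by auto
  qed
  show ?thesis
  proof (intro exI[of _ L'] conjI allI impI ballI)
    fix z assume z: "z \<in> set L'"
    obtain w s where ws: "z = (w, s)" by (rule prod.exhaust[of z])
    show "case z of (w, s) \<Rightarrow> 0 \<le> w \<and> seg_ok s \<and> (ig \<longrightarrow> w \<in> \<int>)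
      \<and> seg_start g s = 0 \<and> seg_end g s = 0 \<and> (\<forall>h. (\<forall>z\<in>set L. seg_start h (snd z) = 0) \<longrightarrow> seg_start h s = 0)
      \<and> (\<forall>h. (\<forall>z\<in>set L. seg_end h (snd z) = 0) \<longrightarrow> seg_end h s = 0)"
      using str[of w s] z unfolding ws by blast
  next
    fix h assume "h \<noteq> g"
    then show "fsum L' (seg_start h) = fsum L (seg_start h)" "fsum L' (seg_end h) = fsum L (seg_end h)"
      by (auto intro!: add glok simp: d_def seg_start_def seg_end_def)
  next
    show "fsum L' (seg_exit v) = fsum L (seg_exit v)" for v
      by (rule add) (auto intro!: glok, simp add: d_def seg_exit_def)
  qed (rule hit)
qed

text \<open>The gadgets are treated one after another. The last two claims of
  \<open>uncross_step\<close> on vanishing \<open>seg_start\<close> and \<open>seg_end\<close>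
  ensure that later steps create no new ends at gadgets already treated. In the end every segment
  leads from the root to an exit.\<close>

lemma uncross:
  assumes L: "\<And>w s. (w, s) \<in> set L \<Longrightarrow> 0 \<le> w \<and> seg_ok s \<and> (ig \<longrightarrow> w \<in> \<int>)"
    and c: "\<And>g. g < G \<Longrightarrow> fsum L (seg_start g) = c g \<and> fsum L (seg_end g) = c g"
  shows "\<exists>L'. (\<forall>(w, s)\<in>set L'. 0 \<le> w \<and> seg_ok s \<and> (ig \<longrightarrow> w \<in> \<int>) \<and> fst s \<and> snd (snd s) \<noteq> None)
    \<and> (\<forall>v. fsum L' (seg_exit v) = fsum L (seg_exit v))
    \<and> (\<forall>S. S \<subseteq> {..<G} \<longrightarrow> fsum L' (seg_hit S) + (\<Sum>g\<in>S. c g) \<le> fsum L (seg_hit S))"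
proof -
  have "n \<le> G \<Longrightarrow> \<exists>L'. (\<forall>(w, s)\<in>set L'. 0 \<le> w \<and> seg_ok s \<and> (ig \<longrightarrow> w \<in> \<int>)
      \<and> (\<forall>g<n. seg_start g s = 0 \<and> seg_end g s = 0))
    \<and> (\<forall>g. n \<le> g \<and> g < G \<longrightarrow> fsum L' (seg_start g) = c g \<and> fsum L' (seg_end g) = c g)
    \<and> (\<forall>v. fsum L' (seg_exit v) = fsum L (seg_exit v))
    \<and> (\<forall>S. fsum L' (seg_hit S) + (\<Sum>g<n. of_bool (g \<in> S) * c g) \<le> fsum L (seg_hit S))" for n
  proof (induction n)
    case 0
    show ?case by (rule exI[of _ L]) (use L c in auto)
  next
    case (Suc n)
    then obtain L1 where L1: "\<And>w s. (w, s) \<in> set L1 \<Longrightarrow> 0 \<le> w \<and> seg_ok s \<and> (ig \<longrightarrow> w \<in> \<int>)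
        \<and> (\<forall>g<n. seg_start g s = 0 \<and> seg_end g s = 0)"
      "\<And>g. n \<le> g \<Longrightarrow> g < G \<Longrightarrow> fsum L1 (seg_start g) = c g \<and> fsum L1 (seg_end g) = c g"
      "\<And>v. fsum L1 (seg_exit v) = fsum L (seg_exit v)"
      "\<And>S. fsum L1 (seg_hit S) + (\<Sum>g<n. of_bool (g \<in> S) * c g) \<le> fsum L (seg_hit S)"
      by fastforce
    obtain L2 where L2: "\<And>w s. (w, s) \<in> set L2 \<Longrightarrow> 0 \<le> w \<and> seg_ok s \<and> (ig \<longrightarrow> w \<in> \<int>)
        \<and> seg_start n s = 0 \<and> seg_end n s = 0 \<and> (\<forall>h. (\<forall>z\<in>set L1. seg_start h (snd z) = 0) \<longrightarrow> seg_start h s = 0)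
        \<and> (\<forall>h. (\<forall>z\<in>set L1. seg_end h (snd z) = 0) \<longrightarrow> seg_end h s = 0)"
      "\<And>h. h \<noteq> n \<Longrightarrow> fsum L2 (seg_start h) = fsum L1 (seg_start h) \<and> fsum L2 (seg_end h) = fsum L1 (seg_end h)"
      "\<And>v. fsum L2 (seg_exit v) = fsum L1 (seg_exit v)"
      "\<And>S. fsum L2 (seg_hit S) + of_bool (n \<in> S) * c n \<le> fsum L1 (seg_hit S)"
      using uncross_step[of L1 ig n "c n"] L1(1,2) Suc.prems by fastforce
    show ?case
    proof (intro exI[of _ L2] conjI allI impI ballI)
      fix z assume z: "z \<in> set L2"
      obtain w s where ws: "z = (w, s)" by (rule prod.exhaust[of z])
      have 0: "\<forall>z\<in>set L1. seg_start h (snd z) = 0 \<and> seg_end h (snd z) = 0" if "h < n" for h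
        using L1(1) that by (metis prod.collapse)
      show "case z of (w, s) \<Rightarrow> 0 \<le> w \<and> seg_ok s \<and> (ig \<longrightarrow> w \<in> \<int>)
         \<and> (\<forall>g<Suc n. seg_start g s = 0 \<and> seg_end g s = 0)"
        using L2(1)[of w s] z 0 unfolding ws by (auto simp: less_Suc_eq)
    next
      fix S
      show "fsum L2 (seg_hit S) + (\<Sum>g<Suc n. of_bool (g \<in> S) * c g) \<le> fsum L (seg_hit S)"
        using L1(4)[of S] L2(4)[of S] by simp
    qed (use L1 L2 in auto)
  qed
  from this[of G] obtain L' where L': "\<And>w s. (w, s) \<in> set L' \<Longrightarrow> 0 \<le> w \<and> seg_ok s \<and> (ig \<longrightarrow> w \<in> \<int>)
        \<and> (\<forall>g<G. seg_start g s = 0 \<and> seg_end g s = 0)"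
      "\<And>v. fsum L' (seg_exit v) = fsum L (seg_exit v)"
      "\<And>S. fsum L' (seg_hit S) + (\<Sum>g<G. of_bool (g \<in> S) * c g) \<le> fsum L (seg_hit S)"
    by fastforce
  show ?thesis
  proof (intro exI[of _ L'] conjI allI impI ballI)
    fix z assume z: "z \<in> set L'"
    obtain w b gs e where ws: "z = (w, b, gs, e)" by (metis prod.collapse)
    have 1: "gs \<noteq> []" "set gs \<subseteq> {..<G}" using L'(1)[of w "(b, gs, e)"] z by (auto simp: ws seg_ok_def)
    then have "hd gs < G" "last gs < G" by (auto dest: hd_in_set last_in_set)
    then have "seg_start (hd gs) (b, gs, e) = 0" "seg_end (last gs) (b, gs, e) = 0"
      using L'(1)[of w "(b, gs, e)"] z by (auto simp: ws)
    then show "case z of (w, s) \<Rightarrow> 0 \<le> w \<and> seg_ok s \<and> (ig \<longrightarrow> w \<in> \<int>) \<and> fst s \<and> snd (snd s) \<noteq> None"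
      using L'(1)[of w "(b, gs, e)"] z unfolding ws by (auto simp: seg_start_def seg_end_def)
  next
    fix S :: "nat set" assume "S \<subseteq> {..<G}"
    then have "(\<Sum>g\<in>S. c g) = (\<Sum>g<G. of_bool (g \<in> S) * c g)"
      by (simp add: sum.inter_restrict[symmetric] of_bool_def if_distrib[of "\<lambda>x. x * _"] Int_absorb1 cong: if_cong)
    then show "fsum L' (seg_hit S) + (\<Sum>g\<in>S. c g) \<le> fsum L (seg_hit S)" using L'(3) by simp
  qed (rule L'(2))
qed

end

section \<open>Path flows\<close>

lemma (in pre_digraph) cas_telescope:
  "cas u p v \<Longrightarrow> (\<Sum>a\<leftarrow>p. \<pi> (head G a) - \<pi> (tail G a)) = \<pi> v - (\<pi> u :: rat)"
  by (induction p arbitrary: u) auto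

lemma (in pre_digraph) apath_distinct: "apath u p v \<Longrightarrow> distinct p"
  by (auto simp: apath_def awalk_verts_conv distinct_map split: if_splits)

lemma st_pathsE:
  assumes "P \<in> st_paths D s t"
  obtains p where "P = set p" "pre_digraph.apath D s p t" "pre_digraph.cas D s p t" "set p \<subseteq> arcs D" "distinct p"
proof -
  obtain p where p: "P = set p" "pre_digraph.apath D s p t" using assms unfolding st_paths_def by blast
  then show thesis
    using that[of p] pre_digraph.apath_distinct[of D s p t]
    by (auto simp: pre_digraph.apath_def pre_digraph.awalk_def)
qed

lemma st_paths_subset: "P \<in> st_paths D s t \<Longrightarrow> P \<subseteq> arcs D"
  by (auto elim: st_pathsE)

lemma finite_st_paths: "finite (arcs D) \<Longrightarrow> finite (st_paths D s t)"
  by (rule finite_subset[of _ "Pow (arcs D)"]) (auto dest: st_paths_subset)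

lemma st_path_telescope:
  assumes "P \<in> st_paths D s t"
  shows "(\<Sum>a\<in>P. \<pi> (head D a) - \<pi> (tail D a)) = \<pi> t - (\<pi> s :: rat)"
proof -
  obtain p where "P = set p" "pre_digraph.cas D s p t" "distinct p" using assms by (rule st_pathsE)
  then show ?thesis using pre_digraph.cas_telescope[of D s p t \<pi>] by (simp add: sum_list_distinct_conv_sum_set)
qed

lemma arc_flow_sum: "finite \<P> \<Longrightarrow> arc_flow \<P> x a = (\<Sum>P\<in>\<P>. x P * of_bool (a \<in> P))"
  unfolding arc_flow_def by (rule sum.mono_neutral_cong_left) auto

lemma interdicted_sum: "finite \<P> \<Longrightarrow> interdicted \<P> x S = (\<Sum>P\<in>\<P>. x P * of_bool (P \<inter> S \<noteq> {}))"
  unfolding interdicted_def by (rule sum.mono_neutral_cong_left) auto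

text \<open>Conservation tested against an arbitrary potential. Indicators of single nodes give the
  usual balance equations, and the potential \<open>pot\<close> below gives the counting argument
  for the transition arcs.\<close>

lemma flow_conservation:
  assumes "finite (arcs D)"
  shows "(\<Sum>a\<in>arcs D. arc_flow (st_paths D s t) x a * (\<pi> (head D a) - \<pi> (tail D a)))
    = (\<Sum>P\<in>st_paths D s t. x P) * (\<pi> t - \<pi> s)"
proof -
  let ?P = "st_paths D s t"
  have "(\<Sum>a\<in>arcs D. arc_flow ?P x a * (\<pi> (head D a) - \<pi> (tail D a)))
    = (\<Sum>a\<in>arcs D. \<Sum>P\<in>?P. x P * (of_bool (a \<in> P) * (\<pi> (head D a) - \<pi> (tail D a))))"
    by (simp add: arc_flow_sum[OF finite_st_paths[OF assms]] sum_distrib_right mult.assoc)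
  also have "\<dots> = (\<Sum>P\<in>?P. x P * (\<Sum>a\<in>arcs D. of_bool (a \<in> P) * (\<pi> (head D a) - \<pi> (tail D a))))"
    by (subst sum.swap) (simp add: sum_distrib_left)
  also have "\<dots> = (\<Sum>P\<in>?P. x P * (\<pi> t - \<pi> s))"
  proof (rule sum.cong[OF refl])
    fix P assume P: "P \<in> ?P"
    have "(\<Sum>a\<in>arcs D. of_bool (a \<in> P) * (\<pi> (head D a) - \<pi> (tail D a)))
       = (\<Sum>a\<in>P. \<pi> (head D a) - \<pi> (tail D a))"
      by (rule sum.mono_neutral_cong_right) (use st_paths_subset[OF P] assms in auto)
    then show "x P * (\<Sum>a\<in>arcs D. of_bool (a \<in> P) * (\<pi> (head D a) - \<pi> (tail D a))) = x P * (\<pi> t - \<pi> s)"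
      using st_path_telescope[OF P] by simp
  qed
  finally show ?thesis by (simp add: sum_distrib_right)
qed

lemma arc_flow_nonneg: "nonneg_flow \<P> x \<Longrightarrow> 0 \<le> arc_flow \<P> x a"
  unfolding arc_flow_def nonneg_flow_def by (auto intro!: sum_nonneg)

lemma arc_flow_mono:
  "finite \<P> \<Longrightarrow> nonneg_flow \<P> x \<Longrightarrow> \<Q> \<subseteq> \<P> \<Longrightarrow> arc_flow \<Q> x a \<le> arc_flow \<P> x a"
  unfolding arc_flow_def nonneg_flow_def by (auto intro!: sum_mono2)

lemma arc_flow_zeroD:
  assumes "finite \<P>" "nonneg_flow \<P> x" "arc_flow \<P> x a = 0" "P \<in> \<P>" "a \<in> P"
  shows "x P = 0"
  using assms sum_nonneg_eq_0_iff[of "{P \<in> \<P>. a \<in> P}" x] unfolding arc_flow_def nonneg_flow_def by auto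

lemma interdicted_le:
  assumes "finite \<P>" "nonneg_flow \<P> x" "finite S"
  shows "interdicted \<P> x S \<le> (\<Sum>a\<in>S. arc_flow \<P> x a)"
proof -
  have "interdicted \<P> x S \<le> (\<Sum>P\<in>\<P>. x P * (\<Sum>a\<in>S. of_bool (a \<in> P)))"
    unfolding interdicted_sum[OF assms(1)]
  proof (intro sum_mono mult_left_mono)
    fix P assume "P \<in> \<P>"
    show "of_bool (P \<inter> S \<noteq> {}) \<le> (\<Sum>a\<in>S. of_bool (a \<in> P) :: rat)"
    proof (cases "P \<inter> S = {}")
      case False
      then obtain a where "a \<in> P" "a \<in> S" by auto
      then show ?thesis using member_le_sum[of a S "\<lambda>a. of_bool (a \<in> P) :: rat"] assms(3) by auto
    qed (simp add: sum_nonneg)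
  qed (use assms(2) in \<open>auto simp: nonneg_flow_def\<close>)
  also have "\<dots> = (\<Sum>a\<in>S. arc_flow \<P> x a)"
    by (simp add: arc_flow_sum[OF assms(1)] sum_distrib_left) (rule sum.swap)
  finally show ?thesis .
qed

lemma Max_image_le_iff:
  "finite A \<Longrightarrow> A \<noteq> {} \<Longrightarrow> Max (f ` A) \<le> (c :: rat) \<longleftrightarrow> (\<forall>a\<in>A. f a \<le> c)"
  by (subst Max_le_iff) auto

lemma arc_flow_flow_of:
  assumes "finite \<P>" "snd ` set L \<subseteq> \<P>"
  shows "arc_flow \<P> (flow_of L) a = fsum L (\<lambda>R. of_bool (a \<in> R))"
proof -
  have "arc_flow \<P> (flow_of L) a = fsum L (\<lambda>R. of_bool (R \<in> {P \<in> \<P>. a \<in> P}))"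
    unfolding arc_flow_def using assms(1) by (intro sum_flow_of) auto
  also have "\<dots> = fsum L (\<lambda>R. of_bool (a \<in> R))" using assms(2) by (intro fsum_cong) auto
  finally show ?thesis .
qed

lemma interdicted_flow_of:
  assumes "finite \<P>" "snd ` set L \<subseteq> \<P>"
  shows "interdicted \<P> (flow_of L) S = fsum L (\<lambda>R. of_bool (R \<inter> S \<noteq> {}))"
proof -
  have "interdicted \<P> (flow_of L) S = fsum L (\<lambda>R. of_bool (R \<in> {P \<in> \<P>. P \<inter> S \<noteq> {}}))"
    unfolding interdicted_def using assms(1) by (intro sum_flow_of) auto
  also have "\<dots> = fsum L (\<lambda>R. of_bool (R \<inter> S \<noteq> {}))" using assms(2) by (intro fsum_cong) auto
  finally show ?thesis .
qed

text \<open>Paths of weight 0 are left out, because only paths that carry flow are known to avoid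
  the forbidden arcs and to be decodable.\<close>

lemma flow_as_list:
  assumes "finite \<P>"
  shows "\<exists>L. set L = (\<lambda>P. (x P, P)) ` {P \<in> \<P>. x P \<noteq> 0} \<and> (\<forall>F. fsum L F = (\<Sum>P\<in>\<P>. x P * F P))"
proof -
  obtain Ps where Ps: "set Ps = {P \<in> \<P>. x P \<noteq> 0}" "distinct Ps"
    using finite_distinct_list[of "{P \<in> \<P>. x P \<noteq> 0}"] assms by auto
  have "fsum (map (\<lambda>P. (x P, P)) Ps) F = (\<Sum>P\<in>\<P>. x P * F P)" for F
  proof -
    have "fsum (map (\<lambda>P. (x P, P)) Ps) F = (\<Sum>P\<leftarrow>Ps. x P * F P)"
      by (simp add: fsum_def comp_def)
    also have "\<dots> = (\<Sum>P\<in>\<P>. x P * F P)"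
      unfolding sum_list_distinct_conv_sum_set[OF Ps(2)] Ps(1)
      by (rule sum.mono_neutral_cong_left) (use assms in auto)
    finally show ?thesis .
  qed
  then show ?thesis using Ps by (intro exI[of _ "map (\<lambda>P. (x P, P)) Ps"]) auto
qed

lemma (in pre_digraph) ranked_cas_distinct:
  assumes "cas u p v" "\<And>a. a \<in> set p \<Longrightarrow> rk (tail G a) < (rk (head G a) :: nat)"
  shows "distinct (awalk_verts u p) \<and> (\<forall>w\<in>set (awalk_verts u p). rk u \<le> rk w)"
  using assms
proof (induction p arbitrary: u)
  case (Cons e es)
  have "distinct (awalk_verts (head G e) es) \<and> (\<forall>w\<in>set (awalk_verts (head G e) es). rk (head G e) \<le> rk w)"
    by (rule Cons.IH) (use Cons.prems in auto)
  moreover have "rk u < rk (head G e)" "tail G e = u" using Cons.prems by auto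
  ultimately show ?case by fastforce
qed simp

text \<open>Increasing ranks exclude repeated nodes, which replaces a direct comparison of the nodes
  of paths of unknown length.\<close>

lemma st_pathsI:
  assumes "pre_digraph.cas D s p t" "set p \<subseteq> arcs D" "s \<in> verts D"
    "\<And>a. a \<in> set p \<Longrightarrow> rk (tail D a) < (rk (head D a) :: nat)"
  shows "set p \<in> st_paths D s t"
  using pre_digraph.ranked_cas_distinct[OF assms(1,4)] assms
  unfolding st_paths_def pre_digraph.apath_def pre_digraph.awalk_def by blast

lemma sum_of_bool_eq:
  "finite A \<Longrightarrow> (\<Sum>g\<in>A. f g * of_bool (g = h)) = (if h \<in> A then f h else (0 :: rat))"
  "finite A \<Longrightarrow> (\<Sum>g\<in>A. f g * of_bool (h = g)) = (if h \<in> A then f h else (0 :: rat))"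
  "finite A \<Longrightarrow> (\<Sum>g\<in>A. of_bool (g = h) * f g) = (if h \<in> A then f h else (0 :: rat))"
  by (simp_all add: of_bool_def if_distrib[of "\<lambda>x. _ * x"] if_distrib[of "\<lambda>x. x * _"] cong: if_cong)

lemma sum_eq_imp_eq:
  assumes "finite A" "\<And>a. a \<in> A \<Longrightarrow> f a \<le> (g a :: rat)" "sum f A = sum g A" "a \<in> A"
  shows "f a = g a"
  using sum_mono_inv[OF assms(3)] assms by blast

section \<open>The multicommodity instance of a gadget network\<close>

text \<open>Residues modulo 5 keep apart sources, sinks, entries and exits of gadgets, and network
  nodes.\<close>

definition nS :: "nat \<Rightarrow> nat" where "nS i = 5 * i"
definition nT :: "nat \<Rightarrow> nat" where "nT i = 5 * i + 1"
definition nI :: "nat \<Rightarrow> nat" where "nI g = 5 * g + 2"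
definition nO :: "nat \<Rightarrow> nat" where "nO g = 5 * g + 3"
definition nV :: "nat \<Rightarrow> nat" where "nV v = 5 * v + 4"

lemmas node_defs = nS_def nT_def nI_def nO_def nV_def

lemma node_simps [simp]:
  "nS i = nS j \<longleftrightarrow> i = j" "nT i = nT j \<longleftrightarrow> i = j" "nI i = nI j \<longleftrightarrow> i = j"
  "nO i = nO j \<longleftrightarrow> i = j" "nV i = nV j \<longleftrightarrow> i = j"
  "nS i \<noteq> nT j" "nS i \<noteq> nI j" "nS i \<noteq> nO j" "nS i \<noteq> nV j"
  "nT i \<noteq> nS j" "nT i \<noteq> nI j" "nT i \<noteq> nO j" "nT i \<noteq> nV j"
  "nI i \<noteq> nS j" "nI i \<noteq> nT j" "nI i \<noteq> nO j" "nI i \<noteq> nV j"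
  "nO i \<noteq> nS j" "nO i \<noteq> nT j" "nO i \<noteq> nI j" "nO i \<noteq> nV j"
  "nV i \<noteq> nS j" "nV i \<noteq> nT j" "nV i \<noteq> nI j" "nV i \<noteq> nO j"
  unfolding node_defs by presburger+

definition hit :: "nat set \<Rightarrow> nat list \<Rightarrow> rat" where
  "hit S gs = of_bool (set gs \<inter> S \<noteq> {})"

text \<open>A gadget \<open>g < m\<close> stands for an arc from \<open>ta g\<close> to
  \<open>he g\<close>; the \<open>k - 1\<close> gadgets from \<open>m\<close> on are the special
  ones. \<open>ex\<close> prescribes how much flow ends at each exit node. A pair
  \<open>(f, e)\<close> in \<open>pr\<close> has \<open>e < f\<close>, so that its transition arc
  runs against the topological order, and \<open>e < m\<close>, so that two special gadgets never
  form a pair.\<close>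

locale core =
  fixes k m :: nat and ta he :: "nat \<Rightarrow> nat" and root :: nat and ex :: "(nat \<times> nat) list"
    and nn :: "nat list" and pr :: "(nat \<times> nat) list"
  assumes k: "1 \<le> k" and pr_ne: "pr \<noteq> []" and pr_dist: "distinct pr"
    and pr: "\<And>f e. (f, e) \<in> set pr \<Longrightarrow> e < f \<and> e < m \<and> f < m + (k - 1)"
    and topo: "\<And>g h. g < m \<Longrightarrow> h < m \<Longrightarrow> he g = ta h \<Longrightarrow> g < h"
    and nn: "distinct nn" "root \<in> set nn" "\<And>g. g < m \<Longrightarrow> ta g \<in> set nn" "\<And>g. g < m \<Longrightarrow> he g \<in> set nn"
      "fst ` set ex \<subseteq> set nn"
    and ex: "distinct (map fst ex)" "root \<notin> fst ` set ex"
begin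

definition G :: nat where "G = m + (k - 1)"
definition N :: nat where "N = length pr"
definition \<Theta> :: nat where "\<Theta> = sum_list (map snd ex)"
text \<open>\<open>M\<close> must exceed the total demand \<open>N * (3 * G - 1)\<close> of the
  small commodities by at least 3, and the capacity of every arc that is not big by more than 2. It
  stays polynomial in the number of arcs because the small commodities alone have
  \<open>N * G\<close> source arcs.\<close>

definition M :: nat where "M = 3 * N * G + \<Theta> + 6"
definition c0 :: nat where "c0 = M - 1 - 3 * N"
definition cz :: "nat \<Rightarrow> nat" where "cz g = (if g < m then c0 else Suc c0)"

text \<open>Every small commodity shall send 3 units through each gadget. At \<open>snd\<close> of
  its pair one of them arrives by the transition arc instead of the source arc, and at
  \<open>fst\<close> one of them leaves by it instead of the sink arc; hence the two capacities
  2.\<close>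

definition sg :: "nat \<Rightarrow> nat \<Rightarrow> nat" where
  "sg i g = (case i of 0 \<Rightarrow> cz g | Suc j \<Rightarrow> if g = snd (pr ! j) then 2 else 3)"
definition tg :: "nat \<Rightarrow> nat \<Rightarrow> nat" where
  "tg i g = (case i of 0 \<Rightarrow> cz g | Suc j \<Rightarrow> if g = fst (pr ! j) then 2 else 3)"
definition al :: "((nat \<times> nat) \<times> nat) list" where
  "al = map (\<lambda>g. ((nI g, nO g), M)) [0..<G]
    @ map (\<lambda>g. ((nS 0, nI g), cz g)) [0..<G]
    @ map (\<lambda>g. ((nO g, nT 0), cz g)) [0..<G]
    @ concat (map (\<lambda>i. map (\<lambda>g. ((nS (Suc i), nI g), sg (Suc i) g)) [0..<G]) [0..<N])
    @ concat (map (\<lambda>i. map (\<lambda>g. ((nO g, nT (Suc i)), tg (Suc i) g)) [0..<G]) [0..<N])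
    @ map (\<lambda>z. ((nO (fst z), nI (snd z)), 1)) pr
    @ map (\<lambda>g. ((nV (ta g), nI g), 1)) [0..<m]
    @ map (\<lambda>g. ((nO g, nV (he g)), 1)) [0..<m]
    @ [((nS 0, nV root), \<Theta>)]
    @ map (\<lambda>z. ((nV (fst z), nT 0), snd z)) ex"

definition nodes :: "nat list" where
  "nodes = map nS [0..<Suc N] @ map nT [0..<Suc N] @ map nI [0..<G] @ map nO [0..<G] @ map nV nn"

definition coms :: "(nat \<times> nat \<times> nat) list" where
  "coms = (nS 0, nT 0, sum_list (map cz [0..<G]) + \<Theta>) # map (\<lambda>i. (nS (Suc i), nT (Suc i), 3 * G - 1)) [0..<N]"

definition J :: mrf_m where
  "J = \<lparr>node_list = nodes, arc_list = map fst al, budget = k,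
     capacity = (\<lambda>a. of_nat (the (map_of al a))),
     commodity_list = map (\<lambda>(s, t, d). (s, t, of_nat d)) coms\<rparr>"

abbreviation "D \<equiv> graph_of J"
definition "A = set (map fst al)"

definition dem :: "nat \<Rightarrow> nat" where
  "dem i = (if i = 0 then sum_list (map cz [0..<G]) + \<Theta> else 3 * G - 1)"

lemma prE: "z \<in> set pr \<Longrightarrow> snd z < fst z \<and> snd z < m \<and> fst z < G \<and> snd z < G"
  using pr[of "fst z" "snd z"] by (auto simp: G_def)

lemma pr_nth: "i < N \<Longrightarrow> pr ! i \<in> set pr \<and> snd (pr ! i) < fst (pr ! i) \<and> snd (pr ! i) < m
    \<and> fst (pr ! i) < G \<and> snd (pr ! i) < G"
  using prE[of "pr ! i"] by (simp add: N_def)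

lemma N_pos: "1 \<le> N" using pr_ne by (simp add: N_def Suc_le_eq)
lemma m_pos: "1 \<le> m" "2 \<le> G" using pr_nth[of 0] N_pos by auto

lemma M_bounds: "c0 + 3 * N + 1 = M" "c0 + 3 * N < M" "\<Theta> + 6 + 3 * N * G = M" "Suc c0 + 2 < M" "6 + 6 * N \<le> M"
proof -
  have "3 * N * 2 \<le> 3 * N * G" using m_pos by (intro mult_le_mono) auto
  then show "6 + 6 * N \<le> M" unfolding M_def by linarith
  then show "c0 + 3 * N + 1 = M" "c0 + 3 * N < M" "Suc c0 + 2 < M"
    using N_pos unfolding c0_def by linarith+
qed (simp add: M_def)

lemma distinct_concat_map:
  "distinct xs \<Longrightarrow> distinct ys \<Longrightarrow> (\<And>i i' g g'. f i g = f i' g' \<Longrightarrow> i = i' \<and> g = g') \<Longrightarrow>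
    distinct (concat (map (\<lambda>i. map (f i) xs) ys))"
  by (induction ys) (fastforce simp: distinct_map inj_on_def)+

lemma map_fst_al: "map fst al = map (\<lambda>g. (nI g, nO g)) [0..<G]
    @ map (\<lambda>g. (nS 0, nI g)) [0..<G]
    @ map (\<lambda>g. (nO g, nT 0)) [0..<G]
    @ concat (map (\<lambda>i. map (\<lambda>g. (nS (Suc i), nI g)) [0..<G]) [0..<N])
    @ concat (map (\<lambda>i. map (\<lambda>g. (nO g, nT (Suc i))) [0..<G]) [0..<N])
    @ map (\<lambda>z. (nO (fst z), nI (snd z))) pr
    @ map (\<lambda>g. (nV (ta g), nI g)) [0..<m]
    @ map (\<lambda>g. (nO g, nV (he g))) [0..<m]
    @ [(nS 0, nV root)]
    @ map (\<lambda>z. (nV (fst z), nT 0)) ex"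
  unfolding al_def by (simp add: comp_def map_concat)

lemma distinct_al: "distinct (map fst al)"
proof -
  have "distinct (concat (map (\<lambda>i. map (\<lambda>g. (nS (Suc i), nI g)) [0..<G]) [0..<N]))"
    "distinct (concat (map (\<lambda>i. map (\<lambda>g. (nO g, nT (Suc i))) [0..<G]) [0..<N]))"
    by (rule distinct_concat_map; simp)+
  moreover have "distinct (map (\<lambda>z. (nO (fst z), nI (snd z))) pr)"
    using pr_dist by (auto simp: distinct_map inj_on_def prod_eq_iff)
  moreover have "distinct (map (\<lambda>z. (nV (fst z), nT 0)) ex)"
    using ex(1) by (auto simp: distinct_map inj_on_def)
  ultimately show ?thesis
    unfolding map_fst_al by (auto simp: distinct_map inj_on_def)
qed

lemma capI: "(a, c) \<in> set al \<Longrightarrow> capacity J a = of_nat c"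
  using distinct_al by (simp add: J_def)

lemma cap [simp]:
  "g < G \<Longrightarrow> capacity J (nI g, nO g) = of_nat M"
  "i \<le> N \<Longrightarrow> g < G \<Longrightarrow> capacity J (nS i, nI g) = of_nat (sg i g)"
  "i \<le> N \<Longrightarrow> g < G \<Longrightarrow> capacity J (nO g, nT i) = of_nat (tg i g)"
  "z \<in> set pr \<Longrightarrow> capacity J (nO (fst z), nI (snd z)) = 1"
  "g < m \<Longrightarrow> capacity J (nV (ta g), nI g) = 1"
  "g < m \<Longrightarrow> capacity J (nO g, nV (he g)) = 1"
  "capacity J (nS 0, nV root) = of_nat \<Theta>"
  "z \<in> set ex \<Longrightarrow> capacity J (nV (fst z), nT 0) = of_nat (snd z)"
proof -
  show "g < G \<Longrightarrow> capacity J (nI g, nO g) = of_nat M"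
    by (rule capI) (auto simp: al_def)
  show "i \<le> N \<Longrightarrow> g < G \<Longrightarrow> capacity J (nS i, nI g) = of_nat (sg i g)"
  proof (rule capI, cases i)
    case 0
    assume "g < G" with 0 show "((nS i, nI g), sg i g) \<in> set al" by (simp add: al_def sg_def)
  next
    case (Suc j)
    assume "i \<le> N" "g < G" with Suc
    have "((nS i, nI g), sg i g) \<in> set (concat (map (\<lambda>i. map (\<lambda>g. ((nS (Suc i), nI g), sg (Suc i) g)) [0..<G]) [0..<N]))"
      by (auto intro!: bexI[of _ j])
    then show "((nS i, nI g), sg i g) \<in> set al" unfolding al_def set_append by blast
  qed
  show "i \<le> N \<Longrightarrow> g < G \<Longrightarrow> capacity J (nO g, nT i) = of_nat (tg i g)"
  proof (rule capI, cases i)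
    case 0
    assume "g < G" with 0 show "((nO g, nT i), tg i g) \<in> set al" by (simp add: al_def tg_def)
  next
    case (Suc j)
    assume "i \<le> N" "g < G" with Suc
    have "((nO g, nT i), tg i g) \<in> set (concat (map (\<lambda>i. map (\<lambda>g. ((nO g, nT (Suc i)), tg (Suc i) g)) [0..<G]) [0..<N]))"
      by (auto intro!: bexI[of _ j])
    then show "((nO g, nT i), tg i g) \<in> set al" unfolding al_def set_append by blast
  qed
  have "z \<in> set pr \<Longrightarrow> capacity J (nO (fst z), nI (snd z)) = of_nat 1" by (rule capI) (auto simp: al_def)
  then show "z \<in> set pr \<Longrightarrow> capacity J (nO (fst z), nI (snd z)) = 1" by simp
  have "g < m \<Longrightarrow> capacity J (nV (ta g), nI g) = of_nat 1" by (rule capI) (auto simp: al_def)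
  then show "g < m \<Longrightarrow> capacity J (nV (ta g), nI g) = 1" by simp
  have "g < m \<Longrightarrow> capacity J (nO g, nV (he g)) = of_nat 1" by (rule capI) (auto simp: al_def)
  then show "g < m \<Longrightarrow> capacity J (nO g, nV (he g)) = 1" by simp
  show "capacity J (nS 0, nV root) = of_nat \<Theta>" by (rule capI) (auto simp: al_def)
  show "z \<in> set ex \<Longrightarrow> capacity J (nV (fst z), nT 0) = of_nat (snd z)" by (rule capI) (auto simp: al_def)
qed

lemma A_iff: "a \<in> A \<longleftrightarrow> (\<exists>g<G. a = (nI g, nO g)) \<or> (\<exists>i\<le>N. \<exists>g<G. a = (nS i, nI g))
    \<or> (\<exists>i\<le>N. \<exists>g<G. a = (nO g, nT i)) \<or> (\<exists>z\<in>set pr. a = (nO (fst z), nI (snd z)))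
    \<or> (\<exists>g<m. a = (nV (ta g), nI g)) \<or> (\<exists>g<m. a = (nO g, nV (he g)))
    \<or> a = (nS 0, nV root) \<or> (\<exists>z\<in>set ex. a = (nV (fst z), nT 0))" (is "_ \<longleftrightarrow> ?R")
proof -
  have 1: "(\<exists>i\<le>N. P i) \<longleftrightarrow> P 0 \<or> (\<exists>i<N. P (Suc i))" for P
    by (metis Suc_le_eq le0 not0_implies_Suc)
  have 2: "a \<in> set (map f [0..<n]) \<longleftrightarrow> (\<exists>g<n. a = f g)" for f :: "nat \<Rightarrow> nat \<times> nat" and n
    by auto
  have 3: "a \<in> set (concat (map (\<lambda>i. map (f i) [0..<G]) [0..<N])) \<longleftrightarrow> (\<exists>i<N. \<exists>g<G. a = f i g)"
    for f :: "nat \<Rightarrow> nat \<Rightarrow> nat \<times> nat"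
    by (auto; (blast | (rule bexI, rule imageI; simp)))
  have 4: "a \<in> set (map f xs) \<longleftrightarrow> (\<exists>z\<in>set xs. a = f z)" for f :: "nat \<times> nat \<Rightarrow> nat \<times> nat" and xs
    by auto
  have 5: "a \<in> set [b] \<longleftrightarrow> a = b" for b by simp
  show ?thesis unfolding 1 A_def map_fst_al set_append Un_iff
    by (simp only: 2 3 4 5 disj_ac)
qed

lemma asum: "(\<Sum>a\<in>A. F a) = (\<Sum>g<G. F (nI g, nO g)) + (\<Sum>i\<le>N. \<Sum>g<G. F (nS i, nI g))
    + (\<Sum>i\<le>N. \<Sum>g<G. F (nO g, nT i)) + (\<Sum>z\<in>set pr. F (nO (fst z), nI (snd z)))
    + (\<Sum>g<m. F (nV (ta g), nI g)) + (\<Sum>g<m. F (nO g, nV (he g)))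
    + F (nS 0, nV root) + (\<Sum>z\<in>set ex. F (nV (fst z), nT 0))" for F :: "nat \<times> nat \<Rightarrow> rat"
proof -
  have "(\<Sum>a\<in>A. F a) = sum_list (map F (map fst al))"
    unfolding A_def by (rule sum_list_distinct_conv_sum_set[OF distinct_al, symmetric])
  moreover have "sum_list (map f (concat (map g xs))) = (\<Sum>x\<leftarrow>xs. sum_list (map f (g x)))"
    for f :: "nat \<times> nat \<Rightarrow> rat" and g and xs :: "nat list"
    by (induction xs) auto
  moreover have "(\<Sum>z\<leftarrow>pr. f z) = (\<Sum>z\<in>set pr. f z)" "(\<Sum>z\<leftarrow>ex. f' z) = (\<Sum>z\<in>set ex. f' z)"
    for f f' :: "nat \<times> nat \<Rightarrow> rat"
    using pr_dist ex(1) by (auto intro: sum_list_distinct_conv_sum_set simp: distinct_map)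
  moreover have "(\<Sum>i\<le>N. f i) = f 0 + (\<Sum>i<N. f (Suc i))" for f :: "nat \<Rightarrow> rat"
    by (rule sum.atMost_shift)
  ultimately show ?thesis
    unfolding map_fst_al by (simp add: comp_def interv_sum_list_conv_sum_set_nat atLeast0LessThan)
qed

lemma D_simps [simp]: "arcs D = A" "tail D = fst" "head D = snd" "verts D = set nodes" "budget J = k"
  by (auto simp: graph_of_def J_def A_def)

lemma finite_A [simp]: "finite A" by (simp add: A_def)

lemma com_simps: "commodities J = {..N}"
  "i \<le> N \<Longrightarrow> m_source J i = nS i" "i \<le> N \<Longrightarrow> m_sink J i = nT i" "i \<le> N \<Longrightarrow> m_demand J i = of_nat (dem i)"
  by (auto simp: commodities_def J_def coms_def m_source_def m_sink_def m_demand_def dem_def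
      nth_Cons split: nat.splits)

lemma nodes_mem: "i \<le> N \<Longrightarrow> nS i \<in> set nodes" "i \<le> N \<Longrightarrow> nT i \<in> set nodes"
  "g < G \<Longrightarrow> nI g \<in> set nodes" "g < G \<Longrightarrow> nO g \<in> set nodes" "v \<in> set nn \<Longrightarrow> nV v \<in> set nodes"
  by (auto simp: nodes_def)

lemma A_nodes: "a \<in> A \<Longrightarrow> fst a \<in> set nodes \<and> snd a \<in> set nodes \<and> fst a \<noteq> snd a"
  using nn prE by (auto simp: A_iff G_def intro!: nodes_mem)

lemma valid_J: "valid_graph J"
proof -
  have "distinct nodes" using nn(1) by (auto simp: nodes_def distinct_map inj_on_def)
  moreover have "digraph D"
    by unfold_locales (use A_nodes in \<open>auto simp: arc_to_ends_def prod_eq_iff\<close>)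
  ultimately show ?thesis using k distinct_al by (auto simp: valid_graph_def) (simp_all add: J_def)
qed

lemma big_A: "g < G \<Longrightarrow> (nI g, nO g) \<in> A" by (auto simp: A_iff)

lemma J_instance: "J \<in> mrf_m_instances"
proof -
  have "A \<noteq> {}" using big_A[of 0] m_pos by auto
  then show ?thesis using valid_J by (auto simp: mrf_m_instances_def com_simps nodes_mem) (auto simp: J_def)
qed

lemma sum_cz: "sum_list (map cz [0..<G]) = (\<Sum>g<G. cz g)"
  by (simp add: interv_sum_list_conv_sum_set_nat atLeast0LessThan)

lemma sum_if_nat: "h < G \<Longrightarrow> (\<Sum>g<G. if g = h then 2 else (3 :: nat)) = 3 * G - 1"
proof -
  assume h: "h < G"
  have "(\<Sum>g<G. if g = h then 2 else (3 :: nat)) = 2 + (\<Sum>g\<in>{..<G} - {h}. 3)"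
    using h by (subst sum.remove[of _ h]) (auto intro!: sum.cong)
  also have "\<dots> = 3 * G - 1" using h by simp
  finally show ?thesis .
qed

lemma sum_sg: "i \<le> N \<Longrightarrow> (\<Sum>g<G. sg i g) = dem i - (if i = 0 then \<Theta> else 0)"
  and sum_tg: "i \<le> N \<Longrightarrow> (\<Sum>g<G. tg i g) = dem i - (if i = 0 then \<Theta> else 0)"
proof -
  have "(\<Sum>g<G. sg i g) = dem i - (if i = 0 then \<Theta> else 0) \<and> (\<Sum>g<G. tg i g) = dem i - (if i = 0 then \<Theta> else 0)"
    if "i \<le> N"
  proof (cases i)
    case (Suc j)
    then show ?thesis using sum_if_nat[of "snd (pr ! j)"] sum_if_nat[of "fst (pr ! j)"] pr_nth[of j] that
      by (simp add: sg_def tg_def dem_def)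
  qed (simp add: sg_def tg_def dem_def sum_cz)
  then show "i \<le> N \<Longrightarrow> (\<Sum>g<G. sg i g) = dem i - (if i = 0 then \<Theta> else 0)"
    "i \<le> N \<Longrightarrow> (\<Sum>g<G. tg i g) = dem i - (if i = 0 then \<Theta> else 0)" by auto
qed

lemma dem_ge: "\<Theta> \<le> dem 0" by (simp add: dem_def)

lemma \<Theta>_sum: "\<Theta> = (\<Sum>z\<in>set ex. snd z)"
  unfolding \<Theta>_def using ex(1) by (intro sum_list_distinct_conv_sum_set) (simp add: distinct_map)

lemma sg_ge: "1 \<le> i \<Longrightarrow> i \<le> N \<Longrightarrow> 2 \<le> sg i g \<and> sg i g \<le> 3 \<and> 2 \<le> tg i g \<and> tg i g \<le> 3"
  by (auto simp: sg_def tg_def split: nat.splits)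

lemma ex_le: "z \<in> set ex \<Longrightarrow> snd z \<le> \<Theta>"
  unfolding \<Theta>_sum by (rule member_le_sum) auto

text \<open>The gap of 2 has two uses: an arc of capacity at least \<open>M - 2\<close> is
  recognised as big, and a scenario containing another arc misses \<open>k * M\<close> by more than
  1.\<close>

lemma cap_cases:
  assumes "a \<in> A" shows "(\<exists>g<G. a = (nI g, nO g)) \<or> capacity J a + 2 < of_nat M"
proof -
  have s: "sg i g + 2 < M" "tg i g + 2 < M" if "i \<le> N" for i g
    using sg_ge[of i g] M_bounds that by (cases i; auto simp: sg_def tg_def cz_def)+
  have "\<exists>c. capacity J a = of_nat c \<and> c + 2 < M" if "\<not> (\<exists>g<G. a = (nI g, nO g))"
    using assms that unfolding A_iff
  proof (elim disjE exE conjE bexE)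
    fix i g assume "i \<le> N" "g < G" "a = (nS i, nI g)"
    then show ?thesis using s[of i g] by auto
  next
    fix i g assume "i \<le> N" "g < G" "a = (nO g, nT i)"
    then show ?thesis using s[of i g] by auto
  next
    fix z assume "z \<in> set pr" "a = (nO (fst z), nI (snd z))"
    then show ?thesis using M_bounds by (auto intro!: exI[of _ 1])
  next
    fix g assume "g < m" "a = (nV (ta g), nI g)"
    then show ?thesis using M_bounds by (auto intro!: exI[of _ 1])
  next
    fix g assume "g < m" "a = (nO g, nV (he g))"
    then show ?thesis using M_bounds by (auto intro!: exI[of _ 1])
  next
    assume "a = (nS 0, nV root)"
    then show ?thesis using M_bounds by (auto intro!: exI[of _ \<Theta>])
  next
    fix z assume "z \<in> set ex" "a = (nV (fst z), nT 0)"
    then show ?thesis using M_bounds ex_le[of z] by (auto intro!: exI[of _ "snd z"])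
  qed auto
  then show ?thesis by (metis of_nat_add of_nat_less_iff of_nat_numeral)
qed

lemma max_cap: "max_capacity J = of_nat M"
  unfolding max_capacity_def
proof (rule Max_eqI)
  show "of_nat M \<in> capacity J ` arcs D" using big_A[of 0] m_pos by (force simp: image_iff)
  show "y \<le> of_nat M" if "y \<in> capacity J ` arcs D" for y
    using that cap_cases by fastforce
qed simp

lemma cap_Ints: "capacity J a \<in> \<int>" by (simp add: J_def)

lemma cap_le: "a \<in> A \<Longrightarrow> capacity J a \<le> of_nat M"
  using cap_cases by fastforce

lemma leaving_S: "i \<le> N \<Longrightarrow> leaving D {nS i} = (\<lambda>g. (nS i, nI g)) ` {..<G} \<union> (if i = 0 then {(nS 0, nV root)} else {})"
  and entering_S: "i \<le> N \<Longrightarrow> entering D {nS i} = {}"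
  and entering_T: "i \<le> N \<Longrightarrow> entering D {nT i} = (\<lambda>g. (nO g, nT i)) ` {..<G} \<union> (if i = 0 then (\<lambda>z. (nV (fst z), nT 0)) ` set ex else {})"
  and leaving_T: "i \<le> N \<Longrightarrow> leaving D {nT i} = {}"
  by (auto simp: leaving_def entering_def A_iff)

lemma of_nat_dem: "of_nat (dem i) = (of_nat (dem i - (if i = 0 then \<Theta> else 0)) + (if i = 0 then of_nat \<Theta> else 0) :: rat)"
  using dem_ge by auto

lemma source_sum: "i \<le> N \<Longrightarrow> (\<Sum>a\<in>leaving D {nS i}. capacity J a) = of_nat (dem i)"
proof -
  assume i: "i \<le> N"
  have "(\<Sum>a\<in>(\<lambda>g. (nS i, nI g)) ` {..<G}. capacity J a) = of_nat (\<Sum>g<G. sg i g)"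
    using i by (subst sum.reindex) (auto simp: inj_on_def)
  then show ?thesis unfolding of_nat_dem[of i] leaving_S[OF i] sum_sg[OF i]
    by (subst sum.union_disjoint) auto
qed

lemma sink_sum: "i \<le> N \<Longrightarrow> (\<Sum>a\<in>entering D {nT i}. capacity J a) = of_nat (dem i)"
proof -
  assume i: "i \<le> N"
  have "(\<Sum>a\<in>(\<lambda>g. (nO g, nT i)) ` {..<G}. capacity J a) = of_nat (\<Sum>g<G. tg i g)"
    using i by (subst sum.reindex) (auto simp: inj_on_def)
  moreover have "(\<Sum>a\<in>(\<lambda>z. (nV (fst z), nT 0)) ` set ex. capacity J a) = of_nat \<Theta>"
    unfolding \<Theta>_sum using ex(1) by (subst sum.reindex) (auto simp: inj_on_def distinct_map)
  ultimately show ?thesis unfolding of_nat_dem[of i] entering_T[OF i] sum_tg[OF i]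
    by (subst sum.union_disjoint) auto
qed

lemma small_demands: "(\<Sum>i\<in>commodities J - {0}. m_demand J i) \<le> max_capacity J - 3"
proof -
  have "(\<Sum>i\<in>commodities J - {0}. m_demand J i) = (\<Sum>i\<in>{..N} - {0}. of_nat (3 * G - 1))"
    by (rule sum.cong) (auto simp: com_simps dem_def)
  also have "\<dots> = of_nat (N * (3 * G - 1))" by simp
  also have "\<dots> \<le> of_nat (M - 3)"
  proof (intro of_nat_mono)
    have "N * (3 * G - 1) \<le> N * (3 * G)" by (intro mult_le_mono) auto
    also have "\<dots> = 3 * N * G" by simp
    finally show "N * (3 * G - 1) \<le> M - 3" unfolding M_def by linarith
  qed
  also have "\<dots> = max_capacity J - 3" using M_bounds by (simp add: max_cap of_nat_diff)
  finally show ?thesis .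
qed

text \<open>The sources together with the entries of the special gadgets. The private source arcs of
  a special gadget add up to \<open>M\<close>, so replacing them by its big arc keeps the capacity
  of the cut and contributes exactly \<open>k - 1\<close> arcs of capacity \<open>M\<close>.\<close>

definition U :: "nat set" where "U = nS ` {..N} \<union> nI ` {m..<G}"

lemma cut:
  "U \<subseteq> set nodes" "nS ` {..N} \<subseteq> U" "nT ` {..N} \<subseteq> set nodes - U"
  "(\<Sum>a\<in>leaving D U. capacity J a) = (\<Sum>i\<le>N. of_nat (dem i))"
  "card {a \<in> leaving D U. capacity J a = of_nat M} = k - 1"
proof -
  show "U \<subseteq> set nodes" "nS ` {..N} \<subseteq> U" "nT ` {..N} \<subseteq> set nodes - U"
    by (auto simp: U_def intro: nodes_mem)
  have mG: "m \<le> G" by (simp add: G_def)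
  have l: "leaving D U = (\<lambda>(i, g). (nS i, nI g)) ` ({..N} \<times> {..<m}) \<union> {(nS 0, nV root)} \<union> (\<lambda>g. (nI g, nO g)) ` {m..<G}"
    using prE mG by (auto simp: leaving_def U_def A_iff image_iff)
  \<comment> \<open>A special gadget is never the second member of a pair, so all its small source
    arcs have capacity 3.\<close>
  have tot: "(\<Sum>i\<le>N. sg i g) = M" if "m \<le> g" "g < G" for g
  proof -
    have "(\<Sum>i\<le>N. sg i g) = sg 0 g + (\<Sum>i<N. sg (Suc i) g)" by (rule sum.atMost_shift)
    also have "(\<Sum>i<N. sg (Suc i) g) = (\<Sum>i<N. 3)"
    proof (rule sum.cong[OF refl])
      fix i assume "i \<in> {..<N}"
      then show "sg (Suc i) g = 3" using pr_nth[of i] that by (auto simp: sg_def)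
    qed
    finally show ?thesis using M_bounds that by (simp add: sg_def cz_def)
  qed
  have "(\<Sum>a\<in>leaving D U. capacity J a) = (\<Sum>a\<in>(\<lambda>(i, g). (nS i, nI g)) ` ({..N} \<times> {..<m}). capacity J a)
      + of_nat \<Theta> + (\<Sum>a\<in>(\<lambda>g. (nI g, nO g)) ` {m..<G}. capacity J a)"
    unfolding l by (subst sum.union_disjoint, simp, simp, force, subst sum.union_disjoint) auto
  also have "(\<Sum>a\<in>(\<lambda>(i, g). (nS i, nI g)) ` ({..N} \<times> {..<m}). capacity J a) = (\<Sum>i\<le>N. \<Sum>g<m. of_nat (sg i g))"
    by (subst sum.reindex) (use mG in \<open>auto simp: inj_on_def sum.cartesian_product intro!: sum.cong\<close>)
  also have "(\<Sum>a\<in>(\<lambda>g. (nI g, nO g)) ` {m..<G}. capacity J a) = (\<Sum>g\<in>{m..<G}. of_nat M)"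
    by (subst sum.reindex) (auto simp: inj_on_def)
  also have "\<dots> = (\<Sum>g\<in>{m..<G}. of_nat (\<Sum>i\<le>N. sg i g))" using tot by simp
  also have "\<dots> = (\<Sum>i\<le>N. \<Sum>g\<in>{m..<G}. of_nat (sg i g))" by simp (rule sum.swap)
  also have "(\<Sum>i\<le>N. \<Sum>g<m. of_nat (sg i g)) + of_nat \<Theta> + (\<Sum>i\<le>N. \<Sum>g\<in>{m..<G}. of_nat (sg i g))
     = (\<Sum>i\<le>N. of_nat (\<Sum>g<G. sg i g) :: rat) + of_nat \<Theta>"
  proof -
    have "{..<G} = {..<m} \<union> {m..<G}" using mG by auto
    then have "(\<Sum>g<G. of_nat (sg i g) :: rat) = (\<Sum>g<m. of_nat (sg i g)) + (\<Sum>g\<in>{m..<G}. of_nat (sg i g))" for i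
      by (simp add: sum.union_disjoint ivl_disj_int)
    then show ?thesis by (simp add: sum.distrib)
  qed
  also have "\<dots> = (\<Sum>i\<le>N. of_nat (dem i))"
    using dem_ge by (simp add: sum_sg sum.atMost_shift of_nat_diff)
  finally show "(\<Sum>a\<in>leaving D U. capacity J a) = (\<Sum>i\<le>N. of_nat (dem i))" .
  have "{a \<in> leaving D U. capacity J a = of_nat M} = (\<lambda>g. (nI g, nO g)) ` {m..<G}"
  proof (intro equalityI subsetI)
    fix a assume a: "a \<in> {a \<in> leaving D U. capacity J a = of_nat M}"
    then have "a \<in> A" by (auto simp: leaving_def)
    from cap_cases[OF this] a obtain g where "g < G" "a = (nI g, nO g)" by auto
    then show "a \<in> (\<lambda>g. (nI g, nO g)) ` {m..<G}" using a unfolding l by auto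
  qed (auto simp: l)
  then show "card {a \<in> leaving D U. capacity J a = of_nat M} = k - 1"
    by (simp add: card_image inj_on_def G_def)
qed

end

section \<open>The condition on network flows that the instance expresses\<close>

context core
begin

definition nx :: "nat \<Rightarrow> nat \<Rightarrow> bool" where
  "nx g h \<longleftrightarrow> g < m \<and> h < m \<and> he g = ta h"
definition indep :: "nat set \<Rightarrow> bool" where
  "indep S \<longleftrightarrow> (\<forall>z\<in>set pr. \<not> (fst z \<in> S \<and> snd z \<in> S))"
definition cvalid :: "nat list \<Rightarrow> bool" where
  "cvalid gs \<longleftrightarrow> gs \<noteq> [] \<and> set gs \<subseteq> {..<m} \<and> successively nx gs \<and> ta (hd gs) = root
     \<and> he (last gs) \<in> fst ` set ex"
text \<open>What remains of the instance when the private units and the small commodities are fixed.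
  Special gadgets are full, so each of them in \<open>S\<close> counts as one hit. Smaller scenarios
  and those containing a pair do not occur, as they respect the bound anyway.\<close>

definition core_sol :: "(rat \<times> nat list) list \<Rightarrow> bool" where
  "core_sol L \<longleftrightarrow> (\<forall>z\<in>set L. 0 \<le> fst z \<and> cvalid (snd z))
     \<and> (\<forall>z\<in>set ex. fsum L (\<lambda>gs. of_bool (he (last gs) = fst z)) = of_nat (snd z))
     \<and> (\<forall>g<m. fsum L (hit {g}) \<le> 1)
     \<and> (\<forall>S\<subseteq>{..<G}. card S = k \<longrightarrow> indep S \<longrightarrow>
          fsum L (hit S) + of_nat (card (S - {..<m})) \<le> of_nat k - 1)"

subsection \<open>Flow conservation and forced flows\<close>

abbreviation "PP \<equiv> m_paths_of J"

lemma PP_eq: "i \<le> N \<Longrightarrow> PP i = st_paths D (nS i) (nT i)"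
  by (simp add: m_paths_of_def com_simps)

lemma finite_PP: "i \<le> N \<Longrightarrow> finite (PP i)"
  by (simp add: PP_eq finite_st_paths)

lemma PP_sub: "i \<le> N \<Longrightarrow> P \<in> PP i \<Longrightarrow> P \<subseteq> A"
  using st_paths_subset[of P D] by (auto simp: PP_eq)

lemma finite_P: "i \<le> N \<Longrightarrow> P \<in> PP i \<Longrightarrow> finite P"
  using PP_sub finite_A finite_subset by blast

lemma m_paths_eq: "m_paths J = (\<Union>i\<in>{..N}. PP i)"
  by (simp add: m_paths_def com_simps)

lemma finite_m_paths: "finite (m_paths J)"
  by (auto simp: m_paths_eq finite_PP)

text \<open>The indicator of \<open>nS j\<close> telescopes along the path, and no arc enters
  \<open>nS j\<close>. Hence a path reveals its commodity by its source arc.\<close>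

lemma path_src_count:
  assumes "i \<le> N" "P \<in> PP i" shows "(\<Sum>a\<in>P. of_bool (fst a = nS j)) = (of_bool (i = j) :: rat)"
proof -
  have "(\<Sum>a\<in>P. of_bool (snd a = nS j) - of_bool (fst a = nS j)) = of_bool (nT i = nS j) - (of_bool (nS i = nS j) :: rat)"
    using st_path_telescope[of P D "nS i" "nT i" "\<lambda>u. of_bool (u = nS j)"] assms by (simp add: PP_eq)
  moreover have "(\<Sum>a\<in>P. of_bool (snd a = nS j) - of_bool (fst a = nS j) :: rat) = (\<Sum>a\<in>P. - of_bool (fst a = nS j))"
  proof (rule sum.cong[OF refl])
    fix a assume "a \<in> P"
    then have "a \<in> A" using PP_sub assms by blast
    then have "snd a \<noteq> nS j" by (auto simp: A_iff)
    then show "of_bool (snd a = nS j) - of_bool (fst a = nS j) = (- of_bool (fst a = nS j) :: rat)" by simp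
  qed
  ultimately show ?thesis by (simp add: sum_negf)
qed

lemma path_snk_count:
  assumes "i \<le> N" "P \<in> PP i" shows "(\<Sum>a\<in>P. of_bool (snd a = nT j)) = (of_bool (i = j) :: rat)"
proof -
  have "(\<Sum>a\<in>P. of_bool (snd a = nT j) - of_bool (fst a = nT j)) = of_bool (nT i = nT j) - (of_bool (nS i = nT j) :: rat)"
    using st_path_telescope[of P D "nS i" "nT i" "\<lambda>u. of_bool (u = nT j)"] assms by (simp add: PP_eq)
  moreover have "(\<Sum>a\<in>P. of_bool (snd a = nT j) - of_bool (fst a = nT j) :: rat) = (\<Sum>a\<in>P. of_bool (snd a = nT j))"
  proof (rule sum.cong[OF refl])
    fix a assume "a \<in> P"
    then have "a \<in> A" using PP_sub assms by blast
    then have "fst a \<noteq> nT j" by (auto simp: A_iff)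
    then show "of_bool (snd a = nT j) - of_bool (fst a = nT j) = (of_bool (snd a = nT j) :: rat)" by simp
  qed
  ultimately show ?thesis by simp
qed

lemma path_src: "i \<le> N \<Longrightarrow> P \<in> PP i \<Longrightarrow> a \<in> P \<Longrightarrow> fst a = nS j \<Longrightarrow> i = j"
  using path_src_count[of i P j] sum_nonneg_eq_0_iff[of P "\<lambda>a. of_bool (fst a = nS j) :: rat"] finite_P
  by (cases "i = j") auto

lemma path_snk: "i \<le> N \<Longrightarrow> P \<in> PP i \<Longrightarrow> a \<in> P \<Longrightarrow> snd a = nT j \<Longrightarrow> i = j"
  using path_snk_count[of i P j] sum_nonneg_eq_0_iff[of P "\<lambda>a. of_bool (snd a = nT j) :: rat"] finite_P
  by (cases "i = j") auto

lemma PP_disjoint: "i \<le> N \<Longrightarrow> j \<le> N \<Longrightarrow> P \<in> PP i \<Longrightarrow> P \<in> PP j \<Longrightarrow> i = j"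
proof (rule ccontr)
  assume ij: "i \<le> N" "j \<le> N" "P \<in> PP i" "P \<in> PP j" "i \<noteq> j"
  have "(\<Sum>a\<in>P. of_bool (fst a = nS i)) = (1 :: rat)" using path_src_count[OF ij(1,3), of i] by simp
  moreover have "(\<Sum>a\<in>P. of_bool (fst a = nS i)) = (0 :: rat)" using path_src_count[OF ij(2,4), of i] ij(5) by simp
  ultimately show False by simp
qed

lemma sum_m_paths: "(\<Sum>P\<in>m_paths J. F P) = (\<Sum>i\<le>N. \<Sum>P\<in>PP i. F P)" for F :: "(nat \<times> nat) set \<Rightarrow> rat"
  unfolding m_paths_eq by (rule sum.UNION_disjoint) (auto simp: finite_PP dest: PP_disjoint)

lemma flow_split: "arc_flow (m_paths J) x a = (\<Sum>i\<le>N. arc_flow (PP i) x a)"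
  by (simp add: arc_flow_sum finite_m_paths finite_PP sum_m_paths)

lemma interdicted_split: "interdicted (m_paths J) x S = (\<Sum>i\<le>N. interdicted (PP i) x S)"
  unfolding interdicted_sum[OF finite_m_paths] sum_m_paths
  by (rule sum.cong) (simp_all only: interdicted_sum[OF finite_PP] atMost_iff)

text \<open>The potential increases along network arcs and decreases along transitions.\<close>

definition pv :: "nat \<Rightarrow> nat" where
  "pv v = Max (insert 0 {2 * g + 2 | g. g < m \<and> he g = v})"

lemma pv_he: "g < m \<Longrightarrow> 2 * g + 2 \<le> pv (he g)"
  unfolding pv_def by (rule Max_ge) auto

lemma pv_ta: "h < m \<Longrightarrow> pv (ta h) \<le> 2 * h"
  unfolding pv_def using topo[of _ h] by (subst Max_le_iff) (auto, fastforce)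

text \<open>Gadgets have odd and network nodes even values, so the potential rises strictly into and
  out of a gadget and is level on its big arc. The private arcs start and end at 0 and record the
  positions at which flow enters and leaves.\<close>

definition pot :: "nat \<Rightarrow> rat" where
  "pot u = of_nat (if u mod 5 < 2 then 0 else if u mod 5 = 4 then pv (u div 5) else 2 * (u div 5) + 1)"

lemma pot_simps: "pot (nS i) = 0" "pot (nT i) = 0" "pot (nI g) = of_nat (2 * g + 1)"
  "pot (nO g) = of_nat (2 * g + 1)" "pot (nV v) = of_nat (pv v)"
proof -
  have "(5 * a + b) mod 5 = b" "(5 * a + b) div 5 = a" if "b < 5" for a b :: nat using that by auto
  from this[of 0] this[of 1] this[of 2] this[of 3] this[of 4]
  show "pot (nS i) = 0" "pot (nT i) = 0" "pot (nI g) = of_nat (2 * g + 1)"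
    "pot (nO g) = of_nat (2 * g + 1)" "pot (nV v) = of_nat (pv v)"
    unfolding pot_def node_defs by simp_all
qed

context
  fixes x :: "(nat \<times> nat) set \<Rightarrow> rat"
  assumes x: "x \<in> m_flows J"
begin

abbreviation "zz i a \<equiv> arc_flow (PP i) x a"

lemma nonneg_PP: "i \<le> N \<Longrightarrow> nonneg_flow (PP i) x"
  using x by (auto simp: m_flows_def nonneg_flow_def m_paths_eq)

lemma zz_nonneg: "i \<le> N \<Longrightarrow> 0 \<le> zz i a"
  by (rule arc_flow_nonneg[OF nonneg_PP])

lemma zz_total: "a \<in> A \<Longrightarrow> (\<Sum>i\<le>N. zz i a) \<le> capacity J a"
  using x by (auto simp: m_flows_def flow_split)

lemma zz_cap: "a \<in> A \<Longrightarrow> i \<le> N \<Longrightarrow> zz i a \<le> capacity J a"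
  using zz_total[of a] member_le_sum[of i "{..N}" "\<lambda>i. zz i a"] zz_nonneg by fastforce

lemma zz_zero: "zz i a = 0 \<Longrightarrow> i \<le> N \<Longrightarrow> P \<in> PP i \<Longrightarrow> a \<in> P \<Longrightarrow> x P = 0"
  by (rule arc_flow_zeroD[OF finite_PP nonneg_PP])

lemma conservation:
  assumes "i \<le> N"
  shows "(\<Sum>g<G. zz i (nI g, nO g) * (\<pi> (nO g) - \<pi> (nI g)))
    + (\<Sum>j\<le>N. \<Sum>g<G. zz i (nS j, nI g) * (\<pi> (nI g) - \<pi> (nS j)))
    + (\<Sum>j\<le>N. \<Sum>g<G. zz i (nO g, nT j) * (\<pi> (nT j) - \<pi> (nO g)))
    + (\<Sum>q\<in>set pr. zz i (nO (fst q), nI (snd q)) * (\<pi> (nI (snd q)) - \<pi> (nO (fst q))))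
    + (\<Sum>g<m. zz i (nV (ta g), nI g) * (\<pi> (nI g) - \<pi> (nV (ta g))))
    + (\<Sum>g<m. zz i (nO g, nV (he g)) * (\<pi> (nV (he g)) - \<pi> (nO g)))
    + zz i (nS 0, nV root) * (\<pi> (nV root) - \<pi> (nS 0))
    + (\<Sum>q\<in>set ex. zz i (nV (fst q), nT 0) * (\<pi> (nT 0) - \<pi> (nV (fst q))))
    = of_nat (dem i) * (\<pi> (nT i) - (\<pi> (nS i) :: rat))"
proof -
  have "(\<Sum>P\<in>PP i. x P) = of_nat (dem i)" using x assms by (auto simp: m_flows_def com_simps)
  moreover have "(\<Sum>a\<in>A. zz i a * (\<pi> (snd a) - \<pi> (fst a))) = (\<Sum>P\<in>PP i. x P) * (\<pi> (nT i) - \<pi> (nS i))"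
    using flow_conservation[of D "nS i" "nT i" x \<pi>] assms by (simp add: PP_eq)
  ultimately show ?thesis unfolding asum by simp
qed

lemma zz_no_path: "(\<And>P. P \<in> PP i \<Longrightarrow> a \<notin> P) \<Longrightarrow> zz i a = 0"
  unfolding arc_flow_def by (rule sum.neutral) auto

lemma zz_src_other: "i \<le> N \<Longrightarrow> i \<noteq> j \<Longrightarrow> zz i (nS j, v) = 0"
  using path_src[of i] by (intro zz_no_path) fastforce

lemma zz_snk_other: "i \<le> N \<Longrightarrow> i \<noteq> j \<Longrightarrow> zz i (v, nT j) = 0"
  using path_snk[of i] by (intro zz_no_path) fastforce

text \<open>The demand equals the total capacity around the source, and no flow of another commodity
  uses these arcs; so none of them can be short of its capacity.\<close>

lemma zz_src:
  assumes i: "i \<le> N"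
  shows "g < G \<Longrightarrow> zz i (nS i, nI g) = of_nat (sg i g)" "i = 0 \<Longrightarrow> zz i (nS 0, nV root) = of_nat \<Theta>"
proof -
  have "(\<Sum>j\<le>N. \<Sum>g<G. zz i (nS j, nI g) * - of_bool (j = i)) = - (\<Sum>j\<le>N. (\<Sum>g<G. zz i (nS j, nI g)) * of_bool (j = i))"
    by (simp add: sum_distrib_right sum_negf)
  also have "\<dots> = - (\<Sum>g<G. zz i (nS i, nI g))" by (subst sum_of_bool_eq) (use i in auto)
  finally have "(\<Sum>g<G. zz i (nS i, nI g)) + of_bool (i = 0) * zz i (nS 0, nV root) = of_nat (dem i)"
    using conservation[OF i, of "\<lambda>u. of_bool (u = nS i)"] by (auto simp: of_bool_def split: if_splits)
  also have "\<dots> = (\<Sum>g<G. of_nat (sg i g)) + (if i = 0 then of_nat \<Theta> else 0)"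
    using of_nat_dem[of i] sum_sg[OF i] by (metis of_nat_sum)
  finally have eq: "(\<Sum>g<G. zz i (nS i, nI g)) + of_bool (i = 0) * zz i (nS 0, nV root)
    = (\<Sum>g<G. of_nat (sg i g)) + (if i = 0 then of_nat \<Theta> else 0)" .
  have le: "zz i (nS i, nI g) \<le> of_nat (sg i g)" if "g < G" for g
    using zz_cap[of "(nS i, nI g)" i] that i by (auto simp: A_iff)
  have le2: "zz i (nS 0, nV root) \<le> of_nat \<Theta>" using zz_cap[of "(nS 0, nV root)" i] i by (auto simp: A_iff)
  have le3: "(\<Sum>g<G. zz i (nS i, nI g)) \<le> (\<Sum>g<G. of_nat (sg i g))" by (rule sum_mono) (use le in auto)
  have "(\<Sum>g<G. zz i (nS i, nI g)) = (\<Sum>g<G. of_nat (sg i g))" using eq le2 le3 by (auto split: if_splits)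
  then show "g < G \<Longrightarrow> zz i (nS i, nI g) = of_nat (sg i g)"
    using sum_eq_imp_eq[of "{..<G}" "\<lambda>g. zz i (nS i, nI g)" "\<lambda>g. of_nat (sg i g)" g] le by simp
  show "i = 0 \<Longrightarrow> zz i (nS 0, nV root) = of_nat \<Theta>" using eq le2 le3 by (auto split: if_splits)
qed

lemma zz_snk:
  assumes i: "i \<le> N"
  shows "g < G \<Longrightarrow> zz i (nO g, nT i) = of_nat (tg i g)"
    "i = 0 \<Longrightarrow> q \<in> set ex \<Longrightarrow> zz i (nV (fst q), nT 0) = of_nat (snd q)"
proof -
  have "(\<Sum>j\<le>N. \<Sum>g<G. zz i (nO g, nT j) * of_bool (j = i)) = (\<Sum>j\<le>N. (\<Sum>g<G. zz i (nO g, nT j)) * of_bool (j = i))"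
    by (simp add: sum_distrib_right)
  also have "\<dots> = (\<Sum>g<G. zz i (nO g, nT i))" by (subst sum_of_bool_eq) (use i in auto)
  finally have "(\<Sum>g<G. zz i (nO g, nT i)) + of_bool (i = 0) * (\<Sum>q\<in>set ex. zz i (nV (fst q), nT 0)) = of_nat (dem i)"
    using conservation[OF i, of "\<lambda>u. of_bool (u = nT i)"] by (auto simp: of_bool_def split: if_splits)
  also have "\<dots> = (\<Sum>g<G. of_nat (tg i g)) + (if i = 0 then of_nat \<Theta> else 0)"
    using of_nat_dem[of i] sum_tg[OF i] by (metis of_nat_sum)
  finally have eq: "(\<Sum>g<G. zz i (nO g, nT i)) + of_bool (i = 0) * (\<Sum>q\<in>set ex. zz i (nV (fst q), nT 0))
    = (\<Sum>g<G. of_nat (tg i g)) + (if i = 0 then \<Sum>q\<in>set ex. of_nat (snd q) else 0)" by (simp add: \<Theta>_sum)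
  have le: "zz i (nO g, nT i) \<le> of_nat (tg i g)" if "g < G" for g
    using zz_cap[of "(nO g, nT i)" i] that i by (auto simp: A_iff)
  have le2: "zz i (nV (fst q), nT 0) \<le> of_nat (snd q)" if "q \<in> set ex" for q
    using zz_cap[of "(nV (fst q), nT 0)" i] i that cap(8)[OF that] by (auto simp: A_iff)
  have le3: "(\<Sum>g<G. zz i (nO g, nT i)) \<le> (\<Sum>g<G. of_nat (tg i g))" by (rule sum_mono) (use le in auto)
  have le4: "(\<Sum>q\<in>set ex. zz i (nV (fst q), nT 0)) \<le> (\<Sum>q\<in>set ex. of_nat (snd q))" by (rule sum_mono) (use le2 in auto)
  have "(\<Sum>g<G. zz i (nO g, nT i)) = (\<Sum>g<G. of_nat (tg i g))" using eq le4 le3 by (auto split: if_splits)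
  then show "g < G \<Longrightarrow> zz i (nO g, nT i) = of_nat (tg i g)"
    using sum_eq_imp_eq[of "{..<G}" "\<lambda>g. zz i (nO g, nT i)" "\<lambda>g. of_nat (tg i g)" g] le by simp
  assume 0: "i = 0" "q \<in> set ex"
  have "(\<Sum>q\<in>set ex. zz i (nV (fst q), nT 0)) = (\<Sum>q\<in>set ex. of_nat (snd q))" using eq le4 le3 0 by (auto split: if_splits)
  then show "zz i (nV (fst q), nT 0) = of_nat (snd q)"
    using sum_eq_imp_eq[of "set ex" "\<lambda>q. zz i (nV (fst q), nT 0)" "\<lambda>q. of_nat (snd q)" q] le2 0 by simp
qed

lemma zz_in:
  assumes i: "i \<le> N" and g: "g < G"
  shows "zz i (nI g, nO g) = of_nat (sg i g) + (\<Sum>q\<in>set pr. zz i (nO (fst q), nI (snd q)) * of_bool (snd q = g))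
    + (\<Sum>h<m. zz i (nV (ta h), nI h) * of_bool (h = g))"
proof -
  have "(\<Sum>j\<le>N. \<Sum>h<G. zz i (nS j, nI h) * of_bool (h = g)) = (\<Sum>j\<le>N. zz i (nS j, nI g))"
    by (rule sum.cong[OF refl], subst sum_of_bool_eq) (use g in auto)
  also have "\<dots> = (\<Sum>j\<le>N. zz i (nS i, nI g) * of_bool (j = i))"
    by (rule sum.cong[OF refl]) (use zz_src_other[OF i] in \<open>auto simp: of_bool_def\<close>)
  also have "\<dots> = of_nat (sg i g)" by (subst sum_of_bool_eq) (use i g zz_src in auto)
  finally have 1: "(\<Sum>j\<le>N. \<Sum>h<G. zz i (nS j, nI h) * of_bool (h = g)) = of_nat (sg i g)" .
  have 2: "(\<Sum>h<G. zz i (nI h, nO h) * - of_bool (h = g)) = - zz i (nI g, nO g)"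
    using sum_of_bool_eq(1)[of "{..<G}" "\<lambda>h. zz i (nI h, nO h)" g] g by (simp add: sum_negf)
  show ?thesis
    using conservation[OF i, of "\<lambda>u. of_bool (u = nI g)"] 1 2 by simp
qed

lemma zz_out:
  assumes i: "i \<le> N" and g: "g < G"
  shows "zz i (nI g, nO g) = of_nat (tg i g) + (\<Sum>q\<in>set pr. zz i (nO (fst q), nI (snd q)) * of_bool (fst q = g))
    + (\<Sum>h<m. zz i (nO h, nV (he h)) * of_bool (h = g))"
proof -
  have "(\<Sum>j\<le>N. \<Sum>h<G. zz i (nO h, nT j) * - of_bool (h = g)) = (\<Sum>j\<le>N. - zz i (nO g, nT j))"
    by (rule sum.cong[OF refl]) (use sum_of_bool_eq(1)[of "{..<G}" _ g] g in \<open>simp add: sum_negf\<close>)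
  also have "\<dots> = - (\<Sum>j\<le>N. zz i (nO g, nT i) * of_bool (j = i))"
    unfolding sum_negf by (rule arg_cong[where f = uminus], rule sum.cong[OF refl]) (use zz_snk_other[OF i] in \<open>auto simp: of_bool_def\<close>)
  also have "\<dots> = - of_nat (tg i g)" by (subst sum_of_bool_eq) (use i g zz_snk in auto)
  finally have 1: "(\<Sum>j\<le>N. \<Sum>h<G. zz i (nO h, nT j) * - of_bool (h = g)) = - of_nat (tg i g)" .
  have 2: "(\<Sum>h<G. zz i (nI h, nO h) * of_bool (h = g)) = zz i (nI g, nO g)"
    using sum_of_bool_eq(1)[of "{..<G}" "\<lambda>h. zz i (nI h, nO h)" g] g by simp
  have 3: "(\<Sum>q\<in>set pr. zz i (nO (fst q), nI (snd q)) * - of_bool (fst q = g)) =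
     - (\<Sum>q\<in>set pr. zz i (nO (fst q), nI (snd q)) * of_bool (fst q = g))"
    "(\<Sum>h<m. zz i (nO h, nV (he h)) * - of_bool (h = g)) = - (\<Sum>h<m. zz i (nO h, nV (he h)) * of_bool (h = g))"
    by (simp_all add: sum_negf)
  show ?thesis
    using conservation[OF i, of "\<lambda>u. of_bool (u = nO g)"] 1 2 3 by simp
qed

lemma zz_big_ge: "i \<le> N \<Longrightarrow> g < G \<Longrightarrow> of_nat (sg i g) \<le> zz i (nI g, nO g)"
  unfolding zz_in using zz_nonneg[of i] by (auto intro!: add_nonneg_nonneg sum_nonneg)

text \<open>Such an arc is big, and the saturated source arc of commodity \<open>i\<close> alone
  brings at least 2 units onto it.\<close>

lemma property4:
  assumes "i \<in> commodities J - {0}" "a \<in> A" "max_capacity J - 2 \<le> capacity J a"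
  shows "2 \<le> zz i a"
proof -
  obtain g where "g < G" "a = (nI g, nO g)"
    using cap_cases[OF assms(2)] assms(3) by (auto simp: max_cap)
  moreover have "i \<le> N" "2 \<le> sg i g" using assms(1) sg_ge[of i g] by (auto simp: com_simps)
  ultimately show ?thesis using zz_big_ge[of i g] by (metis of_nat_mono of_nat_numeral order.trans)
qed

text \<open>Conservation against \<open>pot\<close>: the fall achieved by commodity
  \<open>Suc i\<close> on transition arcs equals twice the index difference of its pair plus the
  nonnegative rise \<open>net\<close> on network arcs. Summed over all small commodities, the
  required fall is at least the sum of all differences, while the transition arcs, having capacity
  1, offer at most this sum. So every inequality involved is an equality: no rise, all transition
  arcs full, nothing left on them for the main commodity.\<close>

lemma forced:
  shows "\<And>i g. 1 \<le> i \<Longrightarrow> i \<le> N \<Longrightarrow> g < m \<Longrightarrow> zz i (nV (ta g), nI g) = 0"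
    "\<And>i g. 1 \<le> i \<Longrightarrow> i \<le> N \<Longrightarrow> g < m \<Longrightarrow> zz i (nO g, nV (he g)) = 0"
    "\<And>q. q \<in> set pr \<Longrightarrow> zz 0 (nO (fst q), nI (snd q)) = 0"
    "\<And>q. q \<in> set pr \<Longrightarrow> (\<Sum>i<N. zz (Suc i) (nO (fst q), nI (snd q))) = 1"
proof -
  let ?t = "\<lambda>i q. zz i (nO (fst q), nI (snd q))"
  let ?\<delta> = "\<lambda>q. 2 * (of_nat (fst q) - of_nat (snd q)) :: rat"
  define net where "net i = (\<Sum>g<m. zz i (nV (ta g), nI g) * (of_nat (2 * g + 1) - of_nat (pv (ta g))))
    + (\<Sum>g<m. zz i (nO g, nV (he g)) * (of_nat (pv (he g)) - of_nat (2 * g + 1)))" for i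
  have d_pos: "(0 :: rat) < of_nat (2 * g + 1) - of_nat (pv (ta g))" "(0 :: rat) < of_nat (pv (he g)) - of_nat (2 * g + 1)"
    if "g < m" for g
  proof -
    have "pv (ta g) < 2 * g + 1" "2 * g + 1 < pv (he g)" using pv_he[OF that] pv_ta[OF that] by auto
    then have "(of_nat (pv (ta g)) :: rat) < of_nat (2 * g + 1)" "(of_nat (2 * g + 1) :: rat) < of_nat (pv (he g))"
      by (simp_all only: of_nat_less_iff)
    then show "(0 :: rat) < of_nat (2 * g + 1) - of_nat (pv (ta g))" "(0 :: rat) < of_nat (pv (he g)) - of_nat (2 * g + 1)"
      by simp_all
  qed
  have net_nn: "0 \<le> net i" if "i \<le> N" for i
    unfolding net_def using d_pos zz_nonneg[OF that] by (intro add_nonneg_nonneg sum_nonneg mult_nonneg_nonneg) (auto simp: less_imp_le)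
  \<comment> \<open>Source and sink capacities agree except that one extra unit enters at
    \<open>fst (pr ! i)\<close> and one extra unit leaves at \<open>snd (pr ! i)\<close>; the
    private arcs therefore contribute just the difference of these two.\<close>
  have pot_eq: "net (Suc i) + ?\<delta> (pr ! i) = (\<Sum>q\<in>set pr. ?t (Suc i) q * ?\<delta> q)" if i: "i < N" for i
  proof -
    let ?i = "Suc i"
    have iN: "?i \<le> N" using i by simp
    have s: "(\<Sum>j\<le>N. \<Sum>g<G. zz ?i (nS j, nI g) * of_nat (2 * g + 1)) = (\<Sum>g<G. of_nat (sg ?i g) * of_nat (2 * g + 1))"
    proof -
      have "(\<Sum>j\<le>N. \<Sum>g<G. zz ?i (nS j, nI g) * of_nat (2 * g + 1))
         = (\<Sum>j\<le>N. (\<Sum>g<G. zz ?i (nS j, nI g) * of_nat (2 * g + 1)) * of_bool (j = ?i))"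
        by (rule sum.cong[OF refl]) (use zz_src_other[OF iN] in \<open>auto simp: of_bool_def\<close>)
      also have "\<dots> = (\<Sum>g<G. zz ?i (nS ?i, nI g) * of_nat (2 * g + 1))" by (subst sum_of_bool_eq) (use i in auto)
      finally show ?thesis using zz_src(1)[OF iN] by simp
    qed
    have t: "(\<Sum>j\<le>N. \<Sum>g<G. zz ?i (nO g, nT j) * - of_nat (2 * g + 1)) = - (\<Sum>g<G. of_nat (tg ?i g) * of_nat (2 * g + 1))"
    proof -
      have "(\<Sum>j\<le>N. \<Sum>g<G. zz ?i (nO g, nT j) * - of_nat (2 * g + 1))
         = (\<Sum>j\<le>N. (\<Sum>g<G. zz ?i (nO g, nT j) * - of_nat (2 * g + 1)) * of_bool (j = ?i))"
        by (rule sum.cong[OF refl]) (use zz_snk_other[OF iN] in \<open>auto simp: of_bool_def\<close>)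
      also have "\<dots> = (\<Sum>g<G. zz ?i (nO g, nT ?i) * - of_nat (2 * g + 1))" by (subst sum_of_bool_eq) (use i in auto)
      finally show ?thesis unfolding mult_minus_right sum_negf using zz_snk(1)[OF iN] by simp
    qed
    have r: "zz ?i (nS 0, nV root) = 0" "zz ?i (nV v, nT 0) = 0" for v
      using zz_src_other[OF iN, of 0] zz_snk_other[OF iN, of 0] by auto
    have e: "(\<Sum>q\<in>set pr. ?t ?i q * (of_nat (2 * snd q + 1) - of_nat (2 * fst q + 1))) = - (\<Sum>q\<in>set pr. ?t ?i q * ?\<delta> q)"
      unfolding sum_negf[symmetric] by (rule sum.cong) (auto simp: algebra_simps)
    have "(\<Sum>g<G. of_nat (sg ?i g) * of_nat (2 * g + 1)) - (\<Sum>g<G. of_nat (tg ?i g) * of_nat (2 * g + 1))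
       = (\<Sum>g<G. of_nat (2 * g + 1) * of_bool (g = fst (pr ! i)) - of_nat (2 * g + 1) * of_bool (g = snd (pr ! i)) :: rat)"
      unfolding sum_subtractf[symmetric] by (rule sum.cong) (auto simp: sg_def tg_def of_bool_def)
    also have "\<dots> = ?\<delta> (pr ! i)"
      using pr_nth[OF i] by (simp add: sum_subtractf sum_of_bool_eq)
    finally have st: "(\<Sum>g<G. of_nat (sg ?i g) * of_nat (2 * g + 1)) - (\<Sum>g<G. of_nat (tg ?i g) * of_nat (2 * g + 1))
       = ?\<delta> (pr ! i)" .
    have "(\<Sum>j\<le>N. \<Sum>g<G. zz ?i (nS j, nI g) * of_nat (2 * g + 1)) + (\<Sum>j\<le>N. \<Sum>g<G. zz ?i (nO g, nT j) * - of_nat (2 * g + 1))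
      + (\<Sum>q\<in>set pr. ?t ?i q * (of_nat (2 * snd q + 1) - of_nat (2 * fst q + 1))) + net ?i = 0"
      using conservation[OF iN, of pot] unfolding pot_simps net_def by (simp add: r)
    then show ?thesis unfolding s t e using st by simp
  qed
  have setpr: "(\<Sum>q\<in>set pr. f q) = (\<Sum>i<N. f (pr ! i))" for f :: "nat \<times> nat \<Rightarrow> rat"
    using pr_dist sum_list_distinct_conv_sum_set[OF pr_dist, of f]
    by (simp add: sum_list_sum_nth N_def atLeast0LessThan)
  have d: "0 < ?\<delta> q" if "q \<in> set pr" for q using prE[OF that] by simp
  have tot: "(\<Sum>i<N. net (Suc i)) + (\<Sum>q\<in>set pr. ?\<delta> q) = (\<Sum>q\<in>set pr. (\<Sum>i<N. ?t (Suc i) q) * ?\<delta> q)"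
  proof -
    have "(\<Sum>i<N. net (Suc i)) + (\<Sum>q\<in>set pr. ?\<delta> q) = (\<Sum>i<N. net (Suc i) + ?\<delta> (pr ! i))"
      by (simp only: setpr[of ?\<delta>] sum.distrib)
    also have "\<dots> = (\<Sum>i<N. \<Sum>q\<in>set pr. ?t (Suc i) q * ?\<delta> q)" by (rule sum.cong) (use pot_eq in auto)
    also have "\<dots> = (\<Sum>q\<in>set pr. (\<Sum>i<N. ?t (Suc i) q) * ?\<delta> q)" by (subst sum.swap) (simp add: sum_distrib_right)
    finally show ?thesis .
  qed
  have le1: "?t 0 q + (\<Sum>i<N. ?t (Suc i) q) \<le> 1" if "q \<in> set pr" for q
    using zz_total[of "(nO (fst q), nI (snd q))"] that cap(4)[OF that] unfolding sum.atMost_shift by (auto simp: A_iff)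
  have t0: "0 \<le> ?t 0 q" for q by (rule zz_nonneg) simp
  have tle: "(\<Sum>i<N. ?t (Suc i) q) * ?\<delta> q \<le> ?\<delta> q" if "q \<in> set pr" for q
    using le1[OF that] t0[of q] d[OF that] mult_right_mono[of "\<Sum>i<N. ?t (Suc i) q" 1 "?\<delta> q"] by simp
  have "(\<Sum>q\<in>set pr. (\<Sum>i<N. ?t (Suc i) q) * ?\<delta> q) \<le> (\<Sum>q\<in>set pr. ?\<delta> q)" by (rule sum_mono[OF tle])
  moreover have "0 \<le> (\<Sum>i<N. net (Suc i))" by (rule sum_nonneg) (auto intro: net_nn)
  ultimately have z: "(\<Sum>i<N. net (Suc i)) = 0" "(\<Sum>q\<in>set pr. (\<Sum>i<N. ?t (Suc i) q) * ?\<delta> q) = (\<Sum>q\<in>set pr. ?\<delta> q)"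
    using tot by linarith+
  have one: "(\<Sum>i<N. ?t (Suc i) q) = 1" if "q \<in> set pr" for q
    using sum_eq_imp_eq[OF _ tle z(2) that] d[OF that] by simp
  then show "\<And>q. q \<in> set pr \<Longrightarrow> (\<Sum>i<N. ?t (Suc i) q) = 1" .
  show "?t 0 q = 0" if "q \<in> set pr" for q
    using le1[OF that] one[OF that] t0[of q] by simp
  have n0: "net (Suc i) = 0" if "i < N" for i
    using z(1) sum_nonneg_eq_0_iff[of "{..<N}" "\<lambda>i. net (Suc i)"] net_nn that by auto
  have "zz i (nV (ta g), nI g) = 0 \<and> zz i (nO g, nV (he g)) = 0" if "1 \<le> i" "i \<le> N" "g < m" for i g
  proof -
    obtain j where j: "i = Suc j" "j < N" using \<open>1 \<le> i\<close> \<open>i \<le> N\<close> by (cases i) auto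
    let ?a = "\<lambda>g. zz i (nV (ta g), nI g) * (of_nat (2 * g + 1) - of_nat (pv (ta g)))"
    let ?b = "\<lambda>g. zz i (nO g, nV (he g)) * (of_nat (pv (he g)) - of_nat (2 * g + 1))"
    have nn: "0 \<le> ?a g" "0 \<le> ?b g" if "g < m" for g
      using d_pos[OF that] zz_nonneg[OF \<open>i \<le> N\<close>] by (auto intro!: mult_nonneg_nonneg less_imp_le)
    have "sum ?a {..<m} + sum ?b {..<m} = 0" using n0[OF j(2)] unfolding net_def j(1) .
    moreover have "0 \<le> sum ?a {..<m}" "0 \<le> sum ?b {..<m}" by (rule sum_nonneg; use nn in simp)+
    ultimately have "sum ?a {..<m} = 0" "sum ?b {..<m} = 0" by linarith+
    moreover have "sum ?a {..<m} = 0 \<longleftrightarrow> (\<forall>g\<in>{..<m}. ?a g = 0)" "sum ?b {..<m} = 0 \<longleftrightarrow> (\<forall>g\<in>{..<m}. ?b g = 0)"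
      by (rule sum_nonneg_eq_0_iff; use nn in simp)+
    ultimately have "?a g = 0" "?b g = 0" using \<open>g < m\<close> by blast+
    then show ?thesis using d_pos[OF that(3)] by simp
  qed
  then show "\<And>i g. 1 \<le> i \<Longrightarrow> i \<le> N \<Longrightarrow> g < m \<Longrightarrow> zz i (nV (ta g), nI g) = 0"
    "\<And>i g. 1 \<le> i \<Longrightarrow> i \<le> N \<Longrightarrow> g < m \<Longrightarrow> zz i (nO g, nV (he g)) = 0" by auto
qed

text \<open>At the first gadget of its pair the big arc carries at least 3 units and the sink arc
  takes 2, so at least one unit leaves by transition arcs; likewise one arrives at the second
  gadget. Each of the \<open>N\<close> commodities thus uses transition arcs to an amount of at
  least 1, and together they use \<open>N\<close>. So each uses exactly 1, all of it starting at the
  first and ending at the second gadget of its own pair.\<close>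

lemma forced_transition:
  assumes i: "i < N" and q: "q \<in> set pr" "q \<noteq> pr ! i"
  shows "zz (Suc i) (nO (fst q), nI (snd q)) = 0"
proof -
  let ?t = "\<lambda>i q. zz (Suc i) (nO (fst q), nI (snd q))"
  have nn: "0 \<le> ?t i q" if "i < N" for i q using that by (intro zz_nonneg) simp
  have out: "1 \<le> (\<Sum>q\<in>set pr. ?t i q * of_bool (fst q = fst (pr ! i)))" if i: "i < N" for i
  proof -
    have "(\<Sum>h<m. zz (Suc i) (nO h, nV (he h)) * of_bool (h = fst (pr ! i))) = 0"
      by (rule sum.neutral) (use forced(2)[of "Suc i"] i in auto)
    moreover have "of_nat (sg (Suc i) (fst (pr ! i))) \<le> zz (Suc i) (nI (fst (pr ! i)), nO (fst (pr ! i)))"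
      by (rule zz_big_ge) (use pr_nth[OF i] i in auto)
    moreover have "sg (Suc i) (fst (pr ! i)) = 3" "tg (Suc i) (fst (pr ! i)) = 2"
      using pr_nth[OF i] by (auto simp: sg_def tg_def)
    ultimately show ?thesis using zz_out[of "Suc i" "fst (pr ! i)"] pr_nth[OF i] i by simp
  qed
  have inn: "1 \<le> (\<Sum>q\<in>set pr. ?t i q * of_bool (snd q = snd (pr ! i)))" if i: "i < N" for i
  proof -
    have "(\<Sum>h<m. zz (Suc i) (nV (ta h), nI h) * of_bool (h = snd (pr ! i))) = 0"
      by (rule sum.neutral) (use forced(1)[of "Suc i"] i in auto)
    moreover have "of_nat (tg (Suc i) (snd (pr ! i))) \<le> zz (Suc i) (nI (snd (pr ! i)), nO (snd (pr ! i)))"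
      unfolding zz_out[of "Suc i" "snd (pr ! i)", OF Suc_leI[OF i] pr_nth[OF i, THEN conjunct2, THEN conjunct2, THEN conjunct2, THEN conjunct2]]
      using i by (auto intro!: add_nonneg_nonneg sum_nonneg mult_nonneg_nonneg zz_nonneg)
    moreover have "tg (Suc i) (snd (pr ! i)) = 3" "sg (Suc i) (snd (pr ! i)) = 2"
      using pr_nth[OF i] by (auto simp: sg_def tg_def)
    ultimately show ?thesis using zz_in[of "Suc i" "snd (pr ! i)"] pr_nth[OF i] i by simp
  qed
  have le_out: "(\<Sum>q\<in>set pr. ?t i q * of_bool (fst q = fst (pr ! i))) \<le> (\<Sum>q\<in>set pr. ?t i q)" if "i < N" for i
    by (rule sum_mono) (use nn[OF that] in \<open>auto simp: of_bool_def\<close>)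
  have ge: "1 \<le> (\<Sum>q\<in>set pr. ?t i q)" if "i < N" for i
    using out[OF that] le_out[OF that] by linarith
  have "(\<Sum>i<N. \<Sum>q\<in>set pr. ?t i q) = (\<Sum>q\<in>set pr. \<Sum>i<N. ?t i q)" by (rule sum.swap)
  also have "\<dots> = (\<Sum>q\<in>set pr. 1)" by (rule sum.cong[OF refl forced(4)])
  also have "\<dots> = (\<Sum>i<N. 1)" using distinct_card[OF pr_dist] by (simp add: N_def)
  finally have "(\<Sum>q\<in>set pr. ?t i q) = 1"
    using sum_eq_imp_eq[of "{..<N}" "\<lambda>_. 1" "\<lambda>i. \<Sum>q\<in>set pr. ?t i q" i] ge i by simp
  moreover have "(\<Sum>q\<in>set pr. ?t i q * of_bool (fst q = fst (pr ! i) )) + (\<Sum>q\<in>set pr. ?t i q * of_bool (fst q \<noteq> fst (pr ! i)))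
     = (\<Sum>q\<in>set pr. ?t i q)"
    unfolding sum.distrib[symmetric] by (rule sum.cong) auto
  moreover have "(\<Sum>q\<in>set pr. ?t i q * of_bool (snd q = snd (pr ! i) )) + (\<Sum>q\<in>set pr. ?t i q * of_bool (snd q \<noteq> snd (pr ! i)))
     = (\<Sum>q\<in>set pr. ?t i q)"
    unfolding sum.distrib[symmetric] by (rule sum.cong) auto
  ultimately have "(\<Sum>q\<in>set pr. ?t i q * of_bool (fst q \<noteq> fst (pr ! i))) \<le> 0"
    "(\<Sum>q\<in>set pr. ?t i q * of_bool (snd q \<noteq> snd (pr ! i))) \<le> 0"
    using out[OF i] inn[OF i] by linarith+
  moreover have "?t i q * of_bool (fst q \<noteq> fst (pr ! i)) \<le> (\<Sum>q\<in>set pr. ?t i q * of_bool (fst q \<noteq> fst (pr ! i)))"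
    "?t i q * of_bool (snd q \<noteq> snd (pr ! i)) \<le> (\<Sum>q\<in>set pr. ?t i q * of_bool (snd q \<noteq> snd (pr ! i)))"
    by (rule member_le_sum; use q nn[OF i] in simp)+
  moreover have "fst q \<noteq> fst (pr ! i) \<or> snd q \<noteq> snd (pr ! i)" using q(2) by (auto simp: prod_eq_iff)
  ultimately show ?thesis using nn[OF i, of q] by fastforce
qed

end

end

context core
begin

subsection \<open>Decoding the paths of the main commodity\<close>

lemma out_arcs:
  assumes "a \<in> A"
  shows "fst a = nI g \<Longrightarrow> g < G \<and> a = (nI g, nO g)"
    "fst a = nO g \<Longrightarrow> g < G \<and> ((\<exists>i\<le>N. a = (nO g, nT i)) \<or> (\<exists>z\<in>set pr. fst z = g \<and> a = (nO (fst z), nI (snd z)))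
        \<or> (g < m \<and> a = (nO g, nV (he g))))"
    "fst a = nV v \<Longrightarrow> (\<exists>h<m. ta h = v \<and> a = (nV v, nI h)) \<or> (\<exists>z\<in>set ex. fst z = v \<and> a = (nV v, nT 0))"
    "fst a \<noteq> nT i"
    "fst a = nS i \<Longrightarrow> (\<exists>g<G. a = (nS i, nI g)) \<or> i = 0 \<and> a = (nS 0, nV root)"
proof -
  have mG: "h < G" if "h < m" for h using that by (simp add: G_def)
  show "fst a = nI g \<Longrightarrow> g < G \<and> a = (nI g, nO g)" using assms unfolding A_iff by auto
  show "fst a = nO g \<Longrightarrow> g < G \<and> ((\<exists>i\<le>N. a = (nO g, nT i)) \<or> (\<exists>z\<in>set pr. fst z = g \<and> a = (nO (fst z), nI (snd z)))
        \<or> (g < m \<and> a = (nO g, nV (he g))))"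
    using assms unfolding A_iff by (elim disjE exE bexE conjE) (auto dest: prE mG)
  show "fst a = nV v \<Longrightarrow> (\<exists>h<m. ta h = v \<and> a = (nV v, nI h)) \<or> (\<exists>z\<in>set ex. fst z = v \<and> a = (nV v, nT 0))"
    using assms unfolding A_iff by (elim disjE exE bexE conjE) auto
  show "fst a \<noteq> nT i" using assms unfolding A_iff by auto
  show "fst a = nS i \<Longrightarrow> (\<exists>g<G. a = (nS i, nI g)) \<or> i = 0 \<and> a = (nS 0, nV root)"
    using assms unfolding A_iff by auto
qed

definition er :: "nat \<Rightarrow> nat \<Rightarrow> bool" where
  "er g v \<longleftrightarrow> g < m \<and> he g = v \<and> v \<in> fst ` set ex"
definition sr :: "nat \<Rightarrow> bool" where
  "sr g \<longleftrightarrow> g < m \<and> ta g = root"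

definition trans :: "(nat \<times> nat) set" where
  "trans = (\<lambda>z. (nO (fst z), nI (snd z))) ` set pr"

lemma cas_J: "pre_digraph.cas D u [] v \<longleftrightarrow> u = v"
  "pre_digraph.cas D u (a # p) v \<longleftrightarrow> fst a = u \<and> pre_digraph.cas D (snd a) p v"
  unfolding pre_digraph.cas.simps D_simps by blast+

interpretation unc: uncrossing nx sr er G
  by unfold_locales (auto simp: nx_def topo)

text \<open>Without transition arcs the path has no choice but big arc, network arc, network node,
  network arc, and so on, until it takes an arc into the sink. The equivalences on single arcs are
  all that the later counting asks of a segment.\<close>

lemma decode_tail:
  assumes "pre_digraph.cas D (nI g) p (nT 0)" "set p \<subseteq> A" "set p \<inter> trans = {}"
  shows "\<exists>gs c. gs \<noteq> [] \<and> hd gs = g \<and> unc.seg_ok (False, gs, c)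
    \<and> (\<forall>h. (nI h, nO h) \<in> set p \<longleftrightarrow> h \<in> set gs)
    \<and> (\<forall>h. (nO h, nT 0) \<in> set p \<longleftrightarrow> c = None \<and> h = last gs)
    \<and> (\<forall>v. (nV v, nT 0) \<in> set p \<longleftrightarrow> c = Some v)
    \<and> (\<forall>i u. (nS i, u) \<notin> set p)"
  using assms
proof (induction p arbitrary: g rule: length_induct)
  case (1 p)
  obtain p1 where p1: "p = (nI g, nO g) # p1" and g: "g < G" and c1: "pre_digraph.cas D (nO g) p1 (nT 0)"
  proof (cases p)
    case (Cons a q)
    then show thesis using 1 out_arcs(1)[of a g] by (auto simp: cas_J intro: that)
  qed (use 1 in \<open>simp add: cas_J\<close>)
  obtain a p2 where p2: "p1 = a # p2" "fst a = nO g" "pre_digraph.cas D (snd a) p2 (nT 0)" "a \<in> A" "a \<notin> trans"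
  proof (cases p1)
    case (Cons a q)
    then show thesis using 1 c1 p1 by (auto simp: cas_J intro: that)
  qed (use c1 in \<open>simp add: cas_J\<close>)
  from out_arcs(2)[OF p2(4,2)] p2(5)
  have "(\<exists>i. a = (nO g, nT i)) \<or> (g < m \<and> a = (nO g, nV (he g)))" by (auto simp: trans_def image_iff)
  then show ?case
  proof
    assume "\<exists>i. a = (nO g, nT i)"
    then obtain i where a: "a = (nO g, nT i)" by blast
    \<comment> \<open>No arc leaves a sink, so the path stops here.\<close>
    have "p2 = []"
    proof (cases p2)
      case (Cons b q)
      then show ?thesis using p2 1(3) p1 out_arcs(4)[of b i] by (auto simp: cas_J a)
    qed simp
    then have "a = (nO g, nT 0)" using p2(3) a by (simp add: cas_J)
    then show ?thesis using g \<open>p2 = []\<close> p1 p2(1)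
      by (intro exI[of _ "[g]"] exI[of _ None]) (auto simp: unc.seg_ok_def)
  next
    assume a: "g < m \<and> a = (nO g, nV (he g))"
    obtain b p3 where p3: "p2 = b # p3" "fst b = nV (he g)" "pre_digraph.cas D (snd b) p3 (nT 0)" "b \<in> A"
    proof (cases p2)
      case (Cons b q)
      then show thesis using 1 p2 p1 a by (auto simp: cas_J intro: that)
    qed (use p2 a in \<open>simp add: cas_J\<close>)
    from out_arcs(3)[OF p3(4,2)] show ?thesis
    proof
      assume "\<exists>h<m. ta h = he g \<and> b = (nV (he g), nI h)"
      then obtain h where h: "h < m" "ta h = he g" "b = (nV (he g), nI h)" by blast
      have "\<exists>gs c. gs \<noteq> [] \<and> hd gs = h \<and> unc.seg_ok (False, gs, c)
        \<and> (\<forall>h. (nI h, nO h) \<in> set p3 \<longleftrightarrow> h \<in> set gs)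
        \<and> (\<forall>h. (nO h, nT 0) \<in> set p3 \<longleftrightarrow> c = None \<and> h = last gs)
        \<and> (\<forall>v. (nV v, nT 0) \<in> set p3 \<longleftrightarrow> c = Some v) \<and> (\<forall>i u. (nS i, u) \<notin> set p3)"
      proof (rule 1(1)[rule_format, of p3 h])
        show "length p3 < length p" using p1 p2(1) p3(1) by simp
        show "pre_digraph.cas D (nI h) p3 (nT 0)" using p3(3) h by simp
      qed (use 1 p1 p2(1) p3(1) in auto)
      then obtain gs c where gs: "gs \<noteq> []" "hd gs = h" "unc.seg_ok (False, gs, c)"
        "\<And>h. (nI h, nO h) \<in> set p3 \<longleftrightarrow> h \<in> set gs"
        "\<And>h. (nO h, nT 0) \<in> set p3 \<longleftrightarrow> c = None \<and> h = last gs"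
        "\<And>v. (nV v, nT 0) \<in> set p3 \<longleftrightarrow> c = Some v" "\<And>i u. (nS i, u) \<notin> set p3" by blast
      have sp: "set p = insert (nI g, nO g) (insert (nO g, nV (he g)) (insert (nV (he g), nI h) (set p3)))"
        using p1 p2(1) p3(1) a h by auto
      have "unc.seg_ok (False, g # gs, c)"
        using gs(1-3) a h g by (auto simp: unc.seg_ok_def successively_Cons nx_def)
      then show ?thesis using gs
        by (intro exI[of _ "g # gs"] exI[of _ c]) (auto simp: sp)
    next
      assume "\<exists>z\<in>set ex. fst z = he g \<and> b = (nV (he g), nT 0)"
      then obtain z where z: "z \<in> set ex" "fst z = he g" "b = (nV (he g), nT 0)" by blast
      have "p3 = []"
      proof (cases p3)
        case (Cons b' q)
        then show ?thesis using p3 p2(1) 1(3) p1 out_arcs(4)[of b' 0] z by (auto simp: cas_J)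
      qed simp
      then have sp: "set p = {(nI g, nO g), (nO g, nV (he g)), (nV (he g), nT 0)}"
        using p1 p2(1) p3(1) a z by auto
      have "unc.seg_ok (False, [g], Some (he g))" using a g z(1) z(2)[symmetric] by (auto simp: unc.seg_ok_def er_def)
      then show ?thesis by (intro exI[of _ "[g]"] exI[of _ "Some (he g)"]) (auto simp: sp)
    qed
  qed
qed

definition decodes :: "(nat \<times> nat) set \<Rightarrow> seg \<Rightarrow> bool" where
  "decodes P s \<longleftrightarrow> unc.seg_ok s
     \<and> (\<forall>h. (nI h, nO h) \<in> P \<longleftrightarrow> h \<in> set (fst (snd s)))
     \<and> (\<forall>h. (nS 0, nI h) \<in> P \<longleftrightarrow> \<not> fst s \<and> h = hd (fst (snd s)))
     \<and> (\<forall>h. (nO h, nT 0) \<in> P \<longleftrightarrow> snd (snd s) = None \<and> h = last (fst (snd s)))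
     \<and> (\<forall>v. (nV v, nT 0) \<in> P \<longleftrightarrow> snd (snd s) = Some v)"

lemma decode:
  assumes "P \<in> PP 0" "P \<inter> trans = {}"
  shows "\<exists>s. decodes P s"
proof -
  obtain p where p: "P = set p" "pre_digraph.cas D (nS 0) p (nT 0)" "set p \<subseteq> A"
  proof -
    have "P \<in> st_paths D (nS 0) (nT 0)" using assms(1) by (simp add: PP_eq)
    then show thesis by (rule st_pathsE) (use that in auto)
  qed
  obtain a q where q: "p = a # q" "fst a = nS 0" "pre_digraph.cas D (snd a) q (nT 0)" "a \<in> A"
    using p by (cases p) (auto simp: cas_J)
  from out_arcs(5)[OF q(4,2)] show ?thesis
  proof
    assume "\<exists>g<G. a = (nS 0, nI g)"
    then obtain g where g: "a = (nS 0, nI g)" by blast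
    have "pre_digraph.cas D (nI g) q (nT 0)" "set q \<subseteq> A" "set q \<inter> trans = {}"
      using p q g assms by auto
    from decode_tail[OF this] obtain gs c where gs: "gs \<noteq> []" "hd gs = g" "unc.seg_ok (False, gs, c)"
        "\<And>h. (nI h, nO h) \<in> set q \<longleftrightarrow> h \<in> set gs"
        "\<And>h. (nO h, nT 0) \<in> set q \<longleftrightarrow> c = None \<and> h = last gs"
        "\<And>v. (nV v, nT 0) \<in> set q \<longleftrightarrow> c = Some v" "\<And>i u. (nS i, u) \<notin> set q" by blast
    have "P = insert (nS 0, nI g) (set q)" using p(1) q(1) g by simp
    then show ?thesis using gs by (intro exI[of _ "(False, gs, c)"]) (auto simp: decodes_def)
  next
    assume "0 = 0 \<and> a = (nS 0, nV root)"
    then have a: "a = (nS 0, nV root)" by simp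
    obtain b r where r: "q = b # r" "fst b = nV root" "pre_digraph.cas D (snd b) r (nT 0)" "b \<in> A"
      using q p a by (cases q) (auto simp: cas_J)
    \<comment> \<open>The root is not an exit, so the next arc enters a gadget.\<close>
    from out_arcs(3)[OF r(4,2)] ex(2) obtain h where h: "h < m" "ta h = root" "b = (nV root, nI h)"
      by (auto simp: image_iff)
    have "pre_digraph.cas D (nI h) r (nT 0)" "set r \<subseteq> A" "set r \<inter> trans = {}"
      using p q r h assms by auto
    from decode_tail[OF this] obtain gs c where gs: "gs \<noteq> []" "hd gs = h" "unc.seg_ok (False, gs, c)"
        "\<And>h. (nI h, nO h) \<in> set r \<longleftrightarrow> h \<in> set gs"
        "\<And>h. (nO h, nT 0) \<in> set r \<longleftrightarrow> c = None \<and> h = last gs"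
        "\<And>v. (nV v, nT 0) \<in> set r \<longleftrightarrow> c = Some v" "\<And>i u. (nS i, u) \<notin> set r" by blast
    have "P = insert (nS 0, nV root) (insert (nV root, nI h) (set r))" using p(1) q(1) r(1) a h by simp
    moreover have "unc.seg_ok (True, gs, c)" using gs(2,3) h by (auto simp: unc.seg_ok_def sr_def)
    ultimately show ?thesis using gs by (intro exI[of _ "(True, gs, c)"]) (auto simp: decodes_def)
  qed
qed

text \<open>After a big arc such a path either ends or takes its own transition arc, which is
  possible only at the first gadget of the pair and leads to the second; from there only the sink
  remains.\<close>

lemma pair_path:
  assumes i: "i < N" and P: "P \<in> PP (Suc i)"
    and 1: "\<And>a. a \<in> P \<Longrightarrow> a \<in> trans \<Longrightarrow> a = (nO (fst (pr ! i)), nI (snd (pr ! i)))"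
    and 2: "\<And>g v. (nO g, nV v) \<notin> P"
    and g: "(nI g, nO g) \<in> P" "(nI h, nO h) \<in> P" "g \<noteq> h"
  shows "{g, h} = {fst (pr ! i), snd (pr ! i)}"
proof -
  let ?f = "fst (pr ! i)" and ?e = "snd (pr ! i)"
  obtain p where p: "P = set p" "pre_digraph.cas D (nS (Suc i)) p (nT (Suc i))" "set p \<subseteq> A"
  proof -
    have "P \<in> st_paths D (nS (Suc i)) (nT (Suc i))" using P i by (simp add: PP_eq)
    then show thesis by (rule st_pathsE) (use that in auto)
  qed
  have step: "\<exists>p1. p = (nI g, nO g) # p1 \<and> (set p1 \<subseteq> {(nO g, nT (Suc i))} \<or> g = ?f \<and>
     (\<exists>p2. p1 = (nO ?f, nI ?e) # p2 \<and> pre_digraph.cas D (nI ?e) p2 (nT (Suc i))))"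
    if p: "pre_digraph.cas D (nI g) p (nT (Suc i))" "set p \<subseteq> P" for p g
  proof -
    have pA: "set p \<subseteq> A" using that PP_sub[OF _ P] i by auto
    obtain p1 where p1: "p = (nI g, nO g) # p1" and g: "g < G" and c1: "pre_digraph.cas D (nO g) p1 (nT (Suc i))"
    proof (cases p)
      case (Cons a q)
      then show thesis using p pA out_arcs(1)[of a g] by (auto simp: cas_J intro: that)
    qed (use p in \<open>simp add: cas_J\<close>)
    obtain a p2 where p2: "p1 = a # p2" "fst a = nO g" "pre_digraph.cas D (snd a) p2 (nT (Suc i))" "a \<in> A" "a \<in> P"
    proof (cases p1)
      case (Cons a q)
      then show thesis using p pA c1 p1 by (auto simp: cas_J intro: that)
    qed (use c1 in \<open>simp add: cas_J\<close>)
    consider j where "a = (nO g, nT j)" | "a \<in> trans"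
      using out_arcs(2)[OF p2(4,2)] p2(5) 2 by (auto simp: trans_def)
    then show ?thesis
    proof cases
      case 1
      have "p2 = []"
      proof (cases p2)
        case (Cons b q)
        then show ?thesis using p2 p pA p1 out_arcs(4)[of b j] by (auto simp: cas_J 1)
      qed simp
      then show ?thesis using p1 p2 1 by (simp add: cas_J)
    next
      case c2: 2
      from 1[OF p2(5) this] show ?thesis using p1 p2 by auto
    qed
  qed
  obtain a q where q: "p = a # q" "fst a = nS (Suc i)" "pre_digraph.cas D (snd a) q (nT (Suc i))" "a \<in> A"
    using p by (cases p) (auto simp: cas_J)
  from out_arcs(5)[OF q(4,2)] obtain g1 where g1: "a = (nS (Suc i), nI g1)" by auto
  have "pre_digraph.cas D (nI g1) q (nT (Suc i))" "set q \<subseteq> P" using q g1 p(1) by auto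
  from step[OF this] obtain q1 where q1: "q = (nI g1, nO g1) # q1" "set q1 \<subseteq> {(nO g1, nT (Suc i))} \<or> g1 = ?f \<and>
     (\<exists>p2. q1 = (nO ?f, nI ?e) # p2 \<and> pre_digraph.cas D (nI ?e) p2 (nT (Suc i)))" by blast
  from q1(2) show ?thesis
  proof
    assume "set q1 \<subseteq> {(nO g1, nT (Suc i))}"
    then have sub: "P \<subseteq> {(nS (Suc i), nI g1), (nI g1, nO g1), (nO g1, nT (Suc i))}" using p(1) q(1) q1(1) g1 by auto
    show ?thesis using subsetD[OF sub g(1)] subsetD[OF sub g(2)] g(3) by auto
  next
    assume "g1 = ?f \<and> (\<exists>p2. q1 = (nO ?f, nI ?e) # p2 \<and> pre_digraph.cas D (nI ?e) p2 (nT (Suc i)))"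
    then obtain p2 where p2: "g1 = ?f" "q1 = (nO ?f, nI ?e) # p2" "pre_digraph.cas D (nI ?e) p2 (nT (Suc i))" by blast
    have "set p2 \<subseteq> P" using p(1) q(1) q1(1) p2 by auto
    from step[OF p2(3) this] pr_nth[OF i] obtain p3 where "p2 = (nI ?e, nO ?e) # p3" "set p3 \<subseteq> {(nO ?e, nT (Suc i))}"
      by auto
    then have sub: "P \<subseteq> {(nS (Suc i), nI ?f), (nI ?f, nO ?f), (nO ?f, nI ?e), (nI ?e, nO ?e), (nO ?e, nT (Suc i))}"
      using p(1) q(1) q1(1) p2 g1 by auto
    show ?thesis using subsetD[OF sub g(1)] subsetD[OF sub g(2)] g(3) by auto
  qed
qed

definition big :: "nat set \<Rightarrow> (nat \<times> nat) set" where
  "big S = (\<lambda>g. (nI g, nO g)) ` S"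

lemma card_big: "card (big S) = card S"
  unfolding big_def by (rule card_image) (simp add: inj_on_def)

lemma finite_core_set: "S \<subseteq> {..<G} \<Longrightarrow> finite S"
  by (rule finite_subset) auto

text \<open>Each big arc carries at least 3 units of the commodity, and by \<open>pair_path\<close>
  a path in use meets a set without pairs at most once, so these units belong to different
  paths.\<close>

lemma pair_interdicted:
  assumes x: "x \<in> m_flows J" and i: "i < N" and S: "S \<subseteq> {..<G}" "indep S"
  shows "3 * of_nat (card S) \<le> interdicted (PP (Suc i)) x (big S)"
proof -
  let ?z = "arc_flow (PP (Suc i)) x"
  have fin: "finite S" using S finite_core_set by blast
  have iN: "Suc i \<le> N" using i by simp
  have le1: "card (P \<inter> big S) \<le> 1" if P: "P \<in> PP (Suc i)" "x P \<noteq> 0" for P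
  proof (rule ccontr)
    assume "\<not> card (P \<inter> big S) \<le> 1"
    then obtain a b where "a \<in> P \<inter> big S" "b \<in> P \<inter> big S" "a \<noteq> b"
      using card_le_Suc0_iff_eq[of "P \<inter> big S"] finite_P[OF iN P(1)] by (metis One_nat_def finite_Int)
    then obtain g h where gh: "g \<in> S" "h \<in> S" "(nI g, nO g) \<in> P" "(nI h, nO h) \<in> P" "g \<noteq> h" by (auto simp: big_def)
    have "{g, h} = {fst (pr ! i), snd (pr ! i)}"
    proof (rule pair_path[OF i P(1) _ _ gh(3-5)])
      fix a assume a: "a \<in> P" "a \<in> trans"
      then obtain q where q: "q \<in> set pr" "a = (nO (fst q), nI (snd q))" by (auto simp: trans_def)
      show "a = (nO (fst (pr ! i)), nI (snd (pr ! i)))"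
      proof (rule ccontr)
        assume "a \<noteq> (nO (fst (pr ! i)), nI (snd (pr ! i)))"
        then have "q \<noteq> pr ! i" using q by auto
        then show False using forced_transition[OF x i q(1)] zz_zero[OF x _ iN P(1) a(1)] q(2) P(2) by auto
      qed
    next
      fix g v show "(nO g, nV v) \<notin> P"
      proof
        assume a: "(nO g, nV v) \<in> P"
        then have "(nO g, nV v) \<in> A" using PP_sub[OF iN P(1)] by blast
        then have "g < m" "v = he g" by (auto simp: A_iff)
        then show False using forced(2)[OF x, of "Suc i" g] zz_zero[OF x _ iN P(1) a] iN P(2) by auto
      qed
    qed
    then have "fst (pr ! i) \<in> S" "snd (pr ! i) \<in> S" using gh by auto
    then show False using S(2) pr_nth[OF i] by (auto simp: indep_def)
  qed
  have "3 * of_nat (card S) = (\<Sum>g\<in>S. 3 :: rat)" by simp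
  also have "\<dots> \<le> (\<Sum>g\<in>S. ?z (nI g, nO g))"
  proof (rule sum_mono)
    fix g assume g: "g \<in> S"
    then have gG: "g < G" using S by auto
    show "3 \<le> ?z (nI g, nO g)"
    \<comment> \<open>Here the source arc brings only 2 units, and the bound 3 is read off the sink
      arc.\<close>
    proof (cases "g = snd (pr ! i)")
      case True
      have "of_nat (tg (Suc i) g) \<le> ?z (nI g, nO g)"
        unfolding zz_out[OF x iN gG] by (auto intro!: add_nonneg_nonneg sum_nonneg mult_nonneg_nonneg zz_nonneg[OF x iN])
      moreover have "tg (Suc i) g = 3" using True pr_nth[OF i] by (auto simp: tg_def)
      ultimately show ?thesis by simp
    next
      case False
      then have "sg (Suc i) g = 3" by (simp add: sg_def)
      then show ?thesis using zz_big_ge[OF x iN gG] by simp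
    qed
  qed
  also have "\<dots> = (\<Sum>a\<in>big S. ?z a)" unfolding big_def by (subst sum.reindex) (auto simp: inj_on_def)
  also have "\<dots> = (\<Sum>P\<in>PP (Suc i). x P * of_nat (card (P \<inter> big S)))"
  proof -
    have "(\<Sum>a\<in>big S. of_bool (a \<in> P)) = (of_nat (card (P \<inter> big S)) :: rat)" for P
      using fin by (simp add: big_def Int_commute)
    then show ?thesis
      by (subst arc_flow_sum[OF finite_PP[OF iN]]) (subst sum.swap, simp flip: sum_distrib_left)
  qed
  also have "\<dots> \<le> interdicted (PP (Suc i)) x (big S)"
    unfolding interdicted_sum[OF finite_PP[OF iN]]
  proof (rule sum_mono)
    fix P assume P: "P \<in> PP (Suc i)"
    show "x P * of_nat (card (P \<inter> big S)) \<le> x P * of_bool (P \<inter> big S \<noteq> {})"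
    proof (cases "x P = 0")
      case False
      then have "card (P \<inter> big S) \<le> of_bool (P \<inter> big S \<noteq> {})" using le1[OF P] finite_P[OF iN P] by (auto simp: of_bool_def card_eq_0_iff)
      then have "of_nat (card (P \<inter> big S)) \<le> (of_bool (P \<inter> big S \<noteq> {}) :: rat)" by (metis of_nat_mono of_nat_of_bool)
      then show ?thesis using nonneg_PP[OF x iN] P by (intro mult_left_mono) (auto simp: nonneg_flow_def)
    qed simp
  qed
  finally show ?thesis .
qed

lemma scenario_bound:
  assumes "mrf_m_solution J x" "S \<subseteq> A" "card S \<le> k"
  shows "interdicted (m_paths J) x S \<le> of_nat k * of_nat M - 1"
proof -
  have "{S. S \<subseteq> A \<and> card S \<le> k} \<noteq> {}" by (auto intro: exI[of _ "{}"])
  moreover have "finite {S. S \<subseteq> A \<and> card S \<le> k}" by (rule finite_subset[of _ "Pow A"]) auto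
  ultimately show ?thesis using assms unfolding mrf_m_solution_def max_cap by (simp add: Max_image_le_iff)
qed

lemma chain_lt_m:
  "successively nx gs \<Longrightarrow> gs \<noteq> [] \<Longrightarrow> hd gs < m \<Longrightarrow> set gs \<subseteq> {..<m}"
  by (induction nx gs rule: successively.induct) (auto simp: nx_def)

lemma M_rat: "of_nat M = (of_nat c0 + 3 * of_nat N + 1 :: rat)"
  using arg_cong[OF M_bounds(1), of "of_nat :: nat \<Rightarrow> rat"] by simp

text \<open>The paths of the main commodity are decoded and uncrossed. Uncrossing takes from every
  hit count at least the private units \<open>cz\<close> of the scenario, and each small commodity
  hits it with at least 3 units per gadget. Subtracting both from the capacity, or from the
  interdiction bound, leaves the two inequalities of \<open>core_sol\<close>.\<close>

theorem core_complete:
  assumes sol: "mrf_m_solution J x"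
  shows "\<exists>L. core_sol L \<and> (integral_flow (m_paths J) x \<longrightarrow> (\<forall>z\<in>set L. fst z \<in> \<int>))"
proof -
  have x: "x \<in> m_flows J" using sol by (simp add: mrf_m_solution_def)
  have N0: "(0 :: nat) \<le> N" by simp
  have notr: "P \<inter> trans = {}" if "P \<in> PP 0" "x P \<noteq> 0" for P
  proof (rule ccontr)
    assume "P \<inter> trans \<noteq> {}"
    then obtain q where q: "q \<in> set pr" "(nO (fst q), nI (snd q)) \<in> P" by (auto simp: trans_def)
    from forced(3)[OF x q(1)] zz_zero[OF x _ N0 that(1) q(2)] that(2) show False by simp
  qed
  define dec where "dec P = (SOME s. decodes P s)" for P
  have dec: "decodes P (dec P)" if "P \<in> PP 0" "x P \<noteq> 0" for P
    unfolding dec_def by (rule someI_ex[OF decode[OF that(1) notr[OF that]]])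
  obtain L1 where L1: "set L1 = (\<lambda>P. (x P, P)) ` {P \<in> PP 0. x P \<noteq> 0}" "\<And>F. fsum L1 F = (\<Sum>P\<in>PP 0. x P * F P)"
    using flow_as_list[OF finite_PP[OF N0], of x] by blast
  define L0 where "L0 = map (\<lambda>z. (fst z, dec (snd z))) L1"
  \<comment> \<open>Transfers sums over paths to sums over segments. Paths of weight 0 may fail to
    decode, but then the summand vanishes on both sides.\<close>
  have F0: "fsum L0 F = (\<Sum>P\<in>PP 0. x P * of_bool (Q P))"
    if "\<And>P s. decodes P s \<Longrightarrow> F s = of_bool (Q P)" for F Q
    unfolding L0_def fsum_map L1(2) by (rule sum.cong[OF refl]) (use that dec in \<open>metis mult_zero_left\<close>)
  have start: "fsum L0 (seg_start g) = of_nat (cz g)" if "g < G" for g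
  proof -
    have "fsum L0 (seg_start g) = arc_flow (PP 0) x (nS 0, nI g)"
      unfolding arc_flow_sum[OF finite_PP[OF N0]] by (rule F0) (auto simp: decodes_def seg_start_def)
    then show ?thesis using zz_src(1)[OF x N0 that] by (simp add: sg_def)
  qed
  have endd: "fsum L0 (seg_end g) = of_nat (cz g)" if "g < G" for g
  proof -
    have "fsum L0 (seg_end g) = arc_flow (PP 0) x (nO g, nT 0)"
      unfolding arc_flow_sum[OF finite_PP[OF N0]] by (rule F0) (auto simp: decodes_def seg_end_def)
    then show ?thesis using zz_snk(1)[OF x N0 that] by (simp add: tg_def)
  qed
  have exit: "fsum L0 (seg_exit (fst z)) = of_nat (snd z)" if "z \<in> set ex" for z
  proof -
    have "fsum L0 (seg_exit (fst z)) = arc_flow (PP 0) x (nV (fst z), nT 0)"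
      unfolding arc_flow_sum[OF finite_PP[OF N0]] by (rule F0) (auto simp: decodes_def seg_exit_def)
    then show ?thesis using zz_snk(2)[OF x N0 refl that] by simp
  qed
  have hit0: "fsum L0 (seg_hit S) = interdicted (PP 0) x (big S)" for S
    unfolding interdicted_sum[OF finite_PP[OF N0]] by (rule F0) (fastforce simp: decodes_def seg_hit_def big_def)
  let ?int = "integral_flow (m_paths J) x"
  have "\<exists>L'. (\<forall>(w, s)\<in>set L'. 0 \<le> w \<and> unc.seg_ok s \<and> (?int \<longrightarrow> w \<in> \<int>) \<and> fst s \<and> snd (snd s) \<noteq> None)
    \<and> (\<forall>v. fsum L' (seg_exit v) = fsum L0 (seg_exit v))
    \<and> (\<forall>S. S \<subseteq> {..<G} \<longrightarrow> fsum L' (seg_hit S) + (\<Sum>g\<in>S. of_nat (cz g)) \<le> fsum L0 (seg_hit S))"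
  proof (rule unc.uncross)
    fix w s assume "(w, s) \<in> set L0"
    then obtain P where P: "P \<in> PP 0" "x P \<noteq> 0" "w = x P" "s = dec P" by (auto simp: L0_def L1(1))
    then show "0 \<le> w \<and> unc.seg_ok s \<and> (?int \<longrightarrow> w \<in> \<int>)"
      using dec[OF P(1,2)] nonneg_PP[OF x N0]
      by (auto simp: decodes_def nonneg_flow_def integral_flow_def m_paths_eq)
  qed (use start endd in auto)
  then obtain L' where L': "\<And>w s. (w, s) \<in> set L' \<Longrightarrow> 0 \<le> w \<and> unc.seg_ok s \<and> (?int \<longrightarrow> w \<in> \<int>) \<and> fst s \<and> snd (snd s) \<noteq> None"
    "\<And>v. fsum L' (seg_exit v) = fsum L0 (seg_exit v)"
    "\<And>S. S \<subseteq> {..<G} \<Longrightarrow> fsum L' (seg_hit S) + (\<Sum>g\<in>S. of_nat (cz g)) \<le> fsum L0 (seg_hit S)" by fastforce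
  define L where "L = map (\<lambda>z. (fst z, fst (snd (snd z)))) L'"
  have fL: "fsum L F = fsum L' (\<lambda>s. F (fst (snd s)))" for F
    unfolding L_def by (rule fsum_map)
  have hitL: "fsum L (hit S) = fsum L' (seg_hit S)" for S
    unfolding fL by (rule fsum_cong) (simp add: hit_def seg_hit_def)
  have segs: "cvalid (fst (snd s)) \<and> snd (snd s) = Some (he (last (fst (snd s))))" if m: "(w, s) \<in> set L'" for w s
  proof -
    obtain gs c where s: "s = (True, gs, c)" "c \<noteq> None" using L'(1)[OF m] by (cases s) auto
    have ok: "unc.seg_ok (True, gs, c)" using L'(1)[OF m] s by simp
    then have "set gs \<subseteq> {..<m}" by (intro chain_lt_m) (auto simp: unc.seg_ok_def sr_def)
    then show ?thesis using ok s by (auto simp: cvalid_def unc.seg_ok_def sr_def er_def)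
  qed
  have split: "interdicted (m_paths J) x S = interdicted (PP 0) x S + (\<Sum>i<N. interdicted (PP (Suc i)) x S)" for S
    unfolding interdicted_split by (rule sum.atMost_shift)
  have "core_sol L"
    unfolding core_sol_def
  proof (intro conjI ballI allI impI)
    fix z assume "z \<in> set L"
    then show "0 \<le> fst z" "cvalid (snd z)" using L'(1) segs by (auto simp: L_def)
  next
    fix z assume z: "z \<in> set ex"
    have "fsum L (\<lambda>gs. of_bool (he (last gs) = fst z)) = fsum L' (seg_exit (fst z))"
      unfolding fL
    proof (rule fsum_cong)
      fix y assume "y \<in> set L'"
      then show "of_bool (he (last (fst (snd (snd y)))) = fst z) = seg_exit (fst z) (snd y)"
        using segs[of "fst y" "snd y"] by (simp add: seg_exit_def)
    qed
    then show "fsum L (\<lambda>gs. of_bool (he (last gs) = fst z)) = of_nat (snd z)"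
      using L'(2) exit[OF z] by simp
  next
    fix g assume g: "g < m"
    then have gG: "g < G" by (simp add: G_def)
    have i3: "3 \<le> arc_flow (PP (Suc i)) x (nI g, nO g)" if "i < N" for i
    proof -
      have "fst z \<noteq> snd z" if "z \<in> set pr" for z using prE[OF that] by simp
      then have S: "{g} \<subseteq> {..<G}" "indep {g}" using gG by (auto simp: indep_def, blast)
      have "3 \<le> interdicted (PP (Suc i)) x (big {g})" using pair_interdicted[OF x that S] by simp
      also have "\<dots> = arc_flow (PP (Suc i)) x (nI g, nO g)"
        by (simp add: interdicted_def arc_flow_def big_def)
      finally show ?thesis .
    qed
    have "arc_flow (PP 0) x (nI g, nO g) + (\<Sum>i<N. arc_flow (PP (Suc i)) x (nI g, nO g)) \<le> of_nat M"
      using zz_total[OF x big_A[OF gG]] gG unfolding sum.atMost_shift by simp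
    moreover have "(\<Sum>i<N. 3) \<le> (\<Sum>i<N. arc_flow (PP (Suc i)) x (nI g, nO g))" by (rule sum_mono) (use i3 in auto)
    ultimately have "arc_flow (PP 0) x (nI g, nO g) \<le> of_nat M - 3 * of_nat N" by simp
    moreover have "arc_flow (PP 0) x (nI g, nO g) = fsum L0 (seg_hit {g})"
      unfolding hit0 by (simp add: interdicted_def arc_flow_def big_def)
    moreover have "of_nat M = (of_nat c0 + 3 * of_nat N + 1 :: rat)"
      by (rule M_rat)
    ultimately show "fsum L (hit {g}) \<le> 1"
      using L'(3)[of "{g}"] gG g unfolding hitL by (simp add: cz_def)
  next
    fix S assume S: "S \<subseteq> {..<G}" "card S = k" "indep S"
    have fin: "finite S" using S finite_core_set by blast
    have "big S \<subseteq> A" using S(1) big_A by (auto simp: big_def)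
    then have "interdicted (PP 0) x (big S) + (\<Sum>i<N. interdicted (PP (Suc i)) x (big S)) \<le> of_nat k * of_nat M - 1"
      using scenario_bound[OF sol, of "big S"] S(2) by (simp add: split card_big)
    moreover have "(\<Sum>i<N. 3 * of_nat k) \<le> (\<Sum>i<N. interdicted (PP (Suc i)) x (big S))"
      by (rule sum_mono) (use pair_interdicted[OF x _ S(1,3)] S(2) in auto)
    moreover have "(\<Sum>g\<in>S. of_nat (cz g)) = (of_nat k * of_nat c0 + of_nat (card (S - {..<m})) :: rat)"
    proof -
      have "(\<Sum>g\<in>S. of_nat (cz g)) = (\<Sum>g\<in>S. of_nat c0 + of_bool (g \<in> S - {..<m}) :: rat)"
        by (rule sum.cong) (auto simp: cz_def)
      also have "\<dots> = of_nat k * of_nat c0 + of_nat (card (S - {..<m}))"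
        using fin S(2) by (simp add: sum.distrib Diff_eq Int_def)
      finally show ?thesis .
    qed
    moreover have "of_nat k * of_nat M = (of_nat k * of_nat c0 + of_nat N * (3 * of_nat k) + of_nat k :: rat)"
      by (simp add: M_rat algebra_simps)
    ultimately show "fsum L (hit S) + of_nat (card (S - {..<m})) \<le> of_nat k - 1"
      using L'(3)[OF S(1)] unfolding hitL hit0 by simp
  qed
  moreover have "?int \<longrightarrow> (\<forall>z\<in>set L. fst z \<in> \<int>)" using L'(1) by (auto simp: L_def)
  ultimately show ?thesis by blast
qed

end

context core
begin

subsection \<open>From network flows to multicommodity flows\<close>

lemma cas_append: "pre_digraph.cas D u p w \<Longrightarrow> pre_digraph.cas D w q v \<Longrightarrow> pre_digraph.cas D u (p @ q) v"
  by (induction p arbitrary: u) (auto simp: cas_J)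

text \<open>The doubled potential, shifted so that big arcs increase as well. It decreases on
  transition arcs and therefore serves only for the paths \<open>rp\<close>.\<close>

definition rk :: "nat \<Rightarrow> nat" where
  "rk u = (if u mod 5 = 0 then 0 else if u mod 5 = 1 then 4 * G + 10 else if u mod 5 = 2 then 4 * (u div 5) + 2
     else if u mod 5 = 3 then 4 * (u div 5) + 3 else 2 * pv (u div 5) + 1)"

lemma rk_simps: "rk (nS i) = 0" "rk (nT i) = 4 * G + 10" "rk (nI g) = 4 * g + 2" "rk (nO g) = 4 * g + 3"
  "rk (nV v) = 2 * pv v + 1"
proof -
  have "(5 * a + b) mod 5 = b" "(5 * a + b) div 5 = a" if "b < 5" for a b :: nat using that by auto
  from this[of 0] this[of 1] this[of 2] this[of 3] this[of 4]
  show "rk (nS i) = 0" "rk (nT i) = 4 * G + 10" "rk (nI g) = 4 * g + 2" "rk (nO g) = 4 * g + 3"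
    "rk (nV v) = 2 * pv v + 1"
    unfolding rk_def node_defs by simp_all
qed

text \<open>The three kinds of paths in the intended flow: straight through one gadget, through both
  gadgets of a pair, and along a chain of network gadgets.\<close>

definition sp :: "nat \<Rightarrow> nat \<Rightarrow> (nat \<times> nat) set" where
  "sp i g = {(nS i, nI g), (nI g, nO g), (nO g, nT i)}"
definition dp :: "nat \<Rightarrow> (nat \<times> nat) set" where
  "dp i = {(nS (Suc i), nI (fst (pr ! i))), (nI (fst (pr ! i)), nO (fst (pr ! i))),
     (nO (fst (pr ! i)), nI (snd (pr ! i))), (nI (snd (pr ! i)), nO (snd (pr ! i))), (nO (snd (pr ! i)), nT (Suc i))}"
definition rmid :: "nat list \<Rightarrow> (nat \<times> nat) list" where
  "rmid gs = concat (map (\<lambda>h. [(nV (ta h), nI h), (nI h, nO h), (nO h, nV (he h))]) gs)"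
definition rp :: "nat list \<Rightarrow> (nat \<times> nat) set" where
  "rp gs = set ((nS 0, nV root) # rmid gs @ [(nV (he (last gs)), nT 0)])"

lemma sp_PP: "i \<le> N \<Longrightarrow> g < G \<Longrightarrow> sp i g \<in> PP i"
proof -
  assume i: "i \<le> N" "g < G"
  let ?p = "[(nS i, nI g), (nI g, nO g), (nO g, nT i)]"
  have "pre_digraph.apath D (nS i) ?p (nT i)"
    using i by (auto simp: pre_digraph.apath_def pre_digraph.awalk_def cas_J pre_digraph.awalk_verts.simps nodes_mem A_iff)
  then have "set ?p \<in> PP i" unfolding PP_eq[OF i(1)] st_paths_def by blast
  then show ?thesis by (simp add: sp_def)
qed

lemma dp_PP: "i < N \<Longrightarrow> dp i \<in> PP (Suc i)"
proof -
  assume i: "i < N"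
  let ?f = "fst (pr ! i)" and ?e = "snd (pr ! i)"
  let ?p = "[(nS (Suc i), nI ?f), (nI ?f, nO ?f), (nO ?f, nI ?e), (nI ?e, nO ?e), (nO ?e, nT (Suc i))]"
  have sub: "set ?p \<subseteq> A" using i pr_nth[OF i] by (auto simp: A_iff Suc_le_eq)
  have "pre_digraph.apath D (nS (Suc i)) ?p (nT (Suc i))"
    using i pr_nth[OF i] sub
    by (auto simp: pre_digraph.apath_def pre_digraph.awalk_def cas_J pre_digraph.awalk_verts.simps nodes_mem)
  then have "set ?p \<in> PP (Suc i)" using i unfolding PP_eq[OF Suc_leI[OF i]] st_paths_def by blast
  then show ?thesis by (simp add: dp_def)
qed

lemma rmid_cas: "successively nx gs \<Longrightarrow> gs \<noteq> [] \<Longrightarrow> pre_digraph.cas D (nV (ta (hd gs))) (rmid gs) (nV (he (last gs)))"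
  by (induction nx gs rule: successively.induct) (auto simp: rmid_def cas_J nx_def)

lemma set_rmid: "set (rmid gs) = (\<lambda>h. (nV (ta h), nI h)) ` set gs \<union> (\<lambda>h. (nI h, nO h)) ` set gs
    \<union> (\<lambda>h. (nO h, nV (he h))) ` set gs"
  by (auto simp: rmid_def)

lemma A_intros: "g < m \<Longrightarrow> (nV (ta g), nI g) \<in> A" "g < m \<Longrightarrow> (nO g, nV (he g)) \<in> A"
  "g < m \<Longrightarrow> (nI g, nO g) \<in> A" "(nS 0, nV root) \<in> A" "(v, c) \<in> set ex \<Longrightarrow> (nV v, nT 0) \<in> A"
  using big_A[of g] by (auto simp: A_iff G_def, force)

lemma rp_PP: "cvalid gs \<Longrightarrow> rp gs \<in> PP 0"
proof -
  assume gs: "cvalid gs"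
  let ?p = "(nS 0, nV root) # rmid gs @ [(nV (he (last gs)), nT 0)]"
  have m: "h < m" if "h \<in> set gs" for h using gs that by (auto simp: cvalid_def)
  obtain c where c: "(he (last gs), c) \<in> set ex" using gs by (auto simp: cvalid_def)
  have "set ?p \<in> st_paths D (nS 0) (nT 0)"
  proof (rule st_pathsI[where rk = rk])
    have "pre_digraph.cas D (nV (he (last gs))) [(nV (he (last gs)), nT 0)] (nT 0)" by (simp add: cas_J)
    then show "pre_digraph.cas D (nS 0) ?p (nT 0)"
      using cas_append[OF rmid_cas[of gs]] gs by (simp add: cas_J cvalid_def)
    show "set ?p \<subseteq> arcs D" using m A_intros c by (auto simp: set_rmid)
    show "nS 0 \<in> verts D" by (simp add: nodes_mem)
    have "pv (he (last gs)) \<le> 2 * G"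
      unfolding pv_def by (subst Max_le_iff) (auto simp: G_def)
    moreover fix a assume "a \<in> set ?p"
    ultimately show "rk (tail D a) < rk (head D a)"
    proof -
      have 1: "2 * pv (ta h) < Suc (4 * h)" "Suc (Suc (4 * h)) < 2 * pv (he h)" if "h \<in> set gs" for h
        using pv_he[OF m[OF that]] pv_ta[OF m[OF that]] by linarith+
      show ?thesis
        using \<open>a \<in> set ?p\<close> \<open>pv (he (last gs)) \<le> 2 * G\<close> 1
        by (auto simp: set_rmid rk_simps)
    qed
  qed
  then show ?thesis by (simp add: PP_eq rp_def)
qed

lemma rp_mem:
  "(nI h, nO h) \<in> rp gs \<longleftrightarrow> h \<in> set gs" "(nS i, nI h) \<notin> rp gs" "(nO h, nT i) \<notin> rp gs"
  "(nS 0, nV root) \<in> rp gs" "(nO h, nI e) \<notin> rp gs" "(nV (ta h), nI h) \<in> rp gs \<longleftrightarrow> h \<in> set gs"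
  "(nO h, nV (he h)) \<in> rp gs \<longleftrightarrow> h \<in> set gs" "(nV v, nT 0) \<in> rp gs \<longleftrightarrow> he (last gs) = v"
  by (auto simp: rp_def rmid_def)

text \<open>The path \<open>dp i\<close> already brings one of the 3 units to both gadgets of its
  pair.\<close>

definition wt :: "nat \<Rightarrow> nat \<Rightarrow> nat" where
  "wt i g = (if g = fst (pr ! i) \<or> g = snd (pr ! i) then 2 else 3)"

definition pair_flow :: "nat \<Rightarrow> (rat \<times> (nat \<times> nat) set) list" where
  "pair_flow i = (1, dp i) # map (\<lambda>g. (of_nat (wt i g), sp (Suc i) g)) [0..<G]"

definition LJ :: "(rat \<times> nat list) list \<Rightarrow> (rat \<times> (nat \<times> nat) set) list" where
  "LJ L = map (\<lambda>g. (of_nat (cz g), sp 0 g)) [0..<G] @ map (\<lambda>z. (fst z, rp (snd z))) L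
     @ concat (map pair_flow [0..<N])"

lemma fsum_LJ: "fsum (LJ L) F = (\<Sum>g<G. of_nat (cz g) * F (sp 0 g)) + fsum L (\<lambda>gs. F (rp gs))
   + (\<Sum>i<N. F (dp i) + (\<Sum>g<G. of_nat (wt i g) * F (sp (Suc i) g)))"
proof -
  have c: "fsum (concat xs) F = (\<Sum>l\<leftarrow>xs. fsum l F)" for xs by (induction xs) auto
  have m: "fsum (map (\<lambda>g. (f g, h g)) [0..<n]) F = (\<Sum>g<n. f g * F (h g))" for f and h :: "nat \<Rightarrow> (nat \<times> nat) set" and n
    by (simp add: fsum_def comp_def interv_sum_list_conv_sum_set_nat atLeast0LessThan)
  have "(\<Sum>l\<leftarrow>map pair_flow [0..<N]. fsum l F) = (\<Sum>i<N. fsum (pair_flow i) F)"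
    by (simp add: comp_def interv_sum_list_conv_sum_set_nat atLeast0LessThan)
  then show ?thesis by (simp add: LJ_def c fsum_map m pair_flow_def add.assoc)
qed

context
  fixes L assumes L: "core_sol L"
begin

abbreviation "y \<equiv> flow_of (LJ L)"

lemma L_valid: "z \<in> set L \<Longrightarrow> 0 \<le> fst z \<and> cvalid (snd z)"
  using L unfolding core_sol_def by blast

lemma LJ_mem:
  assumes "z \<in> set (LJ L)" shows "snd z \<in> m_paths J \<and> 0 \<le> fst z"
proof -
  consider g where "g < G" "z = (of_nat (cz g), sp 0 g)" | u where "u \<in> set L" "z = (fst u, rp (snd u))"
    | i where "i < N" "z = (1, dp i)" | i g where "i < N" "g < G" "z = (of_nat (wt i g), sp (Suc i) g)"
    using assms by (auto simp: LJ_def pair_flow_def)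
  then show ?thesis
  proof cases
    case 1 then show ?thesis using sp_PP[of 0 g] by (auto simp: m_paths_eq)
  next
    case 2 then show ?thesis using rp_PP[of "snd u"] L_valid[of u] by (auto simp: m_paths_eq)
  next
    case 3 then show ?thesis using dp_PP[of i] by (force simp: m_paths_eq)
  next
    case 4 then show ?thesis using sp_PP[of "Suc i" g] by (force simp: m_paths_eq)
  qed
qed

lemma LJ_sub: "snd ` set (LJ L) \<subseteq> m_paths J" using LJ_mem by auto

lemma flow_y: "arc_flow (m_paths J) y a = fsum (LJ L) (\<lambda>R. of_bool (a \<in> R))"
  by (rule arc_flow_flow_of[OF finite_m_paths LJ_sub])

lemma interdicted_y: "interdicted (m_paths J) y S = fsum (LJ L) (\<lambda>R. of_bool (R \<inter> S \<noteq> {}))"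
  by (rule interdicted_flow_of[OF finite_m_paths LJ_sub])

text \<open>Every chain ends at exactly one exit, so its weight is counted in exactly one of the
  prescribed amounts.\<close>

lemma L_total: "fsum L (\<lambda>_. 1) = of_nat \<Theta>"
proof -
  have "fsum L (\<lambda>_. 1) = fsum L (\<lambda>gs. \<Sum>z\<in>set ex. of_bool (he (last gs) = fst z))"
  proof (rule fsum_cong)
    fix u assume "u \<in> set L"
    then have "he (last (snd u)) \<in> fst ` set ex" using L_valid[of u] by (simp add: cvalid_def)
    then obtain c where c: "(he (last (snd u)), c) \<in> set ex" by auto
    have "(\<Sum>z\<in>set ex. of_bool (he (last (snd u)) = fst z)) = (\<Sum>z\<in>set ex. (1 :: rat) * of_bool (z = (he (last (snd u)), c)))"
      by (rule sum.cong[OF refl]) (use c ex(1) in \<open>auto simp: eq_key_imp_eq_value\<close>)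
    also have "\<dots> = 1" by (subst sum_of_bool_eq) (use c in auto)
    finally show "1 = (\<Sum>z\<in>set ex. of_bool (he (last (snd u)) = fst z) :: rat)" by simp
  qed
  also have "\<dots> = (\<Sum>z\<in>set ex. of_nat (snd z))"
    unfolding fsum_sum[OF finite_set] by (rule sum.cong[OF refl]) (use L in \<open>simp add: core_sol_def\<close>)
  finally show ?thesis by (simp add: \<Theta>_sum)
qed

lemma hit_le: "g < m \<Longrightarrow> fsum L (hit {g}) \<le> 1"
  using L by (simp add: core_sol_def)

lemma hit_special: "m \<le> g \<Longrightarrow> fsum L (hit {g}) = 0"
  by (rule fsum_0) (use L_valid in \<open>fastforce simp: hit_def cvalid_def\<close>)

lemma hit_single: "hit {g} gs = of_bool (g \<in> set gs)" by (simp add: hit_def)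

text \<open>One case for each family of arcs. All arcs are saturated except for network arcs and
  ordinary big arcs, where the remaining unit is governed by the bound on
  \<open>hit {g}\<close>.\<close>

lemma y_cap:
  assumes "a \<in> A" shows "arc_flow (m_paths J) y a \<le> capacity J a"
  using assms unfolding A_iff
proof (elim disjE exE bexE conjE)
  fix g assume g: "g < G" "a = (nI g, nO g)"
  have "(of_bool (a \<in> dp i) + (\<Sum>h<G. of_nat (wt i h) * of_bool (a \<in> sp (Suc i) h)) :: rat) = 3" if i: "i < N" for i
  proof -
    have "(\<Sum>h<G. of_nat (wt i h) * of_bool (a \<in> sp (Suc i) h)) = (\<Sum>h<G. of_nat (wt i h) * of_bool (h = g) :: rat)"
      by (rule sum.cong) (auto simp: g sp_def)
    also have "\<dots> = of_nat (wt i g)" by (subst sum_of_bool_eq) (use g in auto)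
    finally show ?thesis using pr_nth[OF i] by (auto simp: g dp_def wt_def)
  qed
  then have 1: "(\<Sum>i<N. of_bool (a \<in> dp i) + (\<Sum>h<G. of_nat (wt i h) * of_bool (a \<in> sp (Suc i) h))) = (3 * of_nat N :: rat)"
    by simp
  have 2: "(\<Sum>h<G. of_nat (cz h) * of_bool (a \<in> sp 0 h)) = (of_nat (cz g) :: rat)"
  proof -
    have "(\<Sum>h<G. of_nat (cz h) * of_bool (a \<in> sp 0 h)) = (\<Sum>h<G. of_nat (cz h) * of_bool (h = g) :: rat)"
      by (rule sum.cong) (auto simp: g sp_def)
    also have "\<dots> = of_nat (cz g)" by (subst sum_of_bool_eq) (use g in auto)
    finally show ?thesis .
  qed
  have 3: "fsum L (\<lambda>gs. of_bool (a \<in> rp gs)) = fsum L (hit {g})"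
    by (rule fsum_cong) (simp add: g rp_mem hit_single)
  show ?thesis unfolding flow_y fsum_LJ 1 2 3
    using hit_le[of g] hit_special[of g] g by (cases "g < m") (auto simp: cz_def M_rat)
next
  fix i g assume g: "i \<le> N" "g < G" "a = (nS i, nI g)"
  have 2: "(\<Sum>h<G. of_nat (cz h) * of_bool (a \<in> sp 0 h)) = (of_nat (cz g) * of_bool (i = 0) :: rat)"
  proof -
    have "(\<Sum>h<G. of_nat (cz h) * of_bool (a \<in> sp 0 h)) = (\<Sum>h<G. (of_nat (cz h) * of_bool (i = 0)) * of_bool (h = g) :: rat)"
      by (rule sum.cong) (auto simp: g sp_def)
    also have "\<dots> = of_nat (cz g) * of_bool (i = 0)" by (subst sum_of_bool_eq) (use g in auto)
    finally show ?thesis .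
  qed
  have 3: "fsum L (\<lambda>gs. of_bool (a \<in> rp gs)) = 0" by (rule fsum_0) (simp add: g rp_mem)
  have "(of_bool (a \<in> dp j) + (\<Sum>h<G. of_nat (wt j h) * of_bool (a \<in> sp (Suc j) h)) :: rat) = of_nat (sg i g) * of_bool (Suc j = i)"
    if j: "j < N" for j
  proof -
    have "(\<Sum>h<G. of_nat (wt j h) * of_bool (a \<in> sp (Suc j) h)) = (\<Sum>h<G. (of_nat (wt j h) * of_bool (Suc j = i)) * of_bool (h = g) :: rat)"
      by (rule sum.cong) (auto simp: g sp_def)
    also have "\<dots> = of_nat (wt j g) * of_bool (Suc j = i)" by (subst sum_of_bool_eq) (use g in auto)
    finally show ?thesis using pr_nth[OF j] by (auto simp: g dp_def wt_def sg_def)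
  qed
  then have "(\<Sum>j<N. of_bool (a \<in> dp j) + (\<Sum>h<G. of_nat (wt j h) * of_bool (a \<in> sp (Suc j) h)))
      = (\<Sum>j<N. of_nat (sg i g) * of_bool (Suc j = i) :: rat)" by (intro sum.cong) auto
  also have "\<dots> = of_nat (sg i g) * of_bool (i \<noteq> 0)"
    using sum_of_bool_eq(1)[of "{..<N}" "\<lambda>_. of_nat (sg i g) :: rat" "i - 1"] g(1) by (cases i) auto
  finally show ?thesis unfolding flow_y fsum_LJ 2 3 using g by (cases i) (auto simp: sg_def)
next
  fix i g assume g: "i \<le> N" "g < G" "a = (nO g, nT i)"
  have 2: "(\<Sum>h<G. of_nat (cz h) * of_bool (a \<in> sp 0 h)) = (of_nat (cz g) * of_bool (i = 0) :: rat)"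
  proof -
    have "(\<Sum>h<G. of_nat (cz h) * of_bool (a \<in> sp 0 h)) = (\<Sum>h<G. (of_nat (cz h) * of_bool (i = 0)) * of_bool (h = g) :: rat)"
      by (rule sum.cong) (auto simp: g sp_def)
    also have "\<dots> = of_nat (cz g) * of_bool (i = 0)" by (subst sum_of_bool_eq) (use g in auto)
    finally show ?thesis .
  qed
  have 3: "fsum L (\<lambda>gs. of_bool (a \<in> rp gs)) = 0" by (rule fsum_0) (simp add: g rp_mem)
  have "(of_bool (a \<in> dp j) + (\<Sum>h<G. of_nat (wt j h) * of_bool (a \<in> sp (Suc j) h)) :: rat) = of_nat (tg i g) * of_bool (Suc j = i)"
    if j: "j < N" for j
  proof -
    have "(\<Sum>h<G. of_nat (wt j h) * of_bool (a \<in> sp (Suc j) h)) = (\<Sum>h<G. (of_nat (wt j h) * of_bool (Suc j = i)) * of_bool (h = g) :: rat)"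
      by (rule sum.cong) (auto simp: g sp_def)
    also have "\<dots> = of_nat (wt j g) * of_bool (Suc j = i)" by (subst sum_of_bool_eq) (use g in auto)
    finally show ?thesis using pr_nth[OF j] by (auto simp: g dp_def wt_def tg_def)
  qed
  then have "(\<Sum>j<N. of_bool (a \<in> dp j) + (\<Sum>h<G. of_nat (wt j h) * of_bool (a \<in> sp (Suc j) h)))
      = (\<Sum>j<N. of_nat (tg i g) * of_bool (Suc j = i) :: rat)" by (intro sum.cong) auto
  also have "\<dots> = of_nat (tg i g) * of_bool (i \<noteq> 0)"
    using sum_of_bool_eq(1)[of "{..<N}" "\<lambda>_. of_nat (tg i g) :: rat" "i - 1"] g(1) by (cases i) auto
  finally show ?thesis unfolding flow_y fsum_LJ 2 3 using g by (cases i) (auto simp: tg_def)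
next
  fix z assume z: "z \<in> set pr" "a = (nO (fst z), nI (snd z))"
  have 2: "of_bool (a \<in> sp i h) = (0 :: rat)" for i h by (simp add: z sp_def)
  have 3: "fsum L (\<lambda>gs. of_bool (a \<in> rp gs)) = 0" by (rule fsum_0) (simp add: z rp_mem)
  obtain j where j: "j < N" "z = pr ! j" using z(1) by (auto simp: in_set_conv_nth N_def)
  have "(\<Sum>i<N. of_bool (a \<in> dp i) :: rat) = (\<Sum>i<N. 1 * of_bool (i = j))"
  proof (rule sum.cong[OF refl])
    fix i assume i: "i \<in> {..<N}"
    have "a \<in> dp i \<longleftrightarrow> pr ! j = pr ! i" by (auto simp: z(2) j(2) dp_def prod_eq_iff)
    then show "of_bool (a \<in> dp i) = (1 * of_bool (i = j) :: rat)"
      using pr_dist i j(1) by (auto simp: nth_eq_iff_index_eq N_def)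
  qed
  also have "\<dots> = 1" by (subst sum_of_bool_eq) (use j in auto)
  finally show ?thesis unfolding flow_y fsum_LJ 2 3 using z by simp
next
  fix g assume g: "g < m" "a = (nV (ta g), nI g)"
  have 2: "of_bool (a \<in> sp i h) = (0 :: rat)" "of_bool (a \<in> dp i) = (0 :: rat)" for i h by (simp_all add: g sp_def dp_def)
  have 3: "fsum L (\<lambda>gs. of_bool (a \<in> rp gs)) = fsum L (hit {g})"
    by (rule fsum_cong) (simp add: g rp_mem hit_single)
  show ?thesis unfolding flow_y fsum_LJ 2 3 using g hit_le by simp
next
  fix g assume g: "g < m" "a = (nO g, nV (he g))"
  have 2: "of_bool (a \<in> sp i h) = (0 :: rat)" "of_bool (a \<in> dp i) = (0 :: rat)" for i h by (simp_all add: g sp_def dp_def)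
  have 3: "fsum L (\<lambda>gs. of_bool (a \<in> rp gs)) = fsum L (hit {g})"
    by (rule fsum_cong) (simp add: g rp_mem hit_single)
  show ?thesis unfolding flow_y fsum_LJ 2 3 using g hit_le by simp
next
  assume g: "a = (nS 0, nV root)"
  have 2: "of_bool (a \<in> sp i h) = (0 :: rat)" "of_bool (a \<in> dp i) = (0 :: rat)" for i h by (simp_all add: g sp_def dp_def)
  have 3: "fsum L (\<lambda>gs. of_bool (a \<in> rp gs)) = fsum L (\<lambda>_. 1)"
    by (rule fsum_cong) (simp add: g rp_mem)
  show ?thesis unfolding flow_y fsum_LJ 2 3 using g L_total by simp
next
  fix z assume g: "z \<in> set ex" "a = (nV (fst z), nT 0)"
  have 2: "of_bool (a \<in> sp i h) = (0 :: rat)" "of_bool (a \<in> dp i) = (0 :: rat)" for i h by (simp_all add: g sp_def dp_def)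
  have 3: "fsum L (\<lambda>gs. of_bool (a \<in> rp gs)) = fsum L (\<lambda>gs. of_bool (he (last gs) = fst z))"
    by (rule fsum_cong) (simp add: g rp_mem)
  show ?thesis unfolding flow_y fsum_LJ 2 3 using g L by (simp add: core_sol_def)
qed

lemma y_demand:
  assumes i: "i \<le> N" shows "(\<Sum>P\<in>PP i. y P) = of_nat (dem i)"
proof -
  have s: "sp j g \<in> PP i \<longleftrightarrow> j = i" if "j \<le> N" "g < G" for j g
    using sp_PP[OF that] PP_disjoint[OF i that(1)] by auto
  have d: "dp j \<in> PP i \<longleftrightarrow> Suc j = i" if "j < N" for j
    using dp_PP[OF that] PP_disjoint[OF i Suc_leI[OF that]] by auto
  have r: "fsum L (\<lambda>gs. of_bool (rp gs \<in> PP i)) = of_bool (i = 0) * of_nat \<Theta>"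
  proof -
    have "fsum L (\<lambda>gs. of_bool (rp gs \<in> PP i)) = fsum L (\<lambda>gs. of_bool (i = 0) * 1)"
    proof (rule fsum_cong)
      fix z assume "z \<in> set L"
      then have "rp (snd z) \<in> PP 0" using L_valid rp_PP by blast
      then have "rp (snd z) \<in> PP i \<longleftrightarrow> i = 0" using PP_disjoint[OF i, of 0] by auto
      then show "of_bool (rp (snd z) \<in> PP i) = (of_bool (i = 0) * 1 :: rat)" by simp
    qed
    then show ?thesis unfolding fsum_cmult L_total .
  qed
  have "(\<Sum>P\<in>PP i. y P) = (\<Sum>g<G. of_nat (cz g) * of_bool (i = 0)) + of_bool (i = 0) * of_nat \<Theta>
    + (\<Sum>j<N. of_bool (Suc j = i) * (1 + (\<Sum>g<G. of_nat (wt j g))))"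
  proof -
    have "(\<Sum>g<G. of_nat (cz g) * of_bool (sp 0 g \<in> PP i)) = (\<Sum>g<G. of_nat (cz g) * of_bool (i = 0) :: rat)"
      by (rule sum.cong[OF refl]) (use s[of 0] in auto)
    moreover have "(\<Sum>j<N. of_bool (dp j \<in> PP i) + (\<Sum>g<G. of_nat (wt j g) * of_bool (sp (Suc j) g \<in> PP i)))
      = (\<Sum>j<N. of_bool (Suc j = i) * (1 + (\<Sum>g<G. of_nat (wt j g))) :: rat)"
      by (rule sum.cong[OF refl]) (use s d in \<open>auto simp: of_bool_def\<close>)
    ultimately show ?thesis unfolding sum_flow_of[OF finite_PP[OF i]] fsum_LJ r by simp
  qed
  also have "\<dots> = of_nat (dem i)"
  proof (cases i)
    case 0
    then show ?thesis by (simp add: dem_def sum_cz)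
  next
    case (Suc j)
    then have j: "j < N" using i by simp
    let ?f = "fst (pr ! j)" and ?e = "snd (pr ! j)"
    have "(\<Sum>g<G. of_nat (wt j g)) = (\<Sum>g<G. 3 - 1 * of_bool (g = ?f) - 1 * of_bool (g = ?e) :: rat)"
      by (rule sum.cong) (use pr_nth[OF j] in \<open>auto simp: wt_def\<close>)
    also have "\<dots> = 3 * of_nat G - 1 - 1"
      unfolding sum_subtractf by (subst (1 2) sum_of_bool_eq) (use pr_nth[OF j] in auto)
    finally have w: "(\<Sum>g<G. of_nat (wt j g)) = (3 * of_nat G - 2 :: rat)" by simp
    have "(\<Sum>l<N. of_bool (Suc l = i) * (1 + (\<Sum>g<G. of_nat (wt l g)))) = (\<Sum>l<N. of_bool (l = j) * (1 + (\<Sum>g<G. of_nat (wt l g))) :: rat)"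
      using Suc by simp
    also have "\<dots> = 1 + (\<Sum>g<G. of_nat (wt j g))" by (subst sum_of_bool_eq) (use j in auto)
    also have "\<dots> = of_nat (3 * G - 1)" unfolding w using m_pos(2) by (simp add: of_nat_diff)
    finally show ?thesis using Suc by (simp add: dem_def)
  qed
  finally show ?thesis .
qed

lemma y_flow: "y \<in> m_flows J"
proof -
  have "nonneg_flow (m_paths J) y"
    unfolding nonneg_flow_def using LJ_mem by (auto intro: flow_of_nonneg)
  then show ?thesis using y_cap y_demand by (auto simp: m_flows_def com_simps)
qed

text \<open>Fewer than \<open>k\<close> arcs, or an arc that is not big, cost at least one unit of
  capacity. If all \<open>k\<close> arcs are big and contain a pair, the unit on \<open>dp i\<close>
  is counted twice in the sum of the arc flows. Otherwise the private and small units are counted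
  exactly and \<open>core_sol\<close> bounds the rest.\<close>

lemma y_scenario:
  assumes S: "S \<subseteq> A" "card S \<le> k"
  shows "interdicted (m_paths J) y S \<le> of_nat k * of_nat M - 1"
proof -
  have fin: "finite S" using S finite_subset finite_A by blast
  have nn: "nonneg_flow (m_paths J) y" using y_flow by (simp add: m_flows_def)
  have flow_le: "(\<Sum>a\<in>S. arc_flow (m_paths J) y a) \<le> (\<Sum>a\<in>S. capacity J a)"
    by (rule sum_mono) (use y_cap S in auto)
  have le: "interdicted (m_paths J) y S \<le> (\<Sum>a\<in>S. arc_flow (m_paths J) y a)"
    by (rule interdicted_le[OF finite_m_paths nn fin])
  have capS: "(\<Sum>a\<in>S. capacity J a) \<le> of_nat (card S) * of_nat M"
    using sum_mono[of S "capacity J" "\<lambda>_. of_nat M"] cap_le S(1) by auto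
  have M1: "(1 :: rat) \<le> of_nat M" using M_bounds by simp
  show ?thesis
  proof (cases "card S = k \<and> (\<forall>a\<in>S. \<exists>g<G. a = (nI g, nO g))")
    case False
    have "(\<Sum>a\<in>S. capacity J a) \<le> of_nat k * of_nat M - 1"
    proof (cases "card S = k")
      case True
      then obtain a where a: "a \<in> S" "\<not> (\<exists>g<G. a = (nI g, nO g))" using False by blast
      have "capacity J a + 2 < of_nat M" using cap_cases[of a] a S by auto
      moreover have "(\<Sum>b\<in>S. capacity J b) = capacity J a + (\<Sum>b\<in>S - {a}. capacity J b)"
        by (rule sum.remove) (use fin a in auto)
      moreover have "(\<Sum>b\<in>S - {a}. capacity J b) \<le> of_nat (card (S - {a})) * of_nat M"
        using sum_mono[of "S - {a}" "capacity J" "\<lambda>_. of_nat M"] cap_le S(1) by auto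
      moreover have "of_nat (card (S - {a})) = (of_nat k - 1 :: rat)"
        using True a(1) fin k by (simp add: of_nat_diff)
      ultimately show ?thesis by (simp add: algebra_simps)
    next
      case False
      then have "card S + 1 \<le> k" using S by simp
      then have "of_nat (card S + 1) * of_nat M \<le> (of_nat k * of_nat M :: rat)"
        by (intro mult_right_mono of_nat_mono) auto
      then show ?thesis using capS M1 by (simp add: algebra_simps)
    qed
    then show ?thesis using le flow_le by linarith
  next
    case True
    define T where "T = {g. g < G \<and> (nI g, nO g) \<in> S}"
    have ST: "S = big T" using True by (auto simp: T_def big_def)
    have T: "T \<subseteq> {..<G}" "card T = k" "finite T"
      using True card_big[of T] by (auto simp: T_def simp flip: ST[unfolded T_def])
    show ?thesis
    proof (cases "indep T")
      case False
      then obtain q where q: "q \<in> set pr" "fst q \<in> T" "snd q \<in> T" by (auto simp: indep_def)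
      then obtain i where i: "i < N" "pr ! i = q" by (auto simp: in_set_conv_nth N_def)
      \<comment> \<open>The path \<open>dp i\<close> has weight at least 1 and contains two arcs of
        \<open>S\<close>: this is the unit gained over the union bound.\<close>
      have "fsum (LJ L) (\<lambda>R. of_bool (R \<inter> S \<noteq> {}) + of_bool (R = dp i)) \<le> fsum (LJ L) (\<lambda>R. \<Sum>a\<in>S. of_bool (a \<in> R))"
      proof (rule fsum_mono)
        fix z assume z: "z \<in> set (LJ L)"
        have "(of_bool (snd z \<inter> S \<noteq> {}) + of_bool (snd z = dp i) :: rat) \<le> (\<Sum>a\<in>S. of_bool (a \<in> snd z))"
        proof (cases "snd z = dp i")
          case True
          let ?B = "{(nI (fst q), nO (fst q)), (nI (snd q), nO (snd q))}"
          have "(2 :: rat) = (\<Sum>a\<in>?B. of_bool (a \<in> snd z))"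
            using prE[OF q(1)] by (simp add: True dp_def i)
          also have "\<dots> \<le> (\<Sum>a\<in>S. of_bool (a \<in> snd z))"
            by (rule sum_mono2) (use fin q ST in \<open>auto simp: big_def\<close>)
          finally show ?thesis by (auto simp: of_bool_def)
        next
          case False
          show ?thesis
          proof (cases "snd z \<inter> S = {}")
            case nonempty: False
            then obtain a where "a \<in> S" "a \<in> snd z" by auto
            then show ?thesis using False member_le_sum[of a S "\<lambda>a. of_bool (a \<in> snd z) :: rat"] fin by auto
          qed (use False in \<open>simp add: sum_nonneg\<close>)
        qed
        then show "0 \<le> fst z \<and> of_bool (snd z \<inter> S \<noteq> {}) + of_bool (snd z = dp i) \<le> (\<Sum>a\<in>S. of_bool (a \<in> snd z) :: rat)"
          using LJ_mem[OF z] by simp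
      qed
      moreover have "fsum (LJ L) (\<lambda>R. \<Sum>a\<in>S. of_bool (a \<in> R)) = (\<Sum>a\<in>S. arc_flow (m_paths J) y a)"
        by (simp add: fsum_sum[OF fin] flow_y)
      moreover have "1 \<le> fsum (LJ L) (\<lambda>R. of_bool (R = dp i))"
      proof -
        have "(1 :: rat) \<le> (\<Sum>j<N. of_bool (dp j = dp i))"
          using member_le_sum[of i "{..<N}" "\<lambda>j. of_bool (dp j = dp i) :: rat"] i by simp
        also have "\<dots> \<le> fsum (LJ L) (\<lambda>R. of_bool (R = dp i))"
          unfolding fsum_LJ sum.distrib
          using L_valid by (auto intro!: add_nonneg_nonneg sum_nonneg fsum_nonneg)
        finally show ?thesis .
      qed
      moreover have "of_nat (card S) = (of_nat k :: rat)" using True by simp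
      ultimately show ?thesis using flow_le capS unfolding interdicted_y fsum_add by simp
    next
      case ind: True
      have c1: "(\<Sum>g<G. of_nat (cz g) * of_bool (sp 0 g \<inter> S \<noteq> {})) = (of_nat k * of_nat c0 + of_nat (card (T - {..<m})) :: rat)"
      proof -
        have "(\<Sum>g<G. of_nat (cz g) * of_bool (sp 0 g \<inter> S \<noteq> {})) = (\<Sum>g<G. if g \<in> T then of_nat (cz g) else (0 :: rat))"
          by (rule sum.cong) (auto simp: ST sp_def big_def)
        also have "\<dots> = (\<Sum>g\<in>T. of_nat (cz g))"
          by (subst sum.inter_restrict[symmetric]) (use T in \<open>auto simp: Int_absorb1\<close>)
        also have "\<dots> = (\<Sum>g\<in>T. of_nat c0 + of_bool (g \<in> T - {..<m}))"
          by (rule sum.cong) (auto simp: cz_def)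
        also have "\<dots> = of_nat k * of_nat c0 + of_nat (card (T - {..<m}))"
          using T by (simp add: sum.distrib Diff_eq Int_def)
        finally show ?thesis .
      qed
      have c2: "fsum L (\<lambda>gs. of_bool (rp gs \<inter> S \<noteq> {})) = fsum L (hit T)"
      proof (rule fsum_cong)
        fix z
        have "rp gs \<inter> big T = (\<lambda>g. (nI g, nO g)) ` (set gs \<inter> T)" for gs by (auto simp: big_def rp_mem)
        then show "of_bool (rp (snd z) \<inter> S \<noteq> {}) = hit T (snd z)" by (simp add: ST hit_def)
      qed
      \<comment> \<open>The unit on \<open>dp i\<close> makes up for a unit missing in
        \<open>wt\<close> at one end of the pair; it is counted once even if both ends lie in
        \<open>T\<close>.\<close>
      have c3: "(of_bool (dp i \<inter> S \<noteq> {}) + (\<Sum>g<G. of_nat (wt i g) * of_bool (sp (Suc i) g \<inter> S \<noteq> {})) :: rat) \<le> 3 * of_nat k"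
        if i: "i < N" for i
      proof -
        let ?f = "fst (pr ! i)" and ?e = "snd (pr ! i)"
        have "(\<Sum>g<G. of_nat (wt i g) * of_bool (sp (Suc i) g \<inter> S \<noteq> {})) = (\<Sum>g<G. if g \<in> T then of_nat (wt i g) else (0 :: rat))"
          by (rule sum.cong) (auto simp: ST sp_def big_def)
        also have "\<dots> = (\<Sum>g\<in>T. of_nat (wt i g))"
          by (subst sum.inter_restrict[symmetric]) (use T in \<open>auto simp: Int_absorb1\<close>)
        also have "\<dots> = (\<Sum>g\<in>T. 3 - 1 * of_bool (g = ?f) - 1 * of_bool (g = ?e) :: rat)"
          by (rule sum.cong) (use pr_nth[OF i] in \<open>auto simp: wt_def\<close>)
        also have "\<dots> = 3 * of_nat k - of_bool (?f \<in> T) - of_bool (?e \<in> T)"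
          unfolding sum_subtractf by (subst (1 2) sum_of_bool_eq) (use T in auto)
        finally have "(\<Sum>g<G. of_nat (wt i g) * of_bool (sp (Suc i) g \<inter> S \<noteq> {})) = (3 * of_nat k - of_bool (?f \<in> T) - of_bool (?e \<in> T) :: rat)" .
        moreover have "dp i \<inter> S \<noteq> {} \<longleftrightarrow> ?f \<in> T \<or> ?e \<in> T" by (auto simp: ST big_def dp_def)
        ultimately show ?thesis by (auto simp: of_bool_def)
      qed
      have "(\<Sum>i<N. of_bool (dp i \<inter> S \<noteq> {}) + (\<Sum>g<G. of_nat (wt i g) * of_bool (sp (Suc i) g \<inter> S \<noteq> {}))) \<le> (\<Sum>i<N. 3 * of_nat k :: rat)"
        by (rule sum_mono) (use c3 in auto)
      moreover have "fsum L (hit T) + of_nat (card (T - {..<m})) \<le> of_nat k - 1"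
        using L T ind by (auto simp: core_sol_def)
      moreover have "of_nat k * of_nat M = (of_nat k * of_nat c0 + of_nat N * (3 * of_nat k) + of_nat k :: rat)"
        by (simp add: M_rat algebra_simps)
      ultimately show ?thesis unfolding interdicted_y fsum_LJ c1 c2 by simp
    qed
  qed
qed

end

theorem core_sound:
  assumes "core_sol L"
  shows "mrf_m_solution J (flow_of (LJ L))"
    and "(\<forall>z\<in>set L. fst z \<in> \<int>) \<Longrightarrow> integral_flow (m_paths J) (flow_of (LJ L))"
proof -
  have "{S. S \<subseteq> A \<and> card S \<le> k} \<noteq> {}" by (auto intro: exI[of _ "{}"])
  moreover have "finite {S. S \<subseteq> A \<and> card S \<le> k}" by (rule finite_subset[of _ "Pow A"]) auto
  ultimately show "mrf_m_solution J (flow_of (LJ L))"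
    using y_flow[OF assms] y_scenario[OF assms] unfolding mrf_m_solution_def max_cap by (auto simp: Max_image_le_iff)
  assume "\<forall>z\<in>set L. fst z \<in> \<int>"
  then have "fst z \<in> \<int>" if "z \<in> set (LJ L)" for z
    using that by (auto simp: LJ_def pair_flow_def)
  then show "integral_flow (m_paths J) (flow_of (LJ L))"
    by (auto simp: integral_flow_def intro: flow_of_Ints)
qed

end

section \<open>Networks with a system of literals\<close>

text \<open>A gadget is described by its tail, its head and a label \<open>(\<kappa>, j, b)\<close>, where \<open>\<kappa>\<close> is 0 for an
  arc of the given network, 1 for the gadgets that carry the value of variable \<open>j\<close> (\<open>b = 1\<close>) or of
  its negation (\<open>b = 0\<close>), 2 for a copy of a literal in a constraint, 3 for padding, and 4 and 5 for
  the special gadgets.\<close>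

type_synonym label = "nat \<times> nat \<times> nat"
type_synonym gadget = "nat \<times> nat \<times> label"

text \<open>A base gadget and a copy of the complementary literal, padded by the
  \<open>k - 2\<close> special gadgets of kind 5, form a clique of size \<open>k\<close>; it limits
  the two flow values to a sum of 1. Kind 4 is compatible with special gadgets only, for otherwise a
  single literal gadget and all \<open>k - 1\<close> special ones would form such a clique and force
  the value 0. Kind 3 is compatible with nothing.\<close>

definition compat :: "(nat \<times> nat \<Rightarrow> nat \<times> nat \<Rightarrow> bool) \<Rightarrow> gadget \<Rightarrow> gadget \<Rightarrow> bool" where
  "compat adj x y \<longleftrightarrow> (let p = fst (snd (snd x)); q = fst (snd (snd y)) in
     (p = 0 \<and> q = 0 \<and> adj (fst x, fst (snd x)) (fst y, fst (snd y)))
     \<or> (p + q = 3 \<and> p \<noteq> 0 \<and> q \<noteq> 0 \<and> fst (snd (snd (snd x))) = fst (snd (snd (snd y)))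
         \<and> snd (snd (snd (snd x))) \<noteq> snd (snd (snd (snd y))))
     \<or> (4 \<le> p \<and> 4 \<le> q)
     \<or> (p = 5 \<and> (q = 1 \<or> q = 2)) \<or> (q = 5 \<and> (p = 1 \<or> p = 2)))"

text \<open>Every entry becomes an exit node fed by one gadget per label, with a prescribed inflow.
  Inflow 1 at a variable makes its two base gadgets complementary. The padding gadgets, of inflow 0,
  guarantee a conflict and hence a small commodity in every instance.\<close>

definition clusters :: "nat \<Rightarrow> nat \<Rightarrow> ((nat \<times> nat) list \<times> nat) list \<Rightarrow> (nat \<times> label list \<times> nat) list" where
  "clusters B V axs = map (\<lambda>z. (B + fst z, snd z)) (enum (([(3, 0, 0), (3, 0, 0)], 0)
     # map (\<lambda>j. ([(1, j, 1), (1, j, 0)], 1)) [0..<V]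
     @ map (\<lambda>z. (map (\<lambda>l. (2, l)) (fst z), snd z)) axs))"

definition items :: "nat \<Rightarrow> nat \<Rightarrow> (nat \<times> label list \<times> nat) list \<Rightarrow> (nat \<times> nat) list \<Rightarrow> gadget list" where
  "items s tn cls outs = concat (map (\<lambda>z. map (\<lambda>l. (s, fst z, l)) (fst (snd z))) cls)
     @ map (\<lambda>l. (s, tn, 2, l)) outs"

definition gadgets :: "nat \<Rightarrow> nat \<Rightarrow> (nat \<times> nat) list \<Rightarrow> (nat \<times> label list \<times> nat) list \<Rightarrow> (nat \<times> nat) list \<Rightarrow> gadget list" where
  "gadgets s tn sa cls outs = map (\<lambda>a. (fst a, snd a, 0, 0, 0)) sa @ items s tn cls outs"

text \<open>The nodes 0 are dummies: special gadgets have indices from \<open>m\<close> on, and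
  network arcs are built only below \<open>m\<close>. The first one is singled out as kind
  4.\<close>

definition specials :: "nat \<Rightarrow> gadget list" where
  "specials k = map (\<lambda>i. (0, 0, if i = 0 then 4 else 5, 0, 0)) [0..<k - 1]"

definition conflicts :: "(nat \<times> nat \<Rightarrow> nat \<times> nat \<Rightarrow> bool) \<Rightarrow> gadget list \<Rightarrow> (nat \<times> nat) list" where
  "conflicts adj full = concat (map (\<lambda>x. map (\<lambda>y. (fst x, fst y))
     (filter (\<lambda>y. fst y < fst x \<and> \<not> compat adj (snd x) (snd y)) (enum full))) (enum full))"

lemma set_conflicts: "(f, e) \<in> set (conflicts adj full) \<longleftrightarrow>
    e < f \<and> f < length full \<and> \<not> compat adj (full ! f) (full ! e)"
proof
  assume "e < f \<and> f < length full \<and> \<not> compat adj (full ! f) (full ! e)"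
  then show "(f, e) \<in> set (conflicts adj full)"
    unfolding conflicts_def
    by (simp, intro bexI[of _ "(f, full ! f)"] image_eqI[of _ _ "(e, full ! e)"]) (auto simp: set_enum)
qed (auto simp: conflicts_def set_enum)

lemma distinct_concat_fst:
  "distinct (map fst xs) \<Longrightarrow> (\<And>x. x \<in> set xs \<Longrightarrow> distinct (F x) \<and> (\<forall>z\<in>set (F x). fst z = fst x)) \<Longrightarrow>
    distinct (concat (map F xs))"
proof (induction xs)
  case (Cons x xs)
  have "set (F x) \<inter> set (concat (map F xs)) = {}"
  proof (intro equals0I)
    fix y assume "y \<in> set (F x) \<inter> set (concat (map F xs))"
    then obtain x' where x': "x' \<in> set xs" "y \<in> set (F x')" "y \<in> set (F x)" by auto
    then have "fst x' = fst x" using Cons.prems(2)[of x] Cons.prems(2)[of x'] by auto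
    then show False using Cons.prems(1) x'(1) by (auto simp: image_iff)
  qed
  then show ?case using Cons by auto
qed simp

lemma map_fst_enum: "map fst (enum xs) = [0..<length xs]"
  by (simp add: enum_def)

lemma distinct_conflicts: "distinct (conflicts adj full)"
  unfolding conflicts_def
proof (rule distinct_concat_fst)
  have d: "distinct (map fst (enum full))" by (simp add: map_fst_enum)
  then show "distinct (map fst (enum full))" .
  fix x :: "nat \<times> gadget"
  have "distinct (map (\<lambda>y. (fst x, fst y)) (filter P (enum full)))" for P
    using d by (auto simp: distinct_map inj_on_def)
  then show "distinct (map (\<lambda>y. (fst x, fst y)) (filter (\<lambda>y. fst y < fst x \<and> \<not> compat adj (snd x) (snd y)) (enum full)))
     \<and> (\<forall>z\<in>set (map (\<lambda>y. (fst x, fst y)) (filter (\<lambda>y. fst y < fst x \<and> \<not> compat adj (snd x) (snd y)) (enum full))). fst z = fst x)"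
    by auto
qed

lemma compat_sym: "(\<And>a b. adj a b \<longleftrightarrow> adj b a) \<Longrightarrow> compat adj x y \<longleftrightarrow> compat adj y x"
  unfolding compat_def Let_def by (auto simp: add.commute)

lemma successively_nthD: "successively R xs \<Longrightarrow> Suc i < length xs \<Longrightarrow> R (xs ! i) (xs ! Suc i)"
  by (induction xs arbitrary: i rule: induct_list012) (auto simp: less_Suc_eq_0_disj)

definition lit :: "(nat \<Rightarrow> rat) \<Rightarrow> nat \<times> nat \<Rightarrow> rat" where
  "lit val l = (if snd l = 1 then val (fst l) else 1 - val (fst l))"

text \<open>\<open>sa\<close> lists the network arcs in topological order, none of them leaving the
  sink \<open>tn\<close>; \<open>c\<close> is the flow required at \<open>tn\<close>, part of which
  may come through the literals in \<open>outs\<close>. Cluster nodes are numbered from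
  \<open>B\<close> on, above all nodes in \<open>nd\<close>.\<close>

locale red =
  fixes k s tn c :: nat and sa :: "(nat \<times> nat) list" and adj :: "nat \<times> nat \<Rightarrow> nat \<times> nat \<Rightarrow> bool"
    and nd :: "nat list" and B V :: nat and axs :: "((nat \<times> nat) list \<times> nat) list" and outs :: "(nat \<times> nat) list"
  assumes k: "1 \<le> k"
    and sa: "\<And>i j. i < length sa \<Longrightarrow> j < length sa \<Longrightarrow> snd (sa ! i) = fst (sa ! j) \<Longrightarrow> i < j"
    and sa_nd: "\<And>a. a \<in> set sa \<Longrightarrow> fst a \<in> set nd \<and> snd a \<in> set nd \<and> fst a \<noteq> tn"
    and nd: "distinct nd" "s \<in> set nd" "tn \<in> set nd" "s \<noteq> tn" "\<And>v. v \<in> set nd \<Longrightarrow> v < B"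
    and adj: "\<And>a b. adj a b \<longleftrightarrow> adj b a"
    and lits: "\<And>z l. z \<in> set axs \<Longrightarrow> l \<in> set (fst z) \<Longrightarrow> fst l < V \<and> snd l < 2"
      "\<And>l. l \<in> set outs \<Longrightarrow> fst l < V \<and> snd l < 2"
begin

definition "cls = clusters B V axs"
definition "il = items s tn cls outs"
definition "gl = gadgets s tn sa cls outs"
definition "full = gl @ specials k"
definition "m = length gl"
definition "md = length sa"
definition "ta g = fst (full ! g)"
definition "he g = fst (snd (full ! g))"
definition "lab g = snd (snd (full ! g))"
definition "exs = (tn, c) # map (\<lambda>z. (fst z, snd (snd z))) cls"
definition "nn = nd @ map fst cls"
definition "prs = conflicts adj full"

lemma compat_comm: "compat adj x y \<longleftrightarrow> compat adj y x"
  using compat_sym[of adj x y] adj by blast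

lemma gl_eq: "gl = map (\<lambda>a. (fst a, snd a, 0, 0, 0)) sa @ il"
  by (simp add: gl_def gadgets_def il_def)

lemma md_le: "md \<le> m" and m_eq: "m = md + length il" by (simp_all add: m_def gl_eq md_def)

lemma full_length: "length full = m + (k - 1)"
  by (simp add: full_def m_def specials_def)

lemma D_gadget: "g < md \<Longrightarrow> full ! g = (fst (sa ! g), snd (sa ! g), 0, 0, 0)"
  by (simp add: full_def gl_eq md_def nth_append)

lemma I_gadget: "i < length il \<Longrightarrow> full ! (md + i) = il ! i"
  by (simp add: full_def gl_eq md_def nth_append)

lemma special_gadget: "m \<le> g \<Longrightarrow> g < m + (k - 1) \<Longrightarrow> full ! g = (0, 0, if g = m then 4 else 5, 0, 0)"
  by (auto simp: full_def m_def nth_append specials_def)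

lemma cls_set: "z \<in> set cls \<Longrightarrow> B \<le> fst z"
  by (auto simp: cls_def clusters_def)

lemma cls_fst: "map fst cls = map (\<lambda>i. B + i) [0..<length cls]"
proof -
  have "map fst (map (\<lambda>z. (B + fst z, snd z)) (enum xs)) = map (\<lambda>i. B + i) [0..<length (map (\<lambda>z. (B + fst z, snd z)) (enum xs))]"
    for xs :: "'x list"
    by (simp add: comp_def map_enum)
  then show ?thesis unfolding cls_def clusters_def by (rule meta_spec)
qed

lemma cls_distinct: "distinct (map fst cls)"
  unfolding cls_fst by (simp add: distinct_map inj_on_def)

lemma cls_snd: "map snd cls = ([(3, 0, 0), (3, 0, 0)], 0)
     # map (\<lambda>j. ([(1, j, 1), (1, j, 0)], 1)) [0..<V]
     @ map (\<lambda>z. (map (\<lambda>l. (2, l)) (fst z), snd z)) axs"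
proof -
  have "map snd (map (\<lambda>z. (B + fst z, snd z)) (enum xs)) = xs" for xs :: "'x list"
    by (simp add: comp_def enum_def)
  then show ?thesis unfolding cls_def clusters_def by (rule meta_spec)
qed

lemma il_mem: "x \<in> set il \<Longrightarrow> fst x = s \<and> (fst (snd x) = tn \<or> fst (snd x) \<in> fst ` set cls)"
  by (force simp: il_def items_def)

lemma cls_items: "z \<in> set cls \<Longrightarrow> l \<in> set (fst (snd z)) \<Longrightarrow>
    l = (3, 0, 0) \<or> (\<exists>j<V. \<exists>b<2. l = (1, j, b)) \<or> (\<exists>j<V. \<exists>b<2. l = (2, j, b))"
proof -
  assume z: "z \<in> set cls" "l \<in> set (fst (snd z))"
  then have "snd z \<in> set (map snd cls)" by simp
  then consider "snd z = ([(3, 0, 0), (3, 0, 0)], 0)" | j where "j < V" "snd z = ([(1, j, 1), (1, j, 0)], 1)"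
    | w where "w \<in> set axs" "snd z = (map (\<lambda>l. (2, l)) (fst w), snd w)"
    unfolding cls_snd by auto
  then show ?thesis
  proof cases
    case 2
    then have "l = (1, j, 1) \<or> l = (1, j, 0)" using z(2) by auto
    then show ?thesis using 2(1) by auto
  next
    case 3
    then obtain l' where l': "l' \<in> set (fst w)" "l = (2, l')" using z(2) by auto
    then have "l = (2, fst l', snd l')" by simp
    then show ?thesis using lits(1)[OF 3(1) l'(1)] by blast
  qed (use z(2) in auto)
qed

lemma cls_B: "v \<in> fst ` set cls \<Longrightarrow> B \<le> v"
  using cls_set by auto

lemma il_lab:
  assumes "x \<in> set il"
  shows "snd (snd x) = (3, 0, 0) \<or> (\<exists>j<V. \<exists>b<2. snd (snd x) = (1, j, b)) \<or> (\<exists>j<V. \<exists>b<2. snd (snd x) = (2, j, b))"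
proof -
  have "(\<exists>z\<in>set cls. \<exists>l\<in>set (fst (snd z)). snd (snd x) = l) \<or> (\<exists>l\<in>set outs. snd (snd x) = (2, l))"
    using assms unfolding il_def items_def by (auto; force)
  then show ?thesis
  proof (elim disjE bexE)
    fix z l assume "z \<in> set cls" "l \<in> set (fst (snd z))" "snd (snd x) = l"
    then show ?thesis using cls_items[of z l] by simp
  next
    fix l assume "l \<in> set outs" "snd (snd x) = (2, l)"
    then have "snd (snd x) = (2, fst l, snd l)" "fst l < V" "snd l < 2" using lits(2)[of l] by auto
    then show ?thesis by blast
  qed
qed

lemma item_simps:
  assumes "md \<le> g" "g < m"
  shows "ta g = s" "he g = tn \<or> he g \<in> fst ` set cls"
    "lab g = (3, 0, 0) \<or> (\<exists>j<V. \<exists>b<2. lab g = (1, j, b)) \<or> (\<exists>j<V. \<exists>b<2. lab g = (2, j, b))"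
proof -
  have i: "g - md < length il" "md + (g - md) = g" using assms m_eq by auto
  have "full ! g \<in> set il" using I_gadget[OF i(1)] i by simp
  from il_mem[OF this] il_lab[OF this]
  show "ta g = s" "he g = tn \<or> he g \<in> fst ` set cls"
    "lab g = (3, 0, 0) \<or> (\<exists>j<V. \<exists>b<2. lab g = (1, j, b)) \<or> (\<exists>j<V. \<exists>b<2. lab g = (2, j, b))"
    unfolding ta_def he_def lab_def by auto
qed

lemma D_simps': "g < md \<Longrightarrow> ta g = fst (sa ! g)" "g < md \<Longrightarrow> he g = snd (sa ! g)" "g < md \<Longrightarrow> lab g = (0, 0, 0)"
  by (auto simp: ta_def he_def lab_def D_gadget)

lemma ta_nd: "g < m \<Longrightarrow> ta g \<in> set nd \<and> ta g \<noteq> tn"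
proof (cases "g < md")
  case True
  then have "sa ! g \<in> set sa" by (simp add: md_def)
  then show ?thesis using sa_nd D_simps'(1)[OF True] by auto
qed (use item_simps(1) nd in auto)

text \<open>Items lead to cluster nodes or to \<open>tn\<close>. No gadget starts at a cluster node,
  and arcs out of \<open>tn\<close> are excluded from \<open>sa\<close>.\<close>

lemma item_no_succ: "md \<le> g \<Longrightarrow> g < m \<Longrightarrow> h < m \<Longrightarrow> he g \<noteq> ta h"
proof
  assume g: "md \<le> g" "g < m" "h < m" "he g = ta h"
  then have "ta h \<in> fst ` set cls" using item_simps(2)[OF g(1,2)] ta_nd[OF g(3)] by auto
  then show False using cls_B[of "ta h"] nd(5)[of "ta h"] ta_nd[OF g(3)] by auto
qed

lemma il_sum: "(\<Sum>g\<in>{md..<m}. f (full ! g)) = (\<Sum>x\<leftarrow>il. f x)" for f :: "gadget \<Rightarrow> rat"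
proof -
  have "(\<Sum>g\<in>{md..<m}. f (full ! g)) = (\<Sum>i<length il. f (full ! (md + i)))"
    unfolding m_eq by (rule sum.reindex_bij_witness[of _ "\<lambda>i. md + i" "\<lambda>g. g - md"]) auto
  also have "\<dots> = (\<Sum>i<length il. f (il ! i))" by (rule sum.cong) (auto simp: I_gadget)
  finally show ?thesis by (simp add: sum_list_sum_nth atLeast0LessThan)
qed

text \<open>The bridge between gadget indices and label lists. Since \<open>F\<close> is arbitrary,
  indicators of labels turn it into statements on the existence of gadgets as well.\<close>

lemma item_sum:
  shows "z \<in> set cls \<Longrightarrow> (\<Sum>g\<in>{md..<m}. F (lab g) * of_bool (he g = fst z)) = (\<Sum>l\<leftarrow>fst (snd z). F l)"
    and "(\<Sum>g\<in>{md..<m}. F (lab g) * of_bool (he g = tn)) = (\<Sum>l\<leftarrow>outs. (F (2, l) :: rat))"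
proof -
  have c: "(\<Sum>x\<leftarrow>concat (map h xs). f x) = (\<Sum>y\<leftarrow>xs. \<Sum>x\<leftarrow>h y. f x)" for h f and xs :: "'x list"
    by (induction xs) auto
  have e: "(\<Sum>g\<in>{md..<m}. F (lab g) * of_bool (he g = v)) = (\<Sum>y\<leftarrow>cls. \<Sum>l\<leftarrow>fst (snd y). F l * of_bool (fst y = v))
      + (\<Sum>l\<leftarrow>outs. F (2, l) * of_bool (tn = v))" for v
  proof -
    have "(\<Sum>g\<in>{md..<m}. F (lab g) * of_bool (he g = v)) = (\<Sum>x\<leftarrow>il. F (snd (snd x)) * of_bool (fst (snd x) = v))"
      using il_sum[of "\<lambda>x. F (snd (snd x)) * of_bool (fst (snd x) = v)"] by (simp add: lab_def he_def)
    then show ?thesis unfolding il_def items_def by (simp add: c comp_def)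
  qed
  have tn: "tn \<noteq> fst y" if "y \<in> set cls" for y using cls_set[OF that] nd(3,5) by force
  show "(\<Sum>g\<in>{md..<m}. F (lab g) * of_bool (he g = tn)) = (\<Sum>l\<leftarrow>outs. F (2, l))"
  proof -
    have "(\<Sum>y\<leftarrow>cls. \<Sum>l\<leftarrow>fst (snd y). F l * of_bool (fst y = tn)) = (\<Sum>y\<leftarrow>cls. 0)"
      by (rule arg_cong[where f = sum_list], rule map_cong[OF refl]) (use tn in \<open>auto simp: of_bool_def\<close>)
    then show ?thesis unfolding e by simp
  qed
  assume z: "z \<in> set cls"
  have "(\<Sum>y\<leftarrow>cls. \<Sum>l\<leftarrow>fst (snd y). F l * of_bool (fst y = fst z)) = (\<Sum>y\<leftarrow>cls. (\<Sum>l\<leftarrow>fst (snd y). F l) * of_bool (y = z))"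
  proof (rule arg_cong[where f = sum_list], rule map_cong[OF refl])
    fix y assume "y \<in> set cls"
    then have "fst y = fst z \<longleftrightarrow> y = z" using z cls_distinct by (auto simp: distinct_map inj_on_def)
    then show "(\<Sum>l\<leftarrow>fst (snd y). F l * of_bool (fst y = fst z)) = (\<Sum>l\<leftarrow>fst (snd y). F l) * of_bool (y = z)"
      by (auto simp: of_bool_def)
  qed
  also have "\<dots> = (\<Sum>y\<in>set cls. (\<Sum>l\<leftarrow>fst (snd y). F l) * of_bool (y = z))"
    using cls_distinct by (intro sum_list_distinct_conv_sum_set) (simp add: distinct_map)
  also have "\<dots> = (\<Sum>l\<leftarrow>fst (snd z). F l)" by (subst sum_of_bool_eq) (use z in auto)
  finally show "(\<Sum>g\<in>{md..<m}. F (lab g) * of_bool (he g = fst z)) = (\<Sum>l\<leftarrow>fst (snd z). F l)"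
    unfolding e using tn[OF z] by simp
qed

lemma pads_conflict: "\<exists>q. q \<in> set prs"
proof -
  obtain z xs where cl: "cls = z # xs" "snd z = ([(3, 0, 0), (3, 0, 0)], 0)"
    using cls_snd by (cases cls) auto
  then have "il = (s, fst z, 3, 0, 0) # (s, fst z, 3, 0, 0) # tl (tl il)" "2 \<le> length il" by (auto simp: il_def items_def)
  then have "il ! 0 = (s, fst z, 3, 0, 0)" "il ! 1 = (s, fst z, 3, 0, 0)" "1 < length il"
    by (metis nth_Cons_0, metis nth_Cons_0 nth_Cons_Suc One_nat_def, simp)
  then have "full ! md = (s, fst z, 3, 0, 0)" "full ! (md + 1) = (s, fst z, 3, 0, 0)" "md + 1 < length full"
    using I_gadget[OF less_trans[OF zero_less_one \<open>1 < length il\<close>]] I_gadget[of 1] by (simp_all add: full_length m_eq)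
  then have "(md + 1, md) \<in> set prs" by (auto simp: prs_def set_conflicts compat_def)
  then show ?thesis by blast
qed

sublocale core k m ta he s exs nn prs
proof
  show "1 \<le> k" by (rule k)
  show "prs \<noteq> []" using pads_conflict by auto
  show "distinct prs" unfolding prs_def by (rule distinct_conflicts)
  show "e < f \<and> e < m \<and> f < m + (k - 1)" if "(f, e) \<in> set prs" for f e
  proof -
    have *: "e < f" "f < m + (k - 1)" "\<not> compat adj (full ! f) (full ! e)"
      using that by (auto simp: prs_def set_conflicts full_length)
    \<comment> \<open>Two special gadgets are compatible, so the smaller member of a conflict is not
      special.\<close>
    have "e < m"
    proof (rule ccontr)
      assume "\<not> e < m"
      then have "full ! e = (0, 0, if e = m then 4 else 5, 0, 0)" "full ! f = (0, 0, if f = m then 4 else 5, 0, 0)"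
      proof -
        have "m \<le> e" "e < m + (k - 1)" "m \<le> f" using * \<open>\<not> e < m\<close> by linarith+
        then show "full ! e = (0, 0, if e = m then 4 else 5, 0, 0)" "full ! f = (0, 0, if f = m then 4 else 5, 0, 0)"
          using special_gadget *(2) by blast+
      qed
      then have "compat adj (full ! f) (full ! e)" by (auto simp: compat_def Let_def)
      then show False using *(3) by simp
    qed
    then show ?thesis using * by simp
  qed
  show "g < h" if "g < m" "h < m" "he g = ta h" for g h
  proof (cases "g < md")
    case True
    show ?thesis
    proof (cases "h < md")
      case h: True
      then show ?thesis using sa[of g h] True that D_simps' by (auto simp: md_def)
    qed (use True in simp)
  qed (use item_no_succ[of g h] that in auto)
  have ndB: "v \<notin> fst ` set cls" if "v \<in> set nd" for v using nd(5)[OF that] cls_set by force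
  show "distinct nn" using nd(1) cls_distinct ndB by (auto simp: nn_def)
  show "s \<in> set nn" using nd by (simp add: nn_def)
  show "ta g \<in> set nn" if "g < m" for g using ta_nd[OF that] by (simp add: nn_def)
  show "he g \<in> set nn" if "g < m" for g
    using item_simps(2)[of g] sa_nd[of "sa ! g"] nd(3) that D_simps'[of g] by (cases "g < md") (auto simp: nn_def md_def)
  have e: "map fst exs = tn # map fst cls" by (simp add: exs_def comp_def)
  then have e': "fst ` set exs = insert tn (fst ` set cls)" by (metis list.set(2) set_map)
  show "fst ` set exs \<subseteq> set nn" unfolding e' nn_def using nd(3) by simp
  show "distinct (map fst exs)" unfolding e using cls_distinct ndB[OF nd(3)] by simp
  show "s \<notin> fst ` set exs" unfolding e' using ndB[OF nd(2)] nd(4) by simp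
qed

lemma indep_iff: "S \<subseteq> {..<G} \<Longrightarrow> indep S \<longleftrightarrow> (\<forall>f\<in>S. \<forall>e\<in>S. f \<noteq> e \<longrightarrow> compat adj (full ! f) (full ! e))"
proof -
  assume S: "S \<subseteq> {..<G}"
  have "indep S \<longleftrightarrow> (\<forall>f\<in>S. \<forall>e\<in>S. e < f \<longrightarrow> compat adj (full ! f) (full ! e))"
  proof -
    have P: "(f, e) \<in> set prs \<longleftrightarrow> e < f \<and> f < length full \<and> \<not> compat adj (full ! f) (full ! e)" for f e
      unfolding prs_def by (rule set_conflicts)
    have "indep S \<longleftrightarrow> (\<forall>f e. (f, e) \<in> set prs \<longrightarrow> \<not> (f \<in> S \<and> e \<in> S))" unfolding indep_def by auto
    moreover have "f < length full" if "f \<in> S" for f using S that unfolding full_length G_def by auto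
    ultimately show ?thesis unfolding P by blast
  qed
  also have "\<dots> \<longleftrightarrow> (\<forall>f\<in>S. \<forall>e\<in>S. f \<noteq> e \<longrightarrow> compat adj (full ! f) (full ! e))"
    using compat_comm by (metis linorder_neqE_nat less_irrefl)
  finally show ?thesis .
qed

definition dvalid :: "nat list \<Rightarrow> bool" where
  "dvalid gs \<longleftrightarrow> gs \<noteq> [] \<and> set gs \<subseteq> {..<md} \<and> successively (\<lambda>g h. snd (sa ! g) = fst (sa ! h)) gs
     \<and> fst (sa ! hd gs) = s \<and> snd (sa ! last gs) = tn"

definition dsol :: "(rat \<times> nat list) list \<Rightarrow> rat \<Rightarrow> bool" where
  "dsol L v \<longleftrightarrow> (\<forall>z\<in>set L. 0 \<le> fst z \<and> dvalid (snd z)) \<and> fsum L (\<lambda>_. 1) = v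
     \<and> (\<forall>g<md. fsum L (hit {g}) \<le> 1)
     \<and> (\<forall>S\<subseteq>{..<md}. card S = k \<longrightarrow> (\<forall>g\<in>S. \<forall>h\<in>S. g \<noteq> h \<longrightarrow> adj (sa ! g) (sa ! h)) \<longrightarrow>
          fsum L (hit S) \<le> of_nat k - 1)"

text \<open>An item has no successor. It has no predecessor either: items start at the root
  \<open>s\<close>, so the predecessor would lead back to the tail of the first gadget and precede
  it in the topological order.\<close>

lemma cvalid_cases:
  assumes "cvalid gs"
  shows "(\<exists>g. md \<le> g \<and> g < m \<and> gs = [g]) \<or> dvalid gs"
proof -
  have gs: "gs \<noteq> []" "set gs \<subseteq> {..<m}" "successively nx gs" "ta (hd gs) = s" "he (last gs) \<in> fst ` set exs"
    using assms by (auto simp: cvalid_def)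
  have sorted: "sorted_wrt (<) gs"
    using successively_mono[of nx gs "(<)"] gs(3) topo
    by (auto simp: successively_conv_sorted_wrt[OF transp_on_less, symmetric] nx_def)
  have nxi: "nx (gs ! i) (gs ! Suc i)" if "Suc i < length gs" for i
    using successively_nthD[OF gs(3) that] .
  show ?thesis
  proof (cases "md \<le> hd gs")
    case True
    have "length gs = 1"
    proof (rule ccontr)
      assume "length gs \<noteq> 1"
      then have "Suc 0 < length gs" using gs(1) by (cases gs) auto
      from nxi[OF this] have "nx (hd gs) (gs ! 1)" using gs(1) by (simp add: hd_conv_nth)
      then show False using item_no_succ[of "hd gs" "gs ! 1"] True by (auto simp: nx_def)
    qed
    then obtain g where "gs = [g]" by (metis One_nat_def length_0_conv length_Suc_conv)
    then show ?thesis using True gs(2) by auto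
  next
    case False
    have D: "gs ! i < md" if "i < length gs" for i
    proof (cases i)
      case 0 then show ?thesis using False gs(1) by (simp add: hd_conv_nth)
    next
      case (Suc i')
      show ?thesis
      proof (rule ccontr)
        assume "\<not> gs ! i < md"
        then have "ta (gs ! i) = s" using item_simps(1)[of "gs ! i"] gs(2) that by (meson lessThan_iff not_le nth_mem subsetD)
        moreover have n: "nx (gs ! i') (gs ! i)" using nxi[of i'] Suc that by simp
        ultimately have "he (gs ! i') = ta (hd gs)" using gs(4) by (simp add: nx_def)
        moreover have "hd gs < m" using gs(1,2) by (auto dest: hd_in_set)
        ultimately have "gs ! i' < hd gs" using topo[of "gs ! i'" "hd gs"] n by (simp add: nx_def)
        moreover have "hd gs \<le> gs ! i'"
          using sorted_wrt_nth_less[OF sorted, of 0 i'] Suc that gs(1) by (cases i') (auto simp: hd_conv_nth)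
        ultimately show False by simp
      qed
    qed
    then have sub: "set gs \<subseteq> {..<md}" by (auto simp: in_set_conv_nth)
    then have l: "last gs < md" "hd gs < md" using subsetD[OF sub last_in_set[OF gs(1)]] subsetD[OF sub hd_in_set[OF gs(1)]] by auto
    have "he (last gs) = tn"
      using gs(5) l(1) sa_nd[of "sa ! last gs"] nd(5) cls_set by (fastforce simp: exs_def D_simps' md_def)
    moreover have "successively (\<lambda>g h. snd (sa ! g) = fst (sa ! h)) gs"
      by (rule successively_mono[OF gs(3)]) (use sub in \<open>auto simp: nx_def D_simps' subset_iff\<close>)
    ultimately show ?thesis using gs(1,4) sub l by (simp add: dvalid_def D_simps')
  qed
qed

lemma dvalid_cvalid: "dvalid gs \<Longrightarrow> cvalid gs \<and> he (last gs) = tn"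
proof -
  assume gs: "dvalid gs"
  then have l: "last gs < md" "hd gs < md"
    unfolding dvalid_def by (meson last_in_set hd_in_set lessThan_iff subsetD)+
  have "successively nx gs"
    by (rule successively_mono[where P = "\<lambda>g h. snd (sa ! g) = fst (sa ! h)"])
      (use gs md_le in \<open>auto simp: dvalid_def nx_def D_simps' subset_iff\<close>)
  moreover have "ta (hd gs) = s" "he (last gs) = tn"
    unfolding D_simps'(1)[OF l(2)] D_simps'(2)[OF l(1)] using gs by (simp_all add: dvalid_def)
  moreover have "gs \<noteq> []" "set gs \<subseteq> {..<m}" using gs md_le by (auto simp: dvalid_def)
  moreover have "tn \<in> fst ` set exs" by (simp add: exs_def)
  ultimately show ?thesis by (simp only: cvalid_def) simp
qed

text \<open>Labels of kind 1 come from the variable clusters only, and there each occurs once; the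
  positions of a duplicate would show up in the filtered list of labels.\<close>

lemma base_unique:
  assumes "md \<le> g" "g < m" "md \<le> h" "h < m" "lab g = (1, j, b)" "lab h = (1, j, b)"
  shows "g = h"
proof -
  have f: "filter P (concat (map F xs)) = concat (map (\<lambda>x. filter P (F x)) xs)" for P and F :: "'x \<Rightarrow> 'y list" and xs
    by (induction xs) auto
  have "map (\<lambda>x. snd (snd x)) il = concat (map (\<lambda>z. fst z) (map snd cls)) @ map (\<lambda>l. (2, l)) outs"
    by (simp add: il_def items_def map_concat comp_def)
  then have "filter (\<lambda>l. fst l = 1) (map (\<lambda>x. snd (snd x)) il) = concat (map (\<lambda>j. [(1, j, 1), (1, j, 0)]) [0..<V])"
    unfolding cls_snd by (simp add: f comp_def filter_map)
  moreover have "distinct (concat (map (\<lambda>j. [(1 :: nat, j, 1 :: nat), (1, j, 0)]) [0..<n]))" for n :: nat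
    by (induction n) auto
  ultimately have d: "distinct (filter (\<lambda>l. fst l = 1) (map (\<lambda>x. snd (snd x)) il))" by simp
  have dn: "i = i'" if "distinct (filter P xs)" "i < length xs" "i' < length xs" "xs ! i = xs ! i'" "P (xs ! i)"
    for P and xs :: "'z list" and i i'
    using that
  proof (induction xs arbitrary: i i')
    case (Cons x xs)
    show ?case
    proof (cases i; cases i')
      fix a assume "i = 0" "i' = Suc a"
      then show ?thesis using Cons.prems nth_mem[of a xs] by (auto split: if_splits)
    next
      fix a assume "i = Suc a" "i' = 0"
      then show ?thesis using Cons.prems nth_mem[of a xs] by (auto split: if_splits)
    next
      fix a b assume ab: "i = Suc a" "i' = Suc b"
      have "a = b" by (rule Cons.IH) (use Cons.prems ab in \<open>auto split: if_splits\<close>)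
      then show ?thesis using ab by simp
    qed auto
  qed simp
  have "g - md = h - md"
    by (rule dn[OF d]) (use assms m_eq I_gadget[of "g - md"] I_gadget[of "h - md"] in \<open>auto simp: lab_def\<close>)
  then show ?thesis using assms by simp
qed

lemma sum_single:
  "cvalid gs \<Longrightarrow> of_bool (he (last gs) = v) = (\<Sum>g\<in>{md..<m}. of_bool (he g = v) * hit {g} gs) + of_bool (v = tn) * of_bool (dvalid gs)"
proof -
  assume "cvalid gs"
  from cvalid_cases[OF this] show ?thesis
  proof
    assume "\<exists>g. md \<le> g \<and> g < m \<and> gs = [g]"
    then obtain g where g: "md \<le> g" "g < m" "gs = [g]" by blast
    have "(\<Sum>h\<in>{md..<m}. of_bool (he h = v) * hit {h} gs) = (\<Sum>h\<in>{md..<m}. of_bool (he h = v) * of_bool (h = g))"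
      by (rule sum.cong) (auto simp: hit_def g)
    also have "\<dots> = of_bool (he g = v)" by (subst sum_of_bool_eq) (use g in auto)
    finally show ?thesis using g by (simp add: dvalid_def)
  next
    assume d: "dvalid gs"
    have "(\<Sum>h\<in>{md..<m}. of_bool (he h = v) * hit {h} gs) = 0"
      by (rule sum.neutral) (use d in \<open>auto simp: hit_def dvalid_def\<close>)
    then show ?thesis using d dvalid_cvalid[OF d] by auto
  qed
qed

lemma weak_specials: "2 \<le> k \<Longrightarrow> g \<in> {m + 1..<G} \<Longrightarrow> fst (snd (snd (full ! g))) = 5"
proof -
  assume "g \<in> {m + 1..<G}"
  then have "m \<le> g" "g < m + (k - 1)" "g \<noteq> m" unfolding G_def by auto
  then show ?thesis using special_gadget[of g] by simp
qed

text \<open>By \<open>cvalid_cases\<close> the weight splits into network chains, collected in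
  \<open>LD\<close>, and single items, so for an item \<open>X g\<close> is just the flow on that
  gadget. Each claim reads one condition of \<open>core_sol\<close> on one of the two parts.\<close>

lemma core_sol_necessary:
  assumes L: "core_sol L"
  defines "LD \<equiv> filter (\<lambda>z. dvalid (snd z)) L" and "X \<equiv> \<lambda>g. fsum L (hit {g})"
  shows "dsol LD (fsum LD (\<lambda>_. 1))"
    and "fsum LD (\<lambda>_. 1) + (\<Sum>g\<in>{md..<m}. X g * of_bool (he g = tn)) = of_nat c"
    and "z \<in> set cls \<Longrightarrow> (\<Sum>g\<in>{md..<m}. X g * of_bool (he g = fst z)) = of_nat (snd (snd z))"
    and "0 \<le> X g"
    and "k = 1 \<Longrightarrow> g < m \<Longrightarrow> X g = 0"
    and "2 \<le> k \<Longrightarrow> md \<le> g \<Longrightarrow> g < m \<Longrightarrow> md \<le> h \<Longrightarrow> h < m \<Longrightarrow> g \<noteq> h \<Longrightarrow> compat adj (full ! g) (full ! h) \<Longrightarrow>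
       {fst (lab g), fst (lab h)} \<subseteq> {1, 2} \<Longrightarrow> X g + X h \<le> 1"
proof -
  have v: "0 \<le> fst z" "cvalid (snd z)" if "z \<in> set L" for z using L that by (auto simp: core_sol_def)
  have ex: "(\<Sum>g\<in>{md..<m}. X g * of_bool (he g = v)) + of_bool (v = tn) * fsum LD (\<lambda>_. 1) = of_nat cap" if "(v, cap) \<in> set exs" for v cap
  proof -
    have "of_nat cap = fsum L (\<lambda>gs. of_bool (he (last gs) = v))" using L that by (force simp: core_sol_def)
    also have "\<dots> = fsum L (\<lambda>gs. (\<Sum>g\<in>{md..<m}. of_bool (he g = v) * hit {g} gs) + of_bool (v = tn) * of_bool (dvalid gs))"
      by (rule fsum_cong) (rule sum_single[OF v(2)])
    also have "\<dots> = (\<Sum>g\<in>{md..<m}. of_bool (he g = v) * X g) + of_bool (v = tn) * fsum L (\<lambda>gs. of_bool (dvalid gs))"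
      by (simp add: fsum_add fsum_sum fsum_cmult X_def)
    also have "fsum L (\<lambda>gs. of_bool (dvalid gs)) = fsum LD (\<lambda>_. 1)" unfolding LD_def fsum_filter by simp
    finally show ?thesis by (simp add: mult.commute)
  qed
  show "fsum LD (\<lambda>_. 1) + (\<Sum>g\<in>{md..<m}. X g * of_bool (he g = tn)) = of_nat c"
    using ex[of tn c] by (simp add: exs_def)
  show "(\<Sum>g\<in>{md..<m}. X g * of_bool (he g = fst z)) = of_nat (snd (snd z))" if "z \<in> set cls"
  proof -
    have "fst z \<noteq> tn" using cls_set[OF that] nd(3,5) by force
    then show ?thesis using ex[of "fst z" "snd (snd z)"] that by (force simp: exs_def)
  qed
  show "0 \<le> X g" for g unfolding X_def by (rule fsum_nonneg) (use v in \<open>auto simp: hit_def\<close>)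
  have LDle: "fsum LD (hit S) \<le> fsum L (hit S)" for S
    unfolding LD_def fsum_filter by (rule fsum_mono) (use v in \<open>auto simp: hit_def\<close>)
  have sc: "fsum L (hit S) + of_nat (card (S - {..<m})) \<le> of_nat k - 1" if "S \<subseteq> {..<G}" "card S = k" "indep S" for S
    using L that by (auto simp: core_sol_def)
  show "dsol LD (fsum LD (\<lambda>_. 1))"
    unfolding dsol_def
  proof (intro conjI ballI allI impI)
    fix g assume "g < md"
    then have "fsum L (hit {g}) \<le> 1" using L md_le by (auto simp: core_sol_def)
    then show "fsum LD (hit {g}) \<le> 1" using LDle[of "{g}"] by linarith
  next
    fix S assume S: "S \<subseteq> {..<md}" "card S = k" "\<forall>g\<in>S. \<forall>h\<in>S. g \<noteq> h \<longrightarrow> adj (sa ! g) (sa ! h)"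
    have SG: "S \<subseteq> {..<G}" "S \<subseteq> {..<m}" using S(1) md_le by (auto simp: G_def)
    have "indep S" unfolding indep_iff[OF SG(1)] using S by (auto simp: compat_def D_gadget subset_iff)
    from sc[OF SG(1) S(2) this] have "fsum L (hit S) \<le> of_nat k - 1" by linarith
    then show "fsum LD (hit S) \<le> of_nat k - 1" using LDle[of S] by linarith
  qed (use v in \<open>auto simp: LD_def\<close>)
  show "X g = 0" if "k = 1" "g < m"
  proof -
    have gG: "{g} \<subseteq> {..<G}" using that(2) unfolding G_def by simp
    have "indep {g}" unfolding indep_iff[OF gG] by simp
    moreover have "card {g} = k" using that(1) by simp
    ultimately have "fsum L (hit {g}) + of_nat (card ({g} - {..<m})) \<le> of_nat k - 1" by (intro sc gG)
    then have "X g \<le> 0" unfolding X_def that(1) by simp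
    then show ?thesis using \<open>\<And>g. 0 \<le> X g\<close>[of g] by simp
  qed
  show "X g + X h \<le> 1" if gh: "2 \<le> k" "md \<le> g" "g < m" "md \<le> h" "h < m" "g \<noteq> h" "compat adj (full ! g) (full ! h)"
       "{fst (lab g), fst (lab h)} \<subseteq> {1, 2}"
  proof -
    \<comment> \<open>Index \<open>m\<close> is the special gadget of kind 4; the
      \<open>k - 2\<close> special gadgets after it are of kind 5 and pad the pair to size
      \<open>k\<close>.\<close>
    let ?S = "{g, h} \<union> {m + 1..<G}"
    have S: "?S \<subseteq> {..<G}" "card ?S = k" "?S - {..<m} = {m + 1..<G}"
      using gh by (auto simp: G_def)
    have "indep ?S" unfolding indep_iff[OF S(1)]
    proof (intro ballI impI)
      fix f e assume fe: "f \<in> ?S" "e \<in> ?S" "f \<noteq> e"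
      have w: "compat adj (full ! a) (full ! b) \<and> compat adj (full ! b) (full ! a)" if "a \<in> {m + 1..<G}" "b \<in> ?S" for a b
      proof -
        have "fst (snd (snd (full ! a))) = 5" "fst (snd (snd (full ! b))) \<in> {1, 2, 5}"
          using weak_specials[OF gh(1)] that gh(8) by (auto simp: lab_def)
        then show ?thesis by (auto simp: compat_def Let_def)
      qed
      show "compat adj (full ! f) (full ! e)"
      proof (cases "f \<in> {m + 1..<G} \<or> e \<in> {m + 1..<G}")
        case False
        then show ?thesis using fe gh(7) compat_comm[of "full ! g" "full ! h"] by auto
      qed (use w fe in blast)
    qed
    from sc[OF S(1,2) this] have "fsum L (hit ?S) + of_nat (k - 2) \<le> of_nat k - 1"
      unfolding S(3) by (simp add: G_def numeral_2_eq_2)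
    then have "fsum L (hit ?S) \<le> 1" using gh(1) by (simp add: of_nat_diff)
    \<comment> \<open>A chain through an item consists of that item, so no chain is counted for both
      \<open>g\<close> and \<open>h\<close>.\<close>
    moreover have "X g + X h \<le> fsum L (hit ?S)"
      unfolding X_def fsum_add[symmetric]
    proof (rule fsum_mono)
      fix z assume z: "z \<in> set L"
      from cvalid_cases[OF v(2)[OF z]]
      have "hit {g} (snd z) + hit {h} (snd z) \<le> hit ?S (snd z)"
        using gh by (auto simp: hit_def dvalid_def subset_iff)
      then show "0 \<le> fst z \<and> hit {g} (snd z) + hit {h} (snd z) \<le> hit ?S (snd z)" using v[OF z] by simp
    qed
    ultimately show ?thesis by linarith
  qed
qed

end

section \<open>Valuations from core solutions and back\<close>

context red
begin

text \<open>\<open>item_sum\<close> is applied to the indicator of the labels outside the list: the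
  list side vanishes, so no gadget with this head can have such a label.\<close>

lemma head_items:
  assumes g: "md \<le> g" "g < m"
  shows "z \<in> set cls \<Longrightarrow> he g = fst z \<Longrightarrow> lab g \<in> set (fst (snd z))"
    and "he g = tn \<Longrightarrow> \<exists>l\<in>set outs. lab g = (2, l)"
proof -
  have nn: "(\<Sum>h\<in>{md..<m}. of_bool (Q (lab h)) * of_bool (he h = v)) = (0 :: rat) \<Longrightarrow> he g = v \<Longrightarrow> \<not> Q (lab g)" for Q v
    using sum_nonneg_eq_0_iff[of "{md..<m}" "\<lambda>h. of_bool (Q (lab h)) * of_bool (he h = v) :: rat"] g by auto
  have z0: "(\<Sum>x\<leftarrow>xs. f x) = (0 :: rat)" if "\<And>x. x \<in> set xs \<Longrightarrow> f x = 0" for f and xs :: "'x list"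
    using that by (induction xs) auto
  show "lab g \<in> set (fst (snd z))" if z: "z \<in> set cls" "he g = fst z"
  proof -
    have "(\<Sum>h\<in>{md..<m}. of_bool (lab h \<notin> set (fst (snd z))) * of_bool (he h = fst z)) = (0 :: rat)"
      unfolding item_sum(1)[OF z(1), of "\<lambda>l. of_bool (l \<notin> set (fst (snd z)))"] by (rule z0) simp
    from nn[OF this z(2)] show ?thesis by simp
  qed
  show "\<exists>l\<in>set outs. lab g = (2, l)" if "he g = tn"
  proof -
    have "(\<Sum>h\<in>{md..<m}. of_bool (lab h \<notin> (\<lambda>l. (2, l)) ` set outs) * of_bool (he h = tn)) = (0 :: rat)"
      unfolding item_sum(2)[of "\<lambda>l. of_bool (l \<notin> (\<lambda>l. (2, l)) ` set outs)"] by (rule z0) auto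
    from nn[OF this that] show ?thesis by auto
  qed
qed

lemma base_cluster: "j < V \<Longrightarrow> \<exists>z\<in>set cls. snd z = ([(1, j, 1), (1, j, 0)], 1)"
proof -
  assume "j < V"
  then have "([(1, j, 1), (1, j, 0)], 1) \<in> set (map snd cls)" unfolding cls_snd by auto
  then show ?thesis by force
qed

lemma base_exists:
  assumes z: "z \<in> set cls" "snd z = ([(1, j, 1), (1, j, 0)], 1)" and b: "b < 2"
  shows "\<exists>g. md \<le> g \<and> g < m \<and> lab g = (1, j, b) \<and> he g = fst z"
proof (rule ccontr)
  assume "\<not> ?thesis"
  then have "(\<Sum>h\<in>{md..<m}. of_bool (lab h = (1, j, b)) * of_bool (he h = fst z)) = (0 :: rat)"
    by (intro sum.neutral) auto
  then have "(\<Sum>l\<leftarrow>fst (snd z). of_bool (l = (1, j, b))) = (0 :: rat)"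
    using item_sum(1)[OF z(1), of "\<lambda>l. of_bool (l = (1, j, b))"] by simp
  moreover have "b = 0 \<or> b = 1" using b by auto
  ultimately show False by (auto simp: z(2))
qed

text \<open>A variable takes the flow value of its positive base gadget. A copy of a literal and the
  base gadget of the complementary literal carry at most 1 together, while the two base gadgets
  carry exactly 1; so a copy carries at most the value of its literal. Hence the prescribed inflows
  become lower bounds on sums of literals.\<close>

lemma core_sol_literals:
  assumes L: "core_sol L" and V: "0 < V \<or> outs \<noteq> [] \<Longrightarrow> 2 \<le> k"
  defines "LD \<equiv> filter (\<lambda>z. dvalid (snd z)) L"
  shows "\<exists>val. (\<forall>j<V. 0 \<le> val j \<and> val j \<le> 1)
     \<and> (\<forall>z\<in>set axs. of_nat (snd z) \<le> (\<Sum>l\<leftarrow>fst z. lit val l))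
     \<and> of_nat c \<le> fsum LD (\<lambda>_. 1) + (\<Sum>l\<leftarrow>outs. lit val l)
     \<and> ((\<forall>z\<in>set L. fst z \<in> \<int>) \<longrightarrow> (\<forall>j<V. val j \<in> \<int>))"
proof -
  define X where "X g = fsum L (hit {g})" for g
  note nec = core_sol_necessary[OF L, folded LD_def X_def]
  define \<beta> where "\<beta> j b = (SOME g. md \<le> g \<and> g < m \<and> lab g = (1, j, b))" for j b
  have \<beta>: "md \<le> \<beta> j b" "\<beta> j b < m" "lab (\<beta> j b) = (1, j, b)" if jV: "j < V" "b < 2" for j b
  proof -
    obtain z where "z \<in> set cls" "snd z = ([(1, j, 1), (1, j, 0)], 1)" using base_cluster[OF jV(1)] by blast
    from base_exists[OF this jV(2)] have "\<exists>g. md \<le> g \<and> g < m \<and> lab g = (1, j, b)" by blast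
    from someI_ex[OF this] show "md \<le> \<beta> j b" "\<beta> j b < m" "lab (\<beta> j b) = (1, j, b)" unfolding \<beta>_def by blast+
  qed
  define val where "val j = X (\<beta> j 1)" for j
  have pair: "X (\<beta> j 1) + X (\<beta> j 0) = 1" if j: "j < V" for j
  proof -
    obtain z where z: "z \<in> set cls" "snd z = ([(1, j, 1), (1, j, 0)], 1)" using base_cluster[OF j] by blast
    \<comment> \<open>\<open>item_sum\<close> needs the flow as a function of the label. For base
      gadgets it is one, by \<open>base_unique\<close>.\<close>
    let ?F = "\<lambda>l :: label. X (\<beta> (fst (snd l)) (snd (snd l)))"
    have "1 = (\<Sum>g\<in>{md..<m}. X g * of_bool (he g = fst z))" using nec(3)[OF z(1)] z(2) by simp
    also have "\<dots> = (\<Sum>g\<in>{md..<m}. ?F (lab g) * of_bool (he g = fst z))"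
    proof (rule sum.cong[OF refl])
      fix g assume g: "g \<in> {md..<m}"
      show "X g * of_bool (he g = fst z) = ?F (lab g) * of_bool (he g = fst z)"
      proof (cases "he g = fst z")
        case True
        then have "lab g = (1, j, 1) \<or> lab g = (1, j, 0)" using head_items(1)[OF _ _ z(1), of g] g z(2) by auto
        then obtain b where b: "b < 2" "lab g = (1, j, b)" by auto
        have "g = \<beta> j b" by (rule base_unique[OF _ _ _ _ b(2)]) (use g \<beta>[OF j b(1)] in auto)
        then show ?thesis using b by simp
      qed simp
    qed
    also have "\<dots> = X (\<beta> j 1) + X (\<beta> j 0)" by (subst item_sum(1)[OF z(1)]) (simp add: z(2))
    finally show ?thesis by simp
  qed
  have aux: "X g \<le> lit val (snd (lab g))" if g: "md \<le> g" "g < m" "lab g = (2, l)" for g l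
  proof -
    obtain j b where jb: "l = (j, b)" "j < V" "b < 2" using item_simps(3)[OF g(1,2)] g(3) by auto
    define b' where "b' = 1 - b"
    have b': "b' < 2" "b \<noteq> b'" using jb(3) unfolding b'_def by presburger+
    have k2: "2 \<le> k" using V jb(2) by auto
    have "X g + X (\<beta> j b') \<le> 1"
    proof (rule nec(6)[OF k2 g(1,2) \<beta>(1,2)[OF jb(2) b'(1)]])
      show "g \<noteq> \<beta> j b'" using g(3) \<beta>(3)[OF jb(2) b'(1)] by auto
      show "compat adj (full ! g) (full ! \<beta> j b')"
        using g(3) \<beta>(3)[OF jb(2) b'(1)] b'(2) by (auto simp: compat_def Let_def lab_def jb(1))
      show "{fst (lab g), fst (lab (\<beta> j b'))} \<subseteq> {1, 2}" using g(3) \<beta>(3)[OF jb(2) b'(1)] by simp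
    qed
    moreover have "b = 0 \<or> b = 1" using jb(3) by auto
    ultimately show ?thesis using pair[OF jb(2)] by (auto simp: lit_def val_def g(3) jb(1) b'_def)
  qed
  have "0 \<le> val j \<and> val j \<le> 1" if "j < V" for j
    using pair[OF that] nec(4)[of "\<beta> j 1"] nec(4)[of "\<beta> j 0"] unfolding val_def by linarith
  moreover have "of_nat (snd w) \<le> (\<Sum>l\<leftarrow>fst w. lit val l)" if w: "w \<in> set axs" for w
  proof -
    have "(map (\<lambda>l. (2, l)) (fst w), snd w) \<in> set (map snd cls)" unfolding cls_snd using w by auto
    then obtain z where z: "z \<in> set cls" "snd z = (map (\<lambda>l. (2, l)) (fst w), snd w)" by auto
    have "of_nat (snd w) = (\<Sum>g\<in>{md..<m}. X g * of_bool (he g = fst z))" using nec(3)[OF z(1)] z(2) by simp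
    also have "\<dots> \<le> (\<Sum>g\<in>{md..<m}. lit val (snd (lab g)) * of_bool (he g = fst z))"
    proof (rule sum_mono)
      fix g assume g: "g \<in> {md..<m}"
      show "X g * of_bool (he g = fst z) \<le> lit val (snd (lab g)) * of_bool (he g = fst z)"
      proof (cases "he g = fst z")
        case True
        then obtain l where "lab g = (2, l)" using head_items(1)[OF _ _ z(1), of g] g z(2) by auto
        then show ?thesis using aux[of g l] g by (auto simp: of_bool_def)
      qed simp
    qed
    also have "\<dots> = (\<Sum>l\<leftarrow>fst w. lit val l)"
      by (subst item_sum(1)[OF z(1), of "\<lambda>l. lit val (snd l)"]) (simp add: z(2) comp_def)
    finally show ?thesis .
  qed
  moreover have "of_nat c \<le> fsum LD (\<lambda>_. 1) + (\<Sum>l\<leftarrow>outs. lit val l)"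
  proof -
    have "(\<Sum>g\<in>{md..<m}. X g * of_bool (he g = tn)) \<le> (\<Sum>g\<in>{md..<m}. lit val (snd (lab g)) * of_bool (he g = tn))"
    proof (rule sum_mono)
      fix g assume g: "g \<in> {md..<m}"
      show "X g * of_bool (he g = tn) \<le> lit val (snd (lab g)) * of_bool (he g = tn)"
      proof (cases "he g = tn")
        case True
        then obtain l where "lab g = (2, l)" using head_items(2)[of g] g by auto
        then show ?thesis using aux[of g l] g by (auto simp: of_bool_def)
      qed simp
    qed
    also have "\<dots> = (\<Sum>l\<leftarrow>outs. lit val l)"
      by (subst item_sum(2)[of "\<lambda>l. lit val (snd l)"]) simp
    finally show ?thesis using nec(2) by linarith
  qed
  moreover have "val j \<in> \<int>" if "\<forall>z\<in>set L. fst z \<in> \<int>" for j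
    unfolding val_def X_def by (rule fsum_Ints) (use that in \<open>auto simp: hit_def of_bool_def\<close>)
  ultimately show ?thesis by blast
qed

text \<open>With budget 1 every single gadget is a scenario with bound 0 and carries nothing, but a
  variable cluster asks for inflow 1.\<close>

lemma core_sol_k1: "core_sol L \<Longrightarrow> k = 1 \<Longrightarrow> V = 0"
proof (rule ccontr)
  assume L: "core_sol L" and k: "k = 1" and "V \<noteq> 0"
  then obtain z where z: "z \<in> set cls" "snd z = ([(1, 0, 1), (1, 0, 0)], 1)" using base_cluster[of 0] by auto
  have "(\<Sum>g\<in>{md..<m}. fsum L (hit {g}) * of_bool (he g = fst z)) = 0"
    by (rule sum.neutral) (use core_sol_necessary(5)[OF L k] in auto)
  then show False using core_sol_necessary(3)[OF L z(1)] z(2) by simp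
qed

definition weight :: "(nat \<Rightarrow> rat) \<Rightarrow> label \<Rightarrow> rat" where
  "weight val l = (if fst l = 3 then 0 else lit val (snd l))"

text \<open>Every copy gets exactly the value of its literal. A set of \<open>k\<close> pairwise
  compatible gadgets lies in the network, or is a single padding gadget, or consists of a base
  gadget, a copy of the complementary literal and \<open>k - 2\<close> special gadgets of kind 5.
  With kind 4 it would contain special gadgets only, which are too few. In the literal case the two
  values add up to 1, as the bound allows.\<close>

lemma core_sol_sufficient:
  assumes LD: "dsol LD v" and val: "\<And>j. j < V \<Longrightarrow> 0 \<le> val j \<and> val j \<le> 1"
    and axs: "\<And>z. z \<in> set axs \<Longrightarrow> (\<Sum>l\<leftarrow>fst z. lit val l) = of_nat (snd z)"
    and c: "v + (\<Sum>l\<leftarrow>outs. lit val l) = of_nat c"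
    and V: "0 < V \<Longrightarrow> 2 \<le> k"
  shows "core_sol (LD @ map (\<lambda>g. (weight val (lab g), [g])) [md..<m])"
proof -
  let ?W = "\<lambda>g. weight val (lab g)"
  let ?LW = "map (\<lambda>g. (?W g, [g])) [md..<m]"
  have W01: "0 \<le> ?W g \<and> ?W g \<le> 1" if "md \<le> g" "g < m" for g
    using item_simps(3)[OF that] val by (auto simp: weight_def lit_def)
  have d: "0 \<le> fst z" "dvalid (snd z)" if "z \<in> set LD" for z using LD that by (auto simp: dsol_def)
  have fW: "fsum ?LW F = (\<Sum>g\<in>{md..<m}. ?W g * F [g])" for F
    by (simp add: fsum_def comp_def interv_sum_list_conv_sum_set_nat)
  have Dhit: "fsum LD (hit S) = 0" if "S \<inter> {..<md} = {}" for S
    by (rule fsum_0) (use d that in \<open>fastforce simp: hit_def dvalid_def\<close>)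
  have cl: "cvalid [g]" if "md \<le> g" "g < m" for g
  proof -
    have "he g \<in> fst ` set exs" using item_simps(2)[OF that] by (auto simp: exs_def image_iff)
    then show ?thesis using item_simps(1)[OF that] that by (simp add: cvalid_def)
  qed
  have Whit: "fsum ?LW (hit S) = (\<Sum>g\<in>{md..<m} \<inter> S. ?W g)" for S
  proof -
    have "fsum ?LW (hit S) = (\<Sum>g\<in>{md..<m}. if g \<in> S then ?W g else 0)"
      unfolding fW by (rule sum.cong) (auto simp: hit_def)
    then show ?thesis by (simp add: sum.inter_restrict)
  qed
  have heD: "fsum LD (\<lambda>gs. of_bool (he (last gs) = u)) = of_bool (u = tn) * v" for u
  proof -
    have "fsum LD (\<lambda>gs. of_bool (he (last gs) = u)) = fsum LD (\<lambda>gs. of_bool (u = tn) * 1)"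
      by (rule fsum_cong) (use d dvalid_cvalid in auto)
    then show ?thesis unfolding fsum_cmult using LD by (simp add: dsol_def)
  qed
  have heW: "fsum ?LW (\<lambda>gs. of_bool (he (last gs) = u)) = (\<Sum>g\<in>{md..<m}. weight val (lab g) * of_bool (he g = u))" for u
    unfolding fW by simp
  have sm: "(\<Sum>l\<leftarrow>map (\<lambda>l. (2, l)) xs. weight val l) = (\<Sum>l\<leftarrow>xs. lit val l)" for xs
    by (simp add: comp_def weight_def)
  show ?thesis
    unfolding core_sol_def
  proof (intro conjI ballI allI impI)
    fix z assume "z \<in> set (LD @ ?LW)"
    then consider "z \<in> set LD" | g where "md \<le> g" "g < m" "z = (?W g, [g])" by auto
    then have "0 \<le> fst z \<and> cvalid (snd z)"
      by cases (use d dvalid_cvalid W01 cl in simp_all)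
    then show "0 \<le> fst z" "cvalid (snd z)" by simp_all
  next
    fix e assume "e \<in> set exs"
    then consider "e = (tn, c)" | z where "z \<in> set cls" "e = (fst z, snd (snd z))" by (auto simp: exs_def)
    then show "fsum (LD @ ?LW) (\<lambda>gs. of_bool (he (last gs) = fst e)) = of_nat (snd e)"
    proof cases
      case 1
      have "(\<Sum>g\<in>{md..<m}. weight val (lab g) * of_bool (he g = tn)) = (\<Sum>l\<leftarrow>outs. lit val l)"
        unfolding item_sum(2) by (simp add: weight_def)
      then show ?thesis unfolding fsum_append heD heW using c 1 by simp
    next
      case 2
      have "fst z \<noteq> tn" using cls_set[OF 2(1)] nd(3,5) by force
      moreover have "(\<Sum>l\<leftarrow>fst (snd z). weight val l) = of_nat (snd (snd z))"
      proof -
        have "snd z \<in> set (map snd cls)" using 2(1) by simp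
        then consider "snd z = ([(3, 0, 0), (3, 0, 0)], 0)" | j where "j < V" "snd z = ([(1, j, 1), (1, j, 0)], 1)"
          | w where "w \<in> set axs" "snd z = (map (\<lambda>l. (2, l)) (fst w), snd w)"
          unfolding cls_snd by auto
        then show ?thesis
        proof cases
          case 3
          then show ?thesis using axs[OF 3(1)] sm[of "fst w"] by simp
        qed (simp_all add: weight_def lit_def)
      qed
      ultimately show ?thesis unfolding fsum_append heD heW 2(2) by (simp add: item_sum(1)[OF 2(1)])
    qed
  next
    fix g assume g: "g < m"
    show "fsum (LD @ ?LW) (hit {g}) \<le> 1"
    proof (cases "g < md")
      case True
      then show ?thesis unfolding fsum_append Whit using LD by (simp add: dsol_def)
    next
      case False
      then show ?thesis unfolding fsum_append Whit using Dhit[of "{g}"] W01[of g] g by simp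
    qed
  next
    fix S assume S: "S \<subseteq> {..<G}" "card S = k" "indep S"
    have fin: "finite S" using S(1) finite_core_set by blast
    have com: "compat adj (full ! g) (full ! h)" if "g \<in> S" "h \<in> S" "g \<noteq> h" for g h
      using S(3) that unfolding indep_iff[OF S(1)] by blast
    have lt: "g < m + (k - 1)" if "g \<in> S" for g using S(1) that unfolding G_def by auto
    define \<kappa> where "\<kappa> g = fst (snd (snd (full ! g)))" for g
    have \<kappa>: "g < md \<Longrightarrow> \<kappa> g = 0" "md \<le> g \<Longrightarrow> g < m \<Longrightarrow> \<kappa> g \<in> {1, 2, 3}" "g \<in> S \<Longrightarrow> m \<le> g \<Longrightarrow> \<kappa> g = (if g = m then 4 else 5)" for g
      using D_gadget[of g] item_simps(3)[of g] special_gadget[of g] lt[of g] by (auto simp: \<kappa>_def lab_def)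
    have "S \<noteq> {}" using S(2) k by auto
    consider g where "g \<in> S" "g < md" | "m \<in> S" | g where "g \<in> S" "\<kappa> g = 3" "md \<le> g" "g < m"
      | "\<And>g. g \<in> S \<Longrightarrow> (md \<le> g \<and> g < m \<and> (\<kappa> g = 1 \<or> \<kappa> g = 2)) \<or> m < g"
    proof -
      have "(\<exists>g\<in>S. g < md) \<or> m \<in> S \<or> (\<exists>g\<in>S. \<kappa> g = 3 \<and> md \<le> g \<and> g < m)
        \<or> (\<forall>g\<in>S. (md \<le> g \<and> g < m \<and> (\<kappa> g = 1 \<or> \<kappa> g = 2)) \<or> m < g)"
      proof (rule ccontr)
        assume n: "\<not> ?thesis"
        then obtain g where g: "g \<in> S" "\<not> ((md \<le> g \<and> g < m \<and> (\<kappa> g = 1 \<or> \<kappa> g = 2)) \<or> m < g)" by blast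
        have "\<not> g < md" "g \<noteq> m" using n g(1) by blast+
        then have "md \<le> g" "g < m" using g(2) by auto
        then show False using \<kappa>(2)[of g] g n by blast
      qed
      then show thesis using that by blast
    qed
    then show "fsum (LD @ ?LW) (hit S) + of_nat (card (S - {..<m})) \<le> of_nat k - 1"
    proof cases
      case 1
      have "h < md" if "h \<in> S" for h
      proof (rule ccontr)
        assume h: "\<not> h < md"
        then have "\<kappa> h \<noteq> 0" using \<kappa>(2,3)[of h] that by (cases "h < m") auto
        then show False using com[OF 1(1) that] 1 h \<kappa>(1)[OF 1(2)] by (auto simp: compat_def Let_def \<kappa>_def)
      qed
      then have Sd: "S \<subseteq> {..<md}" by auto
      have "\<forall>g\<in>S. \<forall>h\<in>S. g \<noteq> h \<longrightarrow> adj (sa ! g) (sa ! h)"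
      proof (intro ballI impI)
        fix g h assume gh: "g \<in> S" "h \<in> S" "g \<noteq> h"
        then have "g < md" "h < md" using Sd by auto
        then show "adj (sa ! g) (sa ! h)" using com[OF gh] by (simp add: D_gadget compat_def Let_def)
      qed
      then have "fsum LD (hit S) \<le> of_nat k - 1" using LD Sd S(2) by (simp add: dsol_def)
      moreover have "{md..<m} \<inter> S = {}" using Sd by auto
      moreover have "S - {..<m} = {}" using Sd md_le by auto
      then have "card (S - {..<m}) = 0" by (simp only: card.empty)
      ultimately show ?thesis unfolding fsum_append Whit by simp
    next
      case 2
      have "m \<le> h" if "h \<in> S" for h
      proof (rule ccontr)
        assume h: "\<not> m \<le> h"
        then have "\<kappa> h \<in> {0, 1, 2, 3}" using \<kappa>(1,2)[of h] by (cases "h < md") auto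
        then show False using com[OF 2 that] h \<kappa>(3)[OF 2] by (auto simp: compat_def Let_def \<kappa>_def)
      qed
      then have "S \<subseteq> {m..<m + (k - 1)}" using lt by auto
      then have "card S \<le> k - 1" using card_mono[of "{m..<m + (k - 1)}" S] by simp
      then show ?thesis using S(2) k by simp
    next
      case 3
      have "h = g" if "h \<in> S" for h
      proof (rule ccontr)
        assume h: "h \<noteq> g"
        have "\<kappa> h \<in> {0, 1, 2, 3, 4, 5}" using \<kappa>[of h] that by (cases "h < md"; cases "h < m") auto
        then show False using com[OF 3(1) that h[symmetric]] 3(2) by (auto simp: compat_def Let_def \<kappa>_def)
      qed
      then have Sg: "S = {g}" using 3(1) by blast
      then have "k = 1" using S(2) by simp
      have "fsum ?LW (hit S) = 0" unfolding Whit Sg using 3 by (simp add: weight_def lab_def \<kappa>_def)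
      then show ?thesis unfolding fsum_append using Dhit[of S] 3 Sg \<open>k = 1\<close> by simp
    next
      case 4
      define T where "T = S \<inter> {..<m}"
      have T: "md \<le> g" "g < m" "\<kappa> g = 1 \<or> \<kappa> g = 2" if "g \<in> T" for g using 4[of g] that by (auto simp: T_def)
      have "S - {..<m} \<subseteq> {m + 1..<m + (k - 1)}" using 4 lt by fastforce
      then have c1: "card (S - {..<m}) \<le> k - 2" using card_mono[of "{m + 1..<m + (k - 1)}" "S - {..<m}"] by simp
      have "card S = card T + card (S - {..<m})"
        using card_Int_Diff[OF fin, of "{..<m}"] by (simp add: T_def)
      then have cT: "card T = k - card (S - {..<m})" "card (S - {..<m}) \<le> k" using S(2) by auto
      have k2: "2 \<le> k"
      proof (rule ccontr)
        assume "\<not> 2 \<le> k"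
        then have "k = 1" using k by simp
        then have "card T = 1" using cT c1 by simp
        then obtain g where "g \<in> T" by fastforce
        from T[OF this] item_simps(3)[of g] have "0 < V" by (auto simp: \<kappa>_def lab_def)
        then show False using V \<open>k = 1\<close> by simp
      qed
      have finT: "finite T" using fin by (simp add: T_def)
      have "2 \<le> card T" using cT c1 k2 by linarith
      then obtain g h where gh: "g \<in> T" "h \<in> T" "g \<noteq> h" by (metis card_le_Suc0_iff_eq finT not_less_eq_eq numeral_2_eq_2)
      have diff: "\<kappa> a \<noteq> \<kappa> b \<and> fst (snd (lab a)) = fst (snd (lab b)) \<and> snd (snd (lab a)) \<noteq> snd (snd (lab b))"
        if "a \<in> T" "b \<in> T" "a \<noteq> b" for a b
        using com[of a b] T[OF that(1)] T[OF that(2)] that by (auto simp: T_def compat_def Let_def \<kappa>_def lab_def)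
      \<comment> \<open>Compatible literal gadgets differ in kind, and there are only the kinds 1
        and 2, so a third gadget finds no place.\<close>
      have TT: "T = {g, h}"
      proof (rule equalityI; rule subsetI)
        fix x assume x: "x \<in> T"
        show "x \<in> {g, h}"
        proof (rule ccontr)
          assume "x \<notin> {g, h}"
          then have "\<kappa> x \<noteq> \<kappa> g" "\<kappa> x \<noteq> \<kappa> h" "\<kappa> g \<noteq> \<kappa> h" using diff[OF x gh(1)] diff[OF x gh(2)] diff[OF gh] by auto
          then show False using T(3)[OF x] T(3)[OF gh(1)] T(3)[OF gh(2)] by auto
        qed
      qed (use gh in auto)
      have b2: "snd (snd (lab a)) < 2" if "a \<in> T" for a
        using item_simps(3)[OF T(1,2)[OF that]] by auto
      have "?W g + ?W h = 1"
        using diff[OF gh] b2[OF gh(1)] b2[OF gh(2)] T(3)[OF gh(1)] T(3)[OF gh(2)]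
        by (auto simp: weight_def lit_def \<kappa>_def lab_def numeral_2_eq_2 less_Suc_eq)
      moreover have "{md..<m} \<inter> S = T" using T by (auto simp: T_def)
      ultimately have "fsum ?LW (hit S) = 1" unfolding Whit TT using gh(3) by simp
      moreover have "fsum LD (hit S) = 0" by (rule Dhit) (use 4 md_le in fastforce)
      moreover have "of_nat (card (S - {..<m})) \<le> (of_nat (k - 2) :: rat)" using c1 by (rule of_nat_mono)
      ultimately show ?thesis unfolding fsum_append using k2 by (simp add: of_nat_diff)
    qed
  qed
qed

end

section \<open>Topological sorting\<close>

definition peel_step :: "(nat \<times> nat) list \<Rightarrow> (nat \<times> nat) list" where
  "peel_step R = filter (\<lambda>a. \<exists>b\<in>set R. snd b = fst a) R"
definition peel_src :: "(nat \<times> nat) list \<Rightarrow> (nat \<times> nat) list" where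
  "peel_src R = filter (\<lambda>a. \<not> (\<exists>b\<in>set R. snd b = fst a)) R"
text \<open>The fold uses \<open>xs\<close> merely to count rounds. As long as arcs remain,
  acyclicity lets each round remove at least one, so \<open>length xs\<close> rounds
  suffice.\<close>

definition peel :: "(nat \<times> nat) list \<Rightarrow> (nat \<times> nat) list" where
  "peel xs = snd (fold (\<lambda>_ acc. (peel_step (fst acc), snd acc @ peel_src (fst acc))) xs (xs, []))"

definition topo_list :: "(nat \<times> nat) list \<Rightarrow> bool" where
  "topo_list xs \<longleftrightarrow> (\<forall>i<length xs. \<forall>j<length xs. snd (xs ! i) = fst (xs ! j) \<longrightarrow> i < j)"

lemma topo_list_append:
  assumes "topo_list xs" "topo_list ys" "\<And>a b. a \<in> set xs \<Longrightarrow> b \<in> set ys \<Longrightarrow> snd b \<noteq> fst a"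
  shows "topo_list (xs @ ys)"
  unfolding topo_list_def
proof (intro allI impI)
  fix i j assume ij: "i < length (xs @ ys)" "j < length (xs @ ys)" "snd ((xs @ ys) ! i) = fst ((xs @ ys) ! j)"
  show "i < j"
  proof (cases "i < length xs"; cases "j < length xs")
    assume "i < length xs" "j < length xs"
    then show ?thesis using assms(1) ij by (auto simp: topo_list_def nth_append)
  next
    assume "\<not> i < length xs" "j < length xs"
    then show ?thesis using assms(3)[of "xs ! j" "ys ! (i - length xs)"] ij by (auto simp: nth_append)
  next
    assume c: "\<not> i < length xs" "\<not> j < length xs"
    then have "i - length xs < j - length xs" using assms(2) ij by (auto simp: topo_list_def nth_append)
    then show ?thesis by simp
  qed auto
qed

lemma peel_src_nonempty:
  assumes "acyclic (set R)" "R \<noteq> []"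
  shows "peel_src R \<noteq> []"
proof
  assume e: "peel_src R = []"
  have "wf (set R)" using finite_acyclic_wf[OF finite_set assms(1)] .
  moreover have "fst (hd R) \<in> fst ` set R" using assms(2) by simp
  ultimately obtain z where z: "z \<in> fst ` set R" "\<And>y. (y, z) \<in> set R \<Longrightarrow> y \<notin> fst ` set R"
    unfolding wf_eq_minimal by blast
  then obtain a where a: "a \<in> set R" "fst a = z" by auto
  then obtain b where b: "b \<in> set R" "snd b = z" using e by (auto simp: peel_src_def filter_empty_conv)
  then have "fst b \<in> fst ` set R" "(fst b, z) \<in> set R" by auto
  then show False using z(2) by blast
qed

lemma peel_correct:
  assumes "distinct xs" "acyclic (set xs)"
  shows "distinct (peel xs)" "set (peel xs) = set xs" "topo_list (peel xs)"
proof -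
  define f where "f = (\<lambda>acc. (peel_step (fst acc), snd acc @ peel_src (fst acc)))"
  have fold: "fold (\<lambda>_. f) ys a = (f ^^ length ys) a" for ys :: "(nat \<times> nat) list" and a
    by (induction ys arbitrary: a) (auto simp: funpow_swap1)
  \<comment> \<open>The condition that no remaining arc leads to the tail of a removed one is what
    allows \<open>topo_list_append\<close> to extend the sorted part.\<close>
  have inv: "distinct (snd ((f ^^ n) (xs, [])) @ fst ((f ^^ n) (xs, [])))
      \<and> set (snd ((f ^^ n) (xs, [])) @ fst ((f ^^ n) (xs, []))) = set xs
      \<and> topo_list (snd ((f ^^ n) (xs, [])))
      \<and> (\<forall>b\<in>set (fst ((f ^^ n) (xs, []))). \<forall>a\<in>set (snd ((f ^^ n) (xs, []))). snd b \<noteq> fst a)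
      \<and> length (fst ((f ^^ n) (xs, []))) \<le> length xs - n" for n
  proof (induction n)
    case 0
    then show ?case using assms(1) by (simp add: topo_list_def)
  next
    case (Suc n)
    obtain R out where Ro: "(f ^^ n) (xs, []) = (R, out)" by fastforce
    have IH: "distinct (out @ R)" "set (out @ R) = set xs" "topo_list out"
      "\<And>b a. b \<in> set R \<Longrightarrow> a \<in> set out \<Longrightarrow> snd b \<noteq> fst a" "length R \<le> length xs - n"
      using Suc unfolding Ro by auto
    have step: "(f ^^ Suc n) (xs, []) = (peel_step R, out @ peel_src R)"
    proof -
      have "(f ^^ Suc n) (xs, []) = f ((f ^^ n) (xs, []))" by simp
      then have "(f ^^ Suc n) (xs, []) = f (R, out)" by (simp only: Ro)
      then show ?thesis by (simp only: f_def fst_conv snd_conv)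
    qed
    have part: "set (peel_src R) \<union> set (peel_step R) = set R" "set (peel_src R) \<inter> set (peel_step R) = {}"
      by (auto simp: peel_src_def peel_step_def)
    have "distinct (peel_src R)" "distinct (peel_step R)" using IH(1) by (auto simp: peel_src_def peel_step_def)
    then have "distinct ((out @ peel_src R) @ peel_step R)" using IH(1) part by auto
    moreover have "set ((out @ peel_src R) @ peel_step R) = set xs" using IH(2) part by auto
    moreover have "topo_list (out @ peel_src R)"
    proof (rule topo_list_append[OF IH(3)])
      show "topo_list (peel_src R)" unfolding topo_list_def
      proof (intro allI impI)
        fix i j assume ij: "i < length (peel_src R)" "j < length (peel_src R)" "snd (peel_src R ! i) = fst (peel_src R ! j)"
        have "peel_src R ! i \<in> set R" "peel_src R ! j \<in> set (peel_src R)" using ij part(1) nth_mem by blast+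
        then show "i < j" using ij(3) by (auto simp: peel_src_def)
      qed
      show "snd b \<noteq> fst a" if "a \<in> set out" "b \<in> set (peel_src R)" for a b
        using IH(4)[of b a] that part(1) by blast
    qed
    moreover have "snd b \<noteq> fst a" if "b \<in> set (peel_step R)" "a \<in> set (out @ peel_src R)" for a b
    proof -
      have "b \<in> set R" using that part by auto
      then show ?thesis using that(2) IH(4)[of b a] unfolding peel_src_def set_append set_filter by blast
    qed
    moreover have "length (peel_step R) \<le> length xs - Suc n"
    proof (cases "R = []")
      case False
      have "acyclic (set R)" using assms(2) IH(2) by (rule_tac acyclic_subset) auto
      then have "0 < length (peel_src R)" using peel_src_nonempty[OF _ False] by simp
      moreover have "length (peel_src R) + length (peel_step R) = length R"
        using sum_length_filter_compl[of "\<lambda>a. \<exists>b\<in>set R. snd b = fst a" R] by (simp add: peel_src_def peel_step_def)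
      ultimately show ?thesis using IH(5) by linarith
    qed (simp add: peel_step_def)
    ultimately show ?case unfolding step by simp
  qed
  have p: "peel xs = snd ((f ^^ length xs) (xs, []))" unfolding peel_def f_def[symmetric] by (simp only: fold)
  have e: "fst ((f ^^ length xs) (xs, [])) = []" using inv[of "length xs"] by simp
  show "distinct (peel xs)" "set (peel xs) = set xs" "topo_list (peel xs)"
    using inv[of "length xs"] unfolding p e by auto
qed

section \<open>Binary expansions\<close>

definition ones :: "nat list \<Rightarrow> nat list" where
  "ones xs = map fst (filter (\<lambda>z. snd z = 1) (enum xs))"

lemma enum_Cons: "enum (x # xs) = (0, x) # map (\<lambda>z. (Suc (fst z), snd z)) (enum xs)"
proof -
  have "zip [Suc 0..<Suc n] xs = map (\<lambda>z. (Suc (fst z), snd z)) (zip [0..<n] xs)" for n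
    unfolding map_Suc_upt[symmetric] by (simp add: zip_map1 case_prod_beta)
  then show ?thesis by (simp add: enum_def upt_conv_Cons del: upt_Suc)
qed

lemma ones_Cons: "ones (x # xs) = (if x = 1 then [0] else []) @ map Suc (ones xs)"
  by (simp add: ones_def enum_Cons filter_map comp_def)

lemma ones_less: "j \<in> set (ones xs) \<Longrightarrow> j < length xs"
  by (auto simp: ones_def set_enum)

lemma sum_list_cmult: "(\<Sum>x\<leftarrow>xs. c * f x) = c * (\<Sum>x\<leftarrow>xs. f x)" for f :: "'x \<Rightarrow> rat"
  by (induction xs) (auto simp: algebra_simps)

lemma ones_bits: "(\<Sum>j\<leftarrow>ones (bits n). 2 ^ j) = (of_nat n :: rat)"
proof (induction n rule: bits.induct)
  case (1 n)
  show ?case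
  proof (cases "n = 0")
    case True
    then show ?thesis by (simp add: bits.simps ones_def enum_def)
  next
    case False
    then have b: "bits n = (n mod 2) # bits (n div 2)" by (subst bits.simps) simp
    have "(\<Sum>j\<leftarrow>ones (bits n). 2 ^ j) = of_nat (n mod 2) + 2 * (\<Sum>j\<leftarrow>ones (bits (n div 2)). 2 ^ j :: rat)"
      unfolding b ones_Cons by (simp add: comp_def sum_list_cmult mod2_eq_if)
    also have "\<dots> = of_nat (n mod 2 + 2 * (n div 2))" by (simp only: 1[OF False] of_nat_add of_nat_mult of_nat_numeral)
    finally show ?thesis by (simp only: mod_mult_div_eq)
  qed
qed

lemma length_bits_mono: "r \<le> q \<Longrightarrow> length (bits r) \<le> length (bits q)"
proof (induction q arbitrary: r rule: bits.induct)
  case (1 q)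
  show ?case
  proof (cases "r = 0")
    case False
    then have "bits r = (r mod 2) # bits (r div 2)" "bits q = (q mod 2) # bits (q div 2)"
      using 1(2) by (subst bits.simps; simp)+
    then show ?thesis using 1(1)[of "r div 2"] 1(2) False by (simp add: div_le_mono)
  qed (simp add: bits.simps)
qed

lemma power_le_bits: "j < length (bits q) \<Longrightarrow> 2 ^ j \<le> q"
proof (induction q arbitrary: j rule: bits.induct)
  case (1 q)
  show ?case
  proof (cases "q = 0")
    case False
    then have b: "bits q = (q mod 2) # bits (q div 2)" by (subst bits.simps) simp
    show ?thesis
    proof (cases j)
      case (Suc i)
      then have "2 ^ i \<le> q div 2" using 1(1)[OF False, of i] 1(2) b by simp
      then show ?thesis using Suc by simp
    qed (use False in simp)
  qed (use 1 in \<open>simp add: bits.simps\<close>)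
qed

lemma bits_Nil: "bits q = [] \<longleftrightarrow> q = 0"
  by (subst bits.simps) simp

section \<open>The fractional part as a system of literals\<close>

text \<open>Read each constraint as a lower bound on a sum of literals. The two constraints for
  \<open>j\<close> say that \<open>val (Suc j)\<close> is at most and at least
  \<open>2 * val j\<close>; the last two say that the variables at the binary digits 1 of
  \<open>q\<close> sum up to at most and at least 1. For \<open>2 ^ j / q\<close> all of them are
  tight, as \<open>core_sol_sufficient\<close> demands.\<close>

definition frac_system :: "nat \<Rightarrow> ((nat \<times> nat) list \<times> nat) list" where
  "frac_system q = concat (map (\<lambda>j. [([(j, 1), (j, 1), (Suc j, 0)], 1), ([(j, 0), (j, 0), (Suc j, 1)], 2)])
       [0..<length (tl (bits q))])
     @ [(map (\<lambda>j. (j, 0)) (ones (bits q)), length (ones (bits q)) - 1), (map (\<lambda>j. (j, 1)) (ones (bits q)), 1)]"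

definition frac_outs :: "nat \<Rightarrow> (nat \<times> nat) list" where
  "frac_outs r = map (\<lambda>j. (j, 1)) (ones (bits r))"

lemma frac_system_lits:
  "z \<in> set (frac_system q) \<Longrightarrow> l \<in> set (fst z) \<Longrightarrow> fst l < length (bits q) \<and> snd l < 2"
  "r \<le> q \<Longrightarrow> l \<in> set (frac_outs r) \<Longrightarrow> fst l < length (bits q) \<and> snd l < 2"
  using ones_less[of _ "bits q"] ones_less[of _ "bits r"] length_bits_mono[of r q]
  by (fastforce simp: frac_system_def frac_outs_def)+

lemma ones_bits_pos: "0 < q \<Longrightarrow> 0 < length (ones (bits q))"
  using ones_bits[of q] by (cases "ones (bits q)") auto

lemma sum_lits: "(\<Sum>l\<leftarrow>map (\<lambda>j. (j, 1)) xs. lit val l) = (\<Sum>j\<leftarrow>xs. val j)"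
  "(\<Sum>l\<leftarrow>map (\<lambda>j. (j, 0)) xs. lit val l) = of_nat (length xs) - (\<Sum>j\<leftarrow>xs. val j)"
  by (induction xs) (auto simp: lit_def)

text \<open>Doubling gives \<open>val j = 2 ^ j * val 0\<close>, so the variables at the digits 1 of
  any number \<open>n\<close> up to \<open>q\<close> sum up to \<open>n * val 0\<close>; the case
  \<open>n = q\<close> fixes \<open>val 0\<close>.\<close>

lemma frac_system_forces:
  assumes "\<And>z. z \<in> set (frac_system q) \<Longrightarrow> of_nat (snd z) \<le> (\<Sum>l\<leftarrow>fst z. lit val l)" "0 < q"
  shows "of_nat q * val 0 = 1" "r \<le> q \<Longrightarrow> (\<Sum>l\<leftarrow>frac_outs r. lit val l) = of_nat r / of_nat q"
proof -
  have st: "val (Suc j) = 2 * val j" if "Suc j < length (bits q)" for j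
  proof -
    have "j < length (tl (bits q))" using that by simp
    then have "([(j, 1), (j, 1), (Suc j, 0)], 1) \<in> set (frac_system q)" "([(j, 0), (j, 0), (Suc j, 1)], 2) \<in> set (frac_system q)"
      by (auto simp: frac_system_def simp del: length_tl)
    from assms(1)[OF this(1)] assms(1)[OF this(2)] show ?thesis by (simp add: lit_def)
  qed
  have pw: "val j = 2 ^ j * val 0" if "j < length (bits q)" for j
    using that by (induction j) (auto simp: st)
  have sum: "(\<Sum>j\<leftarrow>ones (bits n). val j) = of_nat n * val 0" if "n \<le> q" for n
  proof -
    have "(\<Sum>j\<leftarrow>ones (bits n). val j) = (\<Sum>j\<leftarrow>ones (bits n). val 0 * 2 ^ j)"
    proof (rule arg_cong[where f = sum_list], rule map_cong[OF refl])
      fix j assume "j \<in> set (ones (bits n))"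
      then have "j < length (bits q)" using ones_less[of j "bits n"] length_bits_mono[OF that] by simp
      then show "val j = val 0 * 2 ^ j" using pw by simp
    qed
    then show ?thesis by (simp add: sum_list_cmult ones_bits)
  qed
  have "(map (\<lambda>j. (j, 0)) (ones (bits q)), length (ones (bits q)) - 1) \<in> set (frac_system q)"
    "(map (\<lambda>j. (j, 1)) (ones (bits q)), 1) \<in> set (frac_system q)" by (auto simp: frac_system_def)
  from assms(1)[OF this(1)] assms(1)[OF this(2)]
  have "of_nat (length (ones (bits q)) - 1) \<le> of_nat (length (ones (bits q))) - of_nat q * val 0" "1 \<le> of_nat q * val 0"
    by (simp_all only: fst_conv snd_conv sum_lits sum[OF order_refl] of_nat_1)
  then show 1: "of_nat q * val 0 = 1" using ones_bits_pos[OF assms(2)] by (simp add: of_nat_diff)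
  show "(\<Sum>l\<leftarrow>frac_outs r. lit val l) = of_nat r / of_nat q" if "r \<le> q"
  proof -
    have "(\<Sum>l\<leftarrow>frac_outs r. lit val l) = of_nat r * val 0" by (simp only: frac_outs_def sum_lits sum[OF that])
    then show ?thesis using 1 assms(2) by (simp add: field_simps)
  qed
qed

lemma frac_system_solution:
  assumes "0 < q" "val = (\<lambda>j. 2 ^ j / of_nat q)"
  shows "\<And>z. z \<in> set (frac_system q) \<Longrightarrow> (\<Sum>l\<leftarrow>fst z. lit val l) = of_nat (snd z)"
    "(\<Sum>l\<leftarrow>frac_outs r. lit val l) = of_nat r / of_nat q"
    "j < length (bits q) \<Longrightarrow> 0 \<le> val j \<and> val j \<le> 1"
proof -
  have sum: "(\<Sum>j\<leftarrow>ones (bits n). val j) = of_nat n / of_nat q" for n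
    unfolding assms(2) using sum_list_cmult[of "1 / of_nat q" "\<lambda>j. 2 ^ j" "ones (bits n)"] by (simp add: ones_bits)
  show "(\<Sum>l\<leftarrow>frac_outs r. lit val l) = of_nat r / of_nat q"
    by (simp only: frac_outs_def sum_lits sum)
  show "j < length (bits q) \<Longrightarrow> 0 \<le> val j \<and> val j \<le> 1"
  proof -
    assume "j < length (bits q)"
    then have "2 ^ j \<le> q" by (rule power_le_bits)
    then have "(of_nat (2 ^ j) :: rat) \<le> of_nat q" by (rule of_nat_mono)
    then show ?thesis using assms(1) by (simp add: assms(2))
  qed
  fix z assume "z \<in> set (frac_system q)"
  then consider j where "z = ([(j, 1), (j, 1), (Suc j, 0)], 1)" | j where "z = ([(j, 0), (j, 0), (Suc j, 1)], 2)"
    | "z = (map (\<lambda>j. (j, 0)) (ones (bits q)), length (ones (bits q)) - 1)" | "z = (map (\<lambda>j. (j, 1)) (ones (bits q)), 1)"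
    by (auto simp: frac_system_def)
  then show "(\<Sum>l\<leftarrow>fst z. lit val l) = of_nat (snd z)"
  proof cases
    case 3
    have "of_nat q / of_nat q = (1 :: rat)" using assms(1) by simp
    then show ?thesis using ones_bits_pos[OF assms(1)]
      by (simp only: 3 fst_conv snd_conv sum_lits sum of_nat_diff of_nat_1 Suc_leI One_nat_def)
  next
    case 4
    have "of_nat q / of_nat q = (1 :: rat)" using assms(1) by simp
    then show ?thesis by (simp only: 4 fst_conv snd_conv sum_lits sum of_nat_1)
  qed (auto simp: lit_def assms(2))
qed

section \<open>Flows in the given network and chains of its arcs\<close>

definition rflow :: "mrf_r \<Rightarrow> rat \<Rightarrow> ((nat \<times> nat) set \<Rightarrow> rat) \<Rightarrow> bool" where
  "rflow I v x \<longleftrightarrow> nonneg_flow (r_paths I) x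
     \<and> (\<forall>a \<in> arcs (graph_of I). arc_flow (r_paths I) x a \<le> 1)
     \<and> (\<Sum>P \<in> r_paths I. x P) = v
     \<and> (\<forall>S \<in> r_scenarios I. interdicted (r_paths I) x S \<le> of_nat (budget I) - 1)"

lemma graph_simps [simp]: "arcs (graph_of I) = set (arc_list I)" "verts (graph_of I) = set (node_list I)"
  "tail (graph_of I) = fst" "head (graph_of I) = snd"
  by (simp_all add: graph_of_def)

lemma finite_r_paths: "finite (r_paths I)"
  unfolding r_paths_def by (rule finite_st_paths) simp

lemma mrf_r_solution_iff: "mrf_r_solution I x \<longleftrightarrow> rflow I (r_demand I) x"
proof -
  have "finite (r_scenarios I)" by (rule finite_subset[of _ "Pow (set (arc_list I))"]) (auto simp: r_scenarios_def)
  moreover have "{} \<in> r_scenarios I" by (simp add: r_scenarios_def clique_def)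
  ultimately show ?thesis unfolding mrf_r_solution_def rflow_def by (subst Max_image_le_iff) auto
qed

text \<open>All constraints are upper bounds by nonnegative numbers, the scenario bound because the
  budget is positive. It is therefore enough to force a flow value of at least the demand.\<close>

lemma rflow_scale:
  assumes "rflow I v x" "0 \<le> c" "c \<le> 1" "0 < budget I"
  shows "rflow I (c * v) (\<lambda>P. c * x P)"
proof -
  have "c * y \<le> b" if "y \<le> b" "0 \<le> b" for b y :: rat
    using mult_left_mono[OF that(1) assms(2)] mult_right_mono[OF assms(3) that(2)] by simp
  moreover have "arc_flow (r_paths I) (\<lambda>P. c * x P) a = c * arc_flow (r_paths I) x a" for a
    by (simp add: arc_flow_def sum_distrib_left)
  moreover have "interdicted (r_paths I) (\<lambda>P. c * x P) S = c * interdicted (r_paths I) x S" for S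
    by (simp add: interdicted_def sum_distrib_left)
  moreover have b: "(0 :: rat) \<le> of_nat (budget I) - 1" using assms(4) by simp
  moreover have "(\<Sum>P\<in>r_paths I. c * x P) = c * v" using assms(1) by (simp add: sum_distrib_left[symmetric] rflow_def)
  moreover have "nonneg_flow (r_paths I) (\<lambda>P. c * x P)" using assms(1,2) by (simp add: rflow_def nonneg_flow_def)
  ultimately show ?thesis using assms(1) unfolding rflow_def by auto
qed

text \<open>Each arc alone is a scenario with bound 0, and every path between different nodes
  contains an arc.\<close>

lemma rflow_budget_1:
  assumes "rflow I v x" "r_source I \<noteq> r_sink I" "budget I = 1"
  shows "v = 0"
proof -
  have "x P = 0" if P: "P \<in> r_paths I" for P
    using P[unfolded r_paths_def]
  proof (rule st_pathsE)
    fix p assume p: "P = set p" "pre_digraph.cas (graph_of I) (r_source I) p (r_sink I)" "set p \<subseteq> arcs (graph_of I)"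
    have "p \<noteq> []" using p(2) assms(2) by (auto simp: pre_digraph.cas.simps)
    then obtain a where a: "a \<in> P" "a \<in> set (arc_list I)" using p by (cases p) auto
    have "{a} \<in> r_scenarios I" using a assms(3) by (simp add: r_scenarios_def clique_def)
    then have "interdicted (r_paths I) x {a} \<le> 0" using assms(1,3) unfolding rflow_def by force
    then have "arc_flow (r_paths I) x a \<le> 0" by (simp add: interdicted_def arc_flow_def)
    then have "arc_flow (r_paths I) x a = 0" using arc_flow_nonneg[of "r_paths I" x a] assms(1) by (simp add: rflow_def)
    from arc_flow_zeroD[OF finite_r_paths _ this P a(1)] assms(1) show ?thesis by (simp add: rflow_def)
  qed
  then show ?thesis using assms(1) unfolding rflow_def by auto
qed

text \<open>The only path from a node to itself is the empty one. It meets no arc and no scenario,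
  so it can carry any demand.\<close>

lemma rflow_trivial:
  assumes "r_source I = r_sink I" "r_source I \<in> set (node_list I)" "0 < budget I" "0 \<le> v"
  shows "rflow I v (\<lambda>_. v)" "r_paths I = {{}}"
proof -
  have e: "p = []" if "pre_digraph.apath (graph_of I) (r_source I) p (r_sink I)" for p
  proof (rule ccontr)
    assume "p \<noteq> []"
    then obtain a p' where ap: "p = a # p'" by (cases p) auto
    have c: "pre_digraph.cas (graph_of I) u q w \<Longrightarrow> q \<noteq> [] \<Longrightarrow> w \<in> set (tl (pre_digraph.awalk_verts (graph_of I) u q))" for u q w
    proof (induction q arbitrary: u)
      case (Cons b q)
      then show ?case by (cases q) (auto simp: pre_digraph.cas.simps pre_digraph.awalk_verts.simps)
    qed simp
    have "pre_digraph.cas (graph_of I) (r_source I) p (r_sink I)" "distinct (pre_digraph.awalk_verts (graph_of I) (r_source I) p)"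
      using that by (auto simp: pre_digraph.apath_def pre_digraph.awalk_def)
    moreover have "pre_digraph.awalk_verts (graph_of I) (r_source I) p = r_source I # tl (pre_digraph.awalk_verts (graph_of I) (r_source I) p)"
      using calculation(1) by (cases p) (auto simp: pre_digraph.cas.simps pre_digraph.awalk_verts.simps)
    ultimately show False using c[of "r_source I" p "r_sink I"] \<open>p \<noteq> []\<close> assms(1) by (metis distinct.simps(2))
  qed
  have "pre_digraph.apath (graph_of I) (r_source I) [] (r_sink I)"
    using assms(1,2) by (simp add: pre_digraph.apath_def pre_digraph.awalk_def pre_digraph.cas.simps pre_digraph.awalk_verts.simps)
  then show P: "r_paths I = {{}}" unfolding r_paths_def st_paths_def using e by auto
  have "interdicted {{}} (\<lambda>_. v) S = 0" "arc_flow {{}} (\<lambda>_. v) a = 0" for S :: "(nat \<times> nat) set" and a :: "nat \<times> nat"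
    by (simp_all add: interdicted_sum arc_flow_sum)
  moreover have "(1 :: rat) \<le> of_nat (budget I)" using assms(3) by simp
  ultimately show "rflow I v (\<lambda>_. v)" unfolding rflow_def P
    using assms(4) by (simp add: nonneg_flow_def)
qed

locale red_inst = red +
  fixes I :: mrf_r
  assumes src: "r_source I = s" "r_sink I = tn" "budget I = k" "s \<in> set (node_list I)"
    and sa_set: "set sa = {a \<in> set (arc_list I). fst a \<noteq> tn}" "distinct sa"
    and adj_iff: "\<And>a b. adj a b \<longleftrightarrow> (a, b) \<in> set (compat_list I) \<or> (b, a) \<in> set (compat_list I)"
begin

text \<open>One more than the last index of an arc into \<open>v\<close>. Topological order places
  every arc out of \<open>v\<close> after all arcs into \<open>v\<close>, which makes this a rank as
  required by \<open>st_pathsI\<close>.\<close>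

definition drank :: "nat \<Rightarrow> nat" where
  "drank v = (if \<exists>i<md. snd (sa ! i) = v then Suc (Max {i. i < md \<and> snd (sa ! i) = v}) else 0)"

lemma drank_less: "i < md \<Longrightarrow> drank (fst (sa ! i)) < drank (snd (sa ! i))"
proof -
  assume i: "i < md"
  have "i \<le> Max {j. j < md \<and> snd (sa ! j) = snd (sa ! i)}" by (rule Max_ge) (use i in auto)
  moreover have "drank (snd (sa ! i)) = Suc (Max {j. j < md \<and> snd (sa ! j) = snd (sa ! i)})"
    unfolding drank_def by (rule if_P) (use i in blast)
  ultimately have h: "i < drank (snd (sa ! i))" by (simp only: less_Suc_eq_le)
  have "drank (fst (sa ! i)) \<le> i"
  proof (cases "\<exists>j<md. snd (sa ! j) = fst (sa ! i)")
    case True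
    let ?A = "{j. j < md \<and> snd (sa ! j) = fst (sa ! i)}"
    have "Max ?A \<in> ?A" by (rule Max_in) (use True in auto)
    then have "Max ?A < i" using sa[of "Max ?A" i] i by (simp add: md_def)
    moreover have "drank (fst (sa ! i)) = Suc (Max ?A)" unfolding drank_def by (rule if_P) (rule True)
    ultimately show ?thesis by (simp only: Suc_leI)
  next
    case False
    have "drank (fst (sa ! i)) = 0" unfolding drank_def by (rule if_not_P) (rule False)
    then show ?thesis by simp
  qed
  then show ?thesis using h by simp
qed

definition arcset :: "nat list \<Rightarrow> (nat \<times> nat) set" where
  "arcset gs = (!) sa ` set gs"

lemma arcset_hit:
  assumes "set gs \<subseteq> {..<md}" "S \<subseteq> {..<md}"
  shows "arcset gs \<inter> (!) sa ` S \<noteq> {} \<longleftrightarrow> set gs \<inter> S \<noteq> {}"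
proof -
  have "inj_on ((!) sa) {..<md}" using sa_set(2) by (auto simp: inj_on_def md_def nth_eq_iff_index_eq)
  then have "arcset gs \<inter> (!) sa ` S = (!) sa ` (set gs \<inter> S)"
    unfolding arcset_def using assms by (intro inj_on_image_Int[symmetric])
  then show ?thesis by simp
qed

lemma dvalid_path:
  assumes "dvalid gs"
  shows "arcset gs \<in> r_paths I"
proof -
  have gs: "gs \<noteq> []" "set gs \<subseteq> {..<md}" "successively (\<lambda>g h. snd (sa ! g) = fst (sa ! h)) gs"
    "fst (sa ! hd gs) = s" "snd (sa ! last gs) = tn" using assms by (auto simp: dvalid_def)
  have mem: "sa ! g \<in> set (arc_list I)" if "g < md" for g
    using nth_mem[of g sa] that sa_set(1) by (auto simp: md_def)
  have "pre_digraph.cas (graph_of I) (fst (sa ! hd gs)) (map ((!) sa) gs) (snd (sa ! last gs))"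
    using gs(1,3)
  proof (induction gs)
    case (Cons g gs)
    then show ?case by (cases gs) (auto simp: pre_digraph.cas.simps)
  qed simp
  then have "set (map ((!) sa) gs) \<in> st_paths (graph_of I) s tn"
    unfolding gs(4,5)
  proof (rule st_pathsI)
    show "set (map ((!) sa) gs) \<subseteq> arcs (graph_of I)" using gs(2) mem by auto
    show "s \<in> verts (graph_of I)" using src by simp
    show "drank (tail (graph_of I) a) < drank (head (graph_of I) a)" if "a \<in> set (map ((!) sa) gs)" for a
      using that gs(2) drank_less by auto
  qed
  then show ?thesis by (simp add: r_paths_def src arcset_def)
qed

lemma path_dvalid:
  assumes "P \<in> r_paths I"
  shows "\<exists>gs. dvalid gs \<and> arcset gs = P"
proof -
  obtain p where p: "P = set p" "pre_digraph.apath (graph_of I) s p tn" "pre_digraph.cas (graph_of I) s p tn"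
    "set p \<subseteq> set (arc_list I)"
    using assms[unfolded r_paths_def src] by (rule st_pathsE) auto
  define ix where "ix a = (SOME i. i < md \<and> sa ! i = a)" for a
  have ix: "ix a < md" "sa ! ix a = a" if "a \<in> set sa" for a
    using someI_ex[of "\<lambda>i. i < md \<and> sa ! i = a"] that unfolding ix_def md_def in_set_conv_nth by blast+
  \<comment> \<open>A path meets its sink only at the end, so dropping the arcs out of
    \<open>tn\<close> loses no path.\<close>
  have nt: "fst a \<noteq> tn" if "a \<in> set p" for a
  proof -
    have c: "pre_digraph.cas (graph_of I) u q w \<Longrightarrow> distinct (pre_digraph.awalk_verts (graph_of I) u q) \<Longrightarrow> a \<in> set q \<Longrightarrow>
        fst a \<noteq> w" for u q w
    proof (induction q arbitrary: u)
      case (Cons b q)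
      have w: "w \<in> set (pre_digraph.awalk_verts (graph_of I) (snd b) q)" if "pre_digraph.cas (graph_of I) (snd b) q w"
        using that by (induction q arbitrary: b) (auto simp: pre_digraph.cas.simps pre_digraph.awalk_verts.simps)
      show ?case using Cons w by (auto simp: pre_digraph.cas.simps pre_digraph.awalk_verts.simps)
    qed simp
    show ?thesis by (rule c[OF p(3) _ that]) (use p(2) in \<open>simp add: pre_digraph.apath_def\<close>)
  qed
  then have psa: "set p \<subseteq> set sa" using p(4) sa_set(1) by auto
  have ne: "p \<noteq> []" using p(3) nd(4) by (auto simp: pre_digraph.cas.simps)
  have walk: "successively (\<lambda>a b. snd a = fst b) q \<and> fst (hd q) = u \<and> snd (last q) = w"
    if "pre_digraph.cas (graph_of I) u q w" "q \<noteq> []" for u q w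
    using that
  proof (induction q arbitrary: u)
    case (Cons b q)
    then show ?case by (cases q) (auto simp: pre_digraph.cas.simps)
  qed simp
  let ?gs = "map ix p"
  have "successively (\<lambda>g h. snd (sa ! g) = fst (sa ! h)) ?gs"
    unfolding successively_map
  proof (rule successively_mono[where P = "\<lambda>a b. snd a = fst b"])
    show "successively (\<lambda>a b. snd a = fst b) p" using walk[OF p(3) ne] by blast
    fix a b assume "a \<in> set p" "b \<in> set p" "snd a = fst b"
    moreover from this have "sa ! ix a = a" "sa ! ix b = b" using psa ix(2) by blast+
    ultimately show "snd (sa ! ix a) = fst (sa ! ix b)" by (simp only:)
  qed
  moreover have "sa ! ix (hd p) = hd p" "sa ! ix (last p) = last p"
    using ix(2)[of "hd p"] ix(2)[of "last p"] psa hd_in_set[OF ne] last_in_set[OF ne] by blast+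
  ultimately have "dvalid ?gs" unfolding dvalid_def using walk[OF p(3) ne] ne psa ix(1)
    by (auto simp: hd_map last_map)
  moreover have "arcset ?gs = P" unfolding arcset_def p(1) using psa ix(2) by force
  ultimately show ?thesis by blast
qed

lemma clique_image_iff:
  assumes "S \<subseteq> {..<md}"
  shows "clique ((!) sa ` S) (compat_edges I) \<longleftrightarrow> (\<forall>g\<in>S. \<forall>h\<in>S. g \<noteq> h \<longrightarrow> adj (sa ! g) (sa ! h))"
proof -
  have "{a, b} \<in> compat_edges I \<longleftrightarrow> adj a b" for a b
    unfolding adj_iff compat_edges_def mem_Collect_eq doubleton_eq_iff by blast
  moreover have "sa ! g \<noteq> sa ! h \<longleftrightarrow> g \<noteq> h" if "g \<in> S" "h \<in> S" for g h
  proof -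
    have "g < length sa" "h < length sa" using assms that by (auto simp: md_def)
    then show ?thesis using sa_set(2) by (simp add: nth_eq_iff_index_eq)
  qed
  ultimately show ?thesis unfolding clique_def by auto
qed

lemma card_image_sa: "S \<subseteq> {..<md} \<Longrightarrow> card ((!) sa ` S) = card S"
  using sa_set(2) by (intro card_image) (auto simp: inj_on_def md_def nth_eq_iff_index_eq subset_iff)

text \<open>Each chain is charged to its first gadget, and a gadget carries at most 1. Larger
  demands are thus infeasible, which justifies the truncated value of \<open>c\<close>.\<close>

lemma dsol_le:
  assumes "dsol L v"
  shows "v \<le> of_nat md"
proof -
  have "fsum L (\<lambda>_. 1) \<le> fsum L (\<lambda>gs. \<Sum>g<md. hit {g} gs)"
  proof (rule fsum_mono, rule conjI)
    fix z assume z: "z \<in> set L"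
    show "0 \<le> fst z" using assms z by (auto simp: dsol_def)
    have "dvalid (snd z)" using assms z by (auto simp: dsol_def)
    then have h: "hd (snd z) \<in> set (snd z)" "hd (snd z) \<in> {..<md}" unfolding dvalid_def using hd_in_set by blast+
    have "hit {hd (snd z)} (snd z) \<le> (\<Sum>g<md. hit {g} (snd z))"
      by (rule member_le_sum[OF h(2)]) (auto simp: hit_def)
    then show "1 \<le> (\<Sum>g<md. hit {g} (snd z))" using h(1) by (simp add: hit_def)
  qed
  also have "\<dots> = (\<Sum>g<md. fsum L (hit {g}))" by (rule fsum_sum) simp
  also have "\<dots> \<le> (\<Sum>g<md. 1)" by (rule sum_mono) (use assms in \<open>auto simp: dsol_def\<close>)
  finally show ?thesis using assms by (simp add: dsol_def)
qed

lemma rflow_of_dsol: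
  assumes "dsol L v"
  shows "rflow I v (flow_of (map (\<lambda>z. (fst z, arcset (snd z))) L))"
proof -
  let ?L = "map (\<lambda>z. (fst z, arcset (snd z))) L" and ?P = "r_paths I"
  have d: "0 \<le> fst z" "dvalid (snd z)" if "z \<in> set L" for z using assms that by (auto simp: dsol_def)
  have d': "set (snd z) \<subseteq> {..<md}" if "z \<in> set L" for z using d(2)[OF that] by (simp add: dvalid_def)
  have sub: "snd ` set ?L \<subseteq> ?P" using d(2) dvalid_path by auto
  have hit: "interdicted ?P (flow_of ?L) ((!) sa ` S) = fsum L (hit S)" if "S \<subseteq> {..<md}" for S
    unfolding interdicted_flow_of[OF finite_r_paths sub] fsum_map
    using arcset_hit[OF d' that] by (intro fsum_cong) (simp add: hit_def)
  have nn: "nonneg_flow ?P (flow_of ?L)" unfolding nonneg_flow_def using d(1) by (auto intro!: flow_of_nonneg)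
  \<comment> \<open>Arcs out of \<open>tn\<close> carry no flow and can be removed from a
    scenario.\<close>
  have pruned: "interdicted ?P (flow_of ?L) S = interdicted ?P (flow_of ?L) (S \<inter> set sa)" for S
    unfolding interdicted_flow_of[OF finite_r_paths sub] fsum_map
  proof (rule fsum_cong)
    fix z assume "z \<in> set L"
    from d'[OF this] have "arcset (snd z) \<subseteq> set sa" by (auto simp: arcset_def md_def)
    then have "arcset (snd z) \<inter> (S \<inter> set sa) = arcset (snd z) \<inter> S" by blast
    then show "(of_bool (arcset (snd z) \<inter> S \<noteq> {}) :: rat) = of_bool (arcset (snd z) \<inter> (S \<inter> set sa) \<noteq> {})" by simp
  qed
  have image: "\<exists>T\<subseteq>{..<md}. S = (!) sa ` T" if "S \<subseteq> set sa" for S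
    using that by (intro exI[of _ "{g. g < md \<and> sa ! g \<in> S}"]) (force simp: md_def in_set_conv_nth)
  have arc: "arc_flow ?P (flow_of ?L) a \<le> 1" for a
  proof -
    have e: "arc_flow ?P (flow_of ?L) a = interdicted ?P (flow_of ?L) {a}" by (simp add: arc_flow_def interdicted_def)
    show ?thesis
    proof (cases "a \<in> set sa")
      case True
      then obtain g where g: "g < md" "a = sa ! g" by (auto simp: md_def in_set_conv_nth)
      then have "interdicted ?P (flow_of ?L) {a} = fsum L (hit {g})" using hit[of "{g}"] by simp
      then show ?thesis using assms g e by (simp add: dsol_def)
    next
      case False
      then have "interdicted ?P (flow_of ?L) {a} = interdicted ?P (flow_of ?L) {}" using pruned[of "{a}"] by simp
      then show ?thesis unfolding e by (simp add: interdicted_def)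
    qed
  qed
  have "interdicted ?P (flow_of ?L) S \<le> of_nat (budget I) - 1" if S: "S \<in> r_scenarios I" for S
  proof -
    have "finite S" using S by (auto simp: r_scenarios_def intro: finite_subset)
    then have fin: "finite (S \<inter> set sa)" by simp
    have "card (S \<inter> set sa) \<le> k"
      using S card_mono[OF \<open>finite S\<close>, of "S \<inter> set sa"] src by (auto simp: r_scenarios_def)
    then consider "card (S \<inter> set sa) \<le> k - 1" | "card (S \<inter> set sa) = k" by linarith
    then show ?thesis
    proof cases
      \<comment> \<open>Fewer than \<open>k\<close> relevant arcs cannot violate the bound, since
        each carries at most 1; this is why \<open>dsol\<close> mentions only cliques of size
        exactly \<open>k\<close>.\<close>
      case 1
      have "interdicted ?P (flow_of ?L) S \<le> (\<Sum>a\<in>S \<inter> set sa. arc_flow ?P (flow_of ?L) a)"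
        unfolding pruned[of S] by (rule interdicted_le[OF finite_r_paths nn fin])
      also have "\<dots> \<le> (\<Sum>a\<in>S \<inter> set sa. 1)" by (rule sum_mono) (rule arc)
      also have "\<dots> \<le> of_nat (k - 1)" using 1 by simp
      finally show ?thesis using k by (simp add: src of_nat_diff)
    next
      case 2
      obtain T where T: "T \<subseteq> {..<md}" "S \<inter> set sa = (!) sa ` T" using image[of "S \<inter> set sa"] by auto
      have "clique (S \<inter> set sa) (compat_edges I)" using S by (auto simp: r_scenarios_def clique_def)
      then have "\<forall>g\<in>T. \<forall>h\<in>T. g \<noteq> h \<longrightarrow> adj (sa ! g) (sa ! h)" unfolding T(2) clique_image_iff[OF T(1)] .
      moreover have "card T = k" using 2 card_image_sa[OF T(1)] T(2) by simp
      ultimately have "fsum L (hit T) \<le> of_nat k - 1" using assms T(1) unfolding dsol_def by blast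
      then show ?thesis unfolding pruned[of S] T(2) hit[OF T(1)] by (simp add: src)
    qed
  qed
  moreover have "(\<Sum>P\<in>?P. flow_of ?L P) = v"
  proof -
    have "(\<Sum>P\<in>?P. flow_of ?L P) = fsum ?L (\<lambda>R. of_bool (R \<in> ?P))" by (rule sum_flow_of[OF finite_r_paths])
    also have "\<dots> = fsum L (\<lambda>_. 1)" unfolding fsum_map using dvalid_path d(2) by (intro fsum_cong) simp
    finally show ?thesis using assms by (simp add: dsol_def)
  qed
  ultimately show ?thesis using nn arc unfolding rflow_def by simp
qed

lemma dsol_of_rflow:
  assumes "rflow I v x"
  shows "\<exists>L. dsol L v \<and> (integral_flow (r_paths I) x \<longrightarrow> (\<forall>z\<in>set L. fst z \<in> \<int>))"
proof -
  let ?P = "r_paths I"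
  obtain Q where Q: "set Q = (\<lambda>P. (x P, P)) ` {P \<in> ?P. x P \<noteq> 0}" "\<And>F. fsum Q F = (\<Sum>P\<in>?P. x P * F P)"
    using flow_as_list[OF finite_r_paths, where x = x] by blast
  have "\<forall>P. \<exists>gs. P \<in> ?P \<longrightarrow> dvalid gs \<and> arcset gs = P" using path_dvalid by blast
  then obtain h where h: "\<And>P. P \<in> ?P \<Longrightarrow> dvalid (h P) \<and> arcset (h P) = P" by metis
  let ?L = "map (\<lambda>z. (fst z, h (snd z))) Q"
  have hs: "fsum ?L (hit S) = interdicted ?P x ((!) sa ` S)" if S: "S \<subseteq> {..<md}" for S
  proof -
    have "fsum ?L (hit S) = (\<Sum>P\<in>?P. x P * hit S (h P))" unfolding fsum_map Q(2) ..
    also have "\<dots> = (\<Sum>P\<in>?P. x P * of_bool (P \<inter> (!) sa ` S \<noteq> {}))"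
    proof (rule sum.cong[OF refl])
      fix P assume P: "P \<in> ?P"
      have "set (h P) \<subseteq> {..<md}" using h[OF P] by (simp add: dvalid_def)
      from arcset_hit[OF this S] show "x P * hit S (h P) = x P * of_bool (P \<inter> (!) sa ` S \<noteq> {})"
        using h[OF P] by (simp add: hit_def)
    qed
    finally show ?thesis unfolding interdicted_sum[OF finite_r_paths] .
  qed
  have "dsol ?L v" unfolding dsol_def
  proof (intro conjI allI ballI impI)
    fix z assume "z \<in> set ?L"
    then show "0 \<le> fst z" "dvalid (snd z)" using Q(1) h assms by (auto simp: rflow_def nonneg_flow_def)
  next
    show "fsum ?L (\<lambda>_. 1) = v" unfolding fsum_map Q(2) using assms by (simp add: rflow_def)
  next
    fix g assume g: "g < md"
    then have "sa ! g \<in> set (arc_list I)" using nth_mem[of g sa] sa_set(1) by (auto simp: md_def)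
    then have "arc_flow ?P x (sa ! g) \<le> 1" using assms by (auto simp: rflow_def)
    then show "fsum ?L (hit {g}) \<le> 1" using hs[of "{g}"] g by (simp add: arc_flow_def interdicted_def)
  next
    fix S assume S: "S \<subseteq> {..<md}" "card S = k" "\<forall>g\<in>S. \<forall>h\<in>S. g \<noteq> h \<longrightarrow> adj (sa ! g) (sa ! h)"
    have "(!) sa ` S \<subseteq> set sa" using S(1) by (auto simp: md_def)
    then have "(!) sa ` S \<in> r_scenarios I"
      using S clique_image_iff[OF S(1)] card_image_sa[OF S(1)] sa_set(1) src by (auto simp: r_scenarios_def)
    then show "fsum ?L (hit S) \<le> of_nat k - 1" unfolding hs[OF S(1)] using assms src(3) by (simp add: rflow_def)
  qed
  moreover have "\<forall>z\<in>set ?L. fst z \<in> \<int>" if "integral_flow ?P x"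
    using that Q(1) by (auto simp: integral_flow_def)
  ultimately show ?thesis by blast
qed

end

text \<open>The integrality half: the weights of the witness are the given ones and values of
  literals, so integral values of all variables suffice.\<close>

lemma (in red) core_sol_lists:
  assumes "dsol LD v" "\<And>j. j < V \<Longrightarrow> 0 \<le> val j \<and> val j \<le> 1"
    and "\<And>z. z \<in> set axs \<Longrightarrow> (\<Sum>l\<leftarrow>fst z. lit val l) = of_nat (snd z)"
    and "v + (\<Sum>l\<leftarrow>outs. lit val l) = of_nat c" "0 < V \<Longrightarrow> 2 \<le> k"
  shows "\<exists>L. core_sol L \<and> ((\<forall>z\<in>set LD. fst z \<in> \<int>) \<and> (\<forall>j. val j \<in> \<int>) \<longrightarrow> (\<forall>z\<in>set L. fst z \<in> \<int>))"
proof -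
  have "\<forall>z\<in>set (LD @ map (\<lambda>g. (weight val (lab g), [g])) [md..<m]). fst z \<in> \<int>"
    if LDi: "\<forall>z\<in>set LD. fst z \<in> \<int>" and vi: "\<forall>j. val j \<in> \<int>"
  proof
    have w: "weight val l \<in> \<int>" for l using vi by (auto simp: weight_def lit_def)
    fix z assume "z \<in> set (LD @ map (\<lambda>g. (weight val (lab g), [g])) [md..<m])"
    then consider "z \<in> set LD" | g where "z = (weight val (lab g), [g])" by auto
    then show "fst z \<in> \<int>"
    proof cases
      case 1
      then show ?thesis using LDi by blast
    next
      case 2
      show ?thesis unfolding 2 fst_conv by (rule w)
    qed
  qed
  then show ?thesis using core_sol_sufficient[OF assms] by blast
qed

section \<open>Equivalence when source and sink differ\<close>

locale red_num = red_inst +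
  fixes p q :: nat
  assumes q: "0 < q" and dem: "r_demand I = of_nat p / of_nat q"
    and cap_c: "c = (if p < Suc (length sa) * q then (p + q - 1) div q else Suc (length sa))"
    and lits_if: "p mod q \<noteq> 0 \<and> p < Suc (length sa) * q \<Longrightarrow>
      V = length (bits q) \<and> axs = frac_system q \<and> outs = frac_outs (c * q - p)"
    and lits_else: "\<not> (p mod q \<noteq> 0 \<and> p < Suc (length sa) * q) \<Longrightarrow> V = 0 \<and> axs = [] \<and> outs = []"
begin

abbreviation (input) "\<theta> \<equiv> (of_nat p / of_nat q :: rat)"

lemma Ints_demand: "\<theta> \<in> \<int> \<longleftrightarrow> p mod q = 0"
proof
  assume "\<theta> \<in> \<int>"
  moreover have "0 \<le> \<theta>" by simp
  ultimately obtain n :: nat where "\<theta> = of_nat n" by (metis Ints_cases of_int_of_nat_eq of_int_0_le_iff zero_le_imp_eq_int)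
  then have "of_nat p = (of_nat (n * q) :: rat)" using q by (simp add: field_simps)
  then have "p = n * q" by (simp only: of_nat_eq_iff)
  then show "p mod q = 0" by simp
next
  assume "p mod q = 0"
  then have "p = q * (p div q)" by (metis add.right_neutral mult_div_mod_eq)
  then have "of_nat p = (of_nat (q * (p div q)) :: rat)" by (rule arg_cong)
  then have "\<theta> = of_nat (p div q)" using q by (simp add: field_simps)
  then show "\<theta> \<in> \<int>" by (simp only: Ints_of_nat)
qed

text \<open>\<open>c\<close> is the demand rounded up; the excess, a multiple of
  \<open>1 / q\<close> of at most 1, is absorbed at \<open>tn\<close> by the literals in
  \<open>outs\<close>.\<close>

lemma ceiling_c:
  assumes "p < Suc (length sa) * q"
  shows "p \<le> c * q" "c * q - p \<le> q" "p mod q = 0 \<Longrightarrow> \<theta> = of_nat c"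
    "\<theta> + of_nat (c * q - p) / of_nat q = of_nat c"
proof -
  have c: "c = (p + q - 1) div q" using assms by (simp add: cap_c)
  have e: "c * q + (p + q - 1) mod q = p + q - 1" unfolding c by (rule div_mult_mod_eq)
  have "(p + q - 1) mod q < q" using q by simp
  then show le: "p \<le> c * q" and "c * q - p \<le> q" using e by linarith+
  have "of_nat (c * q - p) = (of_nat c * of_nat q - of_nat p :: rat)" using le by (simp add: of_nat_diff)
  then show "\<theta> + of_nat (c * q - p) / of_nat q = of_nat c" using q by (simp add: field_simps)
  show "\<theta> = of_nat c" if "p mod q = 0"
  proof -
    have "q dvd p" using that by (simp add: dvd_eq_mod_eq_0)
    then obtain n where n: "p = n * q" by (metis dvd_div_mult_self)
    have "c = n"
      unfolding c n by (rule div_nat_eqI) (use q in \<open>simp_all add: algebra_simps\<close>)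
    then show ?thesis using q by (simp add: n)
  qed
qed

lemma budget_2:
  assumes "p mod q \<noteq> 0" "rflow I \<theta> x"
  shows "2 \<le> k"
proof (rule ccontr)
  assume "\<not> 2 \<le> k"
  then have "budget I = 1" using k src by simp
  from rflow_budget_1[OF assms(2) _ this] have "\<theta> = 0" using nd(4) src by simp
  then have "p = 0" using q by simp
  then show False using assms(1) by simp
qed

text \<open>If \<open>q\<close> does not divide \<open>p\<close>, the literals take fractional
  values. The claim on integrality is then vacuous, because an integral flow has an integral
  value.\<close>

lemma solution_core_sol:
  assumes x: "mrf_r_solution I x"
  shows "\<exists>L. core_sol L \<and> (integral_flow (r_paths I) x \<longrightarrow> (\<forall>z\<in>set L. fst z \<in> \<int>))"
proof -
  have x: "rflow I \<theta> x" using x by (simp add: mrf_r_solution_iff dem)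
  obtain LD where LD: "dsol LD \<theta>" "integral_flow (r_paths I) x \<longrightarrow> (\<forall>z\<in>set LD. fst z \<in> \<int>)"
    using dsol_of_rflow[OF x] by blast
  have "of_nat p \<le> (of_nat (length sa * q) :: rat)" using dsol_le[OF LD(1)] q by (simp add: md_def field_simps)
  then have "p \<le> length sa * q" by (simp only: of_nat_le_iff)
  then have lt: "p < Suc (length sa) * q" using q by simp
  show ?thesis
  proof (cases "p mod q = 0")
    case True
    then have "V = 0" "axs = []" "outs = []" using lits_else by auto
    then have "\<exists>L. core_sol L \<and> ((\<forall>z\<in>set LD. fst z \<in> \<int>) \<and> (\<forall>j::nat. (0 :: rat) \<in> \<int>) \<longrightarrow> (\<forall>z\<in>set L. fst z \<in> \<int>))"
      using ceiling_c(3)[OF lt True] by (intro core_sol_lists[OF LD(1)]) auto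
    then show ?thesis using LD(2) by auto
  next
    case False
    then have pars: "V = length (bits q)" "axs = frac_system q" "outs = frac_outs (c * q - p)" using lits_if lt by auto
    have "\<not> integral_flow (r_paths I) x"
    proof
      assume "integral_flow (r_paths I) x"
      then have "(\<Sum>P\<in>r_paths I. x P) \<in> \<int>" by (intro Ints_sum) (auto simp: integral_flow_def)
      then show False using x False Ints_demand by (simp add: rflow_def)
    qed
    moreover have "\<exists>L. core_sol L \<and> ((\<forall>z\<in>set LD. fst z \<in> \<int>) \<and> (\<forall>j::nat. (2 ^ j / of_nat q :: rat) \<in> \<int>) \<longrightarrow> (\<forall>z\<in>set L. fst z \<in> \<int>))"
    proof (rule core_sol_lists[OF LD(1)])
      note fs = frac_system_solution[OF q refl]
      show "0 \<le> (2 ^ j / of_nat q :: rat) \<and> 2 ^ j / of_nat q \<le> (1 :: rat)" if "j < V" for j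
        using fs(3)[of j] that pars(1) by simp
      show "(\<Sum>l\<leftarrow>fst z. lit (\<lambda>j. 2 ^ j / of_nat q) l) = of_nat (snd z)" if "z \<in> set axs" for z
        using fs(1)[of z] that pars(2) by simp
      show "\<theta> + (\<Sum>l\<leftarrow>outs. lit (\<lambda>j. 2 ^ j / of_nat q) l) = of_nat c"
        using fs(2)[of "c * q - p"] ceiling_c(4)[OF lt] pars(3) by simp
      show "2 \<le> k" using budget_2[OF False x] .
    qed
    ultimately show ?thesis by blast
  qed
qed

text \<open>Literals are bounded from above only, so the exit \<open>tn\<close> merely yields a
  network flow of value at least the demand, which is then scaled down. Scaling would spoil
  integrality, but it happens only for a fractional demand, and then \<open>q * val 0 = 1\<close>
  with \<open>q\<close> different from 1 excludes integral core solutions. For an integral demand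
  \<open>outs\<close> is empty and the value is exactly \<open>c\<close>.\<close>

lemma core_sol_solution:
  assumes L: "core_sol L"
  shows "\<exists>x. mrf_r_solution I x \<and> ((\<forall>z\<in>set L. fst z \<in> \<int>) \<longrightarrow> integral_flow (r_paths I) x)"
proof -
  define LD where "LD = filter (\<lambda>z. dvalid (snd z)) L"
  define v where "v = fsum LD (\<lambda>_. 1)"
  note nec = core_sol_necessary[OF L, folded LD_def]
  have dsol: "dsol LD v" unfolding v_def by (rule nec(1))
  define x where "x = flow_of (map (\<lambda>z. (fst z, arcset (snd z))) LD)"
  have x: "rflow I v x" unfolding x_def by (rule rflow_of_dsol[OF dsol])
  have xi: "integral_flow (r_paths I) x" if "\<forall>z\<in>set L. fst z \<in> \<int>"
    unfolding integral_flow_def x_def using that by (auto simp: LD_def intro!: flow_of_Ints)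
  have k2: "2 \<le> k" if "V \<noteq> 0" using core_sol_k1[OF L] k that by (cases "k = 1") auto
  have bq: "bits q \<noteq> []" using q by (simp add: bits_Nil)
  have "0 < V \<or> outs \<noteq> [] \<Longrightarrow> 2 \<le> k"
    using k2 lits_if lits_else bq by (cases "p mod q \<noteq> 0 \<and> p < Suc (length sa) * q") auto
  from core_sol_literals[OF L this, folded LD_def v_def] obtain val where
    val: "\<And>j. j < V \<Longrightarrow> 0 \<le> val j \<and> val j \<le> 1"
      "\<And>z. z \<in> set axs \<Longrightarrow> of_nat (snd z) \<le> (\<Sum>l\<leftarrow>fst z. lit val l)"
      "of_nat c \<le> v + (\<Sum>l\<leftarrow>outs. lit val l)"
      "(\<forall>z\<in>set L. fst z \<in> \<int>) \<longrightarrow> (\<forall>j<V. val j \<in> \<int>)" by blast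
  show ?thesis
  proof (cases "p < Suc (length sa) * q")
    case False
    then have "outs = []" "c = Suc (length sa)" using lits_else cap_c by auto
    \<comment> \<open>The exit asks for one unit more than the network arcs can carry
      together.\<close>
    then have "(of_nat (Suc md) :: rat) \<le> of_nat md" using val(3) dsol_le[OF dsol] by (simp add: md_def)
    then show ?thesis by (simp only: of_nat_le_iff)
  next
    case lt: True
    show ?thesis
    proof (cases "p mod q = 0")
      case True
      then have "outs = []" using lits_else by auto
      then have "of_nat c \<le> v" using val(3) by simp
      moreover have "v \<le> of_nat c"
      proof -
        have "0 \<le> (\<Sum>g\<in>{md..<m}. fsum L (hit {g}) * of_bool (he g = tn))"
          by (intro sum_nonneg mult_nonneg_nonneg) (use nec(4) in auto)
        then show ?thesis using nec(2) unfolding v_def by linarith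
      qed
      ultimately have "v = r_demand I" using ceiling_c(3)[OF lt True] dem by simp
      then show ?thesis using x xi by (auto simp: mrf_r_solution_iff)
    next
      case False
      then have pars: "V = length (bits q)" "axs = frac_system q" "outs = frac_outs (c * q - p)" using lits_if lt by auto
      have f: "of_nat q * val 0 = 1" "(\<Sum>l\<leftarrow>outs. lit val l) = of_nat (c * q - p) / of_nat q"
        using frac_system_forces(1)[of q val] frac_system_forces(2)[of q val "c * q - p"] val(2) q ceiling_c(2)[OF lt] unfolding pars by auto
      have "\<theta> \<le> v" using val(3) ceiling_c(4)[OF lt] unfolding f(2) by linarith
      have "0 < p" using False by (cases p) auto
      then have pos: "0 < \<theta>" using q by simp
      define f where "f = \<theta> / v"
      have v0: "0 < v" using pos \<open>\<theta> \<le> v\<close> by linarith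
      then have fv: "f * v = \<theta>" unfolding f_def by (metis less_irrefl nonzero_eq_divide_eq)
      have "0 \<le> f" unfolding f_def using v0 pos by (metis divide_nonneg_pos less_imp_le)
      moreover have "f \<le> 1" by (rule mult_right_le_imp_le[OF _ v0]) (use fv \<open>\<theta> \<le> v\<close> in linarith)
      moreover have "0 < budget I" using k src(3) by simp
      ultimately have "rflow I (f * v) (\<lambda>P. f * x P)" by (rule rflow_scale[OF x])
      then have "mrf_r_solution I (\<lambda>P. f * x P)" by (simp only: mrf_r_solution_iff dem fv)
      moreover have "\<not> (\<forall>z\<in>set L. fst z \<in> \<int>)"
      proof
        assume "\<forall>z\<in>set L. fst z \<in> \<int>"
        then have "val 0 \<in> \<int>" using val(4) pars(1) bq by simp
        then obtain i where "val 0 = of_int i" by (auto elim: Ints_cases)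
        then have "of_int (int q * i) = (of_int 1 :: rat)" using f(1) by simp
        then have "int q * i = 1" by (simp only: of_int_eq_iff)
        then have "q = 1" by (simp add: zmult_eq_1_iff)
        then show False using False by simp
      qed
      ultimately show ?thesis by blast
    qed
  qed
qed

end

section \<open>Equivalence when source and sink coincide\<close>

locale red_eq = red +
  fixes p q :: nat
  assumes q: "0 < q" and empty: "sa = []" "c = 0" "outs = []"
    and lits_eq: "V = (if p mod q = 0 then 0 else length (bits q))" "axs = (if p mod q = 0 then [] else frac_system q)"
    and k_eq: "p mod q \<noteq> 0 \<Longrightarrow> 2 \<le> k"
begin

lemma dsol_Nil: "dsol [] 0"
  unfolding dsol_def md_def using k by (auto simp: empty)

text \<open>The empty path carries every demand, so the instance must be solvable always, and
  integrally exactly if \<open>q\<close> divides \<open>p\<close>. The network part is empty and the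
  constraint system alone makes the distinction.\<close>

lemma ex_core_sol: "\<exists>L. core_sol L" "p mod q = 0 \<Longrightarrow> \<exists>L. core_sol L \<and> (\<forall>z\<in>set L. fst z \<in> \<int>)"
proof -
  have "\<exists>L. core_sol L \<and> ((\<forall>z\<in>set []. fst (z :: rat \<times> nat list) \<in> \<int>) \<and> (\<forall>j::nat. (0 :: rat) \<in> \<int>) \<longrightarrow> (\<forall>z\<in>set L. fst z \<in> \<int>))"
    if "p mod q = 0" using that empty lits_eq by (intro core_sol_lists[OF dsol_Nil]) auto
  then show 1: "p mod q = 0 \<Longrightarrow> \<exists>L. core_sol L \<and> (\<forall>z\<in>set L. fst z \<in> \<int>)" by auto
  show "\<exists>L. core_sol L"
  proof (cases "p mod q = 0")
    case False
    have "\<exists>L. core_sol L \<and> ((\<forall>z\<in>set []. fst (z :: rat \<times> nat list) \<in> \<int>) \<and> (\<forall>j::nat. (2 ^ j / of_nat q :: rat) \<in> \<int>) \<longrightarrow> (\<forall>z\<in>set L. fst z \<in> \<int>))"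
    proof (rule core_sol_lists[OF dsol_Nil])
      note fs = frac_system_solution[OF q refl]
      show "0 \<le> (2 ^ j / of_nat q :: rat) \<and> 2 ^ j / of_nat q \<le> (1 :: rat)" if "j < V" for j
        using fs(3)[of j] that lits_eq(1) False by simp
      show "(\<Sum>l\<leftarrow>fst z. lit (\<lambda>j. 2 ^ j / of_nat q) l) = of_nat (snd z)" if "z \<in> set axs" for z
        using fs(1)[of z] that lits_eq(2) False by simp
    qed (use empty k_eq[OF False] in auto)
    then show ?thesis by blast
  next
    case True
    from 1[OF this] obtain L where "core_sol L" by blast
    then show ?thesis by (rule exI)
  qed
qed

lemma core_sol_integral:
  assumes L: "core_sol L" "\<forall>z\<in>set L. fst z \<in> \<int>"
  shows "p mod q = 0"
proof (rule ccontr)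
  assume False': "p mod q \<noteq> 0"
  have bq: "bits q \<noteq> []" using q by (simp add: bits_Nil)
  from core_sol_literals[OF L(1) k_eq[OF False']] L(2) obtain val where
    val: "\<And>z. z \<in> set axs \<Longrightarrow> of_nat (snd z) \<le> (\<Sum>l\<leftarrow>fst z. lit val l)" "\<forall>j<V. val j \<in> \<int>" by blast
  have f: "of_nat q * val 0 = 1"
    using frac_system_forces(1)[of q val] val(1) q lits_eq(2) False' by auto
  have "val 0 \<in> \<int>" using val(2) lits_eq(1) False' bq by simp
  then obtain i where "val 0 = of_int i" by (auto elim: Ints_cases)
  then have "of_int (int q * i) = (of_int 1 :: rat)" using f(1) by simp
  then have "int q * i = 1" by (simp only: of_int_eq_iff)
  then have "q = 1" by (simp add: zmult_eq_1_iff)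
  then show False using False' by simp
qed

end

section \<open>The structural properties (2) to (5) and the size of the capacities\<close>

definition good_instance :: "mrf_m \<Rightarrow> bool" where
  "good_instance J \<longleftrightarrow> (\<forall>i \<in> commodities J.
            (\<Sum>a \<in> leaving (graph_of J) {m_source J i}. capacity J a) = m_demand J i
            \<and> (\<Sum>a \<in> entering (graph_of J) {m_sink J i}. capacity J a) = m_demand J i
            \<and> entering (graph_of J) {m_source J i} = {}
            \<and> leaving (graph_of J) {m_sink J i} = {})
        \<and> (\<exists>i0 \<in> commodities J.
            (\<Sum>i \<in> commodities J - {i0}. m_demand J i) \<le> max_capacity J - 3
            \<and> (\<forall>x \<in> m_flows J. \<forall>i \<in> commodities J - {i0}. \<forall>a \<in> arcs (graph_of J).
                  max_capacity J - 2 \<le> capacity J a \<longrightarrow> 2 \<le> arc_flow (m_paths_of J i) x a))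
        \<and> (\<exists>U \<subseteq> verts (graph_of J).
            m_source J ` commodities J \<subseteq> U
            \<and> m_sink J ` commodities J \<subseteq> verts (graph_of J) - U
            \<and> (\<Sum>a \<in> leaving (graph_of J) U. capacity J a) = (\<Sum>i \<in> commodities J. m_demand J i)
            \<and> card {a \<in> leaving (graph_of J) U. capacity J a = max_capacity J}
                = budget J - 1)"

declare graph_simps [simp del]

lemma (in core) good_J: "good_instance J"
proof -
  have "2 \<le> arc_flow (m_paths_of J i) x a"
    if "x \<in> m_flows J" "i \<in> commodities J - {0}" "a \<in> A" "max_capacity J - 2 \<le> capacity J a" for x i a
    using property4[OF that] .
  moreover have "m_source J ` commodities J = nS ` {..N}" "m_sink J ` commodities J = nT ` {..N}"
    by (auto simp: com_simps)
  moreover have "(\<Sum>i\<in>commodities J. m_demand J i) = (\<Sum>i\<le>N. of_nat (dem i))"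
    unfolding com_simps(1) by (rule sum.cong) (auto simp: com_simps)
  moreover have "0 \<in> commodities J" by (simp add: com_simps)
  moreover have "(\<Sum>a\<in>leaving D {m_source J i}. capacity J a) = m_demand J i
      \<and> (\<Sum>a\<in>entering D {m_sink J i}. capacity J a) = m_demand J i
      \<and> entering D {m_source J i} = {} \<and> leaving D {m_sink J i} = {}" if "i \<in> commodities J" for i
    using that source_sum[of i] sink_sum[of i] entering_S[of i] leaving_T[of i] by (simp add: com_simps)
  ultimately show ?thesis unfolding good_instance_def D_simps max_cap
    using small_demands[unfolded max_cap] cut by (intro conjI ballI bexI[of _ 0] exI[of _ U]) auto
qed

text \<open>Big arcs and the source arcs of the small commodities already give this many arcs; it
  makes \<open>M\<close> linear in the number of arcs.\<close>

lemma (in core) card_A: "N * G + G \<le> card A"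
proof -
  have c: "length (concat (map (\<lambda>i. map (f i) [0..<n]) [0..<n'])) = n' * n" for f :: "nat \<Rightarrow> nat \<Rightarrow> nat \<times> nat" and n n'
    by (simp add: length_concat comp_def sum_list_triv)
  have "card A = length (map fst al)" unfolding A_def by (rule distinct_card[OF distinct_al])
  then show ?thesis unfolding map_fst_al length_append c by simp
qed

text \<open>The inflow of a cluster never exceeds the number of gadgets feeding it, and
  \<open>c\<close> exceeds the number of network gadgets by at most 1.\<close>

lemma (in red) \<Theta>_le:
  assumes "c \<le> Suc (length sa)" "\<And>z. z \<in> set axs \<Longrightarrow> snd z \<le> length (fst z)"
  shows "\<Theta> \<le> 2 * G + 1"
proof -
  have "snd (snd z) \<le> length (fst (snd z))" if "z \<in> set cls" for z
  proof -
    have "snd z \<in> set (map snd cls)" using that by simp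
    then show ?thesis unfolding cls_snd using assms(2) by auto
  qed
  then have "sum_list (map (\<lambda>z. snd (snd z)) cls) \<le> sum_list (map (\<lambda>z. length (fst (snd z))) cls)"
    by (intro sum_list_mono) auto
  also have "\<dots> \<le> length il" unfolding il_def items_def by (simp add: length_concat comp_def)
  also have "length il \<le> G"
  proof -
    have "m \<le> G" by (simp add: G_def)
    then show ?thesis using m_eq by linarith
  qed
  finally have "sum_list (map (\<lambda>z. snd (snd z)) cls) \<le> G" .
  moreover have "c \<le> Suc G"
  proof -
    have "m \<le> G" by (simp add: G_def)
    then show ?thesis using assms(1) md_le unfolding md_def by linarith
  qed
  moreover have "\<Theta> = c + sum_list (map (\<lambda>z. snd (snd z)) cls)" unfolding \<Theta>_def by (simp add: exs_def comp_def)
  ultimately show ?thesis by simp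
qed

lemma (in red) M_le:
  assumes "c \<le> Suc (length sa)" "\<And>z. z \<in> set axs \<Longrightarrow> snd z \<le> length (fst z)"
  shows "M \<le> 3 * card A + 7"
proof -
  have "M \<le> 3 * N * G + 2 * G + 7" unfolding M_def using \<Theta>_le[OF assms] by linarith
  also have "\<dots> \<le> 3 * (N * G + G) + 7" by (simp add: algebra_simps)
  also have "\<dots> \<le> 3 * card A + 7" using card_A by simp
  finally show ?thesis .
qed

lemma frac_system_caps: "0 < q \<Longrightarrow> z \<in> set (frac_system q) \<Longrightarrow> snd z \<le> length (fst z)"
  using ones_bits_pos[of q] by (auto simp: frac_system_def Suc_le_eq)

lemma st_path_first: "P \<in> st_paths D s t \<Longrightarrow> s \<noteq> t \<Longrightarrow> \<exists>b\<in>P. tail D b = s"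
proof (erule st_pathsE)
  fix p assume p: "P = set p" "pre_digraph.cas D s p t" "s \<noteq> t"
  then show ?thesis by (cases p) (auto simp: pre_digraph.cas.simps)
qed

lemma st_path_next: "P \<in> st_paths D s t \<Longrightarrow> a \<in> P \<Longrightarrow> head D a \<noteq> t \<Longrightarrow> \<exists>b\<in>P. tail D b = head D a"
proof (erule st_pathsE)
  fix p assume p: "P = set p" "pre_digraph.cas D s p t" "a \<in> P" "head D a \<noteq> t"
  have "pre_digraph.cas D u q t \<Longrightarrow> a \<in> set q \<Longrightarrow> \<exists>b\<in>set q. tail D b = head D a" for u q
  proof (induction q arbitrary: u)
    case (Cons b q)
    show ?case
    proof (cases "a = b \<and> q \<noteq> []")
      case True
      then show ?thesis using Cons.prems(1) by (cases q) (auto simp: pre_digraph.cas.simps)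
    next
      case False
      then have "a \<in> set q" using Cons.prems p(4) by (auto simp: pre_digraph.cas.simps)
      then show ?thesis using Cons by (auto simp: pre_digraph.cas.simps)
    qed
  qed simp
  then show ?thesis using p by blast
qed

section \<open>An instance with a fractional but no integral solution\<close>

text \<open>The unit arcs (4, 5), (6, 7), (8, 9), (10, 11) form a 2 by 2 square. Commodity 0 has to
  cross it along a row, the unit of commodity 1 through (1, 3) along a column, and every row meets
  every column. Half a unit on each row and each column fits, but no integral choice does. The arc
  (12, 13) of capacity \<open>M = 6\<close> is there for the structural properties: it must carry 2
  units of commodity 1, and 6 exceeds the total demand 4, so a budget of 1 restricts
  nothing.\<close>

definition gap_arcs :: "((nat \<times> nat) \<times> nat) list" where
  "gap_arcs = [((0, 2), 1), ((2, 4), 1), ((2, 8), 1), ((4, 5), 1), ((6, 7), 1), ((8, 9), 1), ((10, 11), 1),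
    ((5, 6), 1), ((9, 10), 1), ((7, 14), 1), ((11, 14), 1), ((14, 16), 1),
    ((1, 3), 1), ((1, 12), 2), ((12, 13), 6), ((13, 17), 2), ((3, 4), 1), ((3, 6), 1), ((5, 8), 1), ((7, 10), 1),
    ((9, 15), 1), ((11, 15), 1), ((15, 17), 1)]"

definition gap_commodities :: "(nat \<times> nat \<times> nat) list" where
  "gap_commodities = [(0, 16, 1), (1, 17, 3)]"

definition gap_instance :: mrf_m where
  "gap_instance = \<lparr>node_list = [0..<18], arc_list = map fst gap_arcs, budget = 1,
     capacity = (\<lambda>a. of_nat (the (map_of gap_arcs a))),
     commodity_list = map (\<lambda>(s, t, d). (s, t, of_nat d)) gap_commodities\<rparr>"

abbreviation "GD \<equiv> graph_of gap_instance"
abbreviation "GP i \<equiv> m_paths_of gap_instance i"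

definition "GA = set (map fst gap_arcs)"

lemma gap_graph: "arcs GD = GA" "verts GD = {..<18}" "tail GD = fst" "head GD = snd" "budget gap_instance = 1"
  by (auto simp: graph_of_def gap_instance_def GA_def)

lemma GA_eq: "GA = {(0, 2), (2, 4), (2, 8), (4, 5), (6, 7), (8, 9), (10, 11), (5, 6), (9, 10), (7, 14), (11, 14), (14, 16),
    (1, 3), (1, 12), (12, 13), (13, 17), (3, 4), (3, 6), (5, 8), (7, 10), (9, 15), (11, 15), (15, 17)}"
  by (simp add: GA_def gap_arcs_def)

lemma gap_capacity: "capacity gap_instance a = of_nat (the (map_of gap_arcs a))"
  by (simp add: gap_instance_def)

lemma gap_caps:
  "capacity gap_instance (0, 2) = 1" "capacity gap_instance (2, 4) = 1" "capacity gap_instance (2, 8) = 1"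
  "capacity gap_instance (4, 5) = 1" "capacity gap_instance (6, 7) = 1" "capacity gap_instance (8, 9) = 1"
  "capacity gap_instance (10, 11) = 1" "capacity gap_instance (5, 6) = 1" "capacity gap_instance (9, 10) = 1"
  "capacity gap_instance (7, 14) = 1" "capacity gap_instance (11, 14) = 1" "capacity gap_instance (14, 16) = 1"
  "capacity gap_instance (1, 3) = 1" "capacity gap_instance (1, 12) = 2" "capacity gap_instance (12, 13) = 6"
  "capacity gap_instance (13, 17) = 2" "capacity gap_instance (3, 4) = 1" "capacity gap_instance (3, 6) = 1"
  "capacity gap_instance (5, 8) = 1" "capacity gap_instance (7, 10) = 1" "capacity gap_instance (9, 15) = 1"
  "capacity gap_instance (11, 15) = 1" "capacity gap_instance (15, 17) = 1"
  by (simp_all add: gap_instance_def gap_arcs_def)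

lemmas gap_caps' = gap_caps gap_caps[unfolded One_nat_def]

lemma gap_commodity: "commodities gap_instance = {0, 1}"
  "m_source gap_instance 0 = 0" "m_source gap_instance (Suc 0) = 1" "m_sink gap_instance 0 = 16" "m_sink gap_instance (Suc 0) = 17"
  "m_demand gap_instance 0 = 1" "m_demand gap_instance (Suc 0) = 3"
  by (auto simp: commodities_def gap_instance_def gap_commodities_def m_source_def m_sink_def m_demand_def)

lemma gap_max: "max_capacity gap_instance = 6"
  unfolding max_capacity_def gap_graph GA_eq image_insert image_empty gap_caps by simp

lemma gap_mem: "gap_instance \<in> mrf_m_instances"
proof -
  have A: "fst a < 18 \<and> snd a < 18 \<and> fst a \<noteq> snd a" if "a \<in> GA" for a using that unfolding GA_eq by auto
  have "digraph GD"
    by unfold_locales (use A in \<open>auto simp: arc_to_ends_def prod_eq_iff gap_graph GA_def\<close>)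
  moreover have "distinct (map fst gap_arcs)" by (simp add: gap_arcs_def)
  ultimately have "valid_graph gap_instance" by (simp add: valid_graph_def) (simp add: gap_instance_def)
  moreover have "GA \<noteq> {}" by (simp add: GA_eq)
  ultimately show ?thesis by (simp add: mrf_m_instances_def gap_graph gap_commodity gap_capacity)
qed

lemma GP_eq: "GP 0 = st_paths GD 0 16" "GP (Suc 0) = st_paths GD 1 17"
  by (simp_all add: m_paths_of_def gap_commodity)

lemma finite_GP: "finite (st_paths GD s t)"
  by (rule finite_st_paths) (simp add: gap_graph GA_def)

lemma gap_paths: "m_paths gap_instance = st_paths GD 0 16 \<union> st_paths GD 1 17"
  by (simp add: m_paths_def gap_commodity GP_eq)

lemma gap_step:
  assumes "P \<in> st_paths GD s t" "(u, v) \<in> P" "v \<noteq> t"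
  shows "\<exists>w. (v, w) \<in> P \<and> (v, w) \<in> GA"
proof -
  obtain b where b: "b \<in> P" "tail GD b = head GD (u, v)"
    using st_path_next[OF assms(1,2)] assms(3) by (auto simp: gap_graph)
  then have "b = (v, snd b)" by (simp add: gap_graph prod_eq_iff)
  then show ?thesis using b(1) st_paths_subset[OF assms(1)] by (metis gap_graph(1) subsetD)
qed

lemma gap_start:
  assumes "P \<in> st_paths GD s t" "s \<noteq> t"
  shows "\<exists>w. (s, w) \<in> P \<and> (s, w) \<in> GA"
proof -
  obtain b where b: "b \<in> P" "tail GD b = s" using st_path_first[OF assms] by blast
  then have "b = (s, snd b)" by (simp add: gap_graph prod_eq_iff)
  then show ?thesis using b(1) st_paths_subset[OF assms(1)] by (metis gap_graph(1) subsetD)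
qed

lemma gap_out:
  "(0, w) \<in> GA \<Longrightarrow> w = 2" "(1, w) \<in> GA \<Longrightarrow> w = 3 \<or> w = 12" "(2, w) \<in> GA \<Longrightarrow> w = 4 \<or> w = 8"
  "(3, w) \<in> GA \<Longrightarrow> w = 4 \<or> w = 6" "(4, w) \<in> GA \<Longrightarrow> w = 5" "(5, w) \<in> GA \<Longrightarrow> w = 6 \<or> w = 8"
  "(6, w) \<in> GA \<Longrightarrow> w = 7" "(7, w) \<in> GA \<Longrightarrow> w = 10 \<or> w = 14" "(8, w) \<in> GA \<Longrightarrow> w = 9"
  "(9, w) \<in> GA \<Longrightarrow> w = 10 \<or> w = 15" "(10, w) \<in> GA \<Longrightarrow> w = 11" "(12, w) \<in> GA \<Longrightarrow> w = 13"
  "(14, w) \<in> GA \<Longrightarrow> w = 16" "(15, w) \<in> GA \<Longrightarrow> w = 17" "(16, w) \<in> GA \<Longrightarrow> False" "(17, w) \<in> GA \<Longrightarrow> False"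
  by (auto simp: GA_eq)

lemma gap_path_0:
  assumes P: "P \<in> st_paths GD 0 16"
  shows "(4, 5) \<in> P \<and> (6, 7) \<in> P \<or> (8, 9) \<in> P \<and> (10, 11) \<in> P" "(0, 2) \<in> P"
proof -
  note st = gap_step[OF P]
  show 0: "(0, 2) \<in> P" using gap_start[OF P] gap_out(1) by auto
  have 2: "(2, 4) \<in> P \<or> (2, 8) \<in> P" using st[OF 0] gap_out(3) by fastforce
  have 4: "(u, 4) \<in> P \<Longrightarrow> (4, 5) \<in> P" for u using st[of u 4] gap_out(5) by fastforce
  have 5: "(4, 5) \<in> P \<Longrightarrow> (5, 6) \<in> P \<or> (5, 8) \<in> P" using st[of 4 5] gap_out(6) by fastforce
  have 6: "(u, 6) \<in> P \<Longrightarrow> (6, 7) \<in> P" for u using st[of u 6] gap_out(7) by fastforce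
  have 8: "(u, 8) \<in> P \<Longrightarrow> (8, 9) \<in> P" for u using st[of u 8] gap_out(9) by fastforce
  have 9: "(8, 9) \<in> P \<Longrightarrow> (9, 10) \<in> P \<or> (9, 15) \<in> P" using st[of 8 9] gap_out(10) by fastforce
  have 10: "(u, 10) \<in> P \<Longrightarrow> (10, 11) \<in> P" for u using st[of u 10] gap_out(11) by fastforce
  have 15: "(9, 15) \<in> P \<Longrightarrow> (15, 17) \<in> P" using st[of 9 15] gap_out(14) by fastforce
  have 17: "(15, 17) \<notin> P" using st[of 15 17] gap_out(16) by fastforce
  show "(4, 5) \<in> P \<and> (6, 7) \<in> P \<or> (8, 9) \<in> P \<and> (10, 11) \<in> P"
    using 2 4 5 6 8 9 10 15 17 by blast
qed

lemma gap_path_1: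
  assumes P: "P \<in> st_paths GD 1 17"
  shows "(1, 3) \<in> P \<Longrightarrow> (4, 5) \<in> P \<and> (8, 9) \<in> P \<or> (6, 7) \<in> P \<and> (10, 11) \<in> P"
    "(1, 3) \<in> P \<or> (1, 12) \<in> P \<and> (12, 13) \<in> P"
proof -
  note st = gap_step[OF P]
  have 1: "(1, 3) \<in> P \<or> (1, 12) \<in> P" using gap_start[OF P] gap_out(2) by fastforce
  have 12: "(1, 12) \<in> P \<Longrightarrow> (12, 13) \<in> P" using st[of 1 12] gap_out(12) by fastforce
  show "(1, 3) \<in> P \<or> (1, 12) \<in> P \<and> (12, 13) \<in> P" using 1 12 by blast
  assume "(1, 3) \<in> P"
  then have 3: "(3, 4) \<in> P \<or> (3, 6) \<in> P" using st[of 1 3] gap_out(4) by fastforce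
  have 4: "(u, 4) \<in> P \<Longrightarrow> (4, 5) \<in> P" for u using st[of u 4] gap_out(5) by fastforce
  have 5: "(4, 5) \<in> P \<Longrightarrow> (5, 6) \<in> P \<or> (5, 8) \<in> P" using st[of 4 5] gap_out(6) by fastforce
  have 6: "(u, 6) \<in> P \<Longrightarrow> (6, 7) \<in> P" for u using st[of u 6] gap_out(7) by fastforce
  have 7: "(6, 7) \<in> P \<Longrightarrow> (7, 10) \<in> P \<or> (7, 14) \<in> P" using st[of 6 7] gap_out(8) by fastforce
  have 8: "(u, 8) \<in> P \<Longrightarrow> (8, 9) \<in> P" for u using st[of u 8] gap_out(9) by fastforce
  have 10: "(u, 10) \<in> P \<Longrightarrow> (10, 11) \<in> P" for u using st[of u 10] gap_out(11) by fastforce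
  have 14: "(7, 14) \<in> P \<Longrightarrow> (14, 16) \<in> P" using st[of 7 14] gap_out(13) by fastforce
  have 16: "(14, 16) \<notin> P" using st[of 14 16] gap_out(15) by fastforce
  show "(4, 5) \<in> P \<and> (8, 9) \<in> P \<or> (6, 7) \<in> P \<and> (10, 11) \<in> P"
    using 3 4 5 6 7 8 10 14 16 by blast
qed

lemma gap_flowD:
  assumes x: "x \<in> m_flows gap_instance"
  shows "P \<in> m_paths gap_instance \<Longrightarrow> 0 \<le> x P" "a \<in> GA \<Longrightarrow> arc_flow (m_paths gap_instance) x a \<le> capacity gap_instance a"
    "(\<Sum>P\<in>st_paths GD 0 16. x P) = 1" "(\<Sum>P\<in>st_paths GD 1 17. x P) = 3"
  using x by (auto simp: m_flows_def nonneg_flow_def gap_commodity GP_eq gap_graph)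

text \<open>Commodity 1 has demand 3, and its source has only two arcs, of capacities 1 and 2; both
  must be full.\<close>

lemma gap_split:
  assumes x: "x \<in> m_flows gap_instance"
  shows "1 \<le> arc_flow (st_paths GD 1 17) x (1, 3)" "2 \<le> arc_flow (st_paths GD 1 17) x (12, 13)"
proof -
  let ?P = "st_paths GD 1 17"
  have sub: "?P \<subseteq> m_paths gap_instance" by (auto simp: gap_paths)
  have fin: "finite (m_paths gap_instance)" unfolding gap_paths by (simp add: finite_GP)
  have nn: "nonneg_flow (m_paths gap_instance) x" using x by (simp add: m_flows_def)
  have total: "3 \<le> arc_flow ?P x (1, 3) + arc_flow ?P x a" if "a = (1, 12) \<or> a = (12, 13)" for a
  proof -
    have "(\<Sum>P\<in>?P. x P) \<le> (\<Sum>P\<in>?P. x P * of_bool ((1, 3) \<in> P) + x P * of_bool (a \<in> P))"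
    proof (rule sum_mono)
      fix P assume P: "P \<in> ?P"
      have "0 \<le> x P" using gap_flowD(1)[OF x] P sub by blast
      then show "x P \<le> x P * of_bool ((1, 3) \<in> P) + x P * of_bool (a \<in> P)"
        using gap_path_1(2)[OF P] that by (auto simp: of_bool_def)
    qed
    then show ?thesis unfolding gap_flowD(4)[OF x] by (simp add: sum.distrib arc_flow_sum[OF finite_GP])
  qed
  have le: "arc_flow ?P x a \<le> capacity gap_instance a" if "a \<in> GA" for a
    using arc_flow_mono[OF fin nn sub, of a] gap_flowD(2)[OF x that] by simp
  have "arc_flow ?P x (1, 3) \<le> 1" "arc_flow ?P x (1, 12) \<le> 2"
    using le[of "(1, 3)"] le[of "(1, 12)"] by (simp_all add: GA_eq gap_capacity gap_arcs_def)
  then show "1 \<le> arc_flow ?P x (1, 3)" "2 \<le> arc_flow ?P x (12, 13)"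
    using total[of "(1, 12)"] total[of "(12, 13)"] by auto
qed

text \<open>In an integral flow some row path and some column path carry at least 1 each, and they
  share an arc of capacity 1.\<close>

lemma gap_not_integral:
  assumes x: "x \<in> m_flows gap_instance"
  shows "\<not> integral_flow (m_paths gap_instance) x"
proof
  assume int: "integral_flow (m_paths gap_instance) x"
  have ge1: "1 \<le> x P" if "P \<in> m_paths gap_instance" "x P \<noteq> 0" for P
  proof -
    have "x P \<in> \<int>" "0 \<le> x P" using int that(1) gap_flowD(1)[OF x] by (auto simp: integral_flow_def)
    then obtain i where i: "x P = of_int i" "0 \<le> i" by (auto elim: Ints_cases)
    then show ?thesis using that(2) by simp
  qed
  obtain P where P: "P \<in> st_paths GD 0 16" "x P \<noteq> 0"
    using gap_flowD(3)[OF x] by (metis sum.neutral zero_neq_one)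
  have "arc_flow (st_paths GD 1 17) x (1, 3) \<noteq> 0" using gap_split(1)[OF x] by auto
  then obtain Q where Q: "Q \<in> st_paths GD 1 17" "(1, 3) \<in> Q" "x Q \<noteq> 0"
    unfolding arc_flow_def by (metis (mono_tags, lifting) mem_Collect_eq sum.neutral)
  have mem: "P \<in> m_paths gap_instance" "Q \<in> m_paths gap_instance" using P Q by (auto simp: gap_paths)
  \<comment> \<open>The two weights may be added only if the paths differ. A path starting at 0
    contains no arc out of node 1, which no arc enters.\<close>
  have "P \<noteq> Q"
  proof
    assume "P = Q"
    then have "(1, 3) \<in> P" using Q(2) by simp
    have pot: "(\<Sum>a\<in>P. of_bool (snd a = 1) - of_bool (fst a = 1)) = (0 :: rat)"
      using st_path_telescope[OF P(1), of "\<lambda>v. of_bool (v = 1)"] by (simp add: gap_graph)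
    have fP: "finite P" "P \<subseteq> GA" using st_paths_subset[OF P(1)] finite_subset[of P GA] by (auto simp: gap_graph GA_def)
    have "(\<Sum>a\<in>P. of_bool (snd a = 1) - of_bool (fst a = 1)) = (\<Sum>a\<in>P. - of_bool (fst a = 1) :: rat)"
    proof (rule sum.cong[OF refl])
      fix a assume "a \<in> P"
      then have "snd a \<noteq> 1" using fP(2) by (auto simp: GA_eq)
      then show "of_bool (snd a = 1) - of_bool (fst a = 1) = (- of_bool (fst a = 1) :: rat)" by simp
    qed
    also have "\<dots> \<le> - of_bool (fst (1 :: nat, 3 :: nat) = 1)"
      unfolding sum_negf neg_le_iff_le by (rule member_le_sum[OF \<open>(1, 3) \<in> P\<close>]) (auto simp: fP)
    finally show False using pot by simp
  qed
  obtain a where a: "a \<in> P" "a \<in> Q" "a \<in> {(4, 5), (6, 7), (8, 9), (10, 11)}"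
    using gap_path_0(1)[OF P(1)] gap_path_1(1)[OF Q(1,2)] by auto
  have fin: "finite {R \<in> m_paths gap_instance. a \<in> R}" unfolding gap_paths by (simp add: finite_GP)
  have "2 \<le> x P + x Q" using ge1[OF mem(1) P(2)] ge1[OF mem(2) Q(3)] by simp
  also have "\<dots> = (\<Sum>R\<in>{P, Q}. x R)" using \<open>P \<noteq> Q\<close> by simp
  also have "\<dots> \<le> arc_flow (m_paths gap_instance) x a"
    unfolding arc_flow_def by (rule sum_mono2[OF fin]) (use mem a gap_flowD(1)[OF x] in auto)
  also have "\<dots> \<le> capacity gap_instance a" by (rule gap_flowD(2)[OF x]) (use a(3) in \<open>auto simp: GA_eq\<close>)
  also have "\<dots> = 1" using a(3) by (elim insertE emptyE) (simp_all only: gap_caps)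
  finally show False by simp
qed

definition gap_flow :: "(rat \<times> (nat \<times> nat) list) list" where
  "gap_flow = [(1 / 2, [(0, 2), (2, 4), (4, 5), (5, 6), (6, 7), (7, 14), (14, 16)]),
    (1 / 2, [(0, 2), (2, 8), (8, 9), (9, 10), (10, 11), (11, 14), (14, 16)]),
    (1 / 2, [(1, 3), (3, 4), (4, 5), (5, 8), (8, 9), (9, 15), (15, 17)]),
    (1 / 2, [(1, 3), (3, 6), (6, 7), (7, 10), (10, 11), (11, 15), (15, 17)]),
    (2, [(1, 12), (12, 13), (13, 17)])]"

lemma gap_pathI:
  assumes "pre_digraph.cas GD s p t" "set p \<subseteq> GA" "s < 18"
  shows "set p \<in> st_paths GD s t"
proof (rule st_pathsI[OF assms(1)])
  show "set p \<subseteq> arcs GD" "s \<in> verts GD" using assms by (simp_all add: gap_graph)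
  fix a assume "a \<in> set p"
  then have "a \<in> GA" using assms(2) by blast
  then show "id (tail GD a) < (id (head GD a) :: nat)" unfolding gap_graph GA_eq by auto
qed

lemma gap_solution: "\<exists>x. mrf_m_solution gap_instance x"
proof -
  let ?L = "map (\<lambda>z. (fst z, set (snd z))) gap_flow"
  let ?x = "flow_of ?L"
  have fin: "finite (m_paths gap_instance)" unfolding gap_paths by (simp add: finite_GP)
  have P0: "set [(0, 2), (2, 4), (4, 5), (5, 6), (6, 7), (7, 14), (14, 16)] \<in> st_paths GD 0 16"
    "set [(0, 2), (2, 8), (8, 9), (9, 10), (10, 11), (11, 14), (14, 16)] \<in> st_paths GD 0 16"
    by (rule gap_pathI; simp add: pre_digraph.cas.simps gap_graph GA_eq)+
  have P1: "set [(1, 3), (3, 4), (4, 5), (5, 8), (8, 9), (9, 15), (15, 17)] \<in> st_paths GD 1 17"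
    "set [(1, 3), (3, 6), (6, 7), (7, 10), (10, 11), (11, 15), (15, 17)] \<in> st_paths GD 1 17"
    "set [(1, 12), (12, 13), (13, 17)] \<in> st_paths GD 1 17"
    by (rule gap_pathI; simp add: pre_digraph.cas.simps gap_graph GA_eq)+
  have n0: "R \<notin> st_paths GD 0 16" if "(0, 2) \<notin> R" for R using gap_path_0(2)[of R] that by blast
  have n1: "R \<notin> st_paths GD 1 17" if "(1, 3) \<notin> R" "(1, 12) \<notin> R" for R using gap_path_1(2)[of R] that by blast
  have sub: "snd ` set ?L \<subseteq> m_paths gap_instance"
    using P0 P1 by (simp add: gap_flow_def gap_paths)
  have flow: "?x \<in> m_flows gap_instance"
    unfolding m_flows_def
  proof (intro CollectI conjI ballI)
    show "nonneg_flow (m_paths gap_instance) ?x"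
      unfolding nonneg_flow_def by (auto simp: gap_flow_def intro!: flow_of_nonneg)
    show "arc_flow (m_paths gap_instance) ?x a \<le> capacity gap_instance a" if "a \<in> arcs GD" for a
    proof -
      have "\<forall>a\<in>GA. fsum ?L (\<lambda>R. of_bool (a \<in> R)) \<le> capacity gap_instance a"
        unfolding GA_eq gap_flow_def list.map fsum_Cons fsum_Nil fst_conv snd_conv ball_simps gap_caps by simp
      then show ?thesis unfolding arc_flow_flow_of[OF fin sub] using that gap_graph(1) by blast
    qed
    have s: "(\<Sum>P\<in>st_paths GD s t. ?x P) = fsum ?L (\<lambda>R. of_bool (R \<in> st_paths GD s t))" for s t
      by (rule sum_flow_of[OF finite_GP])
    have "fsum ?L (\<lambda>R. of_bool (R \<in> st_paths GD 0 16)) = 1"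
      unfolding gap_flow_def list.map fsum_Cons fsum_Nil fst_conv snd_conv using P0 n0 by simp
    moreover have "fsum ?L (\<lambda>R. of_bool (R \<in> st_paths GD 1 17)) = 3"
      unfolding gap_flow_def list.map fsum_Cons fsum_Nil fst_conv snd_conv using P1 n1 by simp
    ultimately show "(\<Sum>P\<in>GP i. ?x P) = m_demand gap_instance i" if "i \<in> commodities gap_instance" for i
      using that unfolding gap_commodity(1) by (auto simp: GP_eq gap_commodity s)
  qed
  \<comment> \<open>The whole flow has value 4, and the bound is
    \<open>1 * 6 - 1 = 5\<close>.\<close>
  have "interdicted (m_paths gap_instance) ?x S \<le> 5" for S
  proof -
    have "fsum ?L (\<lambda>R. of_bool (R \<inter> S \<noteq> {})) \<le> fsum ?L (\<lambda>_. 1)"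
    proof (rule fsum_mono)
      fix z assume "z \<in> set ?L"
      then have "0 \<le> fst z" by (auto simp: gap_flow_def)
      then show "0 \<le> fst z \<and> (of_bool (snd z \<inter> S \<noteq> {}) :: rat) \<le> 1" by simp
    qed
    moreover have "fsum ?L (\<lambda>_. 1) = 4" unfolding gap_flow_def list.map fsum_Cons fsum_Nil fst_conv by simp
    ultimately show ?thesis unfolding interdicted_flow_of[OF fin sub] by linarith
  qed
  moreover have "finite {S. S \<subseteq> GA \<and> card S \<le> 1}" by (rule finite_subset[of _ "Pow GA"]) (auto simp: GA_def)
  moreover have "{S. S \<subseteq> GA \<and> card S \<le> 1} \<noteq> {}" by (auto intro: exI[of _ "{}"])
  ultimately have "mrf_m_solution gap_instance ?x"
    using flow unfolding mrf_m_solution_def gap_max gap_graph by (subst Max_image_le_iff) auto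
  then show ?thesis by (intro exI[of _ ?x])
qed

lemma gap_good: "good_instance gap_instance"
proof -
  have l: "leaving GD {0} = {(0, 2)}" "leaving GD {1} = {(1, 3), (1, 12)}" "entering GD {16} = {(14, 16)}"
    "entering GD {17} = {(13, 17), (15, 17)}" "entering GD {0} = {}" "entering GD {1} = {}"
    "leaving GD {16} = {}" "leaving GD {17} = {}" "leaving GD {0, 1} = {(0, 2), (1, 3), (1, 12)}"
    unfolding leaving_def entering_def gap_graph GA_eq by auto
  have four: "2 \<le> arc_flow (GP i) x a"
    if "x \<in> m_flows gap_instance" "i \<in> commodities gap_instance - {0}" "a \<in> GA" "6 - 2 \<le> capacity gap_instance a" for x i a
  proof -
    have "a = (12, 13)" using that(3,4) unfolding GA_eq by (elim insertE emptyE) (simp_all add: gap_caps')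
    moreover have "i = Suc 0" using that(2) by (simp add: gap_commodity)
    ultimately show ?thesis using gap_split(2)[OF that(1)] by (simp add: GP_eq)
  qed
  have com: "commodities gap_instance - {0} = {Suc 0}" by (auto simp: gap_commodity)
  have "{a \<in> leaving GD {0, 1}. capacity gap_instance a = 6} = {}" unfolding l by (auto simp: gap_caps')
  then show ?thesis unfolding good_instance_def gap_max gap_graph(1,2,5)
    using four
    by (intro conjI ballI bexI[of _ 0] exI[of _ "{0, 1}"]) (auto simp: com l l[unfolded One_nat_def] gap_caps' gap_commodity)
qed

section \<open>Solutions of the produced instance as core solutions\<close>

context red
begin

text \<open>Names the instance by the parameters of \<open>red\<close>, so that it can be used
  outside the locale.\<close>

definition RJ :: mrf_m where "RJ = J"

lemma RJ_simps: "RJ \<in> mrf_m_instances" "good_instance RJ" "budget RJ = k" "capacity RJ a \<in> \<int>"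
  "max_capacity RJ = of_nat M" "arcs (graph_of RJ) = A"
  unfolding RJ_def by (simp_all add: J_instance good_J cap_Ints max_cap)

lemma RJ_solution: "RJ \<in> MRF_M \<longleftrightarrow> (\<exists>L. core_sol L)"
proof
  assume "RJ \<in> MRF_M"
  then show "\<exists>L. core_sol L" unfolding MRF_M_def RJ_def using core_complete by blast
next
  assume "\<exists>L. core_sol L"
  then show "RJ \<in> MRF_M" unfolding MRF_M_def RJ_def using core_sound(1) J_instance by blast
qed

lemma RJ_integral: "RJ \<in> Integral_MRF_M \<longleftrightarrow> (\<exists>L. core_sol L \<and> (\<forall>z\<in>set L. fst z \<in> \<int>))"
proof
  assume "RJ \<in> Integral_MRF_M"
  then show "\<exists>L. core_sol L \<and> (\<forall>z\<in>set L. fst z \<in> \<int>)" unfolding Integral_MRF_M_def RJ_def using core_complete by blast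
next
  assume "\<exists>L. core_sol L \<and> (\<forall>z\<in>set L. fst z \<in> \<int>)"
  then obtain L where L: "core_sol L" "\<forall>z\<in>set L. fst z \<in> \<int>" by blast
  from core_sound(1)[OF L(1)] core_sound(2)[OF L] show "RJ \<in> Integral_MRF_M"
    unfolding Integral_MRF_M_def RJ_def using J_instance by blast
qed

end

section \<open>The transformation\<close>

text \<open>The locale \<open>red\<close> requires different ends. If they coincide, a fresh node,
  larger than all given ones, takes the place of the sink, and the network is left without
  arcs.\<close>

definition net_sink :: "nat list \<Rightarrow> nat \<Rightarrow> nat \<Rightarrow> nat" where
  "net_sink ns s t = (if s = t then Suc (sum_list ns) else t)"

definition net_arcs :: "(nat \<times> nat) list \<Rightarrow> nat \<Rightarrow> nat \<Rightarrow> (nat \<times> nat) list" where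
  "net_arcs as s t = peel (if s = t then [] else filter (\<lambda>a. fst a \<noteq> t) as)"

definition net_adj :: "((nat \<times> nat) \<times> (nat \<times> nat)) list \<Rightarrow> nat \<times> nat \<Rightarrow> nat \<times> nat \<Rightarrow> bool" where
  "net_adj cs a b \<longleftrightarrow> (a, b) \<in> set cs \<or> (b, a) \<in> set cs"

definition fractional :: "nat \<Rightarrow> nat \<Rightarrow> nat \<Rightarrow> nat \<Rightarrow> nat \<Rightarrow> bool" where
  "fractional s t l p q \<longleftrightarrow> p mod q \<noteq> 0 \<and> (s = t \<or> p < Suc l * q)"

text \<open>Demands that exceed the number \<open>l\<close> of arcs are replaced by \<open>l + 1\<close>, which keeps the capacities
  small.\<close>

definition net_cap :: "nat \<Rightarrow> nat \<Rightarrow> nat \<Rightarrow> nat \<Rightarrow> nat \<Rightarrow> nat" where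
  "net_cap s t l p q = (if s = t then 0 else if p < Suc l * q then (p + q - 1) div q else Suc l)"

definition net_vars :: "nat \<Rightarrow> nat \<Rightarrow> nat \<Rightarrow> nat \<Rightarrow> nat \<Rightarrow> nat" where
  "net_vars s t l p q = (if fractional s t l p q then length (bits q) else 0)"

definition net_axs :: "nat \<Rightarrow> nat \<Rightarrow> nat \<Rightarrow> nat \<Rightarrow> nat \<Rightarrow> ((nat \<times> nat) list \<times> nat) list" where
  "net_axs s t l p q = (if fractional s t l p q then frac_system q else [])"

definition net_outs :: "nat \<Rightarrow> nat \<Rightarrow> nat \<Rightarrow> nat \<Rightarrow> nat \<Rightarrow> (nat \<times> nat) list" where
  "net_outs s t l p q = (if fractional s t l p q \<and> s \<noteq> t then frac_outs (net_cap s t l p q * q - p) else [])"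

definition net_instance :: "nat list \<Rightarrow> (nat \<times> nat) list \<Rightarrow> nat \<Rightarrow> nat \<Rightarrow> nat \<Rightarrow>
    ((nat \<times> nat) \<times> (nat \<times> nat)) list \<Rightarrow> nat \<Rightarrow> nat \<Rightarrow> mrf_m" where
  "net_instance ns as k s t cs p q =
    (let sa = net_arcs as s t; l = length sa in
     red.RJ k s (net_sink ns s t) (net_cap s t l p q) sa (net_adj cs) (Suc (sum_list ns) # ns) (Suc (Suc (sum_list ns)))
       (net_vars s t l p q) (net_axs s t l p q) (net_outs s t l p q))"

definition dem_num :: "mrf_r \<Rightarrow> nat" where "dem_num I = nat (fst (quotient_of (r_demand I)))"
definition dem_den :: "mrf_r \<Rightarrow> nat" where "dem_den I = nat (snd (quotient_of (r_demand I)))"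

definition target :: "mrf_r \<Rightarrow> mrf_m" where
  "target I = (if budget I = 1 \<and> r_source I = r_sink I \<and> dem_num I mod dem_den I \<noteq> 0 then gap_instance
     else net_instance (node_list I) (arc_list I) (budget I) (r_source I) (r_sink I) (compat_list I)
       (dem_num I) (dem_den I))"

lemma acyclic_arcs:
  assumes "wf_digraph (graph_of I)" "\<nexists>p. pre_digraph.cycle (graph_of I) p"
  shows "acyclic (set (arc_list I))"
  unfolding acyclic_def
proof (intro allI notI)
  interpret wf_digraph "graph_of I" by fact
  have w: "\<exists>p. awalk u p v \<and> p \<noteq> []" if "(u, v) \<in> (set (arc_list I))\<^sup>+" for u v
    using that
  proof (induction rule: trancl_induct)
    case (base v)
    then have "awalk u [(u, v)] v" using arc_implies_awalk[of "(u, v)"] by (simp add: graph_simps)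
    then show ?case by blast
  next
    case (step v w)
    then obtain p where "awalk u p v" by blast
    moreover have "awalk v [(v, w)] w" using arc_implies_awalk[of "(v, w)"] step(2) by (simp add: graph_simps)
    ultimately have "awalk u (p @ [(v, w)]) w" by (rule awalk_appendI)
    then show ?case by blast
  qed
  fix v assume "(v, v) \<in> (set (arc_list I))\<^sup>+"
  from w[OF this] have "\<exists>p. closed_w p" by (auto simp: closed_w_def)
  then show False using closed_w_imp_cycle assms(2) by blast
qed

locale mrf_inst =
  fixes I :: mrf_r
  assumes I: "I \<in> mrf_r_instances"
begin

abbreviation "ns \<equiv> node_list I"
abbreviation "as \<equiv> arc_list I"
abbreviation "k \<equiv> budget I"
abbreviation "s \<equiv> r_source I"
abbreviation "t \<equiv> r_sink I"
abbreviation "p \<equiv> dem_num I"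
abbreviation "q \<equiv> dem_den I"
abbreviation "sa \<equiv> net_arcs as s t"
abbreviation "l \<equiv> length sa"
abbreviation "gap \<equiv> k = 1 \<and> s = t \<and> p mod q \<noteq> 0"

lemma basic: "distinct ns" "distinct as" "wf_digraph (graph_of I)" "1 \<le> k" "s \<in> set ns" "t \<in> set ns"
  "acyclic (set as)" "\<And>a. a \<in> set as \<Longrightarrow> fst a \<in> set ns \<and> snd a \<in> set ns"
proof -
  have v: "valid_graph I" "\<nexists>p. pre_digraph.cycle (graph_of I) p" "s \<in> set ns" "t \<in> set ns"
    using I by (auto simp: mrf_r_instances_def graph_simps)
  then show "distinct ns" "distinct as" "1 \<le> k" "s \<in> set ns" "t \<in> set ns" by (auto simp: valid_graph_def)
  have "digraph (graph_of I)" using v(1) by (simp add: valid_graph_def)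
  then show w: "wf_digraph (graph_of I)" by (simp add: digraph_def loopfree_digraph_def fin_digraph_def)
  show "acyclic (set as)" by (rule acyclic_arcs[OF w v(2)])
  show "fst a \<in> set ns \<and> snd a \<in> set ns" if "a \<in> set as" for a
    using wf_digraph.wellformed[OF w, of a] that by (simp add: graph_simps)
qed

lemma demand: "0 < q" "r_demand I = of_nat p / of_nat q"
proof -
  obtain n d where nd: "quotient_of (r_demand I) = (n, d)" by fastforce
  have d: "0 < d" using quotient_of_denom_pos[OF nd] .
  have r: "r_demand I = of_int n / of_int d" using quotient_of_div[OF nd] .
  have "0 \<le> r_demand I" using I by (simp add: mrf_r_instances_def)
  then have "0 \<le> n" using d unfolding r by (simp add: zero_le_divide_iff)
  then show "0 < q" "r_demand I = of_nat p / of_nat q" using d unfolding r by (simp_all add: dem_num_def dem_den_def nd)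
qed

lemma sa_facts: "distinct sa" "topo_list sa" "s \<noteq> t \<Longrightarrow> set sa = {a \<in> set as. fst a \<noteq> t}" "s = t \<Longrightarrow> sa = []"
proof -
  let ?xs = "if s = t then [] else filter (\<lambda>a. fst a \<noteq> t) as"
  have "distinct ?xs" using basic(2) by simp
  moreover have "acyclic (set ?xs)" by (rule acyclic_subset[OF basic(7)]) auto
  ultimately have p: "distinct (peel ?xs)" "set (peel ?xs) = set ?xs" "topo_list (peel ?xs)" by (rule peel_correct)+
  then show "distinct sa" "topo_list sa" "s \<noteq> t \<Longrightarrow> set sa = {a \<in> set as. fst a \<noteq> t}" by (auto simp: net_arcs_def)
  show "s = t \<Longrightarrow> sa = []" using p(2) by (simp add: net_arcs_def)
qed

lemma red: "red k s (net_sink ns s t) sa (net_adj (compat_list I)) (Suc (sum_list ns) # ns) (Suc (Suc (sum_list ns)))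
    (net_vars s t l p q) (net_axs s t l p q) (net_outs s t l p q)"
proof
  have lt: "v < Suc (sum_list ns)" if "v \<in> set ns" for v using member_le_sum_list[OF that] by simp
  have fresh: "Suc (sum_list ns) \<notin> set ns" using lt by blast
  show "1 \<le> k" by (rule basic)
  show "i < j" if "i < l" "j < l" "snd (sa ! i) = fst (sa ! j)" for i j
    using sa_facts(2) that by (auto simp: topo_list_def)
  show "fst a \<in> set (Suc (sum_list ns) # ns) \<and> snd a \<in> set (Suc (sum_list ns) # ns) \<and> fst a \<noteq> net_sink ns s t"
    if "a \<in> set sa" for a
    using that sa_facts(3,4) basic(8)[of a] by (cases "s = t") (auto simp: net_sink_def)
  show "distinct (Suc (sum_list ns) # ns)" using basic(1) fresh by simp
  show "s \<in> set (Suc (sum_list ns) # ns)" "net_sink ns s t \<in> set (Suc (sum_list ns) # ns)"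
    using basic(5,6) by (auto simp: net_sink_def)
  show "s \<noteq> net_sink ns s t" using fresh basic(5) by (auto simp: net_sink_def)
  show "v < Suc (Suc (sum_list ns))" if "v \<in> set (Suc (sum_list ns) # ns)" for v
    using that lt[of v] by auto
  show "net_adj (compat_list I) a b \<longleftrightarrow> net_adj (compat_list I) b a" for a b by (auto simp: net_adj_def)
  show "fst x < net_vars s t l p q \<and> snd x < 2" if "z \<in> set (net_axs s t l p q)" "x \<in> set (fst z)" for z x
    using that frac_system_lits(1)[of z q x] by (auto simp: net_axs_def net_vars_def split: if_splits)
  show "fst x < net_vars s t l p q \<and> snd x < 2" if x: "x \<in> set (net_outs s t l p q)" for x
  proof -
    have f: "fractional s t l p q" "s \<noteq> t" "x \<in> set (frac_outs (net_cap s t l p q * q - p))"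
      using x by (auto simp: net_outs_def split: if_splits)
    then have "net_cap s t l p q = (p + q - 1) div q" by (auto simp: net_cap_def fractional_def)
    then have "net_cap s t l p q * q \<le> p + q - 1" by simp
    then have "net_cap s t l p q * q - p \<le> q" by linarith
    from frac_system_lits(2)[OF this f(3)] show ?thesis using f(1) by (simp add: net_vars_def)
  qed
qed

lemma target_properties: "target I \<in> mrf_m_instances" "good_instance (target I)" "budget (target I) = k"
  "capacity (target I) a \<in> \<int>" "max_capacity (target I) \<le> of_nat (3 * card (arcs (graph_of (target I))) + 7)"
proof -
  interpret R: red k s "net_sink ns s t" "net_cap s t l p q" sa "net_adj (compat_list I)" "Suc (sum_list ns) # ns" "Suc (Suc (sum_list ns))"
    "net_vars s t l p q" "net_axs s t l p q" "net_outs s t l p q" by (rule red)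
  have T: "target I = (if gap then gap_instance else R.RJ)" by (simp add: target_def net_instance_def Let_def)
  show "target I \<in> mrf_m_instances" "good_instance (target I)" unfolding T using gap_mem gap_good R.RJ_simps by simp_all
  show "budget (target I) = k" unfolding T using gap_graph(5) R.RJ_simps by simp
  show "capacity (target I) a \<in> \<int>" unfolding T using gap_capacity[of a] R.RJ_simps by simp
  have c: "net_cap s t l p q \<le> Suc l"
  proof (cases "s \<noteq> t \<and> p < Suc l * q")
    case True
    moreover have "q * Suc (Suc l) = Suc l * q + q" by simp
    ultimately have "p + q - 1 < q * Suc (Suc l)" using demand(1) by linarith
    then have "(p + q - 1) div q < Suc (Suc l)" using demand(1) by (simp add: div_less_iff_less_mult mult.commute)
    then show ?thesis using True by (simp add: net_cap_def)
  qed (auto simp: net_cap_def)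
  have "snd z \<le> length (fst z)" if "z \<in> set (net_axs s t l p q)" for z
    using that frac_system_caps[OF demand(1), of z] by (auto simp: net_axs_def split: if_splits)
  from R.M_le[OF c this] have "max_capacity R.RJ \<le> of_nat (3 * card (arcs (graph_of R.RJ)) + 7)"
    unfolding R.RJ_simps by (rule of_nat_mono)
  moreover have "max_capacity gap_instance \<le> of_nat (3 * card (arcs (graph_of gap_instance)) + 7)"
    by (simp add: gap_max)
  ultimately show "max_capacity (target I) \<le> of_nat (3 * card (arcs (graph_of (target I))) + 7)" unfolding T by simp
qed

lemma integral_trivial:
  assumes "s = t" "mrf_r_solution I x" "integral_flow (r_paths I) x"
  shows "p mod q = 0"
proof -
  have "r_paths I = {{}}" using rflow_trivial(2)[OF assms(1) basic(5), of 0] basic(4) by simp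
  then have "r_demand I \<in> \<int>" using assms(2,3) by (auto simp: mrf_r_solution_iff rflow_def integral_flow_def)
  then obtain i where i: "of_nat p / of_nat q = (of_int i :: rat)" unfolding demand(2) by (auto elim: Ints_cases)
  then have "of_int (int p) = (of_int (i * int q) :: rat)" using demand(1) by (simp add: field_simps)
  then have "int p = i * int q" by (simp only: of_int_eq_iff)
  then have "int q dvd int p" by simp
  then have "q dvd p" by (simp only: int_dvd_int_iff)
  then show ?thesis by (simp only: dvd_eq_mod_eq_0)
qed

lemma ex_trivial:
  assumes "s = t"
  shows "\<exists>x. mrf_r_solution I x" "p mod q = 0 \<Longrightarrow> \<exists>x. mrf_r_solution I x \<and> integral_flow (r_paths I) x"
proof -
  have "0 \<le> r_demand I" using I by (simp add: mrf_r_instances_def)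
  then have s: "mrf_r_solution I (\<lambda>_. r_demand I)"
    unfolding mrf_r_solution_iff using basic(4,5) assms by (intro rflow_trivial(1)) auto
  then show "\<exists>x. mrf_r_solution I x" by blast
  assume "p mod q = 0"
  then have "q dvd p" by (simp add: dvd_eq_mod_eq_0)
  then obtain n where "p = q * n" by blast
  then have "r_demand I = of_nat n" using demand by simp
  then show "\<exists>x. mrf_r_solution I x \<and> integral_flow (r_paths I) x" using s by (intro exI[of _ "\<lambda>_. r_demand I"]) (simp add: integral_flow_def)
qed

text \<open>The first case stands apart because of \<open>core_sol_k1\<close>: with budget 1 no
  constraint system is available to tell fractional from integral solutions. For different ends this
  does no harm, as a budget of 1 then admits only the demand 0.\<close>

lemma target_correct: "I \<in> MRF_R \<longleftrightarrow> target I \<in> MRF_M" "I \<in> Integral_MRF_R \<longleftrightarrow> target I \<in> Integral_MRF_M"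
proof -
  interpret R: red k s "net_sink ns s t" "net_cap s t l p q" sa "net_adj (compat_list I)" "Suc (sum_list ns) # ns" "Suc (Suc (sum_list ns))"
    "net_vars s t l p q" "net_axs s t l p q" "net_outs s t l p q" by (rule red)
  have T: "target I = (if gap then gap_instance else R.RJ)" by (simp add: target_def net_instance_def Let_def)
  have F: "I \<in> MRF_R \<longleftrightarrow> (\<exists>x. mrf_r_solution I x)" "I \<in> Integral_MRF_R \<longleftrightarrow> (\<exists>x. mrf_r_solution I x \<and> integral_flow (r_paths I) x)"
    using I by (auto simp: MRF_R_def Integral_MRF_R_def)
  consider "gap" | "\<not> gap" "s = t" | "s \<noteq> t" by blast
  then have "(I \<in> MRF_R \<longleftrightarrow> target I \<in> MRF_M) \<and> (I \<in> Integral_MRF_R \<longleftrightarrow> target I \<in> Integral_MRF_M)"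
  proof cases
    case 1
    then have "target I = gap_instance" by (simp add: T)
    moreover have "gap_instance \<in> MRF_M" using gap_solution gap_mem by (simp add: MRF_M_def)
    moreover have "gap_instance \<notin> Integral_MRF_M"
      using gap_not_integral by (auto simp: Integral_MRF_M_def mrf_m_solution_def)
    moreover have "I \<in> MRF_R" unfolding F by (rule ex_trivial(1)) (use 1 in blast)
    moreover have "I \<notin> Integral_MRF_R"
    proof
      assume "I \<in> Integral_MRF_R"
      then obtain x where "mrf_r_solution I x" "integral_flow (r_paths I) x" unfolding F by blast
      from integral_trivial[OF conjunct1[OF conjunct2[OF 1]] this] conjunct2[OF conjunct2[OF 1]] show False by contradiction
    qed
    ultimately show ?thesis by simp
  next
    case 2
    have pars: "sa = []" "net_cap s t l p q = 0" "net_outs s t l p q = []" "fractional s t l p q \<longleftrightarrow> p mod q \<noteq> 0"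
      using 2(2) sa_facts(4) by (simp_all add: net_cap_def net_outs_def fractional_def)
    interpret E: red_eq k s "net_sink ns s t" "net_cap s t l p q" sa "net_adj (compat_list I)" "Suc (sum_list ns) # ns" "Suc (Suc (sum_list ns))"
      "net_vars s t l p q" "net_axs s t l p q" "net_outs s t l p q" p q
    proof
      show "net_vars s t l p q = (if p mod q = 0 then 0 else length (bits q))" using pars(4) by (simp add: net_vars_def)
      show "net_axs s t l p q = (if p mod q = 0 then [] else frac_system q)" using pars(4) by (simp add: net_axs_def)
      show "2 \<le> k" if "p mod q \<noteq> 0" using that 2 basic(4) by linarith
    qed (use demand(1) pars in blast)+
    have t: "target I = R.RJ" unfolding T by (rule if_not_P) (rule 2(1))
    have "I \<in> MRF_R" unfolding F by (rule ex_trivial(1)[OF 2(2)])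
    moreover have "target I \<in> MRF_M" unfolding t R.RJ_solution by (rule E.ex_core_sol(1))
    moreover have "I \<in> Integral_MRF_R \<longleftrightarrow> p mod q = 0"
    proof
      assume "I \<in> Integral_MRF_R"
      then obtain x where "mrf_r_solution I x" "integral_flow (r_paths I) x" unfolding F by blast
      then show "p mod q = 0" by (rule integral_trivial[OF 2(2)])
    qed (unfold F, rule ex_trivial(2)[OF 2(2)])
    moreover have "target I \<in> Integral_MRF_M \<longleftrightarrow> p mod q = 0"
      unfolding t R.RJ_integral
    proof
      assume "\<exists>L. R.core_sol L \<and> (\<forall>z\<in>set L. fst z \<in> \<int>)"
      then show "p mod q = 0" by (elim exE conjE) (rule E.core_sol_integral)
    qed (rule E.ex_core_sol(2))
    ultimately show ?thesis by (simp only:)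
  next
    case 3
    interpret E: red_num k s "net_sink ns s t" "net_cap s t l p q" sa "net_adj (compat_list I)" "Suc (sum_list ns) # ns" "Suc (Suc (sum_list ns))"
      "net_vars s t l p q" "net_axs s t l p q" "net_outs s t l p q" I p q
    proof
      show "t = net_sink ns s t" using 3 by (simp add: net_sink_def)
      show "set sa = {a \<in> set as. fst a \<noteq> net_sink ns s t}" using 3 sa_facts(3) by (simp add: net_sink_def)
      show "net_cap s t l p q = (if p < Suc l * q then (p + q - 1) div q else Suc l)" using 3 by (simp add: net_cap_def)
      show "net_vars s t l p q = length (bits q) \<and> net_axs s t l p q = frac_system q \<and>
          net_outs s t l p q = frac_outs (net_cap s t l p q * q - p)" if f: "p mod q \<noteq> 0 \<and> p < Suc l * q"
      proof -
        have "fractional s t l p q" using f by (simp add: fractional_def)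
        then show ?thesis using 3 by (simp add: net_vars_def net_axs_def net_outs_def)
      qed
      show "net_vars s t l p q = 0 \<and> net_axs s t l p q = [] \<and> net_outs s t l p q = []"
        if f: "\<not> (p mod q \<noteq> 0 \<and> p < Suc l * q)"
      proof -
        have "\<not> fractional s t l p q" using f 3 by (auto simp: fractional_def)
        then show ?thesis by (simp add: net_vars_def net_axs_def net_outs_def)
      qed
    qed (use demand basic(5) sa_facts(1) in \<open>simp_all only: net_adj_def\<close>)
    have t: "target I = R.RJ" using 3 by (simp add: T)
    show ?thesis unfolding F t R.RJ_solution R.RJ_integral
    proof (intro conjI iffI)
      assume "\<exists>x. mrf_r_solution I x"
      then obtain x where "mrf_r_solution I x" by blast
      from E.solution_core_sol[OF this] obtain L where "R.core_sol L" by blast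
      then show "\<exists>L. R.core_sol L" by (rule exI[of _ L])
    next
      assume "\<exists>L. R.core_sol L"
      then obtain L where "R.core_sol L" by blast
      from E.core_sol_solution[OF this] obtain x where "mrf_r_solution I x" by blast
      then show "\<exists>x. mrf_r_solution I x" by (rule exI[of _ x])
    next
      assume "\<exists>x. mrf_r_solution I x \<and> integral_flow (r_paths I) x"
      then obtain x where x: "mrf_r_solution I x" "integral_flow (r_paths I) x" by blast
      from E.solution_core_sol[OF x(1)] x(2) show "\<exists>L. R.core_sol L \<and> (\<forall>z\<in>set L. fst z \<in> \<int>)" by blast
    next
      assume "\<exists>L. R.core_sol L \<and> (\<forall>z\<in>set L. fst z \<in> \<int>)"
      then obtain L where L: "R.core_sol L" "\<forall>z\<in>set L. fst z \<in> \<int>" by blast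
      from E.core_sol_solution[OF L(1)] L(2) show "\<exists>x. mrf_r_solution I x \<and> integral_flow (r_paths I) x" by blast
    qed
  qed
  then show "I \<in> MRF_R \<longleftrightarrow> target I \<in> MRF_M" "I \<in> Integral_MRF_R \<longleftrightarrow> target I \<in> Integral_MRF_M" by blast+
qed

end

section \<open>The transformation is computable in polynomial time\<close>

text \<open>Below the binder of \<open>PT_map\<close>, \<open>PT_filter\<close> or
  \<open>PT_ex\<close> the input is paired with the list element. This lemma moves known facts
  there; nested binders take it twice.\<close>

lemma PT_lift: "PT e b f \<Longrightarrow> PT (eP a e) b (\<lambda>z. f (snd z))"
  by (rule PT_comp[OF PT_snd[OF PT_id]])

lemma PT_mod: "PT e eN f \<Longrightarrow> PT e eN g \<Longrightarrow> PT e eN (\<lambda>x. f x mod g x)"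
  unfolding minus_mult_div_eq_mod[symmetric] by (intro PT_diff PT_mult PT_div)

lemmas PT_intros = PT_const PT_id PT_pair PT_fst PT_snd PT_if PT_add PT_mult PT_diff PT_div PT_mod PT_Suc
  PT_le PT_less PT_eq PT_conj PT_disj PT_not PT_Cons PT_append PT_map PT_filter PT_concat PT_null PT_ex
  PT_length PT_enum PT_sum_list PT_bits

abbreviation "eA \<equiv> eP eN eN"
abbreviation "eB3 \<equiv> eP eN (eP eN eN)"
abbreviation "eG \<equiv> eP eN (eP eN eB3)"

lemma PT_peel_step: "PT e (eL eA) R \<Longrightarrow> PT e (eL eA) (\<lambda>x. peel_step (R x))"
  and PT_peel_src: "PT e (eL eA) R \<Longrightarrow> PT e (eL eA) (\<lambda>x. peel_src (R x))"
proof -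
  assume R: "PT e (eL eA) R"
  show "PT e (eL eA) (\<lambda>x. peel_step (R x))" "PT e (eL eA) (\<lambda>x. peel_src (R x))"
    unfolding peel_step_def peel_src_def by (rule R PT_lift[OF R] PT_intros)+
qed

lemma bitsize_eL_partition:
  "bitsize (eL a (filter P xs)) + bitsize (eL a (filter (\<lambda>x. \<not> P x) xs)) = Suc (bitsize (eL a xs))"
  unfolding bitsize_eL by (induction xs) auto

text \<open>A round only moves arcs from one list of the accumulator to the other, so the sum of
  their sizes is invariant; this is the bound that \<open>PT_fold\<close> asks for.\<close>

lemma PT_peel:
  assumes l: "PT e (eL eA) l" shows "PT e (eL eA) (\<lambda>x. peel (l x))"
proof -
  define f :: "nat \<times> nat \<Rightarrow> _" where
    "f = (\<lambda>_ acc. (peel_step (fst acc), snd acc @ peel_src (fst acc)))"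
  obtain p where p: "\<And>x. bitsize (eL eA (l x)) \<le> poly p (bitsize (e x))" using PT_bound[OF l] by blast
  have size: "bitsize (eL eA (fst (fold f ys acc))) + bitsize (eL eA (snd (fold f ys acc)))
      = bitsize (eL eA (fst acc)) + bitsize (eL eA (snd acc))" for ys and acc :: "(nat \<times> nat) list \<times> (nat \<times> nat) list"
  proof (induction ys arbitrary: acc)
    case (Cons y ys)
    have "bitsize (eL eA (peel_step (fst acc))) + bitsize (eL eA (peel_src (fst acc))) = Suc (bitsize (eL eA (fst acc)))"
      unfolding peel_step_def peel_src_def by (rule bitsize_eL_partition)
    moreover have "1 \<le> bitsize (eL eA (peel_src (fst acc)))" "1 \<le> bitsize (eL eA (snd acc))" by (simp_all add: bitsize_eL)
    ultimately show ?case unfolding fold_Cons comp_apply Cons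
      by (simp add: f_def bitsize_eL_append)
  qed simp
  have "PT e (eP (eL eA) (eL eA)) (\<lambda>x. fold (\<lambda>y acc. f y acc) (l x) (l x, []))"
  proof (rule PT_fold[where h = "\<lambda>y acc x. f y acc" and q = "p + [:2:]" and a = eA])
    show "PT e (eL eA) l" "PT e (eP (eL eA) (eL eA)) (\<lambda>x. (l x, []))" by (rule l PT_intros)+
    show "PT (eP eA (eP (eP (eL eA) (eL eA)) e)) (eP (eL eA) (eL eA)) (\<lambda>z. f (fst z) (fst (snd z)))"
      unfolding f_def by (rule PT_peel_step PT_peel_src PT_intros)+
    show "bitsize (eP (eL eA) (eL eA) (fold f (take n (l x)) (l x, []))) \<le> poly (p + [:2:]) (bitsize (e x))" for x n
      using size[of "take n (l x)" "(l x, [])"] p[of x] by (simp add: eP_def)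
  qed
  from PT_snd[OF this] show ?thesis unfolding f_def peel_def by simp
qed

lemma PT_ones: assumes l: "PT e (eL eN) l" shows "PT e (eL eN) (\<lambda>x. ones (l x))"
  unfolding ones_def by (rule l PT_intros)+

lemma filter_enum_less: "filter (\<lambda>i. Suc i < n) [0..<n] = [0..<n - 1]"
proof (cases n)
  case (Suc n')
  have "filter (\<lambda>i. i < n') [0..<n'] = [0..<n']" by (rule filter_True) auto
  then show ?thesis using Suc by simp
qed simp

text \<open>Turns an index range into an enumeration of a list of suitable length, here the unary
  budget or the binary digits, so that the calculus applies.\<close>

lemma map_upt_pred: "map f [0..<length xs - 1] = map (\<lambda>z. f (fst z)) (filter (\<lambda>z. Suc (fst z) < length xs) (enum xs))"
proof -
  have "map f [0..<length xs - 1] = map f (filter (\<lambda>i. Suc i < length xs) (map fst (enum xs)))"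
    by (simp only: map_fst_enum filter_enum_less)
  then show ?thesis by (simp add: filter_map comp_def)
qed

lemma map_upt: "map f [0..<length xs] = map (\<lambda>z. f (fst z)) (enum xs)"
  by (simp add: map_enum)

abbreviation "eAx \<equiv> eP (eL eA) eN"

lemma PT_frac_system: assumes q: "PT e eN q" shows "PT e (eL eAx) (\<lambda>x. frac_system (q x))"
  unfolding frac_system_def length_tl map_upt_pred
  by (rule q PT_lift[OF q] PT_ones PT_intros)+

lemma PT_frac_outs: assumes q: "PT e eN q" shows "PT e (eL eA) (\<lambda>x. frac_outs (q x))"
  unfolding frac_outs_def by (rule q PT_ones PT_intros)+

lemma PT_net_sink:
  assumes h: "PT e (eL eN) ns" "PT e eN s" "PT e eN t"
  shows "PT e eN (\<lambda>x. net_sink (ns x) (s x) (t x))"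
  unfolding net_sink_def by (rule h PT_intros)+

lemma PT_net_arcs:
  assumes h: "PT e (eL eA) as" "PT e eN s" "PT e eN t"
  shows "PT e (eL eA) (\<lambda>x. net_arcs (as x) (s x) (t x))"
  unfolding net_arcs_def by (rule h h[THEN PT_lift] PT_peel PT_intros)+

lemma PT_fractional:
  assumes h: "PT e eN s" "PT e eN t" "PT e eN l" "PT e eN p" "PT e eN q"
  shows "PT e eB (\<lambda>x. fractional (s x) (t x) (l x) (p x) (q x))"
  unfolding fractional_def by (rule h PT_intros)+

lemma PT_net_cap:
  assumes h: "PT e eN s" "PT e eN t" "PT e eN l" "PT e eN p" "PT e eN q"
  shows "PT e eN (\<lambda>x. net_cap (s x) (t x) (l x) (p x) (q x))"
  unfolding net_cap_def by (rule h PT_intros)+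

text \<open>Supplies the variables as a list whose length is \<open>net_vars\<close>, because a
  program can range over lists only.\<close>

definition net_bits :: "nat \<Rightarrow> nat \<Rightarrow> nat \<Rightarrow> nat \<Rightarrow> nat \<Rightarrow> nat list" where
  "net_bits s t l p q = (if fractional s t l p q then bits q else [])"

lemma net_vars_bits: "net_vars s t l p q = length (net_bits s t l p q)"
  by (simp add: net_vars_def net_bits_def)

lemma PT_net_bits:
  assumes h: "PT e eN s" "PT e eN t" "PT e eN l" "PT e eN p" "PT e eN q"
  shows "PT e (eL eN) (\<lambda>x. net_bits (s x) (t x) (l x) (p x) (q x))"
  unfolding net_bits_def by (rule h PT_fractional PT_intros)+

lemma PT_net_axs:
  assumes h: "PT e eN s" "PT e eN t" "PT e eN l" "PT e eN p" "PT e eN q"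
  shows "PT e (eL eAx) (\<lambda>x. net_axs (s x) (t x) (l x) (p x) (q x))"
  unfolding net_axs_def by (rule h PT_fractional PT_frac_system PT_intros)+

lemma PT_net_outs:
  assumes h: "PT e eN s" "PT e eN t" "PT e eN l" "PT e eN p" "PT e eN q"
  shows "PT e (eL eA) (\<lambda>x. net_outs (s x) (t x) (l x) (p x) (q x))"
  unfolding net_outs_def by (rule h PT_fractional PT_net_cap PT_frac_outs PT_intros)+

abbreviation "eC \<equiv> eP eN (eP (eL eB3) eN)"

lemma PT_clusters:
  assumes h: "PT e eN B" "PT e (eL eN) bs" "PT e (eL eAx) axs"
  shows "PT e (eL eC) (\<lambda>x. clusters (B x) (length (bs x)) (axs x))"
  unfolding clusters_def map_upt by (rule h h[THEN PT_lift] PT_intros)+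

lemma PT_gadgets:
  assumes h: "PT e eN s" "PT e eN tn" "PT e (eL eA) sa" "PT e (eL eC) cls" "PT e (eL eA) outs"
  shows "PT e (eL eG) (\<lambda>x. gadgets (s x) (tn x) (sa x) (cls x) (outs x))"
  unfolding gadgets_def items_def by (rule h h[THEN PT_lift] h[THEN PT_lift, THEN PT_lift] PT_intros)+

lemma PT_specials:
  assumes h: "PT e (eL eN) ks"
  shows "PT e (eL eG) (\<lambda>x. specials (length (ks x)))"
  unfolding specials_def map_upt_pred by (rule h h[THEN PT_lift] PT_intros)+

text \<open>Membership is spelled out by components, since equality is available for numbers
  only.\<close>

lemma PT_net_adj:
  assumes h: "PT e (eL (eP eA eA)) cs" "PT e eA a" "PT e eA b"
  shows "PT e eB (\<lambda>x. net_adj (cs x) (a x) (b x))"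
proof -
  have eq: "net_adj cs a b \<longleftrightarrow> (\<exists>y\<in>set cs. fst (fst y) = fst a \<and> snd (fst y) = snd a \<and> fst (snd y) = fst b \<and> snd (snd y) = snd b)
    \<or> (\<exists>y\<in>set cs. fst (fst y) = fst b \<and> snd (fst y) = snd b \<and> fst (snd y) = fst a \<and> snd (snd y) = snd a)" for cs and a b :: "nat \<times> nat"
    unfolding net_adj_def by (cases a; cases b) force
  show ?thesis unfolding eq by (rule h h[THEN PT_lift] PT_intros)+
qed

lemma PT_compat:
  assumes h: "PT e (eL (eP eA eA)) cs" "PT e eG a" "PT e eG b"
  shows "PT e eB (\<lambda>x. compat (net_adj (cs x)) (a x) (b x))"
  unfolding compat_def Let_def by (rule h PT_net_adj PT_intros)+

lemma PT_conflicts: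
  assumes h: "PT e (eL (eP eA eA)) cs" "PT e (eL eG) full"
  shows "PT e (eL eA) (\<lambda>x. conflicts (net_adj (cs x)) (full x))"
  unfolding conflicts_def by (rule h h[THEN PT_lift] h[THEN PT_lift, THEN PT_lift] PT_compat PT_intros)+

section \<open>The produced instance described by lists instead of index ranges\<close>

definition core_cap :: "gadget list \<Rightarrow> (nat \<times> nat) list \<Rightarrow> (nat \<times> nat) list \<Rightarrow> nat" where
  "core_cap full pr ex = 3 * length pr * length full + sum_list (map (\<lambda>z. snd z) ex) + 6"

definition core_cz :: "gadget list \<Rightarrow> gadget list \<Rightarrow> (nat \<times> nat) list \<Rightarrow> (nat \<times> nat) list \<Rightarrow> nat \<Rightarrow> nat" where
  "core_cz gl full pr ex g = (if g < length gl then core_cap full pr ex - 1 - 3 * length pr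
     else Suc (core_cap full pr ex - 1 - 3 * length pr))"

definition core_arcs :: "gadget list \<Rightarrow> gadget list \<Rightarrow> (nat \<times> nat) list \<Rightarrow> (nat \<times> nat) list \<Rightarrow> nat \<Rightarrow> ((nat \<times> nat) \<times> nat) list" where
  "core_arcs gl full pr ex rt = map (\<lambda>z. ((nI (fst z), nO (fst z)), core_cap full pr ex)) (enum full)
    @ map (\<lambda>z. ((nS 0, nI (fst z)), core_cz gl full pr ex (fst z))) (enum full)
    @ map (\<lambda>z. ((nO (fst z), nT 0), core_cz gl full pr ex (fst z))) (enum full)
    @ concat (map (\<lambda>w. map (\<lambda>z. ((nS (Suc (fst w)), nI (fst z)), if fst z = snd (snd w) then 2 else 3)) (enum full)) (enum pr))
    @ concat (map (\<lambda>w. map (\<lambda>z. ((nO (fst z), nT (Suc (fst w))), if fst z = fst (snd w) then 2 else 3)) (enum full)) (enum pr))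
    @ map (\<lambda>z. ((nO (fst z), nI (snd z)), 1)) pr
    @ map (\<lambda>z. ((nV (fst (snd z)), nI (fst z)), 1)) (enum gl)
    @ map (\<lambda>z. ((nO (fst z), nV (fst (snd (snd z)))), 1)) (enum gl)
    @ [((nS 0, nV rt), sum_list (map (\<lambda>z. snd z) ex))]
    @ map (\<lambda>z. ((nV (fst z), nT 0), snd z)) ex"

definition core_nodes :: "gadget list \<Rightarrow> (nat \<times> nat) list \<Rightarrow> nat list \<Rightarrow> nat list" where
  "core_nodes full pr nn = (nS 0 # map (\<lambda>z. nS (Suc (fst z))) (enum pr)) @ (nT 0 # map (\<lambda>z. nT (Suc (fst z))) (enum pr))
    @ map (\<lambda>z. nI (fst z)) (enum full) @ map (\<lambda>z. nO (fst z)) (enum full) @ map (\<lambda>v. nV v) nn"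

definition core_coms :: "gadget list \<Rightarrow> gadget list \<Rightarrow> (nat \<times> nat) list \<Rightarrow> (nat \<times> nat) list \<Rightarrow> (nat \<times> nat \<times> nat) list" where
  "core_coms gl full pr ex = (nS 0, nT 0, sum_list (map (\<lambda>z. core_cz gl full pr ex (fst z)) (enum full)) + sum_list (map (\<lambda>z. snd z) ex))
    # map (\<lambda>z. (nS (Suc (fst z)), nT (Suc (fst z)), 3 * length full - 1)) (enum pr)"

context red
begin

lemma lengths: "length full = G" "length prs = N" "length gl = m"
  unfolding full_length G_def N_def by (simp_all only: m_def)

lemma core_cap_eq: "core_cap full prs exs = M"
  unfolding core_cap_def lengths M_def \<Theta>_def by simp

lemma core_cz_eq: "core_cz gl full prs exs g = cz g"
  unfolding core_cz_def core_cap_eq lengths cz_def c0_def by simp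

lemma al_eq: "al = core_arcs gl full prs exs s"
proof -
  have ta: "map (\<lambda>g. ((nV (ta g), nI g), 1 :: nat)) [0..<m] = map (\<lambda>z. ((nV (fst (snd z)), nI (fst z)), 1)) (enum gl)"
    "map (\<lambda>g. ((nO g, nV (he g)), 1 :: nat)) [0..<m] = map (\<lambda>z. ((nO (fst z), nV (fst (snd (snd z)))), 1)) (enum gl)"
    unfolding map_enum lengths by (auto simp: ta_def he_def full_def nth_append lengths)
  have \<Theta>: "\<Theta> = sum_list (map (\<lambda>z. snd z) exs)" by (simp add: \<Theta>_def)
  have sgt: "concat (map (\<lambda>i. map (\<lambda>g. ((nS (Suc i), nI g), sg (Suc i) g)) [0..<G]) [0..<N])
      = concat (map (\<lambda>w. map (\<lambda>z. ((nS (Suc (fst w)), nI (fst z)), if fst z = snd (snd w) then 2 else 3)) (enum full)) (enum prs))"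
    "concat (map (\<lambda>i. map (\<lambda>g. ((nO g, nT (Suc i)), tg (Suc i) g)) [0..<G]) [0..<N])
      = concat (map (\<lambda>w. map (\<lambda>z. ((nO (fst z), nT (Suc (fst w))), if fst z = fst (snd w) then 2 else 3)) (enum full)) (enum prs))"
    unfolding map_enum lengths sg_def tg_def by simp_all
  show ?thesis unfolding al_def core_arcs_def ta sgt \<Theta>[symmetric] core_cap_eq core_cz_eq
    by (simp only: map_enum lengths fst_conv snd_conv)
qed

lemma nodes_eq: "nodes = core_nodes full prs nn"
proof -
  have "map f [0..<Suc N] = f 0 # map (\<lambda>z. f (Suc (fst z))) (enum prs)" for f :: "nat \<Rightarrow> nat"
    unfolding map_enum lengths by (simp add: upt_conv_Cons map_Suc_upt[symmetric] comp_def del: upt_Suc)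
  then show ?thesis unfolding nodes_def core_nodes_def by (simp only: map_enum lengths fst_conv)
qed

lemma coms_eq: "coms = core_coms gl full prs exs"
proof -
  have "\<Theta> = sum_list (map (\<lambda>z. snd z) exs)" by (simp add: \<Theta>_def)
  then show ?thesis unfolding coms_def core_coms_def core_cz_eq map_enum lengths fst_conv by simp
qed

end

lemma enc_rat_of_nat: "enc_rat (of_nat c) = eP eN eN (c, 1)"
  by (simp add: enc_rat_def eP_def)

lemma eL_map_cong: "(\<And>x. x \<in> set xs \<Longrightarrow> a (f x) = b (g x)) \<Longrightarrow> eL a (map f xs) = eL b (map g xs)"
  by (induction xs) (auto simp: enc_list_def)

abbreviation "eOut \<equiv> eP (eL eN) (eP (eL (eP eA (eP eN eN))) (eP (eL eN) (eL (eP eN (eP eN (eP eN eN))))))"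

text \<open>The added entries 1 are denominators: all capacities and demands are integral, and
  rationals are encoded in lowest terms.\<close>

definition raw_out :: "nat list \<Rightarrow> ((nat \<times> nat) \<times> nat) list \<Rightarrow> nat list \<Rightarrow> (nat \<times> nat \<times> nat) list \<Rightarrow> _" where
  "raw_out ns al ks coms = (ns, map (\<lambda>z. (fst z, snd z, 1 :: nat)) al, ks, map (\<lambda>z. (fst z, fst (snd z), snd (snd z), 1 :: nat)) coms)"

lemma enc_mrf_m_raw:
  assumes "distinct (map fst al)"
  shows "enc_mrf_m \<lparr>node_list = ns, arc_list = map fst al, budget = k,
     capacity = (\<lambda>a. of_nat (the (map_of al a))),
     commodity_list = map (\<lambda>(s, t, d). (s, t, of_nat d)) coms\<rparr> = eOut (raw_out ns al (replicate k 0) coms)"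
proof -
  have 1: "eL (\<lambda>a. VPair (enc_arc a) (enc_rat (of_nat (the (map_of al a))))) (map fst al)
      = eL (eP eA (eP eN eN)) (map (\<lambda>z. (fst z, snd z, 1)) al)"
  proof (rule eL_map_cong)
    fix z assume "z \<in> set al"
    then have "map_of al (fst z) = Some (snd z)" using assms by simp
    then show "VPair (enc_arc (fst z)) (enc_rat (of_nat (the (map_of al (fst z))))) = eP eA (eP eN eN) (fst z, snd z, 1)"
      by (simp add: enc_rat_of_nat enc_arc_def eP_def)
  qed
  have 2: "eL (\<lambda>(s, t, d). VPair (VNum s) (VPair (VNum t) (enc_rat d))) (map (\<lambda>(s, t, d). (s, t, of_nat d)) coms)
      = eL (eP eN (eP eN (eP eN eN))) (map (\<lambda>z. (fst z, fst (snd z), snd (snd z), 1)) coms)"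
    by (rule eL_map_cong) (auto simp: enc_rat_of_nat eP_def)
  show ?thesis unfolding enc_mrf_m_def raw_out_def using 1 2 by (simp add: eP_def enc_unary_def)
qed

lemma (in red) enc_RJ: "enc_mrf_m RJ = eOut (raw_out (core_nodes full prs nn) (core_arcs gl full prs exs s) (replicate k 0)
    (core_coms gl full prs exs))"
  unfolding RJ_def J_def using enc_mrf_m_raw[OF distinct_al] by (simp only: al_eq nodes_eq coms_eq)

lemma enc_gap: "enc_mrf_m gap_instance = eOut (raw_out [0..<18] gap_arcs (replicate 1 0) gap_commodities)"
  unfolding gap_instance_def by (rule enc_mrf_m_raw) (simp add: gap_arcs_def)

lemma PT_core_cap:
  assumes h: "PT e (eL eG) full" "PT e (eL eA) pr" "PT e (eL eA) ex"
  shows "PT e eN (\<lambda>x. core_cap (full x) (pr x) (ex x))"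
  unfolding core_cap_def by (rule h PT_intros)+

lemma PT_core_cz:
  assumes h: "PT e (eL eG) gl" "PT e (eL eG) full" "PT e (eL eA) pr" "PT e (eL eA) ex" "PT e eN g"
  shows "PT e eN (\<lambda>x. core_cz (gl x) (full x) (pr x) (ex x) (g x))"
  unfolding core_cz_def by (rule h PT_core_cap PT_intros)+

lemma PT_nodes:
  assumes h: "PT e eN g"
  shows "PT e eN (\<lambda>x. nS (g x))" "PT e eN (\<lambda>x. nT (g x))" "PT e eN (\<lambda>x. nI (g x))" "PT e eN (\<lambda>x. nO (g x))" "PT e eN (\<lambda>x. nV (g x))"
  unfolding node_defs by (rule h PT_intros)+

lemma PT_core_arcs:
  assumes h: "PT e (eL eG) gl" "PT e (eL eG) full" "PT e (eL eA) pr" "PT e (eL eA) ex" "PT e eN rt"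
  shows "PT e (eL (eP eA eN)) (\<lambda>x. core_arcs (gl x) (full x) (pr x) (ex x) (rt x))"
  unfolding core_arcs_def
  by (rule h h[THEN PT_lift] h[THEN PT_lift, THEN PT_lift] PT_core_cap PT_core_cz PT_nodes PT_intros)+

lemma PT_core_nodes:
  assumes h: "PT e (eL eG) full" "PT e (eL eA) pr" "PT e (eL eN) nn"
  shows "PT e (eL eN) (\<lambda>x. core_nodes (full x) (pr x) (nn x))"
  unfolding core_nodes_def by (rule h PT_nodes PT_intros)+

lemma PT_core_coms:
  assumes h: "PT e (eL eG) gl" "PT e (eL eG) full" "PT e (eL eA) pr" "PT e (eL eA) ex"
  shows "PT e (eL (eP eN (eP eN eN))) (\<lambda>x. core_coms (gl x) (full x) (pr x) (ex x))"
  unfolding core_coms_def by (rule h h[THEN PT_lift] PT_core_cz PT_nodes PT_intros)+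

lemma PT_raw_out:
  assumes h: "PT e (eL eN) ns" "PT e (eL (eP eA eN)) al" "PT e (eL eN) ks" "PT e (eL (eP eN (eP eN eN))) coms"
  shows "PT e eOut (\<lambda>x. raw_out (ns x) (al x) (ks x) (coms x))"
  unfolding raw_out_def by (rule h PT_intros)+

type_synonym raw = "nat list \<times> (nat \<times> nat) list \<times> nat list \<times> nat \<times> nat \<times> ((nat \<times> nat) \<times> nat \<times> nat) list \<times> nat \<times> nat"

abbreviation "eIn \<equiv> eP (eL eN) (eP (eL eA) (eP (eL eN) (eP eN (eP eN (eP (eL (eP eA eA)) (eP eN eN))))))"

definition raw_of :: "mrf_r \<Rightarrow> raw" where
  "raw_of I = (node_list I, arc_list I, replicate (budget I) 0, r_source I, r_sink I, compat_list I, dem_num I, dem_den I)"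

lemma enc_raw_of: "enc_mrf_r I = eIn (raw_of I)"
proof -
  have arcs: "(\<lambda>(a, b). VPair (enc_arc a) (enc_arc b)) = eP eA eA" "enc_arc = eA"
    by (auto simp: eP_def enc_arc_def)
  show ?thesis unfolding enc_mrf_r_def raw_of_def arcs(1) unfolding arcs(2)
    by (simp add: eP_def enc_unary_def enc_rat_def dem_num_def dem_den_def)
qed

abbreviation "r_ns x \<equiv> fst x"
abbreviation "r_as x \<equiv> fst (snd x)"
abbreviation "r_ks x \<equiv> fst (snd (snd x))"
abbreviation "r_s x \<equiv> fst (snd (snd (snd x)))"
abbreviation "r_t x \<equiv> fst (snd (snd (snd (snd x))))"
abbreviation "r_cs x \<equiv> fst (snd (snd (snd (snd (snd x)))))"
abbreviation "r_p x \<equiv> fst (snd (snd (snd (snd (snd (snd x))))))"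
abbreviation "r_q x \<equiv> snd (snd (snd (snd (snd (snd (snd x))))))"

definition r_sa :: "raw \<Rightarrow> (nat \<times> nat) list" where "r_sa x = net_arcs (r_as x) (r_s x) (r_t x)"
definition r_tn :: "raw \<Rightarrow> nat" where "r_tn x = net_sink (r_ns x) (r_s x) (r_t x)"
definition r_cap :: "raw \<Rightarrow> nat" where "r_cap x = net_cap (r_s x) (r_t x) (length (r_sa x)) (r_p x) (r_q x)"
definition r_cls :: "raw \<Rightarrow> (nat \<times> label list \<times> nat) list" where
  "r_cls x = clusters (Suc (Suc (sum_list (r_ns x)))) (length (net_bits (r_s x) (r_t x) (length (r_sa x)) (r_p x) (r_q x)))
     (net_axs (r_s x) (r_t x) (length (r_sa x)) (r_p x) (r_q x))"
definition r_gl :: "raw \<Rightarrow> gadget list" where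
  "r_gl x = gadgets (r_s x) (r_tn x) (r_sa x) (r_cls x) (net_outs (r_s x) (r_t x) (length (r_sa x)) (r_p x) (r_q x))"
definition r_full :: "raw \<Rightarrow> gadget list" where "r_full x = r_gl x @ specials (length (r_ks x))"
definition r_ex :: "raw \<Rightarrow> (nat \<times> nat) list" where
  "r_ex x = (r_tn x, r_cap x) # map (\<lambda>z. (fst z, snd (snd z))) (r_cls x)"
definition r_nn :: "raw \<Rightarrow> nat list" where
  "r_nn x = (Suc (sum_list (r_ns x)) # r_ns x) @ map (\<lambda>z. fst z) (r_cls x)"
definition r_pr :: "raw \<Rightarrow> (nat \<times> nat) list" where "r_pr x = conflicts (net_adj (r_cs x)) (r_full x)"

definition raw_target :: "raw \<Rightarrow> _" where
  "raw_target x = (if length (r_ks x) = 1 \<and> r_s x = r_t x \<and> r_p x mod r_q x \<noteq> 0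
     then raw_out [0..<18] gap_arcs (replicate 1 0) gap_commodities
     else raw_out (core_nodes (r_full x) (r_pr x) (r_nn x)) (core_arcs (r_gl x) (r_full x) (r_pr x) (r_ex x) (r_s x))
       (r_ks x) (core_coms (r_gl x) (r_full x) (r_pr x) (r_ex x)))"

lemma PT_raw_target: "PT eIn eOut raw_target"
proof -
  have sa: "PT eIn (eL eA) r_sa" unfolding r_sa_def by (rule PT_net_arcs PT_intros)+
  have tn: "PT eIn eN r_tn" unfolding r_tn_def by (rule PT_net_sink PT_intros)+
  have cap: "PT eIn eN r_cap" unfolding r_cap_def by (rule sa PT_net_cap PT_intros)+
  have cls: "PT eIn (eL eC) r_cls" unfolding r_cls_def by (rule sa PT_clusters PT_net_bits PT_net_axs PT_intros)+
  have gl: "PT eIn (eL eG) r_gl" unfolding r_gl_def by (rule sa tn cls PT_gadgets PT_net_outs PT_intros)+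
  have full: "PT eIn (eL eG) r_full" unfolding r_full_def by (rule gl PT_specials PT_intros)+
  have ex: "PT eIn (eL eA) r_ex" unfolding r_ex_def by (rule tn cap cls PT_intros)+
  have nn: "PT eIn (eL eN) r_nn" unfolding r_nn_def by (rule cls PT_intros)+
  have pr: "PT eIn (eL eA) r_pr" unfolding r_pr_def by (rule full PT_conflicts PT_intros)+
  note PT_core = PT_core_nodes PT_core_arcs PT_core_coms
  show ?thesis unfolding raw_target_def by (rule gl full ex nn pr PT_raw_out PT_core PT_intros)+
qed

lemma (in mrf_inst) enc_target: "enc_mrf_m (target I) = eOut (raw_target (raw_of I))"
proof -
  interpret R: red k s "net_sink ns s t" "net_cap s t l p q" sa "net_adj (compat_list I)" "Suc (sum_list ns) # ns" "Suc (Suc (sum_list ns))"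
    "net_vars s t l p q" "net_axs s t l p q" "net_outs s t l p q" by (rule red)
  have T: "target I = (if gap then gap_instance else R.RJ)" by (simp add: target_def net_instance_def Let_def)
  have x: "r_ns (raw_of I) = ns" "r_as (raw_of I) = as" "r_ks (raw_of I) = replicate k 0" "r_s (raw_of I) = s"
    "r_t (raw_of I) = t" "r_cs (raw_of I) = compat_list I" "r_p (raw_of I) = p" "r_q (raw_of I) = q"
    by (simp_all add: raw_of_def)
  have sa: "r_sa (raw_of I) = sa" by (simp only: r_sa_def x)
  have tn: "r_tn (raw_of I) = net_sink ns s t" by (simp only: r_tn_def x)
  have cap: "r_cap (raw_of I) = net_cap s t l p q" by (simp only: r_cap_def x sa)
  have cls: "r_cls (raw_of I) = R.cls" unfolding r_cls_def x sa net_vars_bits[symmetric] by (rule R.cls_def[symmetric])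
  have gl: "r_gl (raw_of I) = R.gl" by (simp only: r_gl_def x sa tn cls R.gl_def)
  have full: "r_full (raw_of I) = R.full" by (simp only: r_full_def x gl R.full_def length_replicate)
  have ex: "r_ex (raw_of I) = R.exs" by (simp only: r_ex_def tn cap cls R.exs_def)
  have nn: "r_nn (raw_of I) = R.nn" by (simp only: r_nn_def x cls R.nn_def)
  have pr: "r_pr (raw_of I) = R.prs" by (simp only: r_pr_def x full R.prs_def)
  show ?thesis
  proof (cases gap)
    case True
    then have "raw_target (raw_of I) = raw_out [0..<18] gap_arcs (replicate 1 0) gap_commodities"
      unfolding raw_target_def x length_replicate by (rule if_P)
    moreover have "target I = gap_instance" unfolding T using True by (rule if_P)
    ultimately show ?thesis by (simp only: enc_gap)
  next
    case False
    then have "raw_target (raw_of I) = raw_out (core_nodes R.full R.prs R.nn) (core_arcs R.gl R.full R.prs R.exs s)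
       (replicate k 0) (core_coms R.gl R.full R.prs R.exs)"
      unfolding raw_target_def x length_replicate gl full ex nn pr by (rule if_not_P)
    moreover have "target I = R.RJ" unfolding T using False by (rule if_not_P)
    ultimately show ?thesis by (simp only: R.enc_RJ)
  qed
qed

lemma polytime_target: "polytime_computable mrf_r_instances enc_mrf_r enc_mrf_m target"
  by (rule polytime_computable_PT[OF PT_raw_target]) (simp_all add: enc_raw_of mrf_inst.enc_target mrf_inst_def)

theorem theorem7:
  shows "\<exists>f :: mrf_r \<Rightarrow> mrf_m.
    polynomial_transformation mrf_r_instances enc_mrf_r MRF_R mrf_m_instances enc_mrf_m MRF_M f
    \<and> polynomial_transformation mrf_r_instances enc_mrf_r Integral_MRF_R
        mrf_m_instances enc_mrf_m Integral_MRF_M f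
    \<and> (\<forall>I \<in> mrf_r_instances. budget (f I) = budget I)
    \<and> (\<exists>p :: nat poly. \<forall>J \<in> f ` mrf_r_instances.
        (\<forall>a \<in> arcs (graph_of J). capacity J a \<in> \<int>)
        \<and> max_capacity J \<le> of_nat (poly p (card (arcs (graph_of J)))))
    \<and> (\<forall>J \<in> f ` mrf_r_instances.
        (\<forall>i \<in> commodities J.
            (\<Sum>a \<in> leaving (graph_of J) {m_source J i}. capacity J a) = m_demand J i
            \<and> (\<Sum>a \<in> entering (graph_of J) {m_sink J i}. capacity J a) = m_demand J i
            \<and> entering (graph_of J) {m_source J i} = {}
            \<and> leaving (graph_of J) {m_sink J i} = {})
        \<and> (\<exists>i0 \<in> commodities J.
            (\<Sum>i \<in> commodities J - {i0}. m_demand J i) \<le> max_capacity J - 3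
            \<and> (\<forall>x \<in> m_flows J. \<forall>i \<in> commodities J - {i0}. \<forall>a \<in> arcs (graph_of J).
                  max_capacity J - 2 \<le> capacity J a \<longrightarrow> 2 \<le> arc_flow (m_paths_of J i) x a))
        \<and> (\<exists>U \<subseteq> verts (graph_of J).
            m_source J ` commodities J \<subseteq> U
            \<and> m_sink J ` commodities J \<subseteq> verts (graph_of J) - U
            \<and> (\<Sum>a \<in> leaving (graph_of J) U. capacity J a) = (\<Sum>i \<in> commodities J. m_demand J i)
            \<and> card {a \<in> leaving (graph_of J) U. capacity J a = max_capacity J}
                = budget J - 1))"
proof (rule exI[of _ target], intro conjI)
  note props = mrf_inst.target_properties[unfolded mrf_inst_def] and correct = mrf_inst.target_correct[unfolded mrf_inst_def]
  show "polynomial_transformation mrf_r_instances enc_mrf_r MRF_R mrf_m_instances enc_mrf_m MRF_M target"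
    "polynomial_transformation mrf_r_instances enc_mrf_r Integral_MRF_R mrf_m_instances enc_mrf_m Integral_MRF_M target"
    unfolding polynomial_transformation_def using polytime_target props(1) correct by blast+
  show "\<forall>I\<in>mrf_r_instances. budget (target I) = budget I" using props(3) by blast
  \<comment> \<open>This is the bound of \<open>M_le\<close>.\<close>
  have "poly [:7, 3:] n = 3 * n + 7" for n :: nat by simp
  then show "\<exists>p :: nat poly. \<forall>J \<in> target ` mrf_r_instances.
        (\<forall>a \<in> arcs (graph_of J). capacity J a \<in> \<int>)
        \<and> max_capacity J \<le> of_nat (poly p (card (arcs (graph_of J))))"
    using props(4,5) by (intro exI[of _ "[:7, 3:]"]) (simp only: ball_simps, blast)
  have "\<forall>J\<in>target ` mrf_r_instances. good_instance J" using props(2) by blast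
  from this[unfolded good_instance_def] show "\<forall>J \<in> target ` mrf_r_instances.
        (\<forall>i \<in> commodities J.
            (\<Sum>a \<in> leaving (graph_of J) {m_source J i}. capacity J a) = m_demand J i
            \<and> (\<Sum>a \<in> entering (graph_of J) {m_sink J i}. capacity J a) = m_demand J i
            \<and> entering (graph_of J) {m_source J i} = {}
            \<and> leaving (graph_of J) {m_sink J i} = {})
        \<and> (\<exists>i0 \<in> commodities J.
            (\<Sum>i \<in> commodities J - {i0}. m_demand J i) \<le> max_capacity J - 3
            \<and> (\<forall>x \<in> m_flows J. \<forall>i \<in> commodities J - {i0}. \<forall>a \<in> arcs (graph_of J).
                  max_capacity J - 2 \<le> capacity J a \<longrightarrow> 2 \<le> arc_flow (m_paths_of J i) x a))
        \<and> (\<exists>U \<subseteq> verts (graph_of J).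
            m_source J ` commodities J \<subseteq> U
            \<and> m_sink J ` commodities J \<subseteq> verts (graph_of J) - U
            \<and> (\<Sum>a \<in> leaving (graph_of J) U. capacity J a) = (\<Sum>i \<in> commodities J. m_demand J i)
            \<and> card {a \<in> leaving (graph_of J) U. capacity J a = max_capacity J}
                = budget J - 1)" .
qed

end
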